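(* Let $(\underline{\mathcal{M}},\underline{\mathcal{W}},\underline{\mathcal{F}},\underline{\mathcal{C}})$ be an $\omega$-combinatorial left proper model category. Let $\mathcal{M}$ denote the full subcategory of $\underline{\mathcal{M}}$ spanned by the finitely presentable objects. Assume that $\mathcal{M}$ has finite limits and let $*$ denote the terminal object in $\mathcal{M}$. Suppose we are given a factorization in $\mathcal{M}$ of the fold map $*\sqcup *\to *$ into a cofibration followed by a weak equivalence: $$*\sqcup *\to I\to *.$$ Assume further: 1. For every morphism $Y\to B$ in $\mathcal{M}$, the functor $Y\times_B(-):\mathcal{M}_{/B}\to\mathcal{M}$ commutes with finite colimits. 2. Every object of $\mathcal{M}$ is cofibrant. 3. For every object $B$ of $\mathcal{M}$, the functor $B\times(-):\mathcal{M}\to\mathcal{M}$ preserves cofibrations and weak equivalences. Then the full subcategory of the morphism category $\underline{\mathcal{M}}^{\to}$ of $\underline{\mathcal{M}}$ spanned by the class of weak equivalences $\underline{\mathcal{W}}$ is finitely accessible.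
   Context: In the quadruple, $\underline{\mathcal{W}},\underline{\mathcal{F}},\underline{\mathcal{C}}$ are the weak equivalences, fibrations and cofibrations. Model categories are taken in Hovey's sense (in particular with functorial factorizations). A model category is combinatorial if it is locally presentable and cofibrantly generated. It is $\omega$-combinatorial if it is combinatorial, its underlying category is locally finitely presentable, and both its cofibrations and its trivial cofibrations are generated by sets of morphisms having finitely presentable ($\omega$-presentable) domains and codomains. Cofibrations and weak equivalences in $\mathcal{M}$ are those of $\underline{\mathcal{M}}$ between objects of $\mathcal{M}$. For a category $\mathcal{D}$, $\mathcal{D}^{\to}$ is the category of morphisms of $\mathcal{D}$ (commutative squares as morphisms). A category is finitely accessible if it has filtered colimits and there is a small set of finitely presentable objects that generates it under filtered colimits. *)

theory Defs
  imports Main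
begin

unbundle cardinal_syntax

section \<open>Sizes\<close>

text \<open>
  ``Small'' is meant in the sense of Grothendieck universes. The universe enters through a type
  \<open>'u\<close> whose cardinality is strongly inaccessible, and a set of any type is small if
  its cardinality is less than that of \<open>'u\<close>. Hence every small category is isomorphic
  to one whose objects and arrows are of type \<open>'u\<close>, and small diagrams are
  quantified over in that form. Objects and arrows of a large category form arbitrary sets.
\<close>

definition universe :: "'u itself \<Rightarrow> bool" where
  "universe _ \<longleftrightarrow>
     natLeq <o |UNIV :: 'u set| \<and> regularCard |UNIV :: 'u set| \<and>
     (\<forall>A :: 'u set. |A| <o |UNIV :: 'u set| \<longrightarrow> |Pow A| <o |UNIV :: 'u set| )"

definition small :: "'u itself \<Rightarrow> 'x set \<Rightarrow> bool" where
  "small _ A \<longleftrightarrow> |A| <o |UNIV :: 'u set|"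

definition regular_cardinal :: "'k rel \<Rightarrow> bool" where
  "regular_cardinal lam \<longleftrightarrow> Card_order lam \<and> cinfinite lam \<and> regularCard lam"


section \<open>Categories and functors\<close>

record ('o, 'a) cat =
  Obj :: "'o set"
  Arr :: "'a set"
  Dom :: "'a \<Rightarrow> 'o"
  Cod :: "'a \<Rightarrow> 'o"
  Ident :: "'o \<Rightarrow> 'a"
  Comp :: "'a \<Rightarrow> 'a \<Rightarrow> 'a" (infixl "\<cdot>\<index>" 70)

definition hom :: "('o, 'a) cat \<Rightarrow> 'o \<Rightarrow> 'o \<Rightarrow> 'a set" where
  "hom C X Y = {f \<in> Arr C. Dom C f = X \<and> Cod C f = Y}"

locale category =
  fixes C :: "('o, 'a) cat" (structure)
  assumes Dom_Obj: "f \<in> Arr C \<Longrightarrow> Dom C f \<in> Obj C"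
    and Cod_Obj: "f \<in> Arr C \<Longrightarrow> Cod C f \<in> Obj C"
    and Ident_hom: "X \<in> Obj C \<Longrightarrow> Ident C X \<in> hom C X X"
    and Comp_hom: "f \<in> hom C X Y \<Longrightarrow> g \<in> hom C Y Z \<Longrightarrow> g \<cdot> f \<in> hom C X Z"
    and Ident_right: "f \<in> hom C X Y \<Longrightarrow> f \<cdot> Ident C X = f"
    and Ident_left: "f \<in> hom C X Y \<Longrightarrow> Ident C Y \<cdot> f = f"
    and Comp_assoc: "f \<in> hom C X Y \<Longrightarrow> g \<in> hom C Y Z \<Longrightarrow> h \<in> hom C Z Z' \<Longrightarrow>
      h \<cdot> (g \<cdot> f) = (h \<cdot> g) \<cdot> f"

definition locally_small :: "'u itself \<Rightarrow> ('o, 'a) cat \<Rightarrow> bool" where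
  "locally_small U C \<longleftrightarrow> (\<forall>X \<in> Obj C. \<forall>Y \<in> Obj C. small U (hom C X Y))"

record ('o, 'a, 'p, 'b) ftor =
  FO :: "'o \<Rightarrow> 'p"
  FA :: "'a \<Rightarrow> 'b"

definition is_functor :: "('o, 'a) cat \<Rightarrow> ('p, 'b) cat \<Rightarrow> ('o, 'a, 'p, 'b) ftor \<Rightarrow> bool" where
  "is_functor A B F \<longleftrightarrow>
     (\<forall>X \<in> Obj A. FO F X \<in> Obj B) \<and>
     (\<forall>f \<in> Arr A. FA F f \<in> hom B (FO F (Dom A f)) (FO F (Cod A f))) \<and>
     (\<forall>X \<in> Obj A. FA F (Ident A X) = Ident B (FO F X)) \<and>
     (\<forall>f \<in> Arr A. \<forall>g \<in> Arr A. Dom A g = Cod A f \<longrightarrow>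
        FA F (g \<cdot>\<^bsub>A\<^esub> f) = FA F g \<cdot>\<^bsub>B\<^esub> FA F f)"

definition compose_ftor ::
    "('p, 'b, 'q, 'c) ftor \<Rightarrow> ('o, 'a, 'p, 'b) ftor \<Rightarrow> ('o, 'a, 'q, 'c) ftor" where
  "compose_ftor G F = \<lparr>FO = FO G \<circ> FO F, FA = FA G \<circ> FA F\<rparr>"

definition full_subcat :: "('o, 'a) cat \<Rightarrow> 'o set \<Rightarrow> ('o, 'a) cat" where
  "full_subcat C S =
     C\<lparr>Obj := Obj C \<inter> S, Arr := {f \<in> Arr C. Dom C f \<in> S \<and> Cod C f \<in> S}\<rparr>"

text \<open>
  A quadruple \<open>(f, u, v, g)\<close> is the commutative square from \<open>f\<close> to
  \<open>g\<close> with upper edge \<open>u\<close> between the domains and lower edge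
  \<open>v\<close> between the codomains.
\<close>

definition arrow_cat :: "('o, 'a) cat \<Rightarrow> ('a, 'a \<times> 'a \<times> 'a \<times> 'a) cat" where
  "arrow_cat C =
     \<lparr>Obj = Arr C,
      Arr = {(f, u, v, g). f \<in> Arr C \<and> g \<in> Arr C \<and>
               u \<in> hom C (Dom C f) (Dom C g) \<and> v \<in> hom C (Cod C f) (Cod C g) \<and>
               v \<cdot>\<^bsub>C\<^esub> f = g \<cdot>\<^bsub>C\<^esub> u},
      Dom = (\<lambda>(f, u, v, g). f),
      Cod = (\<lambda>(f, u, v, g). g),
      Ident = (\<lambda>f. (f, Ident C (Dom C f), Ident C (Cod C f), f)),
      Comp = (\<lambda>(g, u', v', h) (f, u, v, g'). (f, u' \<cdot>\<^bsub>C\<^esub> u, v' \<cdot>\<^bsub>C\<^esub> v, h))\<rparr>"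

text \<open>
  The slice over \<open>B\<close>; a triple \<open>(x, h, y)\<close> is the arrow
  \<open>h\<close> from \<open>x\<close> to \<open>y\<close> over \<open>B\<close>.
\<close>

definition slice :: "('o, 'a) cat \<Rightarrow> 'o \<Rightarrow> ('a, 'a \<times> 'a \<times> 'a) cat" where
  "slice C B =
     \<lparr>Obj = {x \<in> Arr C. Cod C x = B},
      Arr = {(x, h, y). x \<in> Arr C \<and> Cod C x = B \<and> y \<in> Arr C \<and> Cod C y = B \<and>
               h \<in> hom C (Dom C x) (Dom C y) \<and> y \<cdot>\<^bsub>C\<^esub> h = x},
      Dom = (\<lambda>(x, h, y). x),
      Cod = (\<lambda>(x, h, y). y),
      Ident = (\<lambda>x. (x, Ident C (Dom C x), x)),
      Comp = (\<lambda>(y, k, z) (x, h, y'). (x, k \<cdot>\<^bsub>C\<^esub> h, z))\<rparr>"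

definition order_cat :: "'i rel \<Rightarrow> ('i, 'i \<times> 'i) cat" where
  "order_cat r =
     \<lparr>Obj = Field r, Arr = r, Dom = fst, Cod = snd,
      Ident = (\<lambda>i. (i, i)), Comp = (\<lambda>g f. (fst f, snd g))\<rparr>"

lemma category_full_subcat: "category C \<Longrightarrow> category (full_subcat C S)"
  by (simp add: category_def full_subcat_def hom_def)

lemma category_order_cat: "Preorder r \<Longrightarrow> category (order_cat r)"
  by (auto simp: category_def order_cat_def hom_def preorder_on_def refl_on_def Field_def
      dest: transD)

lemma category_arrow_cat:
  fixes C :: "('o, 'a) cat" (structure)
  assumes "category C" shows "category (arrow_cat C)"
proof -
  interpret category C by fact
  have Ident': "X \<in> Obj C \<Longrightarrow> Ident C X \<in> Arr C"
    "X \<in> Obj C \<Longrightarrow> Dom C (Ident C X) = X" "X \<in> Obj C \<Longrightarrow> Cod C (Ident C X) = X"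
    "f \<in> Arr C \<Longrightarrow> Dom C f = X \<Longrightarrow> f \<cdot> Ident C X = f"
    "f \<in> Arr C \<Longrightarrow> Cod C f = X \<Longrightarrow> Ident C X \<cdot> f = f"
    for X f
    using Ident_hom[of X] Ident_right[of f X "Cod C f"] Ident_left[of f "Dom C f" X]
    by (simp_all add: hom_def)
  show ?thesis
  proof (unfold_locales, goal_cases)
    case (4 f X Y g Z)
    then obtain x u v y u' v' z where e: "f = (x, u, v, y)" "g = (y, u', v', z)"
      and xyz: "x = X" "y = Y" "z = Z" "x \<in> Arr C" "y \<in> Arr C" "z \<in> Arr C"
      and u: "u \<in> hom C (Dom C x) (Dom C y)" "v \<in> hom C (Cod C x) (Cod C y)"
        "u' \<in> hom C (Dom C y) (Dom C z)" "v' \<in> hom C (Cod C y) (Cod C z)"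
      and c: "v \<cdot> x = y \<cdot> u" "v' \<cdot> y = z \<cdot> u'"
      by (auto simp: arrow_cat_def hom_def)
    have "(v' \<cdot> v) \<cdot> x = v' \<cdot> (y \<cdot> u)"
      using Comp_assoc[of x "Dom C x" "Cod C x" v "Cod C y" v' "Cod C z"] u xyz c
      by (simp add: hom_def)
    also have "\<dots> = (z \<cdot> u') \<cdot> u"
      using Comp_assoc[of u "Dom C x" "Dom C y" y "Cod C y" v' "Cod C z"] u xyz c
      by (simp add: hom_def)
    also have "\<dots> = z \<cdot> (u' \<cdot> u)"
      using Comp_assoc[of u "Dom C x" "Dom C y" u' "Dom C z" z "Cod C z"] u xyz
      by (simp add: hom_def)
    finally show ?case
      using u xyz e Comp_hom[OF u(1) u(3)] Comp_hom[OF u(2) u(4)]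
      by (auto simp: arrow_cat_def hom_def)
  next
    case (7 f X Y g Z h Z')
    then show ?case
      by (auto simp: arrow_cat_def hom_def intro!: Comp_assoc[unfolded hom_def])
  qed (auto simp: arrow_cat_def hom_def Ident' Dom_Obj Cod_Obj)
qed

lemma category_slice:
  fixes C :: "('o, 'a) cat" (structure)
  assumes "category C" shows "category (slice C B)"
proof -
  interpret category C by fact
  have Ident': "X \<in> Obj C \<Longrightarrow> Ident C X \<in> Arr C"
    "X \<in> Obj C \<Longrightarrow> Dom C (Ident C X) = X" "X \<in> Obj C \<Longrightarrow> Cod C (Ident C X) = X"
    "f \<in> Arr C \<Longrightarrow> Dom C f = X \<Longrightarrow> f \<cdot> Ident C X = f"
    "f \<in> Arr C \<Longrightarrow> Cod C f = X \<Longrightarrow> Ident C X \<cdot> f = f"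
    for X f
    using Ident_hom[of X] Ident_right[of f X "Cod C f"] Ident_left[of f "Dom C f" X]
    by (simp_all add: hom_def)
  have hom_slice: "(x, h, y) \<in> hom (slice C B) X Y \<longleftrightarrow>
      x = X \<and> y = Y \<and> X \<in> Arr C \<and> Y \<in> Arr C \<and> Cod C X = B \<and> Cod C Y = B \<and>
      h \<in> hom C (Dom C X) (Dom C Y) \<and> Y \<cdot> h = X" for x h y X Y
    unfolding slice_def hom_def by (simp, blast)
  show ?thesis
  proof (unfold_locales, goal_cases)
    case (4 f X Y g Z)
    obtain x h y where f: "f = (x, h, y)" by (cases f)
    obtain y' k z where g: "g = (y', k, z)" by (cases g)
    have X: "x = X" "y = Y" "X \<in> Arr C" "Cod C X = B"
        "h \<in> hom C (Dom C X) (Dom C Y)" "Y \<cdot> h = X"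
      and Z: "y' = Y" "z = Z" "Z \<in> Arr C" "Cod C Z = B"
        "k \<in> hom C (Dom C Y) (Dom C Z)" "Z \<cdot> k = Y"
      using 4 unfolding f g hom_slice by blast+
    have "Z \<cdot> (k \<cdot> h) = X"
      using Comp_assoc[OF X(5) Z(5), of Z B] X Z by (simp add: hom_def)
    then have "(X, k \<cdot> h, Z) \<in> hom (slice C B) X Z"
      unfolding hom_slice using X Z Comp_hom[OF X(5) Z(5)] by blast
    moreover have "g \<cdot>\<^bsub>slice C B\<^esub> f = (X, k \<cdot> h, Z)"
      by (simp add: f g X(1) Z(2) slice_def)
    ultimately show ?case by simp
  next
    case (7 f X Y g Z h Z')
    then show ?case
      by (auto simp: slice_def hom_def intro!: Comp_assoc[unfolded hom_def])
  qed (auto simp: slice_def hom_def Ident' Dom_Obj)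
qed


section \<open>Limits and colimits\<close>

definition is_cocone ::
    "('o, 'a) cat \<Rightarrow> ('i, 'j) cat \<Rightarrow> ('i, 'j, 'o, 'a) ftor \<Rightarrow> 'o \<Rightarrow> ('i \<Rightarrow> 'a) \<Rightarrow> bool" where
  "is_cocone C J D X \<iota> \<longleftrightarrow>
     X \<in> Obj C \<and> (\<forall>i \<in> Obj J. \<iota> i \<in> hom C (FO D i) X) \<and>
     (\<forall>a \<in> Arr J. \<iota> (Cod J a) \<cdot>\<^bsub>C\<^esub> FA D a = \<iota> (Dom J a))"

definition is_colimit ::
    "('o, 'a) cat \<Rightarrow> ('i, 'j) cat \<Rightarrow> ('i, 'j, 'o, 'a) ftor \<Rightarrow> 'o \<Rightarrow> ('i \<Rightarrow> 'a) \<Rightarrow> bool" where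
  "is_colimit C J D X \<iota> \<longleftrightarrow>
     is_cocone C J D X \<iota> \<and>
     (\<forall>Y \<tau>. is_cocone C J D Y \<tau> \<longrightarrow>
        (\<exists>!h. h \<in> hom C X Y \<and> (\<forall>i \<in> Obj J. h \<cdot>\<^bsub>C\<^esub> \<iota> i = \<tau> i)))"

definition is_cone ::
    "('o, 'a) cat \<Rightarrow> ('i, 'j) cat \<Rightarrow> ('i, 'j, 'o, 'a) ftor \<Rightarrow> 'o \<Rightarrow> ('i \<Rightarrow> 'a) \<Rightarrow> bool" where
  "is_cone C J D X \<pi> \<longleftrightarrow>
     X \<in> Obj C \<and> (\<forall>i \<in> Obj J. \<pi> i \<in> hom C X (FO D i)) \<and>
     (\<forall>a \<in> Arr J. FA D a \<cdot>\<^bsub>C\<^esub> \<pi> (Dom J a) = \<pi> (Cod J a))"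

definition is_limit ::
    "('o, 'a) cat \<Rightarrow> ('i, 'j) cat \<Rightarrow> ('i, 'j, 'o, 'a) ftor \<Rightarrow> 'o \<Rightarrow> ('i \<Rightarrow> 'a) \<Rightarrow> bool" where
  "is_limit C J D X \<pi> \<longleftrightarrow>
     is_cone C J D X \<pi> \<and>
     (\<forall>Y \<tau>. is_cone C J D Y \<tau> \<longrightarrow>
        (\<exists>!h. h \<in> hom C Y X \<and> (\<forall>i \<in> Obj J. \<pi> i \<cdot>\<^bsub>C\<^esub> h = \<tau> i)))"

definition small_category :: "('u, 'u) cat \<Rightarrow> bool" where
  "small_category J \<longleftrightarrow> category J \<and> small TYPE('u) (Arr J)"

definition cocomplete :: "'u itself \<Rightarrow> ('o, 'a) cat \<Rightarrow> bool" where
  "cocomplete _ C \<longleftrightarrow>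
     (\<forall>(J :: ('u, 'u) cat) D. small_category J \<and> is_functor J C D \<longrightarrow> (\<exists>X \<iota>. is_colimit C J D X \<iota>))"

definition complete :: "'u itself \<Rightarrow> ('o, 'a) cat \<Rightarrow> bool" where
  "complete _ C \<longleftrightarrow>
     (\<forall>(J :: ('u, 'u) cat) D. small_category J \<and> is_functor J C D \<longrightarrow> (\<exists>X \<pi>. is_limit C J D X \<pi>))"

text \<open>
  Every finite category is isomorphic to one with objects and arrows in \<open>nat\<close>.
\<close>

definition finite_category :: "(nat, nat) cat \<Rightarrow> bool" where
  "finite_category J \<longleftrightarrow> category J \<and> finite (Arr J)"

definition has_finite_limits :: "('o, 'a) cat \<Rightarrow> bool" where
  "has_finite_limits C \<longleftrightarrow>
     (\<forall>J D. finite_category J \<and> is_functor J C D \<longrightarrow> (\<exists>X \<pi>. is_limit C J D X \<pi>))"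

definition preserves_finite_colimits ::
    "('o, 'a) cat \<Rightarrow> ('p, 'b) cat \<Rightarrow> ('o, 'a, 'p, 'b) ftor \<Rightarrow> bool" where
  "preserves_finite_colimits A B F \<longleftrightarrow>
     (\<forall>J D X \<iota>. finite_category J \<and> is_functor J A D \<and> is_colimit A J D X \<iota> \<longrightarrow>
        is_colimit B J (compose_ftor F D) (FO F X) (\<lambda>i. FA F (\<iota> i)))"

definition is_initial :: "('o, 'a) cat \<Rightarrow> 'o \<Rightarrow> bool" where
  "is_initial C E \<longleftrightarrow> E \<in> Obj C \<and> (\<forall>X \<in> Obj C. \<exists>!f. f \<in> hom C E X)"

definition is_terminal :: "('o, 'a) cat \<Rightarrow> 'o \<Rightarrow> bool" where
  "is_terminal C T \<longleftrightarrow> T \<in> Obj C \<and> (\<forall>X \<in> Obj C. \<exists>!f. f \<in> hom C X T)"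

definition is_coproduct :: "('o, 'a) cat \<Rightarrow> 'o \<Rightarrow> 'o \<Rightarrow> 'o \<Rightarrow> 'a \<Rightarrow> 'a \<Rightarrow> bool" where
  "is_coproduct C A B S i j \<longleftrightarrow>
     S \<in> Obj C \<and> i \<in> hom C A S \<and> j \<in> hom C B S \<and>
     (\<forall>X f g. f \<in> hom C A X \<and> g \<in> hom C B X \<longrightarrow>
        (\<exists>!h. h \<in> hom C S X \<and> h \<cdot>\<^bsub>C\<^esub> i = f \<and> h \<cdot>\<^bsub>C\<^esub> j = g))"

definition is_fold_map :: "('o, 'a) cat \<Rightarrow> 'o \<Rightarrow> 'o \<Rightarrow> 'a \<Rightarrow> 'a \<Rightarrow> 'a \<Rightarrow> bool" where
  "is_fold_map C A S i j n \<longleftrightarrow>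
     is_coproduct C A A S i j \<and> n \<in> hom C S A \<and>
     n \<cdot>\<^bsub>C\<^esub> i = Ident C A \<and> n \<cdot>\<^bsub>C\<^esub> j = Ident C A"

definition is_product :: "('o, 'a) cat \<Rightarrow> 'o \<Rightarrow> 'o \<Rightarrow> 'o \<Rightarrow> 'a \<Rightarrow> 'a \<Rightarrow> bool" where
  "is_product C A B P p q \<longleftrightarrow>
     P \<in> Obj C \<and> p \<in> hom C P A \<and> q \<in> hom C P B \<and>
     (\<forall>X f g. f \<in> hom C X A \<and> g \<in> hom C X B \<longrightarrow>
        (\<exists>!h. h \<in> hom C X P \<and> p \<cdot>\<^bsub>C\<^esub> h = f \<and> q \<cdot>\<^bsub>C\<^esub> h = g))"

text \<open>
  The square with legs \<open>p : P \<rightarrow> dom f\<close>, \<open>q : P \<rightarrow> dom g\<close> over the cospan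
  \<open>f, g\<close>, and the square with legs \<open>i : cod f \<rightarrow> P\<close>,
  \<open>j : cod g \<rightarrow> P\<close> under the span \<open>f, g\<close>.
\<close>

definition is_pullback :: "('o, 'a) cat \<Rightarrow> 'a \<Rightarrow> 'a \<Rightarrow> 'o \<Rightarrow> 'a \<Rightarrow> 'a \<Rightarrow> bool" where
  "is_pullback C f g P p q \<longleftrightarrow>
     f \<in> Arr C \<and> g \<in> Arr C \<and> Cod C f = Cod C g \<and>
     p \<in> hom C P (Dom C f) \<and> q \<in> hom C P (Dom C g) \<and> f \<cdot>\<^bsub>C\<^esub> p = g \<cdot>\<^bsub>C\<^esub> q \<and>
     (\<forall>X u v. u \<in> hom C X (Dom C f) \<and> v \<in> hom C X (Dom C g) \<and> f \<cdot>\<^bsub>C\<^esub> u = g \<cdot>\<^bsub>C\<^esub> v \<longrightarrow>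
        (\<exists>!h. h \<in> hom C X P \<and> p \<cdot>\<^bsub>C\<^esub> h = u \<and> q \<cdot>\<^bsub>C\<^esub> h = v))"

definition is_pushout :: "('o, 'a) cat \<Rightarrow> 'a \<Rightarrow> 'a \<Rightarrow> 'o \<Rightarrow> 'a \<Rightarrow> 'a \<Rightarrow> bool" where
  "is_pushout C f g P i j \<longleftrightarrow>
     f \<in> Arr C \<and> g \<in> Arr C \<and> Dom C f = Dom C g \<and>
     i \<in> hom C (Cod C f) P \<and> j \<in> hom C (Cod C g) P \<and> i \<cdot>\<^bsub>C\<^esub> f = j \<cdot>\<^bsub>C\<^esub> g \<and>
     (\<forall>X u v. u \<in> hom C (Cod C f) X \<and> v \<in> hom C (Cod C g) X \<and> u \<cdot>\<^bsub>C\<^esub> f = v \<cdot>\<^bsub>C\<^esub> g \<longrightarrow>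
        (\<exists>!h. h \<in> hom C P X \<and> h \<cdot>\<^bsub>C\<^esub> i = u \<and> h \<cdot>\<^bsub>C\<^esub> j = v))"

text \<open>
  A functor \<open>P\<close> is ``the'' functor \<open>B \<times> (-)\<close>, respectively
  \<open>Y \<times>\<^sub>B (-)\<close> for \<open>f : Y \<rightarrow> B\<close>, once projections exhibiting its values
  as products (pullbacks) are given, with respect to which its action on arrows is the induced one.
\<close>

definition product_functor ::
    "('o, 'a) cat \<Rightarrow> 'o \<Rightarrow> ('o, 'a, 'o, 'a) ftor \<Rightarrow> ('o \<Rightarrow> 'a) \<Rightarrow> ('o \<Rightarrow> 'a) \<Rightarrow> bool" where
  "product_functor C B P p q \<longleftrightarrow>
     is_functor C C P \<and>
     (\<forall>X \<in> Obj C. is_product C B X (FO P X) (p X) (q X)) \<and>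
     (\<forall>h \<in> Arr C. p (Cod C h) \<cdot>\<^bsub>C\<^esub> FA P h = p (Dom C h) \<and>
                  q (Cod C h) \<cdot>\<^bsub>C\<^esub> FA P h = h \<cdot>\<^bsub>C\<^esub> q (Dom C h))"

definition pullback_functor ::
    "('o, 'a) cat \<Rightarrow> 'a \<Rightarrow> ('a, 'a \<times> 'a \<times> 'a, 'o, 'a) ftor \<Rightarrow> ('a \<Rightarrow> 'a) \<Rightarrow> ('a \<Rightarrow> 'a) \<Rightarrow> bool" where
  "pullback_functor C f P p q \<longleftrightarrow>
     is_functor (slice C (Cod C f)) C P \<and>
     (\<forall>x \<in> Obj (slice C (Cod C f)). is_pullback C f x (FO P x) (p x) (q x)) \<and>
     (\<forall>(x, h, y) \<in> Arr (slice C (Cod C f)).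
        p y \<cdot>\<^bsub>C\<^esub> FA P (x, h, y) = p x \<and> q y \<cdot>\<^bsub>C\<^esub> FA P (x, h, y) = h \<cdot>\<^bsub>C\<^esub> q x)"


section \<open>Presentable objects, accessible and locally presentable categories\<close>

text \<open>
  The set-valued functor \<open>Hom(A, -)\<close> preserves the colimit \<open>Y\<close> of
  \<open>D\<close>: the canonical map from the colimit of the sets \<open>Hom(A, D i)\<close>, that
  is, their disjoint union modulo the generated equivalence relation, to \<open>Hom(A, Y)\<close>
  is surjective and injective.
\<close>

definition hom_colim_step ::
    "('o, 'a) cat \<Rightarrow> ('i, 'j) cat \<Rightarrow> ('i, 'j, 'o, 'a) ftor \<Rightarrow> 'o \<Rightarrow> ('i \<times> 'a) rel" where
  "hom_colim_step C J D A =
     {((Dom J a, f), (Cod J a, FA D a \<cdot>\<^bsub>C\<^esub> f)) | a f. a \<in> Arr J \<and> f \<in> hom C A (FO D (Dom J a))}"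

definition hom_preserves_colimit ::
    "('o, 'a) cat \<Rightarrow> 'o \<Rightarrow> ('i, 'j) cat \<Rightarrow> ('i, 'j, 'o, 'a) ftor \<Rightarrow> 'o \<Rightarrow> ('i \<Rightarrow> 'a) \<Rightarrow> bool" where
  "hom_preserves_colimit C A J D Y \<iota> \<longleftrightarrow>
     (\<forall>h \<in> hom C A Y. \<exists>i \<in> Obj J. \<exists>f \<in> hom C A (FO D i). \<iota> i \<cdot>\<^bsub>C\<^esub> f = h) \<and>
     (\<forall>i \<in> Obj J. \<forall>i' \<in> Obj J. \<forall>f \<in> hom C A (FO D i). \<forall>f' \<in> hom C A (FO D i').
        \<iota> i \<cdot>\<^bsub>C\<^esub> f = \<iota> i' \<cdot>\<^bsub>C\<^esub> f' \<longrightarrow>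
        ((i, f), (i', f')) \<in> (hom_colim_step C J D A \<union> (hom_colim_step C J D A)\<inverse>)\<^sup>*)"

text \<open>
  The diagrams \<open>E\<close> need not be injective: requiring cocones only for subcategories
  with fewer than \<open>lam\<close> arrows would not coequalize an endomorphism of infinite order
  with an identity.
\<close>

definition filtered :: "'k rel \<Rightarrow> ('u, 'u) cat \<Rightarrow> bool" where
  "filtered lam J \<longleftrightarrow>
     category J \<and>
     (\<forall>(K :: ('u, 'u) cat) E. category K \<and> |Arr K| <o lam \<and> is_functor K J E \<longrightarrow>
        (\<exists>i \<tau>. is_cocone J K E i \<tau>))"

definition presentable :: "'u itself \<Rightarrow> 'k rel \<Rightarrow> ('o, 'a) cat \<Rightarrow> 'o \<Rightarrow> bool" where
  "presentable _ lam C A \<longleftrightarrow>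
     A \<in> Obj C \<and>
     (\<forall>(J :: ('u, 'u) cat) D Y \<iota>.
        small_category J \<and> filtered lam J \<and> is_functor J C D \<and> is_colimit C J D Y \<iota> \<longrightarrow>
        hom_preserves_colimit C A J D Y \<iota>)"

definition accessible :: "'u itself \<Rightarrow> 'k rel \<Rightarrow> ('o, 'a) cat \<Rightarrow> bool" where
  "accessible U lam C \<longleftrightarrow>
     category C \<and> locally_small U C \<and>
     (\<forall>(J :: ('u, 'u) cat) D. small_category J \<and> filtered lam J \<and> is_functor J C D \<longrightarrow>
        (\<exists>X \<iota>. is_colimit C J D X \<iota>)) \<and>
     (\<exists>G \<subseteq> Obj C. small U G \<and> (\<forall>A \<in> G. presentable U lam C A) \<and>
        (\<forall>X \<in> Obj C. \<exists>(J :: ('u, 'u) cat) D \<iota>.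
           small_category J \<and> filtered lam J \<and> is_functor J C D \<and> FO D ` Obj J \<subseteq> G \<and>
           is_colimit C J D X \<iota>))"

definition locally_presentable_card :: "'u itself \<Rightarrow> 'k rel \<Rightarrow> ('o, 'a) cat \<Rightarrow> bool" where
  "locally_presentable_card U lam C \<longleftrightarrow> cocomplete U C \<and> accessible U lam C"

definition locally_presentable :: "'u itself \<Rightarrow> ('o, 'a) cat \<Rightarrow> bool" where
  "locally_presentable U C \<longleftrightarrow>
     (\<exists>lam :: 'u rel. regular_cardinal lam \<and> lam <o |UNIV :: 'u set| \<and>
        locally_presentable_card U lam C)"

abbreviation finitely_presentable :: "'u itself \<Rightarrow> ('o, 'a) cat \<Rightarrow> 'o \<Rightarrow> bool" where
  "finitely_presentable U \<equiv> presentable U natLeq"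

abbreviation finitely_accessible :: "'u itself \<Rightarrow> ('o, 'a) cat \<Rightarrow> bool" where
  "finitely_accessible U \<equiv> accessible U natLeq"

abbreviation locally_finitely_presentable :: "'u itself \<Rightarrow> ('o, 'a) cat \<Rightarrow> bool" where
  "locally_finitely_presentable U \<equiv> locally_presentable_card U natLeq"

lemma regular_cardinal_natLeq: "regular_cardinal natLeq"
  by (simp add: regular_cardinal_def natLeq_Card_order natLeq_cinfinite regularCard_natLeq)


section \<open>Model categories\<close>

definition wide_subcategory :: "('o, 'a) cat \<Rightarrow> 'a set \<Rightarrow> bool" where
  "wide_subcategory C S \<longleftrightarrow>
     S \<subseteq> Arr C \<and> (\<forall>X \<in> Obj C. Ident C X \<in> S) \<and>
     (\<forall>f \<in> S. \<forall>g \<in> S. Dom C g = Cod C f \<longrightarrow> g \<cdot>\<^bsub>C\<^esub> f \<in> S)"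

definition two_out_of_three :: "('o, 'a) cat \<Rightarrow> 'a set \<Rightarrow> bool" where
  "two_out_of_three C W \<longleftrightarrow>
     (\<forall>f \<in> Arr C. \<forall>g \<in> Arr C. Dom C g = Cod C f \<longrightarrow>
        (f \<in> W \<and> g \<in> W \<longrightarrow> g \<cdot>\<^bsub>C\<^esub> f \<in> W) \<and>
        (f \<in> W \<and> g \<cdot>\<^bsub>C\<^esub> f \<in> W \<longrightarrow> g \<in> W) \<and>
        (g \<in> W \<and> g \<cdot>\<^bsub>C\<^esub> f \<in> W \<longrightarrow> f \<in> W))"

definition is_retract :: "('o, 'a) cat \<Rightarrow> 'o \<Rightarrow> 'o \<Rightarrow> bool" where
  "is_retract C X Y \<longleftrightarrow>
     X \<in> Obj C \<and> (\<exists>i \<in> hom C X Y. \<exists>r \<in> hom C Y X. r \<cdot>\<^bsub>C\<^esub> i = Ident C X)"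

definition retract_closed :: "('o, 'a) cat \<Rightarrow> 'a set \<Rightarrow> bool" where
  "retract_closed C S \<longleftrightarrow> (\<forall>f g. g \<in> S \<and> is_retract (arrow_cat C) f g \<longrightarrow> f \<in> S)"

definition has_lift :: "('o, 'a) cat \<Rightarrow> 'a \<Rightarrow> 'a \<Rightarrow> bool" where
  "has_lift C i p \<longleftrightarrow>
     (\<forall>u v. (i, u, v, p) \<in> Arr (arrow_cat C) \<longrightarrow>
        (\<exists>h \<in> hom C (Cod C i) (Dom C p). h \<cdot>\<^bsub>C\<^esub> i = u \<and> p \<cdot>\<^bsub>C\<^esub> h = v))"

definition rlp :: "('o, 'a) cat \<Rightarrow> 'a set \<Rightarrow> 'a set" where
  "rlp C S = {p \<in> Arr C. \<forall>i \<in> S. has_lift C i p}"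

definition llp :: "('o, 'a) cat \<Rightarrow> 'a set \<Rightarrow> 'a set" where
  "llp C S = {i \<in> Arr C. \<forall>p \<in> S. has_lift C i p}"

definition functorial_factorization :: "('o, 'a) cat \<Rightarrow> 'a set \<Rightarrow> 'a set \<Rightarrow> bool" where
  "functorial_factorization C L R \<longleftrightarrow>
     (\<exists>E \<alpha> \<beta>. is_functor (arrow_cat C) C E \<and>
        (\<forall>f \<in> Arr C. \<alpha> f \<in> L \<and> \<beta> f \<in> R \<and>
           \<alpha> f \<in> hom C (Dom C f) (FO E f) \<and> \<beta> f \<in> hom C (FO E f) (Cod C f) \<and>
           \<beta> f \<cdot>\<^bsub>C\<^esub> \<alpha> f = f) \<and>
        (\<forall>(f, u, v, g) \<in> Arr (arrow_cat C).
           FA E (f, u, v, g) \<cdot>\<^bsub>C\<^esub> \<alpha> f = \<alpha> g \<cdot>\<^bsub>C\<^esub> u \<and>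
           \<beta> g \<cdot>\<^bsub>C\<^esub> FA E (f, u, v, g) = v \<cdot>\<^bsub>C\<^esub> \<beta> f))"

definition model_category ::
    "'u itself \<Rightarrow> ('o, 'a) cat \<Rightarrow> 'a set \<Rightarrow> 'a set \<Rightarrow> 'a set \<Rightarrow> bool" where
  "model_category U C W F Cof \<longleftrightarrow>
     category C \<and> locally_small U C \<and> complete U C \<and> cocomplete U C \<and>
     wide_subcategory C W \<and> wide_subcategory C F \<and> wide_subcategory C Cof \<and>
     two_out_of_three C W \<and>
     retract_closed C W \<and> retract_closed C F \<and> retract_closed C Cof \<and>
     (\<forall>i \<in> W \<inter> Cof. \<forall>p \<in> F. has_lift C i p) \<and>
     (\<forall>i \<in> Cof. \<forall>p \<in> W \<inter> F. has_lift C i p) \<and>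
     functorial_factorization C Cof (W \<inter> F) \<and>
     functorial_factorization C (W \<inter> Cof) F"

definition cofibrant :: "('o, 'a) cat \<Rightarrow> 'a set \<Rightarrow> 'o \<Rightarrow> bool" where
  "cofibrant C Cof X \<longleftrightarrow> (\<exists>E f. is_initial C E \<and> f \<in> hom C E X \<and> f \<in> Cof)"

definition left_proper :: "('o, 'a) cat \<Rightarrow> 'a set \<Rightarrow> 'a set \<Rightarrow> bool" where
  "left_proper C W Cof \<longleftrightarrow>
     (\<forall>f g P i j. is_pushout C f g P i j \<and> f \<in> W \<and> g \<in> Cof \<longrightarrow> j \<in> W)"


subsection \<open>Cofibrant generation\<close>

text \<open>Ordinals are represented by well-orders; they are allowed to be arbitrary small ones.\<close>

definition ord_least :: "'i rel \<Rightarrow> 'i \<Rightarrow> bool" where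
  "ord_least r z \<longleftrightarrow> z \<in> Field r \<and> (\<forall>b \<in> Field r. (z, b) \<in> r)"

definition ord_succ :: "'i rel \<Rightarrow> 'i \<Rightarrow> 'i \<Rightarrow> bool" where
  "ord_succ r b b' \<longleftrightarrow> (b, b') \<in> r \<and> b \<noteq> b' \<and> (\<forall>c \<in> underS r b'. (c, b) \<in> r)"

definition ord_limit :: "'i rel \<Rightarrow> 'i \<Rightarrow> bool" where
  "ord_limit r c \<longleftrightarrow> c \<in> Field r \<and> \<not> ord_least r c \<and> \<not> (\<exists>b. ord_succ r b c)"

definition ord_sequence :: "('o, 'a) cat \<Rightarrow> 'i rel \<Rightarrow> ('i, 'i \<times> 'i, 'o, 'a) ftor \<Rightarrow> bool" where
  "ord_sequence C r X \<longleftrightarrow>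
     Well_order r \<and> is_functor (order_cat r) C X \<and>
     (\<forall>c. ord_limit r c \<longrightarrow>
        is_colimit C (order_cat (Restr r (underS r c))) X (FO X c) (\<lambda>b. FA X (b, c)))"

text \<open>
  A limit ordinal \<open>r\<close> is \<open>kappa\<close>-filtered if its subsets of
  cardinality at most \<open>kappa\<close> are bounded. The empty subset makes it nonempty.
\<close>

definition ord_filtered :: "'k rel \<Rightarrow> 'i rel \<Rightarrow> bool" where
  "ord_filtered kappa r \<longleftrightarrow>
     Well_order r \<and> (\<forall>b \<in> Field r. \<exists>c \<in> Field r. (b, c) \<in> r \<and> b \<noteq> c) \<and>
     (\<forall>A \<subseteq> Field r. |A| \<le>o kappa \<longrightarrow> (\<exists>b \<in> Field r. \<forall>a \<in> A. (a, b) \<in> r))"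

definition small_relative :: "'u itself \<Rightarrow> ('o, 'a) cat \<Rightarrow> 'a set \<Rightarrow> 'o \<Rightarrow> bool" where
  "small_relative U C S A \<longleftrightarrow>
     A \<in> Obj C \<and>
     (\<exists>kappa :: 'u rel. Card_order kappa \<and> kappa <o |UNIV :: 'u set| \<and>
        (\<forall>(r :: 'u rel) X Y \<iota>.
           ord_filtered kappa r \<and> small U (Field r) \<and> ord_sequence C r X \<and>
           (\<forall>b b'. ord_succ r b b' \<longrightarrow> FA X (b, b') \<in> S) \<and>
           is_colimit C (order_cat r) X Y \<iota> \<longrightarrow>
           hom_preserves_colimit C A (order_cat r) X Y \<iota>))"

text \<open>Relative cell complexes: transfinite compositions of pushouts of elements of \<open>I\<close>.\<close>

definition relative_cell :: "'u itself \<Rightarrow> ('o, 'a) cat \<Rightarrow> 'a set \<Rightarrow> 'a set" where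
  "relative_cell U C I =
     {\<iota> z | \<iota> z. \<exists>(r :: 'u rel) X Y.
        small U (Field r) \<and> ord_least r z \<and> ord_sequence C r X \<and>
        (\<forall>b b'. ord_succ r b b' \<longrightarrow>
           (\<exists>f \<in> I. \<exists>g i. is_pushout C f g (FO X b') i (FA X (b, b')))) \<and>
        is_colimit C (order_cat r) X Y \<iota>}"

definition cofibrantly_generated ::
    "'u itself \<Rightarrow> ('o, 'a) cat \<Rightarrow> 'a set \<Rightarrow> 'a set \<Rightarrow> bool" where
  "cofibrantly_generated U C W F \<longleftrightarrow>
     (\<exists>I \<subseteq> Arr C. \<exists>J \<subseteq> Arr C. small U I \<and> small U J \<and>
        (\<forall>i \<in> I. small_relative U C (relative_cell U C I) (Dom C i)) \<and>
        (\<forall>j \<in> J. small_relative U C (relative_cell U C J) (Dom C j)) \<and>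
        F = rlp C J \<and> W \<inter> F = rlp C I)"

definition combinatorial_model_category ::
    "'u itself \<Rightarrow> ('o, 'a) cat \<Rightarrow> 'a set \<Rightarrow> 'a set \<Rightarrow> 'a set \<Rightarrow> bool" where
  "combinatorial_model_category U C W F Cof \<longleftrightarrow>
     model_category U C W F Cof \<and> locally_presentable U C \<and> cofibrantly_generated U C W F"

text \<open>
  A class \<open>S\<close> of arrows is generated by a small set \<open>I\<close> if it is the
  class of \<open>I\<close>-cofibrations, \<open>llp (rlp I)\<close>.
\<close>

definition generated_by_finitely_presentable ::
    "'u itself \<Rightarrow> ('o, 'a) cat \<Rightarrow> 'a set \<Rightarrow> bool" where
  "generated_by_finitely_presentable U C S \<longleftrightarrow>
     (\<exists>I \<subseteq> Arr C. small U I \<and>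
        (\<forall>i \<in> I. finitely_presentable U C (Dom C i) \<and> finitely_presentable U C (Cod C i)) \<and>
        S = llp C (rlp C I))"

definition omega_combinatorial_model_category ::
    "'u itself \<Rightarrow> ('o, 'a) cat \<Rightarrow> 'a set \<Rightarrow> 'a set \<Rightarrow> 'a set \<Rightarrow> bool" where
  "omega_combinatorial_model_category U C W F Cof \<longleftrightarrow>
     combinatorial_model_category U C W F Cof \<and>
     locally_finitely_presentable U C \<and>
     generated_by_finitely_presentable U C Cof \<and>
     generated_by_finitely_presentable U C (W \<inter> Cof)"

end

theory Submission
  imports Defs
begin

text \<open>
  Say that an arrow \<open>f\<close> factors via a class \<open>S\<close> if every square from an arrow between
  finitely presentable objects to \<open>f\<close> factors through an element of \<open>S\<close> between such objects.
  The heart of the proof is that \<open>f\<close> is a weak equivalence if and only if it factors via weak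
  equivalences. The condition on the right is stable under filtered colimits, and it says that the
  weak equivalences between presentable objects are cofinal in the canonical diagram of presentable
  arrows over \<open>f\<close>, whose colimit is \<open>f\<close>.

  By the small object argument every trivial cofibration factors via trivial cofibrations. If \<open>f\<close>
  factors via weak equivalences, write \<open>f = p i\<close> with \<open>i\<close> a trivial cofibration and \<open>p\<close> a
  fibration. A lifting problem of \<open>p\<close> against a generating cofibration is pushed forward, first
  along the trivial cofibrations approximating \<open>i\<close> and then along the weak equivalences
  approximating \<open>f\<close>, to one that can be solved with the lifting axioms, so \<open>p\<close> is a trivial
  fibration.

  Conversely let \<open>f = p i\<close> be a weak equivalence, with \<open>i\<close> a trivial cofibration and \<open>p\<close> a trivial
  fibration. Products with \<open>I\<close> give mapping cylinders, hence factorizations into a cofibration and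
  a weak equivalence between presentable objects. Given \<open>g : A \<rightarrow> B\<close> over \<open>f\<close>, factor it through
  a mapping cylinder \<open>A \<rightarrow> C \<rightarrow> B\<close>, lift \<open>C\<close> to the source of \<open>p\<close>, factor
  \<open>A \<rightarrow> C\<close> through a weak equivalence \<open>E \<rightarrow> D\<close> over \<open>i\<close> such that \<open>C \<rightarrow> D\<close> is a cofibration,
  and use left properness to push \<open>C \<rightarrow> B\<close> forward along \<open>C \<rightarrow> D\<close>.
\<close>


section \<open>Small sets\<close>

text \<open>The functorial factorizations of the model structure need not stay among finitely
  presentable objects, and this obstacle shapes the proof: every factorization that has to remain
  presentable is built from \<open>I\<close>. Pullback along the map from \<open>A\<close> to the
  terminal object preserves the coproduct of the terminal object with itself, so the product of
  \<open>A\<close> with \<open>I\<close> receives a map from the coproduct of two copies of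
  \<open>A\<close>. The third hypothesis makes this map a cofibration and the projection to
  \<open>A\<close> a weak equivalence, and cofibrancy of \<open>B\<close> makes the inclusion of
  \<open>A\<close> into its coproduct with \<open>B\<close> a cofibration. The ambient
  factorizations remain in use for arrows between arbitrary objects; there only the trivial
  cofibration is approximated by presentable arrows, while the trivial fibration serves for lifting.

  The condition of factoring via \<open>S\<close> quantifies over squares instead of asking for a
  presentation as a filtered colimit, because in this form its stability under filtered colimits
  follows from presentability alone. Stability of the weak equivalences under filtered colimits is
  thus a result and not an assumption.\<close>

lemma small_inj: "small (U :: 'u itself) A \<Longrightarrow> \<exists>e :: 'x \<Rightarrow> 'u. inj_on e A"
  unfolding small_def using card_of_ordLeq[of A "UNIV :: 'u set"] ordLess_imp_ordLeq by blast

lemma small_subset: "small U A \<Longrightarrow> B \<subseteq> A \<Longrightarrow> small U B"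
  unfolding small_def using card_of_mono1 ordLeq_ordLess_trans by blast

lemma small_image: "small U A \<Longrightarrow> small U (f ` A)"
  unfolding small_def using card_of_image ordLeq_ordLess_trans by blast

lemma small_inj_on: "small U (f ` A) \<Longrightarrow> inj_on f A \<Longrightarrow> small U A"
  using small_image[of U "f ` A" "inv_into A f"] by simp

lemma small_nat:
  assumes "universe (U :: 'u itself)" shows "small U (A :: nat set)"
proof -
  have "|UNIV :: nat set| <o |UNIV :: 'u set|"
    using assms card_of_nat ordIso_ordLess_trans unfolding universe_def by blast
  then show ?thesis using small_subset[of U UNIV A] by (simp add: small_def)
qed

lemma small_finite: "universe U \<Longrightarrow> finite A \<Longrightarrow> small U A"
  using small_image[OF small_nat] finite_imp_nat_seg_image_inj_on[of A] by metis

text \<open>Regularity of the universe enters here: for an infinite cardinal it yields stability,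
  that is, closure of the smaller sets under dependent sums.\<close>

lemma stable_universe:
  assumes "universe (U :: 'u itself)" shows "stable |UNIV :: 'u set|"
proof (rule regularCard_stable)
  have "natLeq \<le>o |UNIV :: 'u set|"
    using assms ordLess_imp_ordLeq unfolding universe_def by blast
  then show "\<not> finite (Field |UNIV :: 'u set| )"
    unfolding Field_card_of using infinite_iff_natLeq_ordLeq[of "UNIV :: 'u set"] by blast
qed (use assms in \<open>auto simp: universe_def card_of_Card_order\<close>)

lemma small_Sigma: "universe U \<Longrightarrow> small U A \<Longrightarrow> (\<And>a. a \<in> A \<Longrightarrow> small U (B a)) \<Longrightarrow> small U (Sigma A B)"
  unfolding small_def by (rule stable_elim[OF stable_universe])

lemma small_Times: "universe U \<Longrightarrow> small U A \<Longrightarrow> small U B \<Longrightarrow> small U (A \<times> B)"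
  by (rule small_Sigma)

lemma small_UN:
  assumes "universe U" "small U A" "\<And>a. a \<in> A \<Longrightarrow> small U (B a)"
  shows "small U (\<Union>a\<in>A. B a)"
proof -
  have "(\<Union>a\<in>A. B a) = snd ` Sigma A B" by force
  moreover have "small U (snd ` Sigma A B)" by (intro small_image small_Sigma assms)
  ultimately show ?thesis by (simp only:)
qed

text \<open>The power set clause of \<open>universe\<close> speaks of sets of type \<open>'u\<close>
  only, so \<open>A\<close> is first embedded there; an injection on \<open>A\<close> induces one on
  its subsets.\<close>

lemma small_Pow:
  assumes "universe (U :: 'u itself)" "small U (A :: 'x set)" shows "small U (Pow A)"
proof -
  obtain e :: "'x \<Rightarrow> 'u" where e: "inj_on e A" using small_inj assms(2) by blast
  have "small U (Pow (e ` A))"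
    using assms small_image[of U A e] unfolding universe_def small_def by blast
  then have "small U ((`) e ` Pow A)" by (simp add: image_Pow_surj)
  then show ?thesis using small_inj_on inj_on_image_Pow[OF e] by blast
qed


section \<open>Categories\<close>

lemma homD: "f \<in> hom C X Y \<Longrightarrow> f \<in> Arr C" "f \<in> hom C X Y \<Longrightarrow> Dom C f = X"
  "f \<in> hom C X Y \<Longrightarrow> Cod C f = Y"
  by (simp_all add: hom_def)

context category
begin

lemma hom_ObjD: "f \<in> hom C X Y \<Longrightarrow> X \<in> Obj C" "f \<in> hom C X Y \<Longrightarrow> Y \<in> Obj C"
  using Dom_Obj Cod_Obj by (auto simp: hom_def)

text \<open>The axioms of \<open>category\<close> mention an intermediate object that rewriting
  cannot guess. Restated through \<open>Dom\<close> and \<open>Cod\<close> they become simp rules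
  that associate composites to the right, so that unfolding \<open>hom_def\<close> settles most
  equations between composites below.\<close>

lemma Arr_Comp [simp]: "f \<in> Arr C \<Longrightarrow> g \<in> Arr C \<Longrightarrow> Dom C g = Cod C f \<Longrightarrow> g \<cdot> f \<in> Arr C"
  and Dom_Comp [simp]: "f \<in> Arr C \<Longrightarrow> g \<in> Arr C \<Longrightarrow> Dom C g = Cod C f \<Longrightarrow> Dom C (g \<cdot> f) = Dom C f"
  and Cod_Comp [simp]: "f \<in> Arr C \<Longrightarrow> g \<in> Arr C \<Longrightarrow> Dom C g = Cod C f \<Longrightarrow> Cod C (g \<cdot> f) = Cod C g"
  using Comp_hom[of f "Dom C f" "Cod C f" g "Cod C g"] by (simp_all add: hom_def)

lemma Comp_assoc' [simp]:
  "f \<in> Arr C \<Longrightarrow> g \<in> Arr C \<Longrightarrow> h \<in> Arr C \<Longrightarrow> Dom C g = Cod C f \<Longrightarrow> Dom C h = Cod C g \<Longrightarrow>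
    (h \<cdot> g) \<cdot> f = h \<cdot> (g \<cdot> f)"
  using Comp_assoc[of f "Dom C f" "Cod C f" g "Cod C g" h "Cod C h"] by (simp add: hom_def)

lemma Arr_Ident [simp]: "X \<in> Obj C \<Longrightarrow> Ident C X \<in> Arr C"
  and Dom_Ident [simp]: "X \<in> Obj C \<Longrightarrow> Dom C (Ident C X) = X"
  and Cod_Ident [simp]: "X \<in> Obj C \<Longrightarrow> Cod C (Ident C X) = X"
  using Ident_hom[of X] by (simp_all add: hom_def)

lemma Comp_Ident_right [simp]: "f \<in> Arr C \<Longrightarrow> Dom C f = X \<Longrightarrow> f \<cdot> Ident C X = f"
  and Comp_Ident_left [simp]: "f \<in> Arr C \<Longrightarrow> Cod C f = Y \<Longrightarrow> Ident C Y \<cdot> f = f"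
  using Ident_right[of f X "Cod C f"] Ident_left[of f "Dom C f" Y] by (simp_all add: hom_def)

lemmas Dom_Obj' [simp] = Dom_Obj and Cod_Obj' [simp] = Cod_Obj

end


section \<open>Transport of index categories\<close>

text \<open>
  The definitions of cocompleteness and presentability quantify over index categories with objects
  and arrows of type \<open>'u\<close>. Index categories arising in the proof live on other types and are
  moved along injections into \<open>'u\<close>.
\<close>

definition transport_cat :: "('i \<Rightarrow> 'x) \<Rightarrow> ('j \<Rightarrow> 'y) \<Rightarrow> ('i, 'j) cat \<Rightarrow> ('x, 'y) cat" where
  "transport_cat p q J =
     \<lparr>Obj = p ` Obj J, Arr = q ` Arr J,
      Dom = (\<lambda>y. p (Dom J (inv_into (Arr J) q y))),
      Cod = (\<lambda>y. p (Cod J (inv_into (Arr J) q y))),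
      Ident = (\<lambda>x. q (Ident J (inv_into (Obj J) p x))),
      Comp = (\<lambda>g f. q (inv_into (Arr J) q g \<cdot>\<^bsub>J\<^esub> inv_into (Arr J) q f))\<rparr>"

definition transport_ftor ::
    "('i \<Rightarrow> 'x) \<Rightarrow> ('j \<Rightarrow> 'y) \<Rightarrow> ('i, 'j) cat \<Rightarrow> ('i, 'j, 'o, 'a) ftor \<Rightarrow> ('x, 'y, 'o, 'a) ftor" where
  "transport_ftor p q J D =
     \<lparr>FO = FO D \<circ> inv_into (Obj J) p, FA = FA D \<circ> inv_into (Arr J) q\<rparr>"

locale transport = category J for J :: "('i, 'j) cat" +
  fixes p :: "'i \<Rightarrow> 'x" and q :: "'j \<Rightarrow> 'y"
  assumes inj_Obj: "inj_on p (Obj J)" and inj_Arr: "inj_on q (Arr J)"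
begin

abbreviation "J' \<equiv> transport_cat p q J"

lemma transport_simps [simp]:
  "Obj J' = p ` Obj J" "Arr J' = q ` Arr J"
  "a \<in> Arr J \<Longrightarrow> Dom J' (q a) = p (Dom J a)" "a \<in> Arr J \<Longrightarrow> Cod J' (q a) = p (Cod J a)"
  "i \<in> Obj J \<Longrightarrow> Ident J' (p i) = q (Ident J i)"
  "a \<in> Arr J \<Longrightarrow> b \<in> Arr J \<Longrightarrow> q b \<cdot>\<^bsub>J'\<^esub> q a = q (b \<cdot>\<^bsub>J\<^esub> a)"
  using inj_Obj inj_Arr by (simp_all add: transport_cat_def)

lemma p_eq_iff [simp]: "i \<in> Obj J \<Longrightarrow> k \<in> Obj J \<Longrightarrow> p i = p k \<longleftrightarrow> i = k"
  using inj_Obj by (auto dest: inj_onD)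

lemma hom_transport: "i \<in> Obj J \<Longrightarrow> k \<in> Obj J \<Longrightarrow> hom J' (p i) (p k) = q ` hom J i k"
  by (auto simp: hom_def)

lemma category_transport: "category J'"
proof (unfold_locales, goal_cases)
  case (4 f X Y g Z)
  then show ?case by (auto simp: hom_def)
next
  case (7 f X Y g Z h Z')
  then show ?case by (auto simp: hom_def)
qed (auto simp: hom_def)

lemma transport_ftor_simps [simp]:
  "i \<in> Obj J \<Longrightarrow> FO (transport_ftor p q J D) (p i) = FO D i"
  "a \<in> Arr J \<Longrightarrow> FA (transport_ftor p q J D) (q a) = FA D a"
  using inj_Obj inj_Arr by (simp_all add: transport_ftor_def)

lemma functor_transport: "is_functor J C D \<Longrightarrow> is_functor J' C (transport_ftor p q J D)"
  by (auto simp: is_functor_def)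

lemma cocone_transport:
  "is_cocone C J' (transport_ftor p q J D) X \<tau> \<longleftrightarrow> is_cocone C J D X (\<tau> \<circ> p)"
  by (simp add: is_cocone_def)

lemma cocone_cong: "(\<And>i. i \<in> Obj J \<Longrightarrow> \<tau> i = \<tau>' i) \<Longrightarrow> is_cocone C J D X \<tau> \<longleftrightarrow> is_cocone C J D X \<tau>'"
  by (simp add: is_cocone_def)

lemma cocone_transport_inv:
  "is_cocone C J' (transport_ftor p q J D) X (\<tau> \<circ> inv_into (Obj J) p) \<longleftrightarrow> is_cocone C J D X \<tau>"
  unfolding cocone_transport by (rule cocone_cong) (simp add: inj_Obj)

text \<open>Transport renames the indices and leaves the vertices of cocones in \<open>C\<close>, so
  both universal properties quantify over the same maps \<open>h\<close>. A cocone on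
  \<open>J\<close> is carried over along the inverse of \<open>p\<close> on the objects of
  \<open>J\<close>.\<close>

lemma colimit_transport:
  "is_colimit C J' (transport_ftor p q J D) X \<tau> \<longleftrightarrow> is_colimit C J D X (\<tau> \<circ> p)"
proof
  assume a: "is_colimit C J' (transport_ftor p q J D) X \<tau>"
  show "is_colimit C J D X (\<tau> \<circ> p)"
    unfolding is_colimit_def
  proof (intro conjI allI impI)
    show "is_cocone C J D X (\<tau> \<circ> p)"
      by (rule cocone_transport[THEN iffD1]) (use a in \<open>simp add: is_colimit_def\<close>)
    fix Y \<sigma> assume "is_cocone C J D Y \<sigma>"
    then have "is_cocone C J' (transport_ftor p q J D) Y (\<sigma> \<circ> inv_into (Obj J) p)"
      by (simp only: cocone_transport_inv)
    then have "\<exists>!h. h \<in> hom C X Y \<and> (\<forall>i \<in> Obj J'. h \<cdot>\<^bsub>C\<^esub> \<tau> i = (\<sigma> \<circ> inv_into (Obj J) p) i)"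
      using a by (simp only: is_colimit_def)
    then show "\<exists>!h. h \<in> hom C X Y \<and> (\<forall>i \<in> Obj J. h \<cdot>\<^bsub>C\<^esub> (\<tau> \<circ> p) i = \<sigma> i)"
      by (simp add: inj_Obj)
  qed
next
  assume a: "is_colimit C J D X (\<tau> \<circ> p)"
  show "is_colimit C J' (transport_ftor p q J D) X \<tau>"
    unfolding is_colimit_def
  proof (intro conjI allI impI)
    show "is_cocone C J' (transport_ftor p q J D) X \<tau>"
      by (rule cocone_transport[THEN iffD2]) (use a in \<open>simp add: is_colimit_def\<close>)
    fix Y \<sigma> assume "is_cocone C J' (transport_ftor p q J D) Y \<sigma>"
    then have "is_cocone C J D Y (\<sigma> \<circ> p)" by (rule cocone_transport[THEN iffD1])
    then have "\<exists>!h. h \<in> hom C X Y \<and> (\<forall>i \<in> Obj J. h \<cdot>\<^bsub>C\<^esub> (\<tau> \<circ> p) i = (\<sigma> \<circ> p) i)"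
      using a by (simp only: is_colimit_def)
    then show "\<exists>!h. h \<in> hom C X Y \<and> (\<forall>i \<in> Obj J'. h \<cdot>\<^bsub>C\<^esub> \<tau> i = \<sigma> i)" by simp
  qed
qed

end

text \<open>The elementary form of filteredness. Unlike \<open>filtered\<close>, which tests
  diagrams indexed by categories on \<open>'u\<close>, it makes sense at every type and has few
  clauses to verify; \<open>filtered_imp_filt\<close> and \<open>filt_imp_filtered\<close> connect
  the two.\<close>

definition filt :: "('i, 'j) cat \<Rightarrow> bool" where
  "filt J \<longleftrightarrow> category J \<and> Obj J \<noteq> {} \<and>
     (\<forall>i \<in> Obj J. \<forall>k \<in> Obj J. \<exists>l. \<exists>\<alpha> \<in> hom J i l. \<exists>\<beta> \<in> hom J k l. True) \<and>
     (\<forall>i \<in> Obj J. \<forall>k \<in> Obj J. \<forall>\<alpha> \<in> hom J i k. \<forall>\<beta> \<in> hom J i k.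
        \<exists>l. \<exists>\<gamma> \<in> hom J k l. \<gamma> \<cdot>\<^bsub>J\<^esub> \<alpha> = \<gamma> \<cdot>\<^bsub>J\<^esub> \<beta>)"

lemma filt_category: "filt J \<Longrightarrow> category J"
  by (simp add: filt_def)

lemma filt_nonempty: "filt J \<Longrightarrow> \<exists>i. i \<in> Obj J"
  by (auto simp: filt_def)

lemma filt_bound:
  "filt J \<Longrightarrow> i \<in> Obj J \<Longrightarrow> k \<in> Obj J \<Longrightarrow> (\<And>l \<alpha> \<beta>. \<alpha> \<in> hom J i l \<Longrightarrow> \<beta> \<in> hom J k l \<Longrightarrow> thesis) \<Longrightarrow> thesis"
  unfolding filt_def by blast

lemma filt_coeq:
  "filt J \<Longrightarrow> \<alpha> \<in> hom J i k \<Longrightarrow> \<beta> \<in> hom J i k \<Longrightarrow>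
    (\<And>l \<gamma>. \<gamma> \<in> hom J k l \<Longrightarrow> \<gamma> \<cdot>\<^bsub>J\<^esub> \<alpha> = \<gamma> \<cdot>\<^bsub>J\<^esub> \<beta> \<Longrightarrow> thesis) \<Longrightarrow> thesis"
  unfolding filt_def using category.hom_ObjD by (smt (verit, best))

lemma filt_transport:
  assumes "filt J" "inj_on p (Obj J)" "inj_on q (Arr J)"
  shows "filt (transport_cat p q J)"
proof -
  interpret transport J p q
    using assms unfolding filt_def transport_def transport_axioms_def by blast
  show ?thesis
    unfolding filt_def
  proof (intro conjI ballI)
    show "category J'" by (rule category_transport)
    show "Obj J' \<noteq> {}" using filt_nonempty[OF assms(1)] by auto
  next
    fix i k assume "i \<in> Obj J'" "k \<in> Obj J'"
    then obtain i0 k0 where ik: "i0 \<in> Obj J" "k0 \<in> Obj J" "i = p i0" "k = p k0" by auto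
    from filt_bound[OF assms(1) ik(1,2)]
    obtain l \<alpha> \<beta> where l: "\<alpha> \<in> hom J i0 l" "\<beta> \<in> hom J k0 l" by blast
    then have "q \<alpha> \<in> hom J' i (p l)" "q \<beta> \<in> hom J' k (p l)" by (auto simp: hom_def ik)
    then show "\<exists>l. \<exists>\<alpha> \<in> hom J' i l. \<exists>\<beta> \<in> hom J' k l. True" by blast
  next
    fix i k \<alpha> \<beta> assume ab: "i \<in> Obj J'" "k \<in> Obj J'" "\<alpha> \<in> hom J' i k" "\<beta> \<in> hom J' i k"
    then obtain i0 k0 where ik: "i0 \<in> Obj J" "k0 \<in> Obj J" "i = p i0" "k = p k0" by auto
    then obtain a b where "a \<in> hom J i0 k0" "b \<in> hom J i0 k0" and ab': "\<alpha> = q a" "\<beta> = q b"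
      using ab hom_transport by auto
    moreover from filt_coeq[OF assms(1) this(1,2)] obtain l c
      where "c \<in> hom J k0 l" "c \<cdot>\<^bsub>J\<^esub> a = c \<cdot>\<^bsub>J\<^esub> b" by blast
    ultimately have "q c \<in> hom J' k (p l) \<and> q c \<cdot>\<^bsub>J'\<^esub> \<alpha> = q c \<cdot>\<^bsub>J'\<^esub> \<beta>"
      by (auto simp: hom_def ik)
    then show "\<exists>l. \<exists>\<gamma> \<in> hom J' k l. \<gamma> \<cdot>\<^bsub>J'\<^esub> \<alpha> = \<gamma> \<cdot>\<^bsub>J'\<^esub> \<beta>" by blast
  qed
qed

definition discrete_cat :: "'i set \<Rightarrow> ('i, 'i) cat" where
  "discrete_cat A = \<lparr>Obj = A, Arr = A, Dom = id, Cod = id, Ident = id, Comp = (\<lambda>g f. f)\<rparr>"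

lemma category_discrete_cat: "category (discrete_cat A)"
  by (auto simp: category_def discrete_cat_def hom_def)

lemma is_functor_discrete_cat:
  "category C \<Longrightarrow> (\<And>i. i \<in> A \<Longrightarrow> D i \<in> Obj C) \<Longrightarrow>
    is_functor (discrete_cat A) C \<lparr>FO = D, FA = \<lambda>i. Ident C (D i)\<rparr>"
  by (auto simp: is_functor_def discrete_cat_def hom_def category.Arr_Ident category.Dom_Ident
      category.Cod_Ident category.Comp_Ident_right)

lemma small_Obj: "category J \<Longrightarrow> small U (Arr J) \<Longrightarrow> small U (Obj J)"
proof -
  assume J: "category J" "small U (Arr J)"
  have "Obj J \<subseteq> Dom J ` Arr J"
    using category.Arr_Ident[OF J(1)] category.Dom_Ident[OF J(1)] by (metis imageI subsetI)
  then show ?thesis using small_subset[OF small_image[OF J(2)]] by blast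
qed

lemma transport_small:
  fixes U :: "'u itself" and J :: "('i, 'j) cat"
  assumes "category J" "small U (Arr J)"
  obtains p :: "'i \<Rightarrow> 'u" and q :: "'j \<Rightarrow> 'u" where "transport J p q"
    "small_category (transport_cat p q J)"
proof -
  obtain p :: "'i \<Rightarrow> 'u" where p: "inj_on p (Obj J)" using small_inj small_Obj assms by blast
  obtain q :: "'j \<Rightarrow> 'u" where q: "inj_on q (Arr J)" using small_inj assms by blast
  interpret transport J p q
    using assms p q by (simp add: transport_def transport_axioms_def)
  have "small TYPE('u) (Arr J')" using small_image[OF assms(2), of q]
    by (simp add: small_def)
  then show thesis using that[of p q] category_transport transport_axioms by (simp add: small_category_def)
qed

lemma cocomplete_any:
  fixes U :: "'u itself" and J :: "('i, 'j) cat"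
  assumes "cocomplete U C" "category J" "small U (Arr J)" "is_functor J C D"
  shows "\<exists>X \<iota>. is_colimit C J D X \<iota>"
proof -
  obtain p :: "'i \<Rightarrow> 'u" and q :: "'j \<Rightarrow> 'u" where t: "transport J p q"
    and s: "small_category (transport_cat p q J)"
    using transport_small[OF assms(2,3)] by metis
  interpret transport J p q by fact
  obtain X \<tau> where "is_colimit C J' (transport_ftor p q J D) X \<tau>"
    using assms(1)[unfolded cocomplete_def, rule_format, OF conjI[OF s functor_transport[OF assms(4)]]]
    by blast
  then show ?thesis unfolding colimit_transport by blast
qed


subsection \<open>Filtered categories\<close>

text \<open>Each clause of \<open>filt\<close> is a cocone over one finite shape: the empty
  category, two points, and a poset that stands in for a parallel pair. The auxiliary fact
  \<open>bd'\<close> first admits finite shapes of any type, which embed into \<open>'u\<close>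
  because the universe is infinite.\<close>

lemma filtered_imp_filt:
  fixes J :: "('u, 'u) cat"
  assumes U: "universe TYPE('u)" and "filtered natLeq J"
  shows "filt J"
proof -
  have J: "category J"
    and bd: "\<And>(K :: ('u, 'u) cat) E. category K \<Longrightarrow> finite (Arr K) \<Longrightarrow> is_functor K J E \<Longrightarrow>
      \<exists>i \<tau>. is_cocone J K E i \<tau>"
    using assms(2) by (auto simp: filtered_def finite_iff_ordLess_natLeq)
  interpret J: category J by fact
  have bd': "\<exists>i \<tau>. is_cocone J K E i \<tau>"
    if K: "category K" "finite (Arr K)" "is_functor K J E" for K :: "('i, 'j) cat" and E
  proof -
    obtain p :: "'i \<Rightarrow> 'u" and q :: "'j \<Rightarrow> 'u" where "transport K p q"
      "small_category (transport_cat p q K)"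
      using transport_small[OF K(1)] small_finite[OF U K(2)] by metis
    interpret transport K p q by fact
    have "finite (Arr J')" using K(2) by simp
    from bd[OF category_transport this functor_transport[OF K(3)]]
    show ?thesis unfolding cocone_transport by blast
  qed
  show ?thesis
    unfolding filt_def
  proof (intro conjI ballI)
    show "category J" by fact
    obtain i and \<tau> :: "'u \<Rightarrow> 'u" where "is_cocone J (discrete_cat {}) \<lparr>FO = \<lambda>_ :: 'u. undefined,
        FA = \<lambda>i. Ident J undefined\<rparr> i \<tau>"
      using bd'[OF category_discrete_cat _ is_functor_discrete_cat[OF J, of "{}"]]
      by (fastforce simp: discrete_cat_def)
    then show "Obj J \<noteq> {}" by (auto simp: is_cocone_def)
  next
    fix i k assume ik: "i \<in> Obj J" "k \<in> Obj J"
    have "\<exists>l \<tau>. is_cocone J (discrete_cat (UNIV :: bool set)) \<lparr>FO = \<lambda>b. if b then i else k,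
        FA = \<lambda>b. Ident J (if b then i else k)\<rparr> l \<tau>"
      by (rule bd'[OF category_discrete_cat _ is_functor_discrete_cat[OF J]])
        (auto simp: discrete_cat_def ik)
    then obtain l \<tau> where "\<And>b. \<tau> b \<in> hom J (if b then i else k) l"
      by (fastforce simp: is_cocone_def discrete_cat_def)
    then have "\<tau> True \<in> hom J i l" "\<tau> False \<in> hom J k l" by (metis (full_types))+
    then show "\<exists>l. \<exists>\<alpha> \<in> hom J i l. \<exists>\<beta> \<in> hom J k l. True" by blast
  next
    fix i k \<alpha> \<beta> assume ik: "i \<in> Obj J" "k \<in> Obj J" and ab: "\<alpha> \<in> hom J i k" "\<beta> \<in> hom J i k"
    \<comment> \<open>A cocone on the poset \<open>0, 1 < 2, 3\<close>, with \<open>\<alpha>\<close> and \<open>\<beta>\<close> starting at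
      \<open>0\<close> and identities at \<open>1\<close>, coequalizes \<open>\<alpha>\<close> and \<open>\<beta>\<close>.\<close>
    define r :: "nat rel" where "r = {(0,0),(1,1),(2,2),(3,3),(0,2),(0,3),(1,2),(1,3)}"
    have "Field r = {0,1,2,3}" by (auto simp: r_def Field_def)
    note r = this
    have "Preorder r"
      unfolding preorder_on_def refl_on_def r by (auto simp: r_def trans_def)
    define E :: "(nat, nat \<times> nat, 'u, 'u) ftor" where "E = \<lparr>FO = (\<lambda>n. if n = 0 then i else k),
      FA = (\<lambda>a. if a = (0,0) then Ident J i else if a = (0,2) then \<alpha> else if a = (0,3) then \<beta>
        else Ident J k)\<rparr>"
    have "is_functor (order_cat r) J E"
    proof -
      have o: "\<forall>X \<in> Field r. FO E X \<in> Obj J" "\<forall>X \<in> Field r. FA E (X, X) = Ident J (FO E X)"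
        unfolding r by (simp_all add: E_def ik)
      have a: "\<forall>f \<in> r. FA E f \<in> hom J (FO E (fst f)) (FO E (snd f))"
        unfolding r_def using ab ik by (simp add: E_def hom_def)
      have "\<forall>f \<in> r. \<forall>g \<in> r. fst g = snd f \<longrightarrow> FA E (fst f, snd g) = FA E g \<cdot>\<^bsub>J\<^esub> FA E f"
        unfolding r_def using ab ik by (simp add: E_def hom_def)
      with o a show ?thesis unfolding is_functor_def order_cat_def by simp
    qed
    then obtain l \<tau> where *: "is_cocone J (order_cat r) E l \<tau>"
      using bd'[OF category_order_cat[OF \<open>Preorder r\<close>]] by (fastforce simp: order_cat_def r_def)
    have t: "\<tau> 0 \<in> hom J i l" "\<tau> 1 \<in> hom J k l" "\<tau> 2 \<in> hom J k l" "\<tau> 3 \<in> hom J k l"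
      using * by (auto simp: is_cocone_def order_cat_def r E_def)
    have "\<tau> 2 \<cdot>\<^bsub>J\<^esub> \<alpha> = \<tau> 0" "\<tau> 3 \<cdot>\<^bsub>J\<^esub> \<beta> = \<tau> 0"
      "\<tau> 2 \<cdot>\<^bsub>J\<^esub> Ident J k = \<tau> 1" "\<tau> 3 \<cdot>\<^bsub>J\<^esub> Ident J k = \<tau> 1"
      using * unfolding is_cocone_def order_cat_def E_def r_def by auto
    \<comment> \<open>The identities force \<open>\<tau> 2\<close> and \<open>\<tau> 3\<close> both
      to equal \<open>\<tau> 1\<close>, hence each other.\<close>
    then have "\<tau> 2 \<cdot>\<^bsub>J\<^esub> \<alpha> = \<tau> 2 \<cdot>\<^bsub>J\<^esub> \<beta>" using t by (simp add: hom_def)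
    then show "\<exists>l. \<exists>\<gamma> \<in> hom J k l. \<gamma> \<cdot>\<^bsub>J\<^esub> \<alpha> = \<gamma> \<cdot>\<^bsub>J\<^esub> \<beta>" using t by blast
  qed
qed

lemma filt_finite_bound:
  assumes "filt J" "finite A" "A \<subseteq> Obj J"
  shows "\<exists>l \<in> Obj J. \<forall>i \<in> A. hom J i l \<noteq> {}"
  using assms(2,3)
proof (induction A)
  case empty
  then show ?case using filt_nonempty[OF assms(1)] by blast
next
  case (insert i A)
  interpret category J using assms filt_category by blast
  obtain l where l: "l \<in> Obj J" "\<And>k. k \<in> A \<Longrightarrow> hom J k l \<noteq> {}" using insert by auto
  have "i \<in> Obj J" using insert by auto
  obtain m \<alpha> \<beta> where m: "\<alpha> \<in> hom J i m" "\<beta> \<in> hom J l m"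
    by (rule filt_bound[OF assms(1) \<open>i \<in> Obj J\<close> l(1)])
  have "hom J k m \<noteq> {}" if k: "k \<in> insert i A" for k
  proof (cases "k = i")
    case False
    then obtain c where "c \<in> hom J k l" using k l by blast
    then show ?thesis using Comp_hom[OF _ m(2)] by blast
  qed (use m in auto)
  then show ?case using hom_ObjD(2)[OF m(1)] by blast
qed

text \<open>The objects of a finite diagram are bounded by one index \<open>l0\<close> through
  arbitrary arrows \<open>\<sigma> k\<close>, which need not be natural. The induction over finite
  sets \<open>A\<close> of arrows repairs naturality one arrow at a time by coequalizing further
  along; earlier repairs survive postcomposition.\<close>

lemma filt_imp_filtered:
  fixes J :: "('u, 'u) cat"
  assumes "filt J"
  shows "filtered natLeq J"
  unfolding filtered_def
proof (intro conjI allI impI)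
  show J: "category J" using assms filt_category by blast
  interpret category J by fact
  fix K :: "('u, 'u) cat" and E
  assume "category K \<and> |Arr K| <o natLeq \<and> is_functor K J E"
  then have K: "category K" "finite (Arr K)" "is_functor K J E"
    by (auto simp: finite_iff_ordLess_natLeq)
  interpret K: category K by fact
  have "Obj K \<subseteq> Dom K ` Arr K"
    using K.Arr_Ident K.Dom_Ident by (metis imageI subsetI)
  then have "finite (Obj K)" using K(2) finite_subset by blast
  moreover have "FO E ` Obj K \<subseteq> Obj J" using K(3) by (auto simp: is_functor_def)
  ultimately obtain l0 where l0: "l0 \<in> Obj J" "\<And>k. k \<in> Obj K \<Longrightarrow> hom J (FO E k) l0 \<noteq> {}"
    using filt_finite_bound[OF assms, of "FO E ` Obj K"] by blast
  define \<sigma> where "\<sigma> k = (SOME s. s \<in> hom J (FO E k) l0)" for k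
  have \<sigma>: "\<sigma> k \<in> hom J (FO E k) l0" if "k \<in> Obj K" for k
    unfolding \<sigma>_def using l0(2)[OF that] by (simp add: some_in_eq)
  have "\<exists>l. \<exists>\<gamma> \<in> hom J l0 l. \<forall>a \<in> A. \<gamma> \<cdot>\<^bsub>J\<^esub> (\<sigma> (Cod K a) \<cdot>\<^bsub>J\<^esub> FA E a) = \<gamma> \<cdot>\<^bsub>J\<^esub> \<sigma> (Dom K a)"
    if "finite A" "A \<subseteq> Arr K" for A
    using that
  proof (induction A)
    case empty
    then show ?case using Ident_hom[OF l0(1)] by blast
  next
    case (insert b A)
    then obtain l \<gamma> where l: "\<gamma> \<in> hom J l0 l"
      "\<And>a. a \<in> A \<Longrightarrow> \<gamma> \<cdot>\<^bsub>J\<^esub> (\<sigma> (Cod K a) \<cdot>\<^bsub>J\<^esub> FA E a) = \<gamma> \<cdot>\<^bsub>J\<^esub> \<sigma> (Dom K a)" by auto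
    have FA: "a \<in> Arr K \<Longrightarrow> FA E a \<in> hom J (FO E (Dom K a)) (FO E (Cod K a))" for a
      using K(3) by (simp add: is_functor_def)
    have b: "\<gamma> \<cdot>\<^bsub>J\<^esub> (\<sigma> (Cod K b) \<cdot>\<^bsub>J\<^esub> FA E b) \<in> hom J (FO E (Dom K b)) l"
      "\<gamma> \<cdot>\<^bsub>J\<^esub> \<sigma> (Dom K b) \<in> hom J (FO E (Dom K b)) l"
      using l(1) \<sigma>[of "Cod K b"] \<sigma>[of "Dom K b"] FA[of b] insert by (auto simp: hom_def)
    obtain m \<delta> where m: "\<delta> \<in> hom J l m"
      "\<delta> \<cdot>\<^bsub>J\<^esub> (\<gamma> \<cdot>\<^bsub>J\<^esub> (\<sigma> (Cod K b) \<cdot>\<^bsub>J\<^esub> FA E b)) = \<delta> \<cdot>\<^bsub>J\<^esub> (\<gamma> \<cdot>\<^bsub>J\<^esub> \<sigma> (Dom K b))"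
      by (rule filt_coeq[OF assms b])
    have "(\<delta> \<cdot>\<^bsub>J\<^esub> \<gamma>) \<cdot>\<^bsub>J\<^esub> (\<sigma> (Cod K a) \<cdot>\<^bsub>J\<^esub> FA E a) = (\<delta> \<cdot>\<^bsub>J\<^esub> \<gamma>) \<cdot>\<^bsub>J\<^esub> \<sigma> (Dom K a)" if "a \<in> insert b A" for a
    proof -
      have "a \<in> Arr K" using that insert by auto
      then have s: "\<sigma> (Cod K a) \<in> hom J (FO E (Cod K a)) l0" "\<sigma> (Dom K a) \<in> hom J (FO E (Dom K a)) l0"
        "FA E a \<in> hom J (FO E (Dom K a)) (FO E (Cod K a))" using \<sigma> FA by auto
      have "\<delta> \<cdot>\<^bsub>J\<^esub> (\<gamma> \<cdot>\<^bsub>J\<^esub> (\<sigma> (Cod K a) \<cdot>\<^bsub>J\<^esub> FA E a)) = \<delta> \<cdot>\<^bsub>J\<^esub> (\<gamma> \<cdot>\<^bsub>J\<^esub> \<sigma> (Dom K a))"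
        using that m(2) l(2) by auto
      then show ?thesis using s l(1) m(1) by (simp add: hom_def)
    qed
    moreover have "\<delta> \<cdot>\<^bsub>J\<^esub> \<gamma> \<in> hom J l0 m" by (rule Comp_hom[OF l(1) m(1)])
    ultimately show ?case by blast
  qed
  from this[OF K(2)] obtain l \<gamma> where g: "\<gamma> \<in> hom J l0 l"
    "\<And>a. a \<in> Arr K \<Longrightarrow> \<gamma> \<cdot>\<^bsub>J\<^esub> (\<sigma> (Cod K a) \<cdot>\<^bsub>J\<^esub> FA E a) = \<gamma> \<cdot>\<^bsub>J\<^esub> \<sigma> (Dom K a)" by auto
  have "is_cocone J K E l (\<lambda>k. \<gamma> \<cdot>\<^bsub>J\<^esub> \<sigma> k)"
    unfolding is_cocone_def
  proof (intro conjI ballI)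
    show "l \<in> Obj J" by (rule hom_ObjD(2)[OF g(1)])
    show "\<gamma> \<cdot>\<^bsub>J\<^esub> \<sigma> k \<in> hom J (FO E k) l" if "k \<in> Obj K" for k
      using Comp_hom[OF \<sigma> g(1)] that .
    fix a assume a: "a \<in> Arr K"
    then have "\<sigma> (Cod K a) \<in> hom J (FO E (Cod K a)) l0"
      "FA E a \<in> hom J (FO E (Dom K a)) (FO E (Cod K a))"
      using \<sigma> K(3) by (auto simp: is_functor_def)
    then show "\<gamma> \<cdot>\<^bsub>J\<^esub> \<sigma> (Cod K a) \<cdot>\<^bsub>J\<^esub> FA E a = \<gamma> \<cdot>\<^bsub>J\<^esub> \<sigma> (Dom K a)"
      using g a by (simp add: hom_def)
  qed
  then show "\<exists>i \<tau>. is_cocone J K E i \<tau>" by blast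
qed

section \<open>Functors, cocones and colimits\<close>

lemma functor_hom: "is_functor J C D \<Longrightarrow> \<alpha> \<in> hom J i k \<Longrightarrow> FA D \<alpha> \<in> hom C (FO D i) (FO D k)"
  by (auto simp: is_functor_def hom_def)

lemma functor_Obj: "is_functor J C D \<Longrightarrow> i \<in> Obj J \<Longrightarrow> FO D i \<in> Obj C"
  by (simp add: is_functor_def)

lemma functor_Comp:
  "is_functor J C D \<Longrightarrow> \<alpha> \<in> hom J i k \<Longrightarrow> \<beta> \<in> hom J k l \<Longrightarrow>
    FA D (\<beta> \<cdot>\<^bsub>J\<^esub> \<alpha>) = FA D \<beta> \<cdot>\<^bsub>C\<^esub> FA D \<alpha>"
  by (auto simp: is_functor_def hom_def)

lemma functor_Ident: "is_functor J C D \<Longrightarrow> i \<in> Obj J \<Longrightarrow> FA D (Ident J i) = Ident C (FO D i)"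
  by (simp add: is_functor_def)

lemma cocone_hom: "is_cocone C J D X \<iota> \<Longrightarrow> i \<in> Obj J \<Longrightarrow> \<iota> i \<in> hom C (FO D i) X"
  by (simp add: is_cocone_def)

lemma cocone_Comp: "is_cocone C J D X \<iota> \<Longrightarrow> \<alpha> \<in> hom J i k \<Longrightarrow> \<iota> k \<cdot>\<^bsub>C\<^esub> FA D \<alpha> = \<iota> i"
  by (auto simp: is_cocone_def hom_def)

lemma colimit_cocone: "is_colimit C J D X \<iota> \<Longrightarrow> is_cocone C J D X \<iota>"
  by (simp add: is_colimit_def)

lemma colimit_ex:
  assumes "is_colimit C J D X \<iota>" "is_cocone C J D Y \<tau>"
  obtains h where "h \<in> hom C X Y" "\<forall>i \<in> Obj J. h \<cdot>\<^bsub>C\<^esub> \<iota> i = \<tau> i"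
  using assms(1)[unfolded is_colimit_def, THEN conjunct2, rule_format, OF assms(2)] by blast

lemma is_coconeI:
  assumes "X \<in> Obj C" "\<And>i. i \<in> Obj J \<Longrightarrow> \<tau> i \<in> hom C (FO D i) X"
    "\<And>i k \<alpha>. i \<in> Obj J \<Longrightarrow> k \<in> Obj J \<Longrightarrow> \<alpha> \<in> hom J i k \<Longrightarrow> \<tau> k \<cdot>\<^bsub>C\<^esub> FA D \<alpha> = \<tau> i"
    "category J"
  shows "is_cocone C J D X \<tau>"
  using assms(1,2) assms(3)[OF category.Dom_Obj[OF assms(4)] category.Cod_Obj[OF assms(4)]]
  by (auto simp: is_cocone_def hom_def)

text \<open>The legs of a colimit are jointly epic, since both maps solve the universal problem
  posed by the cocone \<open>\<lambda>i. h \<cdot> \<iota> i\<close>.\<close>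

lemma (in category) colimit_unique:
  assumes l: "is_colimit C J D X \<iota>" and J: "category J" and D: "is_functor J C D"
    and h: "h \<in> hom C X Y" "h' \<in> hom C X Y"
    and eq: "\<And>i. i \<in> Obj J \<Longrightarrow> h \<cdot> \<iota> i = h' \<cdot> \<iota> i"
  shows "h = h'"
proof -
  interpret J: category J by fact
  have i: "\<And>i. i \<in> Obj J \<Longrightarrow> \<iota> i \<in> hom C (FO D i) X"
    using cocone_hom[OF colimit_cocone[OF l]] .
  have c: "is_cocone C J D Y (\<lambda>i. h \<cdot> \<iota> i)"
  proof (rule is_coconeI)
    show "Y \<in> Obj C" by (rule hom_ObjD(2)[OF h(1)])
    show "h \<cdot> \<iota> i \<in> hom C (FO D i) Y" if "i \<in> Obj J" for i by (rule Comp_hom[OF i[OF that] h(1)])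
    fix i k \<alpha> assume a: "i \<in> Obj J" "k \<in> Obj J" "\<alpha> \<in> hom J i k"
    have "FA D \<alpha> \<in> hom C (FO D i) (FO D k)" by (rule functor_hom[OF D a(3)])
    then show "(h \<cdot> \<iota> k) \<cdot> FA D \<alpha> = h \<cdot> \<iota> i"
      using cocone_Comp[OF colimit_cocone[OF l] a(3)] i[OF a(2)] h by (simp add: hom_def)
  qed fact
  have "\<exists>!g. g \<in> hom C X Y \<and> (\<forall>i \<in> Obj J. g \<cdot> \<iota> i = h \<cdot> \<iota> i)"
    using l[unfolded is_colimit_def, THEN conjunct2, rule_format, OF c] .
  then show ?thesis using h eq by metis
qed

lemma (in category) is_colimitI:
  assumes "is_cocone C J D X \<iota>"
    and "\<And>Y \<tau>. is_cocone C J D Y \<tau> \<Longrightarrow> \<exists>h \<in> hom C X Y. \<forall>i \<in> Obj J. h \<cdot> \<iota> i = \<tau> i"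
    and "\<And>Y h h'. h \<in> hom C X Y \<Longrightarrow> h' \<in> hom C X Y \<Longrightarrow>
      (\<And>i. i \<in> Obj J \<Longrightarrow> h \<cdot> \<iota> i = h' \<cdot> \<iota> i) \<Longrightarrow> h = h'"
  shows "is_colimit C J D X \<iota>"
  unfolding is_colimit_def
proof (intro conjI allI impI)
  fix Y \<tau> assume "is_cocone C J D Y \<tau>"
  then obtain h where h: "h \<in> hom C X Y" "\<forall>i \<in> Obj J. h \<cdot> \<iota> i = \<tau> i" using assms(2) by blast
  show "\<exists>!h. h \<in> hom C X Y \<and> (\<forall>i \<in> Obj J. h \<cdot> \<iota> i = \<tau> i)"
  proof (rule ex1I[of _ h])
    show "h \<in> hom C X Y \<and> (\<forall>i \<in> Obj J. h \<cdot> \<iota> i = \<tau> i)" using h by blast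
    fix h' assume h': "h' \<in> hom C X Y \<and> (\<forall>i \<in> Obj J. h' \<cdot> \<iota> i = \<tau> i)"
    show "h' = h" by (rule assms(3)) (use h h' in auto)
  qed
qed fact

section \<open>Presentable objects and small filtered colimits\<close>

context category
begin

text \<open>In a filtered index category a zigzag collapses to a single cospan. A backward step is
  absorbed by precomposing \<open>\<beta>\<close>; a forward step \<open>a\<close> is absorbed by
  bounding \<open>k\<close> and the target of \<open>a\<close> and then coequalizing the two
  resulting paths out of \<open>j\<close>.\<close>

lemma zigzag_common:
  assumes J: "filt J" and D: "is_functor J C D"
    and zz: "((i, f), z) \<in> (hom_colim_step C J D A \<union> (hom_colim_step C J D A)\<inverse>)\<^sup>*"
    and f: "i \<in> Obj J" "f \<in> hom C A (FO D i)"
  shows "fst z \<in> Obj J \<and> snd z \<in> hom C A (FO D (fst z)) \<and>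
    (\<exists>k. \<exists>\<alpha> \<in> hom J i k. \<exists>\<beta> \<in> hom J (fst z) k. FA D \<alpha> \<cdot> f = FA D \<beta> \<cdot> snd z)"
  using zz
proof (induction rule: rtrancl_induct)
  case base
  then show ?case using f category.Ident_hom[OF filt_category[OF J] f(1)] by auto
next
  case (step y z)
  interpret J: category J using J by (rule filt_category)
  obtain j g where y: "y = (j, g)" by (cases y)
  obtain j' g' where z: "z = (j', g')" by (cases z)
  from step.IH obtain k \<alpha> \<beta> where k: "j \<in> Obj J" "g \<in> hom C A (FO D j)" "\<alpha> \<in> hom J i k"
    "\<beta> \<in> hom J j k" "FA D \<alpha> \<cdot> f = FA D \<beta> \<cdot> g" by (auto simp: y)
  from step.hyps(2) consider
    (fw) a where "a \<in> hom J j j'" "g' = FA D a \<cdot> g" |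
    (bw) a where "a \<in> hom J j' j" "g = FA D a \<cdot> g'" "g' \<in> hom C A (FO D j')"
    by (auto simp: y z hom_colim_step_def hom_def)
  then show ?case
  proof cases
    case fw
    obtain m \<gamma> \<delta> where m: "\<gamma> \<in> hom J k m" "\<delta> \<in> hom J j' m"
      by (rule filt_bound[OF J J.hom_ObjD(2)[OF k(3)] J.hom_ObjD(2)[OF fw(1)]])
    obtain n \<epsilon> where n: "\<epsilon> \<in> hom J m n" "\<epsilon> \<cdot>\<^bsub>J\<^esub> (\<gamma> \<cdot>\<^bsub>J\<^esub> \<beta>) = \<epsilon> \<cdot>\<^bsub>J\<^esub> (\<delta> \<cdot>\<^bsub>J\<^esub> a)"
      by (rule filt_coeq[OF J J.Comp_hom[OF k(4) m(1)] J.Comp_hom[OF fw(1) m(2)]])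
    have e: "\<epsilon> \<cdot>\<^bsub>J\<^esub> \<gamma> \<in> hom J k n" "\<epsilon> \<cdot>\<^bsub>J\<^esub> \<delta> \<in> hom J j' n"
      by (rule J.Comp_hom[OF m(1) n(1)], rule J.Comp_hom[OF m(2) n(1)])
    have "(\<epsilon> \<cdot>\<^bsub>J\<^esub> \<gamma>) \<cdot>\<^bsub>J\<^esub> \<beta> = (\<epsilon> \<cdot>\<^bsub>J\<^esub> \<delta>) \<cdot>\<^bsub>J\<^esub> a"
      using n m k(4) fw(1) by (simp add: hom_def)
    then have E: "FA D (\<epsilon> \<cdot>\<^bsub>J\<^esub> \<gamma>) \<cdot> FA D \<beta> = FA D (\<epsilon> \<cdot>\<^bsub>J\<^esub> \<delta>) \<cdot> FA D a"
      using functor_Comp[OF D k(4) e(1)] functor_Comp[OF D fw(1) e(2)] by simp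
    note h = functor_hom[OF D e(1)] functor_hom[OF D e(2)] functor_hom[OF D k(3)]
      functor_hom[OF D k(4)] functor_hom[OF D fw(1)] k(2) f(2)
    have "FA D ((\<epsilon> \<cdot>\<^bsub>J\<^esub> \<gamma>) \<cdot>\<^bsub>J\<^esub> \<alpha>) \<cdot> f = FA D (\<epsilon> \<cdot>\<^bsub>J\<^esub> \<gamma>) \<cdot> (FA D \<beta> \<cdot> g)"
      unfolding functor_Comp[OF D k(3) e(1)] k(5)[symmetric] using h by (simp add: hom_def)
    also have "\<dots> = (FA D (\<epsilon> \<cdot>\<^bsub>J\<^esub> \<delta>) \<cdot> FA D a) \<cdot> g"
      unfolding E[symmetric] using h by (simp add: hom_def)
    also have "\<dots> = FA D (\<epsilon> \<cdot>\<^bsub>J\<^esub> \<delta>) \<cdot> g'"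
      unfolding fw(2) using h by (simp add: hom_def)
    finally have "FA D ((\<epsilon> \<cdot>\<^bsub>J\<^esub> \<gamma>) \<cdot>\<^bsub>J\<^esub> \<alpha>) \<cdot> f = FA D (\<epsilon> \<cdot>\<^bsub>J\<^esub> \<delta>) \<cdot> g'" .
    moreover have "g' \<in> hom C A (FO D j')"
      unfolding fw(2) by (rule Comp_hom[OF k(2) functor_hom[OF D fw(1)]])
    ultimately show ?thesis
      using J.Comp_hom[OF k(3) e(1)] e(2) J.hom_ObjD(2)[OF fw(1)] by (auto simp: z)
  next
    case bw
    have "FA D (\<beta> \<cdot>\<^bsub>J\<^esub> a) \<cdot> g' = FA D \<beta> \<cdot> g"
      unfolding functor_Comp[OF D bw(1) k(4)] bw(2)
      using functor_hom[OF D bw(1)] functor_hom[OF D k(4)] bw(3) by (simp add: hom_def)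
    then show ?thesis
      using J.Comp_hom[OF bw(1) k(4)] k(3,5) J.hom_ObjD(1)[OF bw(1)] bw(3) unfolding z fst_conv snd_conv
      by metis
  qed
qed

text \<open>Transport moves the diagram to the type \<open>'u\<close>, where
  \<open>presentable\<close> applies, and \<open>zigzag_common\<close> replaces the generated
  equivalence relation by equality at a common later index. The two resulting rules, lifting of a
  map and eventual equality of two lifts, are the form in which presentability is used from here
  on.\<close>

lemma presentable_any:
  fixes U :: "'u itself" and J :: "('i, 'j) cat"
  assumes A: "presentable U natLeq C A"
    and J: "filt J" "small U (Arr J)" and D: "is_functor J C D" and Y: "is_colimit C J D Y \<iota>"
  shows presentable_surj: "\<And>h. h \<in> hom C A Y \<Longrightarrow>
      (\<And>i f. i \<in> Obj J \<Longrightarrow> f \<in> hom C A (FO D i) \<Longrightarrow> \<iota> i \<cdot> f = h \<Longrightarrow> thesis) \<Longrightarrow> thesis"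
    and presentable_inj: "\<And>i k f g. i \<in> Obj J \<Longrightarrow> k \<in> Obj J \<Longrightarrow>
      f \<in> hom C A (FO D i) \<Longrightarrow> g \<in> hom C A (FO D k) \<Longrightarrow> \<iota> i \<cdot> f = \<iota> k \<cdot> g \<Longrightarrow>
      (\<And>l \<alpha> \<beta>. \<alpha> \<in> hom J i l \<Longrightarrow> \<beta> \<in> hom J k l \<Longrightarrow> FA D \<alpha> \<cdot> f = FA D \<beta> \<cdot> g \<Longrightarrow> thesis) \<Longrightarrow> thesis"
proof -
  obtain p :: "'i \<Rightarrow> 'u" and q :: "'j \<Rightarrow> 'u" where t: "transport J p q"
    and s: "small_category (transport_cat p q J)"
    using transport_small[OF filt_category[OF J(1)] J(2)] by metis
  interpret T: transport J p q by fact
  let ?D = "transport_ftor p q J D"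
  let ?\<iota> = "\<iota> \<circ> inv_into (Obj J) p"
  have i: "\<iota> i = (?\<iota> \<circ> p) i" if "i \<in> Obj J" for i using that T.inj_Obj by simp
  have "is_colimit C J D Y (?\<iota> \<circ> p)"
    using Y unfolding is_colimit_def is_cocone_def using i by simp
  then have Y': "is_colimit C T.J' ?D Y ?\<iota>" unfolding T.colimit_transport .
  have J'': "filt T.J'" by (rule filt_transport[OF J(1) T.inj_Obj T.inj_Arr])
  have D': "is_functor T.J' C ?D" by (rule T.functor_transport[OF D])
  have *: "hom_preserves_colimit C A T.J' ?D Y ?\<iota>"
    using A[unfolded presentable_def, THEN conjunct2, rule_format, of T.J' ?D Y ?\<iota>]
      s filt_imp_filtered[OF J''] D' Y' by blast
  show thesis if h: "h \<in> hom C A Y"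
    and th: "\<And>i f. i \<in> Obj J \<Longrightarrow> f \<in> hom C A (FO D i) \<Longrightarrow> \<iota> i \<cdot> f = h \<Longrightarrow> thesis" for h thesis
  proof -
    from *[unfolded hom_preserves_colimit_def, THEN conjunct1, rule_format, OF h]
    obtain i f where "i \<in> Obj J" "f \<in> hom C A (FO ?D (p i))" "?\<iota> (p i) \<cdot> f = h" by auto
    then show thesis using th[of i f] i by simp
  qed
  show thesis if ik: "i \<in> Obj J" "k \<in> Obj J"
    and fg: "f \<in> hom C A (FO D i)" "g \<in> hom C A (FO D k)" "\<iota> i \<cdot> f = \<iota> k \<cdot> g"
    and th: "\<And>l \<alpha> \<beta>. \<alpha> \<in> hom J i l \<Longrightarrow> \<beta> \<in> hom J k l \<Longrightarrow> FA D \<alpha> \<cdot> f = FA D \<beta> \<cdot> g \<Longrightarrow> thesis"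
    for i k f g thesis
  proof -
    have ik': "p i \<in> Obj T.J'" "p k \<in> Obj T.J'" using ik by auto
    have fg': "f \<in> hom C A (FO ?D (p i))" "g \<in> hom C A (FO ?D (p k))" "?\<iota> (p i) \<cdot> f = ?\<iota> (p k) \<cdot> g"
      using fg ik i by simp_all
    have "((p i, f), (p k, g)) \<in> (hom_colim_step C T.J' ?D A \<union> (hom_colim_step C T.J' ?D A)\<inverse>)\<^sup>*"
      using *[unfolded hom_preserves_colimit_def, THEN conjunct2, rule_format, OF ik' fg'] .
    from zigzag_common[OF J'' D' this ik'(1) fg'(1)]
    obtain l \<alpha> \<beta> where l: "\<alpha> \<in> hom T.J' (p i) l" "\<beta> \<in> hom T.J' (p k) l"
      "FA ?D \<alpha> \<cdot> f = FA ?D \<beta> \<cdot> g" by auto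
    obtain l0 where l0: "l0 \<in> Obj J" "l = p l0"
      using category.hom_ObjD(2)[OF T.category_transport l(1)] by auto
    obtain a b where "a \<in> hom J i l0" "b \<in> hom J k l0" "\<alpha> = q a" "\<beta> = q b"
      using l(1,2) unfolding l0(2) T.hom_transport[OF ik(1) l0(1)] T.hom_transport[OF ik(2) l0(1)] by auto
    then show thesis using th[of a l0 b] l(3) homD(1) by (metis T.transport_ftor_simps(2))
  qed
qed

text \<open>The rule \<open>presentable_inj\<close> may return two different arrows out of the same
  index; coequalizing them yields one arrow under which both lifts agree.\<close>

lemma presentable_inj_same:
  fixes U :: "'u itself" and J :: "('i, 'j) cat"
  assumes A: "presentable U natLeq C A"
    and J: "filt J" "small U (Arr J)" and D: "is_functor J C D" and Y: "is_colimit C J D Y \<iota>"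
    and f: "i \<in> Obj J" "f \<in> hom C A (FO D i)" "g \<in> hom C A (FO D i)" "\<iota> i \<cdot> f = \<iota> i \<cdot> g"
  obtains l \<alpha> where "\<alpha> \<in> hom J i l" "FA D \<alpha> \<cdot> f = FA D \<alpha> \<cdot> g"
proof -
  interpret J: category J using J by (simp add: filt_category)
  obtain l \<alpha> \<beta> where l: "\<alpha> \<in> hom J i l" "\<beta> \<in> hom J i l" "FA D \<alpha> \<cdot> f = FA D \<beta> \<cdot> g"
    by (rule presentable_inj[OF A J D Y f(1,1,2,3,4)])
  obtain m \<gamma> where m: "\<gamma> \<in> hom J l m" "\<gamma> \<cdot>\<^bsub>J\<^esub> \<alpha> = \<gamma> \<cdot>\<^bsub>J\<^esub> \<beta>" by (rule filt_coeq[OF J(1) l(1,2)])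
  have "FA D (\<gamma> \<cdot>\<^bsub>J\<^esub> \<alpha>) \<cdot> f = FA D \<gamma> \<cdot> (FA D \<alpha> \<cdot> f)"
    unfolding functor_Comp[OF D l(1) m(1)]
    using functor_hom[OF D l(1)] functor_hom[OF D m(1)] f by (simp add: hom_def)
  also have "\<dots> = FA D (\<gamma> \<cdot>\<^bsub>J\<^esub> \<beta>) \<cdot> g"
    unfolding functor_Comp[OF D l(2) m(1)] l(3)
    using functor_hom[OF D l(2)] functor_hom[OF D m(1)] f by (simp add: hom_def)
  finally show thesis using that[OF J.Comp_hom[OF l(1) m(1)]] m(2) by simp
qed

text \<open>Injectivity has to be checked at a single index only: two lifts at different indices can
  be pushed to a common one, and each push is a step of the generating relation.\<close>

lemma presentableI:
  fixes U :: "'u itself"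
  assumes U: "universe U" and A: "A \<in> Obj C"
    and surj: "\<And>(J :: ('u, 'u) cat) D Y \<iota> h. filt J \<Longrightarrow> small U (Arr J) \<Longrightarrow> is_functor J C D \<Longrightarrow>
      is_colimit C J D Y \<iota> \<Longrightarrow> h \<in> hom C A Y \<Longrightarrow> \<exists>i \<in> Obj J. \<exists>f \<in> hom C A (FO D i). \<iota> i \<cdot> f = h"
    and inj: "\<And>(J :: ('u, 'u) cat) D Y \<iota> i f g. filt J \<Longrightarrow> small U (Arr J) \<Longrightarrow> is_functor J C D \<Longrightarrow>
      is_colimit C J D Y \<iota> \<Longrightarrow> i \<in> Obj J \<Longrightarrow> f \<in> hom C A (FO D i) \<Longrightarrow> g \<in> hom C A (FO D i) \<Longrightarrow>
      \<iota> i \<cdot> f = \<iota> i \<cdot> g \<Longrightarrow> \<exists>l. \<exists>\<alpha> \<in> hom J i l. FA D \<alpha> \<cdot> f = FA D \<alpha> \<cdot> g"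
  shows "presentable U natLeq C A"
  unfolding presentable_def
proof (intro conjI allI impI)
  fix J :: "('u, 'u) cat" and D Y \<iota>
  assume "small_category J \<and> filtered natLeq J \<and> is_functor J C D \<and> is_colimit C J D Y \<iota>"
  moreover have "universe TYPE('u)" using U by (simp add: universe_def)
  ultimately have J: "filt J" and s: "small U (Arr J)" and D: "is_functor J C D"
    and Y: "is_colimit C J D Y \<iota>"
    using filtered_imp_filt by (auto simp: small_category_def small_def)
  interpret J: category J using J by (rule filt_category)
  let ?R = "hom_colim_step C J D A"
  have step: "((i, f), (k, FA D \<alpha> \<cdot> f)) \<in> ?R" if "\<alpha> \<in> hom J i k" "f \<in> hom C A (FO D i)" for \<alpha> i k f
    using that by (auto simp: hom_colim_step_def hom_def)
  show "hom_preserves_colimit C A J D Y \<iota>"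
    unfolding hom_preserves_colimit_def
  proof (intro conjI ballI impI)
    show "\<exists>i \<in> Obj J. \<exists>f \<in> hom C A (FO D i). \<iota> i \<cdot> f = h" if "h \<in> hom C A Y" for h
      by (rule surj[OF J s D Y that])
    fix i k f g assume ik: "i \<in> Obj J" "k \<in> Obj J" and f: "f \<in> hom C A (FO D i)"
      and g: "g \<in> hom C A (FO D k)" and eq: "\<iota> i \<cdot> f = \<iota> k \<cdot> g"
    obtain l \<alpha> \<beta> where l: "\<alpha> \<in> hom J i l" "\<beta> \<in> hom J k l" by (rule filt_bound[OF J ik])
    have h: "FA D \<alpha> \<cdot> f \<in> hom C A (FO D l)" "FA D \<beta> \<cdot> g \<in> hom C A (FO D l)"
      by (rule Comp_hom[OF f functor_hom[OF D l(1)]], rule Comp_hom[OF g functor_hom[OF D l(2)]])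
    have lo: "l \<in> Obj J" by (rule J.hom_ObjD(2)[OF l(1)])
    note c = colimit_cocone[OF Y]
    have "(\<iota> l \<cdot> FA D \<alpha>) \<cdot> f = (\<iota> l \<cdot> FA D \<beta>) \<cdot> g"
      unfolding cocone_Comp[OF c l(1)] cocone_Comp[OF c l(2)] by fact
    then have "\<iota> l \<cdot> (FA D \<alpha> \<cdot> f) = \<iota> l \<cdot> (FA D \<beta> \<cdot> g)"
      using functor_hom[OF D l(1)] functor_hom[OF D l(2)] f g cocone_hom[OF c lo] by (simp add: hom_def)
    from inj[OF J s D Y lo h this] obtain m \<gamma> where m: "\<gamma> \<in> hom J l m"
      "FA D \<gamma> \<cdot> (FA D \<alpha> \<cdot> f) = FA D \<gamma> \<cdot> (FA D \<beta> \<cdot> g)" by blast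
    have "((i, f), (l, FA D \<alpha> \<cdot> f)) \<in> ?R" "((l, FA D \<alpha> \<cdot> f), (m, FA D \<gamma> \<cdot> (FA D \<alpha> \<cdot> f))) \<in> ?R"
      "((k, g), (l, FA D \<beta> \<cdot> g)) \<in> ?R" "((l, FA D \<beta> \<cdot> g), (m, FA D \<gamma> \<cdot> (FA D \<beta> \<cdot> g))) \<in> ?R"
      by (rule step, fact+)+
    then have "((i, f), (m, FA D \<gamma> \<cdot> (FA D \<alpha> \<cdot> f))) \<in> (?R \<union> ?R\<inverse>)\<^sup>*"
      "((m, FA D \<gamma> \<cdot> (FA D \<beta> \<cdot> g)), (k, g)) \<in> (?R \<union> ?R\<inverse>)\<^sup>*"
      by (meson UnI1 UnI2 converseI converse_rtrancl_into_rtrancl r_into_rtrancl)+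
    then show "((i, f), (k, g)) \<in> (?R \<union> ?R\<inverse>)\<^sup>*" using m(2) by (metis rtrancl_trans)
  qed
qed fact

end


section \<open>Multiple pushouts\<close>

text \<open>The pushout of the coproduct of all \<open>t i\<close> along the maps \<open>a i\<close>
  into \<open>X\<close>, phrased without coproducts: \<open>c\<close> is the inclusion of
  \<open>X\<close> and \<open>b i\<close> the characteristic map of the cell \<open>i\<close>. A
  one-element \<open>K\<close> gives ordinary pushouts, a finite \<open>K\<close> keeps
  presentability, and a small \<open>K\<close> is one stage of the small object argument.\<close>

definition is_mpush :: "('o, 'a) cat \<Rightarrow> 'o \<Rightarrow> 'i set \<Rightarrow> ('i \<Rightarrow> 'a) \<Rightarrow> ('i \<Rightarrow> 'a) \<Rightarrow> 'o \<Rightarrow> 'a \<Rightarrow> ('i \<Rightarrow> 'a) \<Rightarrow> bool" where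
  "is_mpush C X K t a P c b \<longleftrightarrow>
     c \<in> hom C X P \<and> (\<forall>i \<in> K. t i \<in> Arr C \<and> a i \<in> hom C (Dom C (t i)) X) \<and>
     (\<forall>i \<in> K. b i \<in> hom C (Cod C (t i)) P \<and> b i \<cdot>\<^bsub>C\<^esub> t i = c \<cdot>\<^bsub>C\<^esub> a i) \<and>
     (\<forall>Y c' b'. c' \<in> hom C X Y \<and> (\<forall>i \<in> K. b' i \<in> hom C (Cod C (t i)) Y \<and> b' i \<cdot>\<^bsub>C\<^esub> t i = c' \<cdot>\<^bsub>C\<^esub> a i) \<longrightarrow>
        (\<exists>!h. h \<in> hom C P Y \<and> h \<cdot>\<^bsub>C\<^esub> c = c' \<and> (\<forall>i \<in> K. h \<cdot>\<^bsub>C\<^esub> b i = b' i)))"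

context category
begin

lemma mpush_hom:
  assumes "is_mpush C X K t a P c b"
  shows "c \<in> hom C X P" "i \<in> K \<Longrightarrow> t i \<in> Arr C" "i \<in> K \<Longrightarrow> a i \<in> hom C (Dom C (t i)) X"
    "i \<in> K \<Longrightarrow> b i \<in> hom C (Cod C (t i)) P" "i \<in> K \<Longrightarrow> b i \<cdot> t i = c \<cdot> a i"
  using assms unfolding is_mpush_def by auto

lemma mpush_ex:
  assumes "is_mpush C X K t a P c b"
    "c' \<in> hom C X Y" "\<And>i. i \<in> K \<Longrightarrow> b' i \<in> hom C (Cod C (t i)) Y"
    "\<And>i. i \<in> K \<Longrightarrow> b' i \<cdot> t i = c' \<cdot> a i"
  obtains h where "h \<in> hom C P Y" "h \<cdot> c = c'" "\<forall>i \<in> K. h \<cdot> b i = b' i"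
  using assms(1)[unfolded is_mpush_def, THEN conjunct2, THEN conjunct2, THEN conjunct2, rule_format, of c' Y b']
    assms(2-) by blast

lemma mpush_unique:
  assumes m: "is_mpush C X K t a P c b" and h: "h \<in> hom C P Y" "h' \<in> hom C P Y"
    and eq: "h \<cdot> c = h' \<cdot> c" "\<And>i. i \<in> K \<Longrightarrow> h \<cdot> b i = h' \<cdot> b i"
  shows "h = h'"
proof -
  note mm = mpush_hom[OF m]
  have "(h \<cdot> b i) \<cdot> t i = (h \<cdot> c) \<cdot> a i" if "i \<in> K" for i
    using mm(2-5)[OF that] mm(1) h by (simp add: hom_def)
  moreover have "h \<cdot> b i \<in> hom C (Cod C (t i)) Y" if "i \<in> K" for i
    by (rule Comp_hom[OF mm(4)[OF that] h(1)])
  moreover have "h \<cdot> c \<in> hom C X Y" by (rule Comp_hom[OF mm(1) h(1)])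
  ultimately have "\<exists>!g. g \<in> hom C P Y \<and> g \<cdot> c = h \<cdot> c \<and> (\<forall>i \<in> K. g \<cdot> b i = h \<cdot> b i)"
    using m[unfolded is_mpush_def, THEN conjunct2, THEN conjunct2, THEN conjunct2, rule_format, of "h \<cdot> c" Y "\<lambda>i. h \<cdot> b i"]
    by blast
  then show ?thesis using h eq by metis
qed

text \<open>A colimit over a poset of height one: \<open>None\<close> carries \<open>X\<close>, and
  \<open>Some (i, False)\<close>, carrying the domain of \<open>t i\<close>, lies below both
  \<open>None\<close> (with arrow \<open>a i\<close>) and \<open>Some (i, True)\<close>, which
  carries the codomain (with arrow \<open>t i\<close>).\<close>

lemma mpush_exists:
  fixes U :: "'u itself" and K :: "'i set"
  assumes co: "cocomplete U C" and U: "universe U" and K: "small U K" and X: "X \<in> Obj C"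
    and t: "\<And>i. i \<in> K \<Longrightarrow> t i \<in> Arr C" and a: "\<And>i. i \<in> K \<Longrightarrow> a i \<in> hom C (Dom C (t i)) X"
  shows "\<exists>P c b. is_mpush C X K t a P c b"
proof -
  define V where "V = insert None (Some ` (K \<times> (UNIV :: bool set)))"
  define r where "r = (\<lambda>x. (x, x)) ` V \<union> (\<lambda>i. (Some (i, False), None)) ` K \<union>
    (\<lambda>i. (Some (i, False), Some (i, True))) ` K"
  define ob where "ob x = (case x of None \<Rightarrow> X | Some (i, e) \<Rightarrow> if e then Cod C (t i) else Dom C (t i))"
    for x :: "('i \<times> bool) option"
  define ar where "ar z = (case z of (x, y) \<Rightarrow> if x = y then Ident C (ob x) else
    (case x of None \<Rightarrow> undefined | Some (i, e) \<Rightarrow> if y = None then a i else t i))"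
    for z :: "('i \<times> bool) option \<times> ('i \<times> bool) option"
  define D where "D = \<lparr>FO = ob, FA = ar\<rparr>"
  have F: "Field r = V" by (auto simp: r_def Field_def V_def)
  have pre: "Preorder r"
    unfolding preorder_on_def refl_on_def F by (auto simp: r_def V_def trans_def)
  have ob: "x \<in> V \<Longrightarrow> ob x \<in> Obj C" for x
    using X t by (auto simp: ob_def V_def split: option.splits)
  have rcases: "z \<in> r \<Longrightarrow> (\<exists>x \<in> V. z = (x, x)) \<or> (\<exists>i \<in> K. z = (Some (i, False), None)) \<or>
    (\<exists>i \<in> K. z = (Some (i, False), Some (i, True)))" for z
    by (auto simp: r_def)
  have ar: "ar z \<in> hom C (ob (fst z)) (ob (snd z))" if "z \<in> r" for z
    using rcases[OF that] ob t a by (auto simp: ar_def hom_def ob_def)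
  have ar_comp: "ar (fst z, snd w) = ar w \<cdot> ar z" if zw: "z \<in> r" "w \<in> r" "fst w = snd z" for z w
  proof -
    \<comment> \<open>In a poset of height one, one of two composable arrows is an identity.\<close>
    have "fst z = snd z \<or> fst w = snd w"
      using rcases[OF zw(1)] rcases[OF zw(2)] zw(3) by auto
    then show ?thesis
    proof
      assume e: "fst z = snd z"
      then have "ar z = Ident C (ob (fst w))" "(fst z, snd w) = w" using zw(3)
        by (auto simp: ar_def prod_eq_iff split: prod.splits)
      then show ?thesis using ar[OF zw(2)] by (simp add: hom_def)
    next
      assume e: "fst w = snd w"
      then have "ar w = Ident C (ob (snd z))" "(fst z, snd w) = z" using zw(3)
        by (auto simp: ar_def prod_eq_iff split: prod.splits)
      then show ?thesis using ar[OF zw(1)] by (simp add: hom_def)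
    qed
  qed
  have D: "is_functor (order_cat r) C D"
    unfolding is_functor_def
    using ob ar ar_comp by (auto simp: order_cat_def F D_def) (simp add: ar_def)
  have "small U V"
  proof -
    have "small U {None :: ('i \<times> bool) option}" by (rule small_finite[OF U]) simp
    moreover have "small U (Some ` (K \<times> (UNIV :: bool set)))"
      by (intro small_image small_Times[OF U K] small_finite[OF U]) simp
    ultimately have "small U (\<Union>x \<in> {True, False}. if x then {None} else Some ` (K \<times> (UNIV :: bool set)))"
      by (intro small_UN[OF U small_finite[OF U]]) auto
    then show ?thesis by (rule small_subset) (auto simp: V_def)
  qed
  then have "small U r"
    using small_subset[OF small_Times[OF U], of V V r] by (auto simp: r_def V_def)
  then have "\<exists>P \<tau>. is_colimit C (order_cat r) D P \<tau>"
    by (intro cocomplete_any[OF co category_order_cat[OF pre] _ D]) (simp add: order_cat_def)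
  then obtain P \<tau> where P: "is_colimit C (order_cat r) D P \<tau>" by blast
  \<comment> \<open>The leg at \<open>Some (i, False)\<close> is forced to be
    \<open>\<sigma> None \<cdot> a i\<close>, so cocones on this poset are exactly the data that the
    universal property of \<open>is_mpush\<close> speaks about.\<close>
  have coc: "is_cocone C (order_cat r) D Y \<sigma> \<longleftrightarrow> \<sigma> None \<in> hom C X Y \<and>
    (\<forall>i \<in> K. \<sigma> (Some (i, True)) \<in> hom C (Cod C (t i)) Y \<and>
      \<sigma> (Some (i, True)) \<cdot> t i = \<sigma> None \<cdot> a i \<and> \<sigma> (Some (i, False)) = \<sigma> None \<cdot> a i)" (is "?L \<longleftrightarrow> ?R") for Y \<sigma>
  proof
    assume L: ?L
    have o: "\<sigma> x \<in> hom C (ob x) Y" if "x \<in> V" for x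
      using L that by (auto simp: is_cocone_def order_cat_def F D_def)
    have c: "\<sigma> (snd z) \<cdot> ar z = \<sigma> (fst z)" if "z \<in> r" for z
      using L that by (auto simp: is_cocone_def order_cat_def D_def)
    show ?R
    proof (intro conjI ballI)
      show "\<sigma> None \<in> hom C X Y" using o[of None] by (simp add: V_def ob_def)
      fix i assume i: "i \<in> K"
      show "\<sigma> (Some (i, True)) \<in> hom C (Cod C (t i)) Y"
        using o[of "Some (i, True)"] i by (simp add: V_def ob_def)
      have "(Some (i, False), None) \<in> r" "(Some (i, False), Some (i, True)) \<in> r"
        using i by (auto simp: r_def)
      from c[OF this(1)] c[OF this(2)]
      show "\<sigma> (Some (i, False)) = \<sigma> None \<cdot> a i" "\<sigma> (Some (i, True)) \<cdot> t i = \<sigma> None \<cdot> a i"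
        by (simp_all add: ar_def)
    qed
  next
    assume R: ?R
    have o': "\<sigma> (Some (i, e)) \<in> hom C (ob (Some (i, e))) Y" if i: "i \<in> K" for i e
      using R i a[OF i] by (cases e) (auto simp: ob_def intro: Comp_hom)
    have o: "\<sigma> x \<in> hom C (ob x) Y" if "x \<in> V" for x
    proof (cases x)
      case None
      then show ?thesis using R by (simp add: ob_def)
    next
      case (Some z)
      then show ?thesis using o'[of "fst z" "snd z"] that by (auto simp: V_def)
    qed
    have "\<sigma> (snd z) \<cdot> ar z = \<sigma> (fst z)" if "z \<in> r" for z
      using rcases[OF that]
    proof (elim disjE bexE)
      fix x assume "x \<in> V" "z = (x, x)"
      then show ?thesis using o[of x] by (simp add: ar_def hom_def)
    qed (use R in \<open>auto simp: ar_def\<close>)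
    moreover have "Y \<in> Obj C" using R hom_ObjD(2) by blast
    ultimately show ?L using o by (auto simp: is_cocone_def order_cat_def F D_def)
  qed
  have m: "is_mpush C X K t a P (\<tau> None) (\<lambda>i. \<tau> (Some (i, True)))"
    unfolding is_mpush_def
  proof (intro conjI allI impI)
    have c: "is_cocone C (order_cat r) D P \<tau>" using P by (rule colimit_cocone)
    then show "\<tau> None \<in> hom C X P" "\<forall>i \<in> K. \<tau> (Some (i, True)) \<in> hom C (Cod C (t i)) P \<and>
      \<tau> (Some (i, True)) \<cdot> t i = \<tau> None \<cdot> a i" unfolding coc by auto
    show "\<forall>i \<in> K. t i \<in> Arr C \<and> a i \<in> hom C (Dom C (t i)) X" using a t by blast
    fix Y c' b'
    assume Y: "c' \<in> hom C X Y \<and> (\<forall>i \<in> K. b' i \<in> hom C (Cod C (t i)) Y \<and> b' i \<cdot> t i = c' \<cdot> a i)"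
    define \<sigma> where "\<sigma> x = (case x of None \<Rightarrow> c' | Some (i, e) \<Rightarrow> if e then b' i else c' \<cdot> a i)" for x
    have "is_cocone C (order_cat r) D Y \<sigma>" unfolding coc using Y by (auto simp: \<sigma>_def)
    from P[unfolded is_colimit_def, THEN conjunct2, rule_format, OF this]
    have *: "\<exists>!h. h \<in> hom C P Y \<and> (\<forall>x \<in> V. h \<cdot> \<tau> x = \<sigma> x)" by (simp add: order_cat_def F)
    have "(\<forall>x \<in> V. h \<cdot> \<tau> x = \<sigma> x) \<longleftrightarrow> h \<cdot> \<tau> None = c' \<and> (\<forall>i \<in> K. h \<cdot> \<tau> (Some (i, True)) = b' i)"
      if h: "h \<in> hom C P Y" for h
    proof
      assume R: "h \<cdot> \<tau> None = c' \<and> (\<forall>i \<in> K. h \<cdot> \<tau> (Some (i, True)) = b' i)"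
      have "h \<cdot> \<tau> (Some (i, False)) = c' \<cdot> a i" if i: "i \<in> K" for i
      proof -
        have "h \<cdot> \<tau> (Some (i, False)) = (h \<cdot> \<tau> None) \<cdot> a i"
          using c[unfolded coc] i h a[OF i] by (simp add: hom_def)
        then show ?thesis using R by simp
      qed
      then show "\<forall>x \<in> V. h \<cdot> \<tau> x = \<sigma> x" using R by (auto simp: V_def \<sigma>_def)
    qed (auto simp: V_def \<sigma>_def)
    then show "\<exists>!h. h \<in> hom C P Y \<and> h \<cdot> \<tau> None = c' \<and> (\<forall>i \<in> K. h \<cdot> \<tau> (Some (i, True)) = b' i)"
      using * by (metis (no_types, lifting))
  qed
  then show ?thesis by blast
qed

end

context category
begin

text \<open>A map out of \<open>P\<close> consists of finitely many maps out of presentable objects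
  subject to finitely many equations. Each map lifts, and each equation holds, at some index;
  induction over the finite set \<open>L\<close> of treated cells reaches an index that serves for
  all.\<close>

lemma mpush_presentable:
  fixes U :: "'u itself"
  assumes U: "universe U" and m: "is_mpush C X K t a P c b" and K: "finite K"
    and X: "presentable U natLeq C X"
    and t: "\<And>i. i \<in> K \<Longrightarrow> presentable U natLeq C (Dom C (t i))"
      "\<And>i. i \<in> K \<Longrightarrow> presentable U natLeq C (Cod C (t i))"
  shows "presentable U natLeq C P"
proof (rule presentableI[OF U])
  note mm = mpush_hom[OF m]
  show "P \<in> Obj C" by (rule hom_ObjD(2)[OF mm(1)])
  fix J :: "('u, 'u) cat" and D Y \<iota>
  assume J: "filt J" "small U (Arr J)" and D: "is_functor J C D" and Y: "is_colimit C J D Y \<iota>"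
  interpret J: category J using J(1) by (rule filt_category)
  note \<iota>c = cocone_Comp[OF colimit_cocone[OF Y]] and \<iota>h = cocone_hom[OF colimit_cocone[OF Y]]
  have push: "\<iota> l \<cdot> (FA D \<alpha> \<cdot> f) = \<iota> k \<cdot> f" if "\<alpha> \<in> hom J k l" "f \<in> hom C Z (FO D k)" for k l \<alpha> f Z
  proof -
    have "\<iota> l \<cdot> (FA D \<alpha> \<cdot> f) = (\<iota> l \<cdot> FA D \<alpha>) \<cdot> f"
      using functor_hom[OF D that(1)] that(2) \<iota>h[OF J.hom_ObjD(2)[OF that(1)]] by (simp add: hom_def)
    then show ?thesis using \<iota>c[OF that(1)] by simp
  qed
  have push2: "FA D (\<beta> \<cdot>\<^bsub>J\<^esub> \<alpha>) \<cdot> f = FA D \<beta> \<cdot> (FA D \<alpha> \<cdot> f)"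
    if "\<alpha> \<in> hom J k l" "\<beta> \<in> hom J l n" "f \<in> hom C Z (FO D k)" for k l n \<alpha> \<beta> f Z
    unfolding functor_Comp[OF D that(1,2)]
    using functor_hom[OF D that(1)] functor_hom[OF D that(2)] that(3) by (simp add: hom_def)
  show "\<exists>i \<in> Obj J. \<exists>f \<in> hom C P (FO D i). \<iota> i \<cdot> f = h" if h: "h \<in> hom C P Y" for h
  proof -
    have hc: "h \<cdot> c \<in> hom C X Y" by (rule Comp_hom[OF mm(1) h])
    have hb: "h \<cdot> b i \<in> hom C (Cod C (t i)) Y" if "i \<in> K" for i by (rule Comp_hom[OF mm(4)[OF that] h])
    have "\<exists>k x. k \<in> Obj J \<and> x \<in> hom C X (FO D k) \<and> \<iota> k \<cdot> x = h \<cdot> c \<and>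
      (\<forall>i \<in> L. \<exists>y \<in> hom C (Cod C (t i)) (FO D k). \<iota> k \<cdot> y = h \<cdot> b i \<and> y \<cdot> t i = x \<cdot> a i)"
      if "finite L" "L \<subseteq> K" for L
      using that
    proof (induction L)
      case empty
      show ?case by (rule presentable_surj[OF X J D Y hc]) blast
    next
      case (insert j L)
      then have j: "j \<in> K" by simp
      from insert obtain k x where k: "k \<in> Obj J" "x \<in> hom C X (FO D k)" "\<iota> k \<cdot> x = h \<cdot> c"
        and L: "\<And>i. i \<in> L \<Longrightarrow> \<exists>y \<in> hom C (Cod C (t i)) (FO D k). \<iota> k \<cdot> y = h \<cdot> b i \<and> y \<cdot> t i = x \<cdot> a i"
        by auto
      obtain k' y where y: "k' \<in> Obj J" "y \<in> hom C (Cod C (t j)) (FO D k')" "\<iota> k' \<cdot> y = h \<cdot> b j"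
        by (rule presentable_surj[OF t(2)[OF j] J D Y hb[OF j]])
      have tj: "t j \<in> hom C (Dom C (t j)) (Cod C (t j))" using mm(2)[OF j] by (simp add: hom_def)
      have "\<iota> k' \<cdot> (y \<cdot> t j) = (h \<cdot> b j) \<cdot> t j"
        unfolding y(3)[symmetric] using y(2) tj \<iota>h[OF y(1)] by (simp add: hom_def)
      also have "\<dots> = (h \<cdot> c) \<cdot> a j" using mm(2-5)[OF j] mm(1) h by (simp add: hom_def)
      also have "\<dots> = \<iota> k \<cdot> (x \<cdot> a j)"
        unfolding k(3)[symmetric] using k(2) mm(3)[OF j] \<iota>h[OF k(1)] by (simp add: hom_def)
      finally have eq: "\<iota> k' \<cdot> (y \<cdot> t j) = \<iota> k \<cdot> (x \<cdot> a j)" .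
      \<comment> \<open>The new lift \<open>y\<close> and the old lift \<open>x\<close> agree on the
        boundary of the cell \<open>j\<close> only after mapping to \<open>Y\<close>; presentability
        of the domain of \<open>t j\<close> makes them agree at a later index.\<close>
      obtain l \<alpha> \<beta> where l: "\<alpha> \<in> hom J k' l" "\<beta> \<in> hom J k l"
        "FA D \<alpha> \<cdot> (y \<cdot> t j) = FA D \<beta> \<cdot> (x \<cdot> a j)"
        by (rule presentable_inj[OF t(1)[OF j] J D Y y(1) k(1) Comp_hom[OF tj y(2)]
              Comp_hom[OF mm(3)[OF j] k(2)] eq])
      note hl = functor_hom[OF D l(1)] functor_hom[OF D l(2)]
      have "\<exists>y \<in> hom C (Cod C (t i)) (FO D l). \<iota> l \<cdot> y = h \<cdot> b i \<and> y \<cdot> t i = (FA D \<beta> \<cdot> x) \<cdot> a i"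
        if i: "i \<in> insert j L" for i
      proof (cases "i = j")
        case True
        have "(FA D \<alpha> \<cdot> y) \<cdot> t j = (FA D \<beta> \<cdot> x) \<cdot> a j"
          using l(3) hl y(2) tj k(2) mm(3)[OF j] by (simp add: hom_def)
        moreover have "\<iota> l \<cdot> (FA D \<alpha> \<cdot> y) = h \<cdot> b j" using push[OF l(1) y(2)] y(3) by simp
        ultimately show ?thesis using Comp_hom[OF y(2) hl(1)] True by blast
      next
        case False
        then have iL: "i \<in> L" "i \<in> K" using i insert by auto
        obtain z where z: "z \<in> hom C (Cod C (t i)) (FO D k)" "\<iota> k \<cdot> z = h \<cdot> b i" "z \<cdot> t i = x \<cdot> a i"
          using L[OF iL(1)] by blast
        have "(FA D \<beta> \<cdot> z) \<cdot> t i = FA D \<beta> \<cdot> (z \<cdot> t i)"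
          using hl z(1) mm(2)[OF iL(2)] by (simp add: hom_def)
        also have "\<dots> = (FA D \<beta> \<cdot> x) \<cdot> a i"
          unfolding z(3) using hl k(2) mm(3)[OF iL(2)] by (simp add: hom_def)
        finally have "(FA D \<beta> \<cdot> z) \<cdot> t i = (FA D \<beta> \<cdot> x) \<cdot> a i" .
        moreover have "\<iota> l \<cdot> (FA D \<beta> \<cdot> z) = h \<cdot> b i" using push[OF l(2) z(1)] z(2) by simp
        ultimately show ?thesis using Comp_hom[OF z(1) hl(2)] by blast
      qed
      moreover have "\<iota> l \<cdot> (FA D \<beta> \<cdot> x) = h \<cdot> c" using push[OF l(2) k(2)] k(3) by simp
      ultimately show ?case using Comp_hom[OF k(2) hl(2)] J.hom_ObjD(2)[OF l(1)] by blast
    qed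
    from this[OF K order_refl] obtain k x y where k: "k \<in> Obj J" "x \<in> hom C X (FO D k)" "\<iota> k \<cdot> x = h \<cdot> c"
      and y: "\<And>i. i \<in> K \<Longrightarrow> y i \<in> hom C (Cod C (t i)) (FO D k)" "\<And>i. i \<in> K \<Longrightarrow> \<iota> k \<cdot> y i = h \<cdot> b i"
        "\<And>i. i \<in> K \<Longrightarrow> y i \<cdot> t i = x \<cdot> a i"
      by metis
    obtain f where f: "f \<in> hom C P (FO D k)" "f \<cdot> c = x" "\<forall>i \<in> K. f \<cdot> b i = y i"
      by (rule mpush_ex[OF m k(2) y(1,3)])
    have "\<iota> k \<cdot> f = h"
    proof (rule mpush_unique[OF m Comp_hom[OF f(1) \<iota>h[OF k(1)]] h])
      show "(\<iota> k \<cdot> f) \<cdot> c = h \<cdot> c"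
        unfolding k(3)[symmetric] f(2)[symmetric] using f(1) mm(1) \<iota>h[OF k(1)] by (simp add: hom_def)
      show "(\<iota> k \<cdot> f) \<cdot> b i = h \<cdot> b i" if i: "i \<in> K" for i
        unfolding y(2)[OF i, symmetric] f(3)[rule_format, OF i, symmetric]
        using f(1) mm(4)[OF i] \<iota>h[OF k(1)] by (simp add: hom_def)
    qed
    then show ?thesis using k(1) f(1) by blast
  qed
  show "\<exists>l. \<exists>\<alpha> \<in> hom J k l. FA D \<alpha> \<cdot> f = FA D \<alpha> \<cdot> g"
    if k: "k \<in> Obj J" and f: "f \<in> hom C P (FO D k)" and g: "g \<in> hom C P (FO D k)"
      and eq: "\<iota> k \<cdot> f = \<iota> k \<cdot> g" for k f g
  proof -
    have eq': "\<iota> k \<cdot> (f \<cdot> e) = \<iota> k \<cdot> (g \<cdot> e)" if "e \<in> hom C Z P" for e Z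
    proof -
      have "(\<iota> k \<cdot> f) \<cdot> e = (\<iota> k \<cdot> g) \<cdot> e" using eq by simp
      then show ?thesis using f g that \<iota>h[OF k] by (simp add: hom_def)
    qed
    have "\<exists>l. \<exists>\<alpha> \<in> hom J k l. FA D \<alpha> \<cdot> (f \<cdot> c) = FA D \<alpha> \<cdot> (g \<cdot> c) \<and>
      (\<forall>i \<in> L. FA D \<alpha> \<cdot> (f \<cdot> b i) = FA D \<alpha> \<cdot> (g \<cdot> b i))" if "finite L" "L \<subseteq> K" for L
      using that
    proof (induction L)
      case empty
      obtain l \<alpha> where "\<alpha> \<in> hom J k l" "FA D \<alpha> \<cdot> (f \<cdot> c) = FA D \<alpha> \<cdot> (g \<cdot> c)"
        by (rule presentable_inj_same[OF X J D Y k Comp_hom[OF mm(1) f] Comp_hom[OF mm(1) g] eq'[OF mm(1)]])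
      then show ?case by blast
    next
      case (insert j L)
      then have j: "j \<in> K" by simp
      from insert obtain l \<alpha> where l: "\<alpha> \<in> hom J k l" "FA D \<alpha> \<cdot> (f \<cdot> c) = FA D \<alpha> \<cdot> (g \<cdot> c)"
        "\<And>i. i \<in> L \<Longrightarrow> FA D \<alpha> \<cdot> (f \<cdot> b i) = FA D \<alpha> \<cdot> (g \<cdot> b i)" by auto
      note bj = mm(4)[OF j]
      have h: "f \<cdot> b j \<in> hom C (Cod C (t j)) (FO D k)" "g \<cdot> b j \<in> hom C (Cod C (t j)) (FO D k)"
        by (rule Comp_hom[OF bj f], rule Comp_hom[OF bj g])
      have "\<iota> l \<cdot> (FA D \<alpha> \<cdot> (f \<cdot> b j)) = \<iota> l \<cdot> (FA D \<alpha> \<cdot> (g \<cdot> b j))"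
        unfolding push[OF l(1) h(1)] push[OF l(1) h(2)] by (rule eq'[OF bj])
      then obtain n \<beta> where n: "\<beta> \<in> hom J l n"
        "FA D \<beta> \<cdot> (FA D \<alpha> \<cdot> (f \<cdot> b j)) = FA D \<beta> \<cdot> (FA D \<alpha> \<cdot> (g \<cdot> b j))"
        by (rule presentable_inj_same[OF t(2)[OF j] J D Y J.hom_ObjD(2)[OF l(1)]
              Comp_hom[OF h(1) functor_hom[OF D l(1)]] Comp_hom[OF h(2) functor_hom[OF D l(1)]]])
      have "FA D (\<beta> \<cdot>\<^bsub>J\<^esub> \<alpha>) \<cdot> (f \<cdot> e) = FA D (\<beta> \<cdot>\<^bsub>J\<^esub> \<alpha>) \<cdot> (g \<cdot> e)"
        if e: "e \<in> hom C Z P" "FA D \<beta> \<cdot> (FA D \<alpha> \<cdot> (f \<cdot> e)) = FA D \<beta> \<cdot> (FA D \<alpha> \<cdot> (g \<cdot> e))" for e Z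
        using push2[OF l(1) n(1) Comp_hom[OF e(1) f]] push2[OF l(1) n(1) Comp_hom[OF e(1) g]] e(2) by simp
      note P = this
      have "FA D (\<beta> \<cdot>\<^bsub>J\<^esub> \<alpha>) \<cdot> (f \<cdot> c) = FA D (\<beta> \<cdot>\<^bsub>J\<^esub> \<alpha>) \<cdot> (g \<cdot> c)"
        using P[OF mm(1)] l(2) by simp
      moreover have "FA D (\<beta> \<cdot>\<^bsub>J\<^esub> \<alpha>) \<cdot> (f \<cdot> b i) = FA D (\<beta> \<cdot>\<^bsub>J\<^esub> \<alpha>) \<cdot> (g \<cdot> b i)"
        if i: "i \<in> insert j L" for i
      proof -
        have "FA D \<beta> \<cdot> (FA D \<alpha> \<cdot> (f \<cdot> b i)) = FA D \<beta> \<cdot> (FA D \<alpha> \<cdot> (g \<cdot> b i))"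
          using i n(2) l(3) by auto
        then show ?thesis using P[OF mm(4)] i insert.prems by blast
      qed
      ultimately show ?case using J.Comp_hom[OF l(1) n(1)] by blast
    qed
    from this[OF K order_refl] obtain l \<alpha> where l: "\<alpha> \<in> hom J k l"
      "FA D \<alpha> \<cdot> (f \<cdot> c) = FA D \<alpha> \<cdot> (g \<cdot> c)" "\<And>i. i \<in> K \<Longrightarrow> FA D \<alpha> \<cdot> (f \<cdot> b i) = FA D \<alpha> \<cdot> (g \<cdot> b i)"
      by blast
    note h = functor_hom[OF D l(1)]
    have "FA D \<alpha> \<cdot> f = FA D \<alpha> \<cdot> g"
    proof (rule mpush_unique[OF m Comp_hom[OF f h] Comp_hom[OF g h]])
      show "(FA D \<alpha> \<cdot> f) \<cdot> c = (FA D \<alpha> \<cdot> g) \<cdot> c"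
        using l(2) h f g mm(1) by (simp add: hom_def)
      show "(FA D \<alpha> \<cdot> f) \<cdot> b i = (FA D \<alpha> \<cdot> g) \<cdot> b i" if i: "i \<in> K" for i
        using l(3)[OF i] h f g mm(4)[OF i] by (simp add: hom_def)
    qed
    then show ?thesis using l(1) by blast
  qed
qed


section \<open>Lifting properties\<close>

lemma has_liftD:
  assumes "has_lift C i p" "i \<in> hom C A B" "p \<in> hom C X Y" "u \<in> hom C A X" "v \<in> hom C B Y"
    "v \<cdot> i = p \<cdot> u"
  obtains h where "h \<in> hom C B X" "h \<cdot> i = u" "p \<cdot> h = v"
proof -
  have "(i, u, v, p) \<in> Arr (arrow_cat C)" using assms by (simp add: arrow_cat_def hom_def)
  then show thesis using assms(1)[unfolded has_lift_def] that assms(2,3) unfolding hom_def by fastforce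
qed

lemma has_liftI:
  assumes "i \<in> hom C A B" "p \<in> hom C X Y"
    and "\<And>u v. u \<in> hom C A X \<Longrightarrow> v \<in> hom C B Y \<Longrightarrow> v \<cdot> i = p \<cdot> u \<Longrightarrow>
      \<exists>h \<in> hom C B X. h \<cdot> i = u \<and> p \<cdot> h = v"
  shows "has_lift C i p"
  unfolding has_lift_def using assms by (auto simp: arrow_cat_def hom_def)

text \<open>Lifts are found cell by cell and glued by the universal property; the glued map is a
  lift because \<open>c\<close> and the maps \<open>b i\<close> are jointly epic.\<close>

lemma llp_mpush:
  assumes m: "is_mpush C X K t a P c b" and t: "\<And>i. i \<in> K \<Longrightarrow> t i \<in> llp C R" and R: "R \<subseteq> Arr C"
  shows "c \<in> llp C R"
proof -
  note mm = mpush_hom[OF m]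
  have "has_lift C c p" if pR: "p \<in> R" for p
  proof (rule has_liftI[OF mm(1)])
    have p: "p \<in> hom C (Dom C p) (Cod C p)" using R pR by (auto simp: hom_def)
    then show "p \<in> hom C (Dom C p) (Cod C p)" .
    fix u v assume uv: "u \<in> hom C X (Dom C p)" "v \<in> hom C P (Cod C p)" "v \<cdot> c = p \<cdot> u"
    have "\<exists>w \<in> hom C (Cod C (t i)) (Dom C p). w \<cdot> t i = u \<cdot> a i \<and> p \<cdot> w = v \<cdot> b i" if i: "i \<in> K" for i
    proof -
      have ti: "t i \<in> hom C (Dom C (t i)) (Cod C (t i))" using mm(2)[OF i] by (simp add: hom_def)
      have l: "has_lift C (t i) p" using t[OF i] pR by (simp add: llp_def)
      have "(v \<cdot> b i) \<cdot> t i = (v \<cdot> c) \<cdot> a i" using mm(1) mm(2-5)[OF i] uv(1,2) by (simp add: hom_def)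
      also have "\<dots> = p \<cdot> (u \<cdot> a i)" unfolding uv(3) using p uv(1,2) mm(3)[OF i] by (simp add: hom_def)
      finally show ?thesis
        by (rule has_liftD[OF l ti p Comp_hom[OF mm(3)[OF i] uv(1)] Comp_hom[OF mm(4)[OF i] uv(2)]]) blast
    qed
    then obtain w where w: "\<And>i. i \<in> K \<Longrightarrow> w i \<in> hom C (Cod C (t i)) (Dom C p)"
      "\<And>i. i \<in> K \<Longrightarrow> w i \<cdot> t i = u \<cdot> a i" "\<And>i. i \<in> K \<Longrightarrow> p \<cdot> w i = v \<cdot> b i" by metis
    obtain h where h: "h \<in> hom C P (Dom C p)" "h \<cdot> c = u" "\<forall>i \<in> K. h \<cdot> b i = w i"
      by (rule mpush_ex[OF m uv(1) w(1,2)])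
    have "p \<cdot> h = v"
    proof (rule mpush_unique[OF m Comp_hom[OF h(1) p] uv(2)])
      show "(p \<cdot> h) \<cdot> c = v \<cdot> c" unfolding uv(3) h(2)[symmetric] using p h mm(1) by (simp add: hom_def)
      show "(p \<cdot> h) \<cdot> b i = v \<cdot> b i" if i: "i \<in> K" for i
        unfolding w(3)[OF i, symmetric] h(3)[rule_format, OF i, symmetric] using p h mm(4)[OF i] by (simp add: hom_def)
    qed
    then show "\<exists>h \<in> hom C P (Dom C p). h \<cdot> c = u \<and> p \<cdot> h = v" using h by blast
  qed
  then show ?thesis using mm(1) by (simp add: llp_def hom_def)
qed

lemma llp_Comp:
  assumes f: "f \<in> llp C R" "f \<in> hom C X Y" and g: "g \<in> llp C R" "g \<in> hom C Y Z" and R: "R \<subseteq> Arr C"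
  shows "g \<cdot> f \<in> llp C R"
proof -
  have "has_lift C (g \<cdot> f) p" if pR: "p \<in> R" for p
  proof (rule has_liftI[OF Comp_hom[OF f(2) g(2)]])
    have p: "p \<in> hom C (Dom C p) (Cod C p)" using R pR by (auto simp: hom_def)
    then show "p \<in> hom C (Dom C p) (Cod C p)" .
    fix u v assume uv: "u \<in> hom C X (Dom C p)" "v \<in> hom C Z (Cod C p)" "v \<cdot> (g \<cdot> f) = p \<cdot> u"
    have lf: "has_lift C f p" and lg: "has_lift C g p" using f g pR by (auto simp: llp_def)
    have "(v \<cdot> g) \<cdot> f = p \<cdot> u" using uv f(2) g(2) by (simp add: hom_def)
    then obtain h where h: "h \<in> hom C Y (Dom C p)" "h \<cdot> f = u" "p \<cdot> h = v \<cdot> g"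
      by (rule has_liftD[OF lf f(2) p uv(1) Comp_hom[OF g(2) uv(2)]])
    obtain k where k: "k \<in> hom C Z (Dom C p)" "k \<cdot> g = h" "p \<cdot> k = v"
      by (rule has_liftD[OF lg g(2) p h(1) uv(2) h(3)[symmetric]])
    have "(k \<cdot> g) \<cdot> f = u" unfolding k(2) by (rule h(2))
    then have "k \<cdot> (g \<cdot> f) = u" using k(1) f(2) g(2) by (simp add: hom_def)
    then show "\<exists>h \<in> hom C Z (Dom C p). h \<cdot> (g \<cdot> f) = u \<and> p \<cdot> h = v" using k by blast
  qed
  moreover have "g \<cdot> f \<in> Arr C" using f(2) g(2) by (simp add: hom_def)
  ultimately show ?thesis by (simp add: llp_def)
qed

lemma llp_iso:
  assumes f: "f \<in> hom C X Y" "g \<in> hom C Y X" "g \<cdot> f = Ident C X" "f \<cdot> g = Ident C Y" and R: "R \<subseteq> Arr C"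
  shows "f \<in> llp C R"
proof -
  have "has_lift C f p" if pR: "p \<in> R" for p
  proof (rule has_liftI[OF f(1)])
    have p: "p \<in> hom C (Dom C p) (Cod C p)" using R pR by (auto simp: hom_def)
    then show "p \<in> hom C (Dom C p) (Cod C p)" .
    fix u v assume uv: "u \<in> hom C X (Dom C p)" "v \<in> hom C Y (Cod C p)" "v \<cdot> f = p \<cdot> u"
    have "(u \<cdot> g) \<cdot> f = u" using uv f by (simp add: hom_def)
    moreover have "p \<cdot> (u \<cdot> g) = (v \<cdot> f) \<cdot> g" unfolding uv(3) using uv(1,2) f p by (simp add: hom_def)
    then have "p \<cdot> (u \<cdot> g) = v" using uv(1,2) f by (simp add: hom_def)
    ultimately show "\<exists>h \<in> hom C Y (Dom C p). h \<cdot> f = u \<and> p \<cdot> h = v" using Comp_hom[OF f(2) uv(1)] by blast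
  qed
  moreover have "f \<in> Arr C" using f(1) by (simp add: hom_def)
  ultimately show ?thesis by (simp add: llp_def)
qed


section \<open>Pushouts and coequalizers\<close>

lemma mpush_singleton:
  assumes "is_mpush C X {x} t a P c b" shows "is_pushout C (t x) (a x) P (b x) c"
proof -
  note mm = mpush_hom[OF assms]
  have "\<exists>!h. h \<in> hom C P Y \<and> h \<cdot> b x = u \<and> h \<cdot> c = v"
    if uv: "u \<in> hom C (Cod C (t x)) Y" "v \<in> hom C (Cod C (a x)) Y" "u \<cdot> t x = v \<cdot> a x" for Y u v
  proof -
    have "v \<in> hom C X Y" using uv mm(3)[of x] by (simp add: hom_def)
    with assms[unfolded is_mpush_def, THEN conjunct2, THEN conjunct2, THEN conjunct2, rule_format, of v Y "\<lambda>_. u"]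
    show ?thesis using uv by (simp add: conj_ac)
  qed
  then show ?thesis using mm(1) mm(2-5)[of x] by (simp add: is_pushout_def hom_def)
qed

lemma pushout_hom:
  assumes "is_pushout C f g P i j" "f \<in> hom C A B" "g \<in> hom C A X"
  shows "i \<in> hom C B P" "j \<in> hom C X P" "i \<cdot> f = j \<cdot> g"
  using assms by (auto simp: is_pushout_def hom_def)

lemma pushout_universal:
  "is_pushout C f g P i j \<Longrightarrow> u \<in> hom C (Cod C f) X \<Longrightarrow> v \<in> hom C (Cod C g) X \<Longrightarrow> u \<cdot> f = v \<cdot> g \<Longrightarrow>
    \<exists>!h. h \<in> hom C P X \<and> h \<cdot> i = u \<and> h \<cdot> j = v"
  by (simp only: is_pushout_def)

lemma pushout_ex:
  assumes "is_pushout C f g P i j" "f \<in> hom C A B" "g \<in> hom C A X"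
    "u \<in> hom C B Y" "v \<in> hom C X Y" "u \<cdot> f = v \<cdot> g"
  obtains h where "h \<in> hom C P Y" "h \<cdot> i = u" "h \<cdot> j = v"
proof -
  have "\<exists>!h. h \<in> hom C P Y \<and> h \<cdot> i = u \<and> h \<cdot> j = v"
    by (rule pushout_universal[OF assms(1) _ _ assms(6)])
      (use assms(4,5) homD(3)[OF assms(2)] homD(3)[OF assms(3)] in simp_all)
  then show thesis using that by blast
qed

lemma pushout_unique:
  assumes P: "is_pushout C f g P i j" and fg: "f \<in> hom C A B" "g \<in> hom C A X"
    and h: "h \<in> hom C P Y" "h' \<in> hom C P Y" "h \<cdot> i = h' \<cdot> i" "h \<cdot> j = h' \<cdot> j"
  shows "h = h'"
proof -
  note p = pushout_hom[OF P fg]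
  have "(h \<cdot> i) \<cdot> f = (h \<cdot> j) \<cdot> g" using p fg h(1) by (simp add: hom_def)
  moreover have "h \<cdot> i \<in> hom C (Cod C f) Y" "h \<cdot> j \<in> hom C (Cod C g) Y"
    using Comp_hom[OF p(1) h(1)] Comp_hom[OF p(2) h(1)] homD(3)[OF fg(1)] homD(3)[OF fg(2)] by simp_all
  ultimately have "\<exists>!k. k \<in> hom C P Y \<and> k \<cdot> i = h \<cdot> i \<and> k \<cdot> j = h \<cdot> j"
    by (intro pushout_universal[OF P])
  then show ?thesis using h by metis
qed

lemma pushout_sym: "is_pushout C f g P i j \<Longrightarrow> is_pushout C g f P j i"
  unfolding is_pushout_def by (safe; metis)

text \<open>Here \<open>f\<close> is the cell and \<open>g\<close> its attaching map, so the leg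
  that inherits properties of \<open>f\<close> is \<open>j\<close>, the one starting at the codomain
  of \<open>g\<close>.\<close>

lemma pushout_mpush:
  assumes P: "is_pushout C f g P i j" and fg: "f \<in> hom C A B" "g \<in> hom C A X"
  shows "is_mpush C X {()} (\<lambda>_. f) (\<lambda>_. g) P j (\<lambda>_. i)"
  unfolding is_mpush_def
proof (intro conjI allI impI)
  note p = pushout_hom[OF P fg]
  show "j \<in> hom C X P" by (rule p)
  show "\<forall>k \<in> {()}. f \<in> Arr C \<and> g \<in> hom C (Dom C f) X" "\<forall>k \<in> {()}. i \<in> hom C (Cod C f) P \<and> i \<cdot> f = j \<cdot> g"
    using fg p by (simp_all add: hom_def)
  fix Y c' b'
  assume "c' \<in> hom C X Y \<and> (\<forall>k \<in> {()}. b' k \<in> hom C (Cod C f) Y \<and> b' k \<cdot> f = c' \<cdot> g)"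
  then have "\<exists>!h. h \<in> hom C P Y \<and> h \<cdot> i = b' () \<and> h \<cdot> j = c'"
    by (intro pushout_universal[OF P]) (simp_all add: homD(3)[OF fg(2)])
  then show "\<exists>!h. h \<in> hom C P Y \<and> h \<cdot> j = c' \<and> (\<forall>k \<in> {()}. h \<cdot> i = b' k)"
    by (simp add: conj_ac)
qed

lemma coproduct_hom: "is_coproduct C A B S i j \<Longrightarrow> i \<in> hom C A S" "is_coproduct C A B S i j \<Longrightarrow> j \<in> hom C B S"
  by (simp_all add: is_coproduct_def)

lemma coproduct_ex:
  assumes "is_coproduct C A B S i j" "u \<in> hom C A Y" "v \<in> hom C B Y"
  obtains h where "h \<in> hom C S Y" "h \<cdot> i = u" "h \<cdot> j = v"
  using assms unfolding is_coproduct_def by blast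

lemma coproduct_unique:
  assumes S: "is_coproduct C A B S i j"
    and h: "h \<in> hom C S Y" "h' \<in> hom C S Y" "h \<cdot> i = h' \<cdot> i" "h \<cdot> j = h' \<cdot> j"
  shows "h = h'"
proof -
  have "\<exists>!k. k \<in> hom C S Y \<and> k \<cdot> i = h \<cdot> i \<and> k \<cdot> j = h \<cdot> j"
    using S Comp_hom[OF coproduct_hom(1)[OF S] h(1)] Comp_hom[OF coproduct_hom(2)[OF S] h(1)]
    by (simp add: is_coproduct_def)
  then show ?thesis using h by metis
qed

lemma llp_pushout:
  assumes "is_pushout C f g P i j" "f \<in> hom C A B" "g \<in> hom C A X" "f \<in> llp C R" "R \<subseteq> Arr C"
  shows "j \<in> llp C R"
  using llp_mpush[OF pushout_mpush[OF assms(1-3)] _ assms(5)] assms(4) by blast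

end

section \<open>Locally finitely presentable categories: finite colimits and density of presentable
  objects\<close>

locale lfp_category = category C for C :: "('o, 'a) cat" (structure) +
  fixes U :: "'u itself"
  assumes universe: "universe U" and cocomplete: "cocomplete U C" and accessible: "accessible U natLeq C"
begin

abbreviation fp :: "'o \<Rightarrow> bool" where "fp \<equiv> presentable U natLeq C"

lemma fp_Obj: "fp A \<Longrightarrow> A \<in> Obj C" by (simp add: presentable_def)

lemma small_hom: "X \<in> Obj C \<Longrightarrow> Y \<in> Obj C \<Longrightarrow> small U (hom C X Y)"
  using accessible by (simp add: accessible_def locally_small_def)

lemma pushout_exists:
  assumes f: "f \<in> hom C A B" and g: "g \<in> hom C A X"
  obtains P i j where "is_pushout C f g P i j" "i \<in> hom C B P" "j \<in> hom C X P" "i \<cdot> f = j \<cdot> g"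
    "fp A \<and> fp B \<and> fp X \<longrightarrow> fp P"
proof -
  obtain P c b where m: "is_mpush C X {()} (\<lambda>_. f) (\<lambda>_. g) P c b"
    using mpush_exists[OF cocomplete universe small_finite[OF universe], of "{()}" X "\<lambda>_. f" "\<lambda>_. g"]
      f g hom_ObjD[OF g] by (auto simp: hom_def)
  have p: "is_pushout C f g P (b ()) c" using mpush_singleton[OF m] .
  show thesis
  proof (rule that[OF p pushout_hom[OF p f g]])
    show "fp A \<and> fp B \<and> fp X \<longrightarrow> fp P" using mpush_presentable[OF universe m] f by (simp add: hom_def)
  qed
qed

lemma initial_exists: "\<exists>E. is_initial C E"
proof -
  define D :: "(nat, nat, 'o, 'a) ftor" where "D = \<lparr>FO = \<lambda>_. undefined, FA = \<lambda>i. Ident C undefined\<rparr>"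
  have J: "category (discrete_cat ({} :: nat set))" by (rule category_discrete_cat)
  have D: "is_functor (discrete_cat {}) C D" by (simp add: is_functor_def discrete_cat_def)
  have s: "small U (Arr (discrete_cat ({} :: nat set)))"
    by (rule small_finite[OF universe]) (simp add: discrete_cat_def)
  obtain E \<iota> where E: "is_colimit C (discrete_cat {}) D E \<iota>"
    using cocomplete_any[OF cocomplete J s D] by blast
  have "\<exists>!h. h \<in> hom C E X" if "X \<in> Obj C" for X
  proof -
    have "is_cocone C (discrete_cat {}) D X \<iota>" using that by (simp add: is_cocone_def discrete_cat_def)
    from E[unfolded is_colimit_def, THEN conjunct2, rule_format, OF this]
    show ?thesis by (simp add: discrete_cat_def)
  qed
  moreover have "E \<in> Obj C" using colimit_cocone[OF E] by (simp add: is_cocone_def)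
  ultimately show ?thesis by (intro exI[of _ E]) (simp add: is_initial_def)
qed

lemma initial_hom:
  assumes "is_initial C E" "X \<in> Obj C"
  obtains e where "e \<in> hom C E X"
  using assms unfolding is_initial_def by blast

lemma initial_unique: "is_initial C E \<Longrightarrow> f \<in> hom C E X \<Longrightarrow> g \<in> hom C E X \<Longrightarrow> f = g"
  unfolding is_initial_def using hom_ObjD(2)[of f E X] by blast

text \<open>Maps out of an initial object are unique, so surjectivity asks only for some index, and
  a filtered category has one.\<close>

lemma fp_initial:
  assumes E: "is_initial C E" shows "fp E"
proof (rule presentableI[OF universe])
  show "E \<in> Obj C" using E by (simp add: is_initial_def)
  fix J :: "('u, 'u) cat" and D Y \<iota>
  assume J: "filt J" and D: "is_functor J C D" and Y: "is_colimit C J D Y \<iota>"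
  interpret J: category J using J by (rule filt_category)
  note \<iota>h = cocone_hom[OF colimit_cocone[OF Y]]
  show "\<exists>i \<in> Obj J. \<exists>f \<in> hom C E (FO D i). \<iota> i \<cdot> f = h" if h: "h \<in> hom C E Y" for h
  proof -
    obtain i where i: "i \<in> Obj J" using filt_nonempty[OF J] by blast
    obtain f where f: "f \<in> hom C E (FO D i)" by (rule initial_hom[OF E functor_Obj[OF D i]])
    show ?thesis using initial_unique[OF E Comp_hom[OF f \<iota>h[OF i]] h] i f by blast
  qed
  show "\<exists>l. \<exists>\<alpha> \<in> hom J i l. FA D \<alpha> \<cdot> f = FA D \<alpha> \<cdot> g"
    if "i \<in> Obj J" "f \<in> hom C E (FO D i)" "g \<in> hom C E (FO D i)" for i f g
    using initial_unique[OF E that(2,3)] J.Ident_hom[OF that(1)] by blast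
qed

text \<open>A coproduct is a pushout over the initial object; obtained this way, it inherits
  presentability from \<open>pushout_exists\<close>.\<close>

lemma coproduct_exists:
  assumes "A \<in> Obj C" "B \<in> Obj C"
  obtains S i j where "is_coproduct C A B S i j" "fp A \<and> fp B \<longrightarrow> fp S"
proof -
  obtain E where E: "is_initial C E" using initial_exists by blast
  obtain f where f: "f \<in> hom C E A" by (rule initial_hom[OF E assms(1)])
  obtain g where g: "g \<in> hom C E B" by (rule initial_hom[OF E assms(2)])
  obtain S i j where P: "is_pushout C f g S i j" and ij: "i \<in> hom C A S" "j \<in> hom C B S" "i \<cdot> f = j \<cdot> g"
    and fpS: "fp E \<and> fp A \<and> fp B \<longrightarrow> fp S" by (rule pushout_exists[OF f g])
  have "\<exists>!h. h \<in> hom C S Y \<and> h \<cdot> i = u \<and> h \<cdot> j = v" if uv: "u \<in> hom C A Y" "v \<in> hom C B Y" for Y u v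
  proof (rule pushout_universal[OF P])
    show "u \<cdot> f = v \<cdot> g" by (rule initial_unique[OF E Comp_hom[OF f uv(1)] Comp_hom[OF g uv(2)]])
  qed (use uv homD(3)[OF f] homD(3)[OF g] in simp_all)
  then have "is_coproduct C A B S i j" using ij(1,2) hom_ObjD(2)[OF ij(1)] by (simp add: is_coproduct_def)
  then show thesis using that fpS fp_initial[OF E] by blast
qed

text \<open>The coequalizer is the pushout of the fold map \<open>n\<close> of the coproduct of
  \<open>A\<close> with itself along the map \<open>w\<close> with components \<open>s\<close> and
  \<open>t\<close>; this keeps it presentable.\<close>

lemma coequalizer_exists:
  assumes s: "s \<in> hom C A B" and t: "t \<in> hom C A B" and fp: "fp A" "fp B"
  obtains Q c where "fp Q" "c \<in> hom C B Q" "c \<cdot> s = c \<cdot> t"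
    "\<forall>Y y. y \<in> hom C B Y \<longrightarrow> y \<cdot> s = y \<cdot> t \<longrightarrow> (\<exists>h \<in> hom C Q Y. h \<cdot> c = y)"
proof -
  note A = hom_ObjD(1)[OF s]
  obtain S i j where S: "is_coproduct C A A S i j" and fpS: "fp A \<and> fp A \<longrightarrow> fp S"
    by (rule coproduct_exists[OF A A])
  note ij = coproduct_hom[OF S]
  obtain n where n: "n \<in> hom C S A" "n \<cdot> i = Ident C A" "n \<cdot> j = Ident C A"
    by (rule coproduct_ex[OF S Ident_hom[OF A] Ident_hom[OF A]])
  obtain w where w: "w \<in> hom C S B" "w \<cdot> i = s" "w \<cdot> j = t" by (rule coproduct_ex[OF S s t])
  obtain Q p c where P: "is_pushout C n w Q p c" and pc: "p \<in> hom C A Q" "c \<in> hom C B Q" "p \<cdot> n = c \<cdot> w"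
    and fpQ: "fp S \<and> fp A \<and> fp B \<longrightarrow> fp Q" by (rule pushout_exists[OF n(1) w(1)])
  have "c \<cdot> s = (p \<cdot> n) \<cdot> i" "c \<cdot> t = (p \<cdot> n) \<cdot> j"
    unfolding pc(3) w(2,3)[symmetric] using w(1) pc ij by (simp_all add: hom_def)
  moreover have "(p \<cdot> n) \<cdot> i = p" "(p \<cdot> n) \<cdot> j = p" using n pc(1,2) ij by (simp_all add: hom_def)
  ultimately have eq: "c \<cdot> s = c \<cdot> t" by simp
  show thesis
  proof (rule that[OF _ pc(2) eq])
    show "fp Q" using fpQ fpS fp by blast
  next
    show "\<forall>Y y. y \<in> hom C B Y \<longrightarrow> y \<cdot> s = y \<cdot> t \<longrightarrow> (\<exists>h \<in> hom C Q Y. h \<cdot> c = y)"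
    proof (intro allI impI)
      fix Y y assume y: "y \<in> hom C B Y" "y \<cdot> s = y \<cdot> t"
      have "(y \<cdot> s) \<cdot> n = y \<cdot> w"
      proof (rule coproduct_unique[OF S])
        show "(y \<cdot> s) \<cdot> n \<in> hom C S Y" by (rule Comp_hom[OF n(1) Comp_hom[OF s y(1)]])
        show "y \<cdot> w \<in> hom C S Y" by (rule Comp_hom[OF w(1) y(1)])
        show "((y \<cdot> s) \<cdot> n) \<cdot> i = (y \<cdot> w) \<cdot> i" "((y \<cdot> s) \<cdot> n) \<cdot> j = (y \<cdot> w) \<cdot> j"
          using y n w s t ij by (simp_all add: hom_def)
      qed
      then show "\<exists>h \<in> hom C Q Y. h \<cdot> c = y"
        by (rule pushout_ex[OF P n(1) w(1) Comp_hom[OF s y(1)] y(1)]) blast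
    qed
  qed
qed

lemma colimit_presentation:
  assumes "X \<in> Obj C"
  obtains J :: "('u, 'u) cat" and D \<iota> where "filt J" "small U (Arr J)" "is_functor J C D"
    "\<forall>i \<in> Obj J. fp (FO D i)" "is_colimit C J D X \<iota>"
proof -
  obtain G where G: "\<forall>A \<in> G. fp A" and "\<forall>X \<in> Obj C. \<exists>(J :: ('u, 'u) cat) D \<iota>.
      small_category J \<and> filtered natLeq J \<and> is_functor J C D \<and> FO D ` Obj J \<subseteq> G \<and> is_colimit C J D X \<iota>"
    using accessible unfolding accessible_def by (elim conjE exE) blast
  then obtain J :: "('u, 'u) cat" and D \<iota> where J: "small_category J" "filtered natLeq J"
    "is_functor J C D" "FO D ` Obj J \<subseteq> G" "is_colimit C J D X \<iota>" using assms by blast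
  have "universe TYPE('u)" using universe by (simp add: universe_def)
  then have "filt J" using J(2) by (rule filtered_imp_filt)
  moreover have "small U (Arr J)" using J(1) by (simp add: small_category_def small_def)
  moreover have "\<forall>i \<in> Obj J. fp (FO D i)" using J(4) G by blast
  ultimately show thesis by (intro that[of J D \<iota>] J(3,5))
qed

text \<open>Converse of \<open>presentable_surj\<close> and \<open>presentable_inj_same\<close>: a
  cocone of presentable objects that behaves like a filtered colimit towards all presentable objects
  is one. The reason is density: \<open>X\<close> is also the colimit of some diagram
  \<open>D\<close> of presentable objects, and the legs of the two diagrams factor through each
  other.\<close>

lemma colimitI_presentable:
  assumes K: "filt K" and E: "is_functor K C E" and c: "is_cocone C K E X \<epsilon>"
    and fpE: "\<And>k. k \<in> Obj K \<Longrightarrow> fp (FO E k)"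
    and surj: "\<And>A h. fp A \<Longrightarrow> h \<in> hom C A X \<Longrightarrow> \<exists>k \<in> Obj K. \<exists>b \<in> hom C A (FO E k). \<epsilon> k \<cdot> b = h"
    and inj: "\<And>A k s t. fp A \<Longrightarrow> k \<in> Obj K \<Longrightarrow> s \<in> hom C A (FO E k) \<Longrightarrow> t \<in> hom C A (FO E k) \<Longrightarrow>
      \<epsilon> k \<cdot> s = \<epsilon> k \<cdot> t \<Longrightarrow> \<exists>l. \<exists>\<alpha> \<in> hom K k l. FA E \<alpha> \<cdot> s = FA E \<alpha> \<cdot> t"
  shows "is_colimit C K E X \<epsilon>"
proof -
  interpret K: category K using K by (rule filt_category)
  note \<epsilon>h = cocone_hom[OF c] and \<epsilon>c = cocone_Comp[OF c]
  have X: "X \<in> Obj C" using c by (simp add: is_cocone_def)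
  obtain J :: "('u, 'u) cat" and D \<iota> where J: "filt J" "small U (Arr J)" and D: "is_functor J C D"
    and fpD: "\<forall>i \<in> Obj J. fp (FO D i)" and XD: "is_colimit C J D X \<iota>"
    by (rule colimit_presentation[OF X])
  interpret J: category J using J(1) by (rule filt_category)
  note \<iota>h = cocone_hom[OF colimit_cocone[OF XD]] and \<iota>c = cocone_Comp[OF colimit_cocone[OF XD]]
  show ?thesis
  proof (rule is_colimitI[OF c])
    fix Y \<tau> assume \<tau>: "is_cocone C K E Y \<tau>"
    note \<tau>h = cocone_hom[OF \<tau>] and \<tau>c = cocone_Comp[OF \<tau>]
    \<comment> \<open>A cocone \<open>\<tau>\<close> assigns to each map from a presentable object
      into \<open>X\<close> a well-defined map into \<open>Y\<close>: the value does not depend on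
      the lift through a leg \<open>\<epsilon> k\<close>.\<close>
    have agree: "\<tau> k \<cdot> s = \<tau> l \<cdot> t"
      if A: "fp A" "k \<in> Obj K" "l \<in> Obj K" "s \<in> hom C A (FO E k)" "t \<in> hom C A (FO E l)"
        "\<epsilon> k \<cdot> s = \<epsilon> l \<cdot> t" for A k l s t
    proof -
      obtain n \<alpha> \<beta> where n: "\<alpha> \<in> hom K k n" "\<beta> \<in> hom K l n" by (rule filt_bound[OF K A(2,3)])
      have no: "n \<in> Obj K" by (rule K.hom_ObjD(2)[OF n(1)])
      note h = functor_hom[OF E n(1)] functor_hom[OF E n(2)]
      have "\<epsilon> n \<cdot> (FA E \<alpha> \<cdot> s) = (\<epsilon> n \<cdot> FA E \<alpha>) \<cdot> s" using h A(4) \<epsilon>h[OF no] by (simp add: hom_def)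
      also have "\<dots> = (\<epsilon> n \<cdot> FA E \<beta>) \<cdot> t" unfolding \<epsilon>c[OF n(1)] \<epsilon>c[OF n(2)] by fact
      also have "\<dots> = \<epsilon> n \<cdot> (FA E \<beta> \<cdot> t)" using h A(5) \<epsilon>h[OF no] by (simp add: hom_def)
      finally have "\<epsilon> n \<cdot> (FA E \<alpha> \<cdot> s) = \<epsilon> n \<cdot> (FA E \<beta> \<cdot> t)" .
      from inj[OF A(1) no Comp_hom[OF A(4) h(1)] Comp_hom[OF A(5) h(2)] this]
      obtain m \<gamma> where m: "\<gamma> \<in> hom K n m" "FA E \<gamma> \<cdot> (FA E \<alpha> \<cdot> s) = FA E \<gamma> \<cdot> (FA E \<beta> \<cdot> t)" by blast
      note h' = functor_hom[OF E m(1)] \<tau>h[OF K.hom_ObjD(2)[OF m(1)]] \<tau>h[OF no]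
      have "\<tau> k \<cdot> s = (\<tau> n \<cdot> FA E \<alpha>) \<cdot> s" using \<tau>c[OF n(1)] by simp
      also have "\<dots> = (\<tau> m \<cdot> FA E \<gamma>) \<cdot> (FA E \<alpha> \<cdot> s)"
        unfolding \<tau>c[OF m(1)] using h h' A by (simp add: hom_def)
      also have "\<dots> = \<tau> m \<cdot> (FA E \<gamma> \<cdot> (FA E \<beta> \<cdot> t))"
        unfolding m(2)[symmetric] using h h' A by (simp add: hom_def)
      also have "\<dots> = (\<tau> m \<cdot> FA E \<gamma>) \<cdot> (FA E \<beta> \<cdot> t)" using h h' A by (simp add: hom_def)
      also have "\<dots> = (\<tau> n \<cdot> FA E \<beta>) \<cdot> t" unfolding \<tau>c[OF m(1)] using h h' A by (simp add: hom_def)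
      also have "\<dots> = \<tau> l \<cdot> t" unfolding \<tau>c[OF n(2)] ..
      finally show ?thesis .
    qed
    have "\<exists>k b. k \<in> Obj K \<and> b \<in> hom C (FO D j) (FO E k) \<and> \<epsilon> k \<cdot> b = \<iota> j" if "j \<in> Obj J" for j
      using surj[OF fpD[rule_format, OF that] \<iota>h[OF that]] by blast
    then obtain k b where kb: "\<And>j. j \<in> Obj J \<Longrightarrow> k j \<in> Obj K"
      "\<And>j. j \<in> Obj J \<Longrightarrow> b j \<in> hom C (FO D j) (FO E (k j))" "\<And>j. j \<in> Obj J \<Longrightarrow> \<epsilon> (k j) \<cdot> b j = \<iota> j"
      by metis
    have "is_cocone C J D Y (\<lambda>j. \<tau> (k j) \<cdot> b j)"
    proof (rule is_coconeI)
      show "Y \<in> Obj C" using \<tau> by (simp add: is_cocone_def)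
      show "\<tau> (k j) \<cdot> b j \<in> hom C (FO D j) Y" if "j \<in> Obj J" for j
        by (rule Comp_hom[OF kb(2)[OF that] \<tau>h[OF kb(1)[OF that]]])
      fix i j \<alpha> assume a: "i \<in> Obj J" "j \<in> Obj J" "\<alpha> \<in> hom J i j"
      note h = functor_hom[OF D a(3)] kb(2)[OF a(1)] kb(2)[OF a(2)] \<epsilon>h[OF kb(1)[OF a(2)]] \<tau>h[OF kb(1)[OF a(2)]]
      have "\<epsilon> (k j) \<cdot> (b j \<cdot> FA D \<alpha>) = (\<epsilon> (k j) \<cdot> b j) \<cdot> FA D \<alpha>" using h by (simp add: hom_def)
      also have "\<dots> = \<epsilon> (k i) \<cdot> b i" unfolding kb(3)[OF a(1)] kb(3)[OF a(2)] by (rule \<iota>c[OF a(3)])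
      finally have "\<tau> (k j) \<cdot> (b j \<cdot> FA D \<alpha>) = \<tau> (k i) \<cdot> b i"
        by (rule agree[OF fpD[rule_format, OF a(1)] kb(1)[OF a(2)] kb(1)[OF a(1)] Comp_hom[OF h(1,3)] h(2)])
      then show "(\<tau> (k j) \<cdot> b j) \<cdot> FA D \<alpha> = \<tau> (k i) \<cdot> b i" using h by (simp add: hom_def)
    qed (rule J.category_axioms)
    then obtain h where h: "h \<in> hom C X Y" "\<forall>j \<in> Obj J. h \<cdot> \<iota> j = \<tau> (k j) \<cdot> b j"
      by (rule colimit_ex[OF XD])
    \<comment> \<open>Presentability of \<open>FO E l\<close> lifts \<open>\<epsilon> l\<close> to
      some \<open>FO D j\<close>, where \<open>h\<close> is known, and \<open>agree\<close> compares
      the outcome with the identity lift.\<close>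
    have "h \<cdot> \<epsilon> l = \<tau> l" if l: "l \<in> Obj K" for l
    proof -
      obtain j d where j: "j \<in> Obj J" "d \<in> hom C (FO E l) (FO D j)" "\<iota> j \<cdot> d = \<epsilon> l"
        by (rule presentable_surj[OF fpE[OF l] J D XD \<epsilon>h[OF l]])
      note hh = kb(2)[OF j(1)] \<epsilon>h[OF kb(1)[OF j(1)]] \<tau>h[OF kb(1)[OF j(1)]] j(2) \<iota>h[OF j(1)] h(1)
        \<epsilon>h[OF l] \<tau>h[OF l]
      have lo: "FO E l \<in> Obj C" by (rule functor_Obj[OF E l])
      have "\<epsilon> (k j) \<cdot> (b j \<cdot> d) = (\<epsilon> (k j) \<cdot> b j) \<cdot> d" using hh by (simp add: hom_def)
      also have "\<dots> = \<epsilon> l \<cdot> Ident C (FO E l)" unfolding kb(3)[OF j(1)] j(3) using hh by (simp add: hom_def)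
      finally have "\<tau> (k j) \<cdot> (b j \<cdot> d) = \<tau> l \<cdot> Ident C (FO E l)"
        by (rule agree[OF fpE[OF l] kb(1)[OF j(1)] l Comp_hom[OF j(2) hh(1)] Ident_hom[OF lo]])
      also have "\<dots> = \<tau> l" using hh by (simp add: hom_def)
      finally have "\<tau> (k j) \<cdot> (b j \<cdot> d) = \<tau> l" .
      moreover have "h \<cdot> \<epsilon> l = (h \<cdot> \<iota> j) \<cdot> d" unfolding j(3)[symmetric] using hh by (simp add: hom_def)
      ultimately show ?thesis unfolding h(2)[rule_format, OF j(1)] using hh by (simp add: hom_def)
    qed
    then show "\<exists>h \<in> hom C X Y. \<forall>l \<in> Obj K. h \<cdot> \<epsilon> l = \<tau> l" using h(1) by blast
  next
    fix Y h h' assume h: "h \<in> hom C X Y" "h' \<in> hom C X Y"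
      and eq: "\<And>l. l \<in> Obj K \<Longrightarrow> h \<cdot> \<epsilon> l = h' \<cdot> \<epsilon> l"
    show "h = h'"
    proof (rule colimit_unique[OF XD J.category_axioms D h])
      fix j assume j: "j \<in> Obj J"
      obtain k b where k: "k \<in> Obj K" "b \<in> hom C (FO D j) (FO E k)" "\<epsilon> k \<cdot> b = \<iota> j"
        using surj[OF fpD[rule_format, OF j] \<iota>h[OF j]] by blast
      have "(h \<cdot> \<epsilon> k) \<cdot> b = (h' \<cdot> \<epsilon> k) \<cdot> b" using eq[OF k(1)] by simp
      then show "h \<cdot> \<iota> j = h' \<cdot> \<iota> j" unfolding k(3)[symmetric] using k h \<epsilon>h[OF k(1)] by (simp add: hom_def)
    qed
  qed
qed

end

section \<open>Factorizations through morphisms of presentable objects\<close>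

context lfp_category
begin

definition square_factors ::
    "'a set \<Rightarrow> 'a \<Rightarrow> 'o \<Rightarrow> 'o \<Rightarrow> 'o \<Rightarrow> 'o \<Rightarrow> 'a \<Rightarrow> 'a \<Rightarrow> 'a \<Rightarrow> bool" where
  "square_factors S f X Y A B g u v \<longleftrightarrow>
     (\<exists>A' B' w a b u' v'. w \<in> S \<and> fp A' \<and> fp B' \<and> w \<in> hom C A' B' \<and> a \<in> hom C A A' \<and> b \<in> hom C B B' \<and>
        u' \<in> hom C A' X \<and> v' \<in> hom C B' Y \<and>
        b \<cdot> g = w \<cdot> a \<and> v' \<cdot> w = f \<cdot> u' \<and> u' \<cdot> a = u \<and> v' \<cdot> b = v)"

text \<open>
  In elementary terms: in the category of arrows, \<open>f\<close> is a filtered colimit of elements of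
  \<open>S\<close> between presentable objects.
\<close>

definition factors_via :: "'a set \<Rightarrow> 'a \<Rightarrow> bool" where
  "factors_via S f \<longleftrightarrow> f \<in> Arr C \<and>
     (\<forall>A B g u v. fp A \<and> fp B \<and> g \<in> hom C A B \<and> u \<in> hom C A (Dom C f) \<and> v \<in> hom C B (Cod C f) \<and>
        v \<cdot> g = f \<cdot> u \<longrightarrow> square_factors S f (Dom C f) (Cod C f) A B g u v)"

lemma factors_viaD:
  assumes "factors_via S f" "f \<in> hom C X Y" "fp A" "fp B" "g \<in> hom C A B"
    "u \<in> hom C A X" "v \<in> hom C B Y" "v \<cdot> g = f \<cdot> u"
  obtains A' B' w a b u' v' where "w \<in> S" "fp A'" "fp B'" "w \<in> hom C A' B'" "a \<in> hom C A A'"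
    "b \<in> hom C B B'" "u' \<in> hom C A' X" "v' \<in> hom C B' Y"
    "b \<cdot> g = w \<cdot> a" "v' \<cdot> w = f \<cdot> u'" "u' \<cdot> a = u" "v' \<cdot> b = v"
proof -
  have d: "Dom C f = X" "Cod C f = Y" using assms(2) by (simp_all add: hom_def)
  have "square_factors S f X Y A B g u v"
    using assms(1)[unfolded factors_via_def, THEN conjunct2, unfolded d] assms(3-8) by blast
  then show thesis unfolding square_factors_def by (elim exE conjE) (rule that)
qed

lemma factors_viaI:
  assumes "f \<in> hom C X Y"
    and "\<And>A B g u v. fp A \<Longrightarrow> fp B \<Longrightarrow> g \<in> hom C A B \<Longrightarrow> u \<in> hom C A X \<Longrightarrow> v \<in> hom C B Y \<Longrightarrow>
      v \<cdot> g = f \<cdot> u \<Longrightarrow>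
      square_factors S f X Y A B g u v"
  shows "factors_via S f"
proof -
  have d: "Dom C f = X" "Cod C f = Y" "f \<in> Arr C" using assms(1) by (simp_all add: hom_def)
  show ?thesis
    unfolding factors_via_def d(1,2)
    by (intro conjI allI impI d(3) assms(2)) (elim conjE, assumption)+
qed

text \<open>A square from \<open>g\<close> to an identity is determined by \<open>v\<close>, and it
  factors through the identity of \<open>B\<close>.\<close>

lemma factors_via_Ident:
  assumes X: "X \<in> Obj C" and S: "\<And>A. fp A \<Longrightarrow> Ident C A \<in> S"
  shows "factors_via S (Ident C X)"
proof (rule factors_viaI[OF Ident_hom[OF X]])
  fix A B g u v assume h: "fp A" "fp B" "g \<in> hom C A B" "u \<in> hom C A X" "v \<in> hom C B X"
    and eq: "v \<cdot> g = Ident C X \<cdot> u"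
  have "v \<cdot> g = u" using eq h by (simp add: hom_def)
  then show "square_factors S (Ident C X) X X A B g u v"
    unfolding square_factors_def
    using S[OF h(2)] h fp_Obj[OF h(2)] Ident_hom[OF fp_Obj[OF h(2)]]
    by (intro exI[of _ B] exI[of _ "Ident C B"] exI[of _ g] exI[of _ v]) (simp add: hom_def)
qed

text \<open>The square into \<open>g\<close> factors through \<open>w1\<close>. The equation
  \<open>u1 \<cdot> a1 = f \<cdot> u\<close> is then a square from \<open>a1\<close> to
  \<open>f\<close>, which factors through \<open>w2\<close>. Pushing \<open>w1\<close> forward along
  \<open>b2\<close> gives \<open>j\<close>, and \<open>j \<cdot> w2\<close> is the arrow sought;
  closure under pushouts and composition is the reason for taking a class of the form
  \<open>llp C R\<close>.\<close>

lemma factors_via_Comp: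
  assumes f: "factors_via (llp C R) f" "f \<in> hom C X Y" and g: "factors_via (llp C R) g" "g \<in> hom C Y Z"
    and R: "R \<subseteq> Arr C"
  shows "factors_via (llp C R) (g \<cdot> f)"
proof (rule factors_viaI[OF Comp_hom[OF f(2) g(2)]])
  fix A B k u v assume h: "fp A" "fp B" "k \<in> hom C A B" "u \<in> hom C A X" "v \<in> hom C B Z"
    and eq: "v \<cdot> k = (g \<cdot> f) \<cdot> u"
  have eq': "v \<cdot> k = g \<cdot> (f \<cdot> u)" unfolding eq using f(2) g(2) h by (simp add: hom_def)
  obtain Y1 Z1 w1 a1 b1 u1 v1 where 1: "w1 \<in> llp C R" "fp Y1" "fp Z1" "w1 \<in> hom C Y1 Z1" "a1 \<in> hom C A Y1"
    "b1 \<in> hom C B Z1" "u1 \<in> hom C Y1 Y" "v1 \<in> hom C Z1 Z"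
    "b1 \<cdot> k = w1 \<cdot> a1" "v1 \<cdot> w1 = g \<cdot> u1" "u1 \<cdot> a1 = f \<cdot> u" "v1 \<cdot> b1 = v"
    by (rule factors_viaD[OF g h(1-3) Comp_hom[OF h(4) f(2)] h(5) eq'])
  obtain X2 Y2 w2 a2 b2 u2 v2 where 2: "w2 \<in> llp C R" "fp X2" "fp Y2" "w2 \<in> hom C X2 Y2" "a2 \<in> hom C A X2"
    "b2 \<in> hom C Y1 Y2" "u2 \<in> hom C X2 X" "v2 \<in> hom C Y2 Y"
    "b2 \<cdot> a1 = w2 \<cdot> a2" "v2 \<cdot> w2 = f \<cdot> u2" "u2 \<cdot> a2 = u" "v2 \<cdot> b2 = u1"
    by (rule factors_viaD[OF f h(1) 1(2,5) h(4) 1(7,11)])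
  obtain Z2 i j where P: "is_pushout C w1 b2 Z2 i j" and ij: "i \<in> hom C Z1 Z2" "j \<in> hom C Y2 Z2"
    "i \<cdot> w1 = j \<cdot> b2" and fpP: "fp Y1 \<and> fp Z1 \<and> fp Y2 \<longrightarrow> fp Z2"
    by (rule pushout_exists[OF 1(4) 2(6)])
  have j: "j \<in> llp C R" by (rule llp_pushout[OF P 1(4) 2(6) 1(1) R])
  have "v1 \<cdot> w1 = (g \<cdot> v2) \<cdot> b2" unfolding 1(10) 2(12)[symmetric] using g(2) 2(6,8) by (simp add: hom_def)
  then obtain z where z: "z \<in> hom C Z2 Z" "z \<cdot> i = v1" "z \<cdot> j = g \<cdot> v2"
    by (rule pushout_ex[OF P 1(4) 2(6) 1(8) Comp_hom[OF 2(8) g(2)]])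
  have "(i \<cdot> b1) \<cdot> k = i \<cdot> (b1 \<cdot> k)" using ij(1) 1(6) h(3) by (simp add: hom_def)
  also have "\<dots> = (i \<cdot> w1) \<cdot> a1" unfolding 1(9) using ij(1) 1(4,5) by (simp add: hom_def)
  also have "\<dots> = j \<cdot> (b2 \<cdot> a1)" unfolding ij(3) using ij(2) 2(6) 1(5) by (simp add: hom_def)
  also have "\<dots> = (j \<cdot> w2) \<cdot> a2" unfolding 2(9) using ij(2) 2(4,5) by (simp add: hom_def)
  finally have e1: "(i \<cdot> b1) \<cdot> k = (j \<cdot> w2) \<cdot> a2" .
  have "z \<cdot> (j \<cdot> w2) = (z \<cdot> j) \<cdot> w2" using z(1) ij(2) 2(4) by (simp add: hom_def)
  also have "\<dots> = g \<cdot> (v2 \<cdot> w2)" unfolding z(3) using g(2) 2(4,8) by (simp add: hom_def)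
  also have "\<dots> = (g \<cdot> f) \<cdot> u2" unfolding 2(10) using g(2) f(2) 2(7) by (simp add: hom_def)
  finally have e2: "z \<cdot> (j \<cdot> w2) = (g \<cdot> f) \<cdot> u2" .
  have e3: "z \<cdot> (i \<cdot> b1) = v" unfolding 1(12)[symmetric] z(2)[symmetric] using z(1) ij(1) 1(6) by (simp add: hom_def)
  have "fp Z2" using fpP 1(2,3) 2(3) by blast
  then show "square_factors (llp C R) (g \<cdot> f) X Z A B k u v"
    unfolding square_factors_def
    using llp_Comp[OF 2(1,4) j ij(2) R] 2(2) Comp_hom[OF 2(4) ij(2)] 2(5) Comp_hom[OF 1(6) ij(1)] 2(7) z(1)
      e1 e2 2(11) e3 by blast
qed

text \<open>Meant for infinite composites: the source \<open>X\<close> is fixed and only the target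
  runs through the diagram. Presentability of \<open>B\<close> brings \<open>v\<close> to a stage
  \<open>j\<close>, and that of \<open>A\<close> makes the square commute over a later stage
  \<open>l\<close>.\<close>

lemma factors_via_colimit:
  assumes J: "filt J" "small U (Arr J)" and D: "is_functor J C D" and P: "is_colimit C J D P \<iota>"
    and c: "\<And>j. j \<in> Obj J \<Longrightarrow> c j \<in> hom C X (FO D j)" "\<And>j. j \<in> Obj J \<Longrightarrow> factors_via S (c j)"
      "\<And>j. j \<in> Obj J \<Longrightarrow> \<iota> j \<cdot> c j = d"
      "\<And>i j \<alpha>. \<alpha> \<in> hom J i j \<Longrightarrow> FA D \<alpha> \<cdot> c i = c j"
    and d: "d \<in> hom C X P"
  shows "factors_via S d"
proof (rule factors_viaI[OF d])
  interpret J: category J using J(1) by (rule filt_category)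
  note \<iota>h = cocone_hom[OF colimit_cocone[OF P]] and \<iota>c = cocone_Comp[OF colimit_cocone[OF P]]
  fix A B g u v assume h: "fp A" "fp B" "g \<in> hom C A B" "u \<in> hom C A X" "v \<in> hom C B P"
    and eq: "v \<cdot> g = d \<cdot> u"
  obtain j y where j: "j \<in> Obj J" "y \<in> hom C B (FO D j)" "\<iota> j \<cdot> y = v"
    by (rule presentable_surj[OF h(2) J D P h(5)])
  note \<iota>j = \<iota>h[OF j(1)] and cj = c(1)[OF j(1)]
  have "\<iota> j \<cdot> (y \<cdot> g) = v \<cdot> g" unfolding j(3)[symmetric] using \<iota>j j(2) h(3) by (simp add: hom_def)
  also have "\<dots> = \<iota> j \<cdot> (c j \<cdot> u)" unfolding eq c(3)[OF j(1), symmetric] using \<iota>j cj h(4) by (simp add: hom_def)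
  finally have "\<iota> j \<cdot> (y \<cdot> g) = \<iota> j \<cdot> (c j \<cdot> u)" .
  then obtain l \<alpha> where l: "\<alpha> \<in> hom J j l" "FA D \<alpha> \<cdot> (y \<cdot> g) = FA D \<alpha> \<cdot> (c j \<cdot> u)"
    by (rule presentable_inj_same[OF h(1) J D P j(1) Comp_hom[OF h(3) j(2)] Comp_hom[OF h(4) cj]])
  have lo: "l \<in> Obj J" by (rule J.hom_ObjD(2)[OF l(1)])
  note \<alpha> = functor_hom[OF D l(1)] and \<iota>l = \<iota>h[OF lo] and cl = c(1)[OF lo]
  have "(FA D \<alpha> \<cdot> y) \<cdot> g = (FA D \<alpha> \<cdot> c j) \<cdot> u" using l(2) \<alpha> j(2) h(3,4) cj by (simp add: hom_def)
  then have eq': "(FA D \<alpha> \<cdot> y) \<cdot> g = c l \<cdot> u" unfolding c(4)[OF l(1)] .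
  obtain A' B' w a b u' v' where w: "w \<in> S" "fp A'" "fp B'" "w \<in> hom C A' B'" "a \<in> hom C A A'"
    "b \<in> hom C B B'" "u' \<in> hom C A' X" "v' \<in> hom C B' (FO D l)"
    "b \<cdot> g = w \<cdot> a" "v' \<cdot> w = c l \<cdot> u'" "u' \<cdot> a = u" "v' \<cdot> b = FA D \<alpha> \<cdot> y"
    by (rule factors_viaD[OF c(2)[OF lo] cl h(1-4) Comp_hom[OF j(2) \<alpha>] eq'])
  have "(\<iota> l \<cdot> v') \<cdot> w = \<iota> l \<cdot> (v' \<cdot> w)" using \<iota>l w(4,8) by (simp add: hom_def)
  also have "\<dots> = d \<cdot> u'" unfolding w(10) c(3)[OF lo, symmetric] using \<iota>l cl w(7) by (simp add: hom_def)
  finally have e1: "(\<iota> l \<cdot> v') \<cdot> w = d \<cdot> u'" .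
  have "(\<iota> l \<cdot> v') \<cdot> b = \<iota> l \<cdot> (v' \<cdot> b)" using \<iota>l w(6,8) by (simp add: hom_def)
  also have "\<dots> = (\<iota> l \<cdot> FA D \<alpha>) \<cdot> y" unfolding w(12) using \<iota>l \<alpha> j(2) by (simp add: hom_def)
  finally have e2: "(\<iota> l \<cdot> v') \<cdot> b = v" unfolding \<iota>c[OF l(1)] j(3) .
  show "square_factors S d X P A B g u v"
    unfolding square_factors_def
    using w(1-7) Comp_hom[OF w(8) \<iota>l] w(9,11) e1 e2 by blast
qed

end


section \<open>Attaching cells to a filtered colimit\<close>

text \<open>
  When \<open>X\<close> is a filtered colimit of presentable objects \<open>D k\<close>, attaching cells to \<open>X\<close> is
  the filtered colimit of attaching finitely many cells to some \<open>D k\<close> along lifts of their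
  attaching maps.
\<close>

locale attachment = lfp_category C U for C :: "('o, 'a) cat" (structure) and U :: "'u itself" +
  fixes J :: "('i, 'j) cat" and D :: "('i, 'j, 'o, 'a) ftor" and X :: 'o and \<iota> :: "'i \<Rightarrow> 'a"
    and K :: "'k set" and t a :: "'k \<Rightarrow> 'a" and P :: 'o and c :: 'a and b :: "'k \<Rightarrow> 'a"
  assumes J: "filt J" "small U (Arr J)" and D: "is_functor J C D"
    and fpD: "\<And>k. k \<in> Obj J \<Longrightarrow> fp (FO D k)" and X: "is_colimit C J D X \<iota>"
    and K: "small U K" and m: "is_mpush C X K t a P c b"
    and fpt: "\<And>i. i \<in> K \<Longrightarrow> fp (Dom C (t i))" "\<And>i. i \<in> K \<Longrightarrow> fp (Cod C (t i))"
begin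

sublocale J: category J using J(1) by (rule filt_category)

lemmas \<iota>_hom = cocone_hom[OF colimit_cocone[OF X]] and \<iota>_Comp = cocone_Comp[OF colimit_cocone[OF X]]
lemmas m_hom = mpush_hom[OF m]

definition lifts :: "'i \<Rightarrow> ('k \<times> 'a) set" where
  "lifts k = {(i, e). i \<in> K \<and> e \<in> hom C (Dom C (t i)) (FO D k) \<and> \<iota> k \<cdot> e = a i}"

definition push :: "'j \<Rightarrow> 'k \<times> 'a \<Rightarrow> 'k \<times> 'a" where
  "push \<alpha> x = (fst x, FA D \<alpha> \<cdot> snd x)"

text \<open>The finite set may contain one cell \<open>i\<close> with several lifts of its attaching
  map, and the cell is then attached several times. The copies become identified at later stages,
  and in the absence of a uniqueness condition unions of finite sets of lifts are again
  admissible.\<close>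

definition cells :: "('i \<times> ('k \<times> 'a) set, ('i \<times> ('k \<times> 'a) set) \<times> 'j \<times> ('i \<times> ('k \<times> 'a) set)) cat" where
  "cells =
     \<lparr>Obj = {z. fst z \<in> Obj J \<and> finite (snd z) \<and> snd z \<subseteq> lifts (fst z)},
      Arr = {(z, \<alpha>, z'). fst z \<in> Obj J \<and> finite (snd z) \<and> snd z \<subseteq> lifts (fst z) \<and>
        fst z' \<in> Obj J \<and> finite (snd z') \<and> snd z' \<subseteq> lifts (fst z') \<and>
        \<alpha> \<in> hom J (fst z) (fst z') \<and> push \<alpha> ` snd z \<subseteq> snd z'},
      Dom = fst, Cod = (\<lambda>x. snd (snd x)), Ident = (\<lambda>z. (z, Ident J (fst z), z)),
      Comp = (\<lambda>g f. (fst f, fst (snd g) \<cdot>\<^bsub>J\<^esub> fst (snd f), snd (snd g)))\<rparr>"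

lemma push_lifts: "\<alpha> \<in> hom J k l \<Longrightarrow> x \<in> lifts k \<Longrightarrow> push \<alpha> x \<in> lifts l"
proof -
  assume \<alpha>: "\<alpha> \<in> hom J k l" and "x \<in> lifts k"
  then obtain i e where x: "x = (i, e)" "i \<in> K" "e \<in> hom C (Dom C (t i)) (FO D k)" "\<iota> k \<cdot> e = a i"
    by (auto simp: lifts_def)
  have "\<iota> l \<cdot> (FA D \<alpha> \<cdot> e) = (\<iota> l \<cdot> FA D \<alpha>) \<cdot> e"
    using functor_hom[OF D \<alpha>] x(3) \<iota>_hom[OF J.hom_ObjD(2)[OF \<alpha>]] by (simp add: hom_def)
  then show "push \<alpha> x \<in> lifts l"
    unfolding \<iota>_Comp[OF \<alpha>] using x Comp_hom[OF x(3) functor_hom[OF D \<alpha>]] by (simp add: lifts_def push_def)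
qed

lemma push_Ident: "k \<in> Obj J \<Longrightarrow> x \<in> lifts k \<Longrightarrow> push (Ident J k) x = x"
  using functor_Ident[OF D] by (auto simp: push_def lifts_def hom_def)

lemma push_Comp: "\<alpha> \<in> hom J k l \<Longrightarrow> \<beta> \<in> hom J l n \<Longrightarrow> x \<in> lifts k \<Longrightarrow>
    push (\<beta> \<cdot>\<^bsub>J\<^esub> \<alpha>) x = push \<beta> (push \<alpha> x)"
  using functor_Comp[OF D, of \<alpha> k l \<beta> n] functor_hom[OF D, of \<alpha> k l] functor_hom[OF D, of \<beta> l n]
  by (auto simp: push_def lifts_def hom_def)

lemma cells_Obj: "z \<in> Obj cells \<longleftrightarrow> fst z \<in> Obj J \<and> finite (snd z) \<and> snd z \<subseteq> lifts (fst z)"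
  by (simp add: cells_def)

lemma cells_Obj_pair: "k \<in> Obj J \<Longrightarrow> finite G \<Longrightarrow> G \<subseteq> lifts k \<Longrightarrow> (k, G) \<in> Obj cells"
  by (simp add: cells_def)

lemma cells_hom: "f \<in> hom cells z z' \<longleftrightarrow> (\<exists>\<alpha>. f = (z, \<alpha>, z') \<and> z \<in> Obj cells \<and> z' \<in> Obj cells \<and>
    \<alpha> \<in> hom J (fst z) (fst z') \<and> push \<alpha> ` snd z \<subseteq> snd z')"
  by (auto simp: cells_def hom_def)

lemma cells_homI: "z \<in> Obj cells \<Longrightarrow> z' \<in> Obj cells \<Longrightarrow> \<alpha> \<in> hom J (fst z) (fst z') \<Longrightarrow>
    push \<alpha> ` snd z \<subseteq> snd z' \<Longrightarrow> (z, \<alpha>, z') \<in> hom cells z z'"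
  by (simp add: cells_hom)

lemma cells_Comp: "(z', \<beta>, z'') \<cdot>\<^bsub>cells\<^esub> (z, \<alpha>, y) = (z, \<beta> \<cdot>\<^bsub>J\<^esub> \<alpha>, z'')"
  by (simp add: cells_def)

lemma category_cells: "category cells"
proof (unfold_locales, goal_cases)
  case (3 z)
  then have "(z, Ident J (fst z), z) \<in> hom cells z z"
    using J.Ident_hom push_Ident by (intro cells_homI) (auto simp: cells_Obj subset_iff)
  then show ?case by (simp add: cells_def)
next
  case (4 f z z' g z'')
  then obtain \<alpha> \<beta> where e: "f = (z, \<alpha>, z')" "g = (z', \<beta>, z'')" "\<alpha> \<in> hom J (fst z) (fst z')"
    "\<beta> \<in> hom J (fst z') (fst z'')" "z \<in> Obj cells" "z'' \<in> Obj cells"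
    "push \<alpha> ` snd z \<subseteq> snd z'" "push \<beta> ` snd z' \<subseteq> snd z''" by (auto simp: cells_hom)
  have "push (\<beta> \<cdot>\<^bsub>J\<^esub> \<alpha>) ` snd z \<subseteq> snd z''"
    using push_Comp[OF e(3,4)] e(5,7,8) by (fastforce simp: cells_Obj)
  then show ?case unfolding e(1,2) cells_Comp by (intro cells_homI e J.Comp_hom[OF e(3,4)])
qed (auto simp: cells_def hom_def)

sublocale cells: category cells by (rule category_cells)

lemma filt_cells: "filt cells"
  unfolding filt_def
proof (intro conjI ballI)
  show "category cells" by (rule category_cells)
  obtain k where "k \<in> Obj J" using filt_nonempty[OF J(1)] by blast
  then show "Obj cells \<noteq> {}" using cells_Obj_pair[of k "{}"] by blast
next
  fix z z' assume z: "z \<in> Obj cells" "z' \<in> Obj cells"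
  then have k: "fst z \<in> Obj J" "fst z' \<in> Obj J" by (auto simp: cells_Obj)
  obtain l \<alpha> \<beta> where l: "\<alpha> \<in> hom J (fst z) l" "\<beta> \<in> hom J (fst z') l" by (rule filt_bound[OF J(1) k])
  let ?y = "(l, push \<alpha> ` snd z \<union> push \<beta> ` snd z')"
  have y: "?y \<in> Obj cells"
    using z push_lifts[OF l(1)] push_lifts[OF l(2)] J.hom_ObjD(2)[OF l(1)]
    by (intro cells_Obj_pair) (auto simp: cells_Obj subset_iff)
  have "(z, \<alpha>, ?y) \<in> hom cells z ?y" "(z', \<beta>, ?y) \<in> hom cells z' ?y"
    using l by (auto intro!: cells_homI z y)
  then show "\<exists>y. \<exists>f \<in> hom cells z y. \<exists>g \<in> hom cells z' y. True" by blast
next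
  fix z z' f g assume "f \<in> hom cells z z'" "g \<in> hom cells z z'"
  then obtain \<alpha> \<beta> where e: "f = (z, \<alpha>, z')" "g = (z, \<beta>, z')" "\<alpha> \<in> hom J (fst z) (fst z')"
    "\<beta> \<in> hom J (fst z) (fst z')" "z' \<in> Obj cells" by (auto simp: cells_hom)
  obtain l \<gamma> where l: "\<gamma> \<in> hom J (fst z') l" "\<gamma> \<cdot>\<^bsub>J\<^esub> \<alpha> = \<gamma> \<cdot>\<^bsub>J\<^esub> \<beta>" by (rule filt_coeq[OF J(1) e(3,4)])
  let ?y = "(l, push \<gamma> ` snd z')"
  have y: "?y \<in> Obj cells"
    using e(5) push_lifts[OF l(1)] J.hom_ObjD(2)[OF l(1)]
    by (intro cells_Obj_pair) (auto simp: cells_Obj subset_iff)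
  have "(z', \<gamma>, ?y) \<in> hom cells z' ?y" using l by (auto intro!: cells_homI e y)
  moreover have "(z', \<gamma>, ?y) \<cdot>\<^bsub>cells\<^esub> f = (z', \<gamma>, ?y) \<cdot>\<^bsub>cells\<^esub> g" unfolding e cells_Comp l(2) ..
  ultimately show "\<exists>y. \<exists>h \<in> hom cells z' y. h \<cdot>\<^bsub>cells\<^esub> f = h \<cdot>\<^bsub>cells\<^esub> g" by blast
qed

lemma small_cells: "small U (Arr cells)"
proof -
  have "small U (Obj J)" by (rule small_Obj[OF J.category_axioms J(2)])
  moreover have "small U (Pow (SIGMA i:K. hom C (Dom C (t i)) (FO D k)))" if "k \<in> Obj J" for k
    by (intro small_Pow[OF universe] small_Sigma[OF universe K] small_hom fp_Obj fpt fpD that)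
  ultimately have *: "small U (SIGMA k:Obj J. Pow (SIGMA i:K. hom C (Dom C (t i)) (FO D k)))" (is "small U ?O")
    by (rule small_Sigma[OF universe])
  have "small U (?O \<times> Arr J \<times> ?O)" by (intro small_Times[OF universe] * J(2))
  then show ?thesis
    by (rule small_subset) (auto simp: cells_def lifts_def hom_def)
qed

definition att :: "'i \<times> ('k \<times> 'a) set \<Rightarrow> 'o \<times> 'a \<times> ('k \<times> 'a \<Rightarrow> 'a)" where
  "att z = (SOME x. is_mpush C (FO D (fst z)) (snd z) (\<lambda>y. t (fst y)) snd (fst x) (fst (snd x)) (snd (snd x)))"

abbreviation Q :: "'i \<times> ('k \<times> 'a) set \<Rightarrow> 'o" where "Q z \<equiv> fst (att z)"
abbreviation qc :: "'i \<times> ('k \<times> 'a) set \<Rightarrow> 'a" where "qc z \<equiv> fst (snd (att z))"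
abbreviation qb :: "'i \<times> ('k \<times> 'a) set \<Rightarrow> 'k \<times> 'a \<Rightarrow> 'a" where "qb z \<equiv> snd (snd (att z))"

lemma att:
  assumes "z \<in> Obj cells"
  shows "is_mpush C (FO D (fst z)) (snd z) (\<lambda>y. t (fst y)) snd (Q z) (qc z) (qb z)"
proof -
  have z: "fst z \<in> Obj J" "finite (snd z)" "snd z \<subseteq> lifts (fst z)" using assms by (auto simp: cells_Obj)
  have "\<exists>P' c' b'. is_mpush C (FO D (fst z)) (snd z) (\<lambda>y. t (fst y)) snd P' c' b'"
    using z m_hom(2) functor_Obj[OF D z(1)]
    by (intro mpush_exists[OF cocomplete universe small_finite[OF universe z(2)]]) (auto simp: lifts_def)
  then have "\<exists>x. is_mpush C (FO D (fst z)) (snd z) (\<lambda>y. t (fst y)) snd (fst x) (fst (snd x)) (snd (snd x))"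
    by simp
  then show ?thesis unfolding att_def by (rule someI_ex)
qed

lemmas att_hom = mpush_hom[OF att]

lemma att_presentable: "z \<in> Obj cells \<Longrightarrow> fp (Q z)"
  using fpD fpt by (intro mpush_presentable[OF universe att]) (auto simp: cells_Obj lifts_def)

lemma att_llp: "z \<in> Obj cells \<Longrightarrow> R \<subseteq> Arr C \<Longrightarrow> (\<And>i. i \<in> K \<Longrightarrow> t i \<in> llp C R) \<Longrightarrow> qc z \<in> llp C R"
  by (rule llp_mpush[OF att]) (auto simp: cells_Obj lifts_def)

text \<open>The choice is harmless: \<open>mpush_unique\<close> leaves only one such map, and this
  uniqueness is what makes the assignment functorial.\<close>

definition att_map :: "('i \<times> ('k \<times> 'a) set) \<times> 'j \<times> ('i \<times> ('k \<times> 'a) set) \<Rightarrow> 'a" where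
  "att_map f = (SOME h. h \<in> hom C (Q (fst f)) (Q (snd (snd f))) \<and>
     h \<cdot> qc (fst f) = qc (snd (snd f)) \<cdot> FA D (fst (snd f)) \<and>
     (\<forall>x \<in> snd (fst f). h \<cdot> qb (fst f) x = qb (snd (snd f)) (push (fst (snd f)) x)))"

lemma att_map:
  assumes f: "(z, \<alpha>, z') \<in> hom cells z z'"
  shows "att_map (z, \<alpha>, z') \<in> hom C (Q z) (Q z')"
    and "att_map (z, \<alpha>, z') \<cdot> qc z = qc z' \<cdot> FA D \<alpha>"
    and "\<And>x. x \<in> snd z \<Longrightarrow> att_map (z, \<alpha>, z') \<cdot> qb z x = qb z' (push \<alpha> x)"
proof -
  have z: "z \<in> Obj cells" "z' \<in> Obj cells" "\<alpha> \<in> hom J (fst z) (fst z')" "push \<alpha> ` snd z \<subseteq> snd z'"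
    using f by (auto simp: cells_hom)
  note \<alpha> = functor_hom[OF D z(3)] and c' = att_hom(1)[OF z(2)]
  have x': "push \<alpha> x \<in> snd z'" if "x \<in> snd z" for x using that z(4) by blast
  have b': "qb z' (push \<alpha> x) \<in> hom C (Cod C (t (fst x))) (Q z')" if "x \<in> snd z" for x
    using att_hom(4)[OF z(2) x'[OF that]] by (simp add: push_def)
  have "qb z' (push \<alpha> x) \<cdot> t (fst x) = (qc z' \<cdot> FA D \<alpha>) \<cdot> snd x" if "x \<in> snd z" for x
  proof -
    have "snd x \<in> hom C (Dom C (t (fst x))) (FO D (fst z))" using att_hom(3)[OF z(1) that] .
    then show ?thesis using att_hom(5)[OF z(2) x'[OF that]] \<alpha> c' by (simp add: push_def hom_def)
  qed
  from mpush_ex[OF att[OF z(1)] Comp_hom[OF \<alpha> c'] b' this]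
  obtain h where "h \<in> hom C (Q z) (Q z')" "h \<cdot> qc z = qc z' \<cdot> FA D \<alpha>"
    "\<forall>x \<in> snd z. h \<cdot> qb z x = qb z' (push \<alpha> x)" by blast
  then have "\<exists>h. h \<in> hom C (Q z) (Q z') \<and> h \<cdot> qc z = qc z' \<cdot> FA D \<alpha> \<and>
    (\<forall>x \<in> snd z. h \<cdot> qb z x = qb z' (push \<alpha> x))" by blast
  from someI_ex[OF this] show "att_map (z, \<alpha>, z') \<in> hom C (Q z) (Q z')"
    "att_map (z, \<alpha>, z') \<cdot> qc z = qc z' \<cdot> FA D \<alpha>"
    "\<And>x. x \<in> snd z \<Longrightarrow> att_map (z, \<alpha>, z') \<cdot> qb z x = qb z' (push \<alpha> x)"
    unfolding att_map_def by simp_all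
qed

definition att_ftor where "att_ftor = \<lparr>FO = Q, FA = att_map\<rparr>"

lemma functor_att: "is_functor cells C att_ftor"
  unfolding is_functor_def
proof (intro conjI ballI impI)
  show "FO att_ftor z \<in> Obj C" if "z \<in> Obj cells" for z
    using hom_ObjD(2)[OF att_hom(1)[OF that]] by (simp add: att_ftor_def)
  show "FA att_ftor f \<in> hom C (FO att_ftor (Dom cells f)) (FO att_ftor (Cod cells f))" if "f \<in> Arr cells" for f
  proof -
    have "f \<in> hom cells (Dom cells f) (Cod cells f)" using that by (simp add: hom_def)
    then obtain z \<alpha> z' where "Dom cells f = z" "Cod cells f = z'" "f = (z, \<alpha>, z')" "(z, \<alpha>, z') \<in> hom cells z z'"
      unfolding cells_hom by blast
    then show ?thesis using att_map(1)[of z \<alpha> z'] by (simp add: att_ftor_def)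
  qed
  show "FA att_ftor (Ident cells z) = Ident C (FO att_ftor z)" if z: "z \<in> Obj cells" for z
  proof -
    have i: "Ident cells z = (z, Ident J (fst z), z)" by (simp add: cells_def)
    have h: "(z, Ident J (fst z), z) \<in> hom cells z z" using cells.Ident_hom[OF z] by (simp add: i)
    have k: "fst z \<in> Obj J" "snd z \<subseteq> lifts (fst z)" using z by (auto simp: cells_Obj)
    have Q: "Q z \<in> Obj C" using hom_ObjD(2)[OF att_hom(1)[OF z]] .
    have "att_map (z, Ident J (fst z), z) = Ident C (Q z)"
    proof (rule mpush_unique[OF att[OF z] att_map(1)[OF h] Ident_hom[OF Q]])
      show "att_map (z, Ident J (fst z), z) \<cdot> qc z = Ident C (Q z) \<cdot> qc z"
        unfolding att_map(2)[OF h] functor_Ident[OF D k(1)] using att_hom(1)[OF z] by (simp add: hom_def)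
      show "att_map (z, Ident J (fst z), z) \<cdot> qb z x = Ident C (Q z) \<cdot> qb z x" if x: "x \<in> snd z" for x
      proof -
        have "push (Ident J (fst z)) x = x" using push_Ident[OF k(1)] k(2) x by blast
        then show ?thesis using att_map(3)[OF h x] att_hom(4)[OF z x] by (simp add: hom_def)
      qed
    qed
    then show ?thesis by (simp add: att_ftor_def i)
  qed
  fix f g assume fg: "f \<in> Arr cells" "g \<in> Arr cells" "Dom cells g = Cod cells f"
  define z z' z'' where "z = Dom cells f" "z' = Cod cells f" "z'' = Cod cells g"
  have "f \<in> hom cells z z'" "g \<in> hom cells z' z''" using fg by (simp_all add: hom_def z_z'_z''_def)
  then obtain \<alpha> \<beta> where e: "f = (z, \<alpha>, z')" "g = (z', \<beta>, z'')" and f: "(z, \<alpha>, z') \<in> hom cells z z'"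
    and g: "(z', \<beta>, z'') \<in> hom cells z' z''" by (auto simp: cells_hom)
  have z: "z \<in> Obj cells" "z' \<in> Obj cells" "z'' \<in> Obj cells" "\<alpha> \<in> hom J (fst z) (fst z')"
    "\<beta> \<in> hom J (fst z') (fst z'')" "push \<alpha> ` snd z \<subseteq> snd z'" "snd z \<subseteq> lifts (fst z)"
    using f g by (auto simp: cells_hom cells_Obj)
  have gf: "(z, \<beta> \<cdot>\<^bsub>J\<^esub> \<alpha>, z'') \<in> hom cells z z''" using cells.Comp_hom[OF f g] by (simp add: cells_Comp)
  note h = att_map(1)[OF f] att_map(1)[OF g] att_hom(1)[OF z(1)] att_hom(1)[OF z(2)] att_hom(1)[OF z(3)]
    functor_hom[OF D z(4)] functor_hom[OF D z(5)]
  have "att_map (z, \<beta> \<cdot>\<^bsub>J\<^esub> \<alpha>, z'') = att_map (z', \<beta>, z'') \<cdot> att_map (z, \<alpha>, z')"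
  proof (rule mpush_unique[OF att[OF z(1)] att_map(1)[OF gf] Comp_hom[OF h(1,2)]])
    have "(att_map (z', \<beta>, z'') \<cdot> att_map (z, \<alpha>, z')) \<cdot> qc z = att_map (z', \<beta>, z'') \<cdot> (att_map (z, \<alpha>, z') \<cdot> qc z)"
      using h by (simp add: hom_def)
    also have "\<dots> = (att_map (z', \<beta>, z'') \<cdot> qc z') \<cdot> FA D \<alpha>" unfolding att_map(2)[OF f] using h by (simp add: hom_def)
    also have "\<dots> = qc z'' \<cdot> FA D (\<beta> \<cdot>\<^bsub>J\<^esub> \<alpha>)"
      unfolding att_map(2)[OF g] functor_Comp[OF D z(4,5)] using h by (simp add: hom_def)
    finally show "att_map (z, \<beta> \<cdot>\<^bsub>J\<^esub> \<alpha>, z'') \<cdot> qc z = (att_map (z', \<beta>, z'') \<cdot> att_map (z, \<alpha>, z')) \<cdot> qc z"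
      unfolding att_map(2)[OF gf] by simp
    fix x assume x: "x \<in> snd z"
    then have x': "push \<alpha> x \<in> snd z'" using z(6) by blast
    have p: "push (\<beta> \<cdot>\<^bsub>J\<^esub> \<alpha>) x = push \<beta> (push \<alpha> x)" using push_Comp[OF z(4,5)] x z(7) by blast
    have "(att_map (z', \<beta>, z'') \<cdot> att_map (z, \<alpha>, z')) \<cdot> qb z x = att_map (z', \<beta>, z'') \<cdot> (att_map (z, \<alpha>, z') \<cdot> qb z x)"
      using h att_hom(4)[OF z(1) x] by (simp add: hom_def)
    then show "att_map (z, \<beta> \<cdot>\<^bsub>J\<^esub> \<alpha>, z'') \<cdot> qb z x = (att_map (z', \<beta>, z'') \<cdot> att_map (z, \<alpha>, z')) \<cdot> qb z x"
      unfolding att_map(3)[OF gf x] att_map(3)[OF f x] att_map(3)[OF g x'] p by simp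
  qed
  then show "FA att_ftor (g \<cdot>\<^bsub>cells\<^esub> f) = FA att_ftor g \<cdot> FA att_ftor f"
    by (simp add: att_ftor_def e cells_Comp)
qed

definition att_leg :: "'i \<times> ('k \<times> 'a) set \<Rightarrow> 'a" where
  "att_leg z = (SOME h. h \<in> hom C (Q z) P \<and> h \<cdot> qc z = c \<cdot> \<iota> (fst z) \<and> (\<forall>x \<in> snd z. h \<cdot> qb z x = b (fst x)))"

lemma att_leg:
  assumes z: "z \<in> Obj cells"
  shows "att_leg z \<in> hom C (Q z) P" "att_leg z \<cdot> qc z = c \<cdot> \<iota> (fst z)"
    "\<And>x. x \<in> snd z \<Longrightarrow> att_leg z \<cdot> qb z x = b (fst x)"
proof -
  have k: "fst z \<in> Obj J" "snd z \<subseteq> lifts (fst z)" using z by (auto simp: cells_Obj)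
  have x: "fst x \<in> K" "\<iota> (fst z) \<cdot> snd x = a (fst x)" "snd x \<in> hom C (Dom C (t (fst x))) (FO D (fst z))"
    if "x \<in> snd z" for x using that k(2) by (auto simp: lifts_def)
  have e: "b (fst x) \<cdot> t (fst x) = (c \<cdot> \<iota> (fst z)) \<cdot> snd x" if "x \<in> snd z" for x
    unfolding m_hom(5)[OF x(1)[OF that]] x(2)[OF that, symmetric]
    using x(3)[OF that] m_hom(1) \<iota>_hom[OF k(1)] by (simp add: hom_def)
  have "b (fst x) \<in> hom C (Cod C (t (fst x))) P" if "x \<in> snd z" for x using m_hom(4)[OF x(1)[OF that]] .
  from mpush_ex[OF att[OF z] Comp_hom[OF \<iota>_hom[OF k(1)] m_hom(1)] this e]
  have "\<exists>h. h \<in> hom C (Q z) P \<and> h \<cdot> qc z = c \<cdot> \<iota> (fst z) \<and> (\<forall>x \<in> snd z. h \<cdot> qb z x = b (fst x))" by blast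
  from someI_ex[OF this] show "att_leg z \<in> hom C (Q z) P" "att_leg z \<cdot> qc z = c \<cdot> \<iota> (fst z)"
    "\<And>x. x \<in> snd z \<Longrightarrow> att_leg z \<cdot> qb z x = b (fst x)"
    unfolding att_leg_def by simp_all
qed

lemma cocone_att: "is_cocone C cells att_ftor P att_leg"
proof (rule is_coconeI[OF _ _ _ category_cells])
  show "P \<in> Obj C" by (rule hom_ObjD(2)[OF m_hom(1)])
  show "att_leg z \<in> hom C (FO att_ftor z) P" if "z \<in> Obj cells" for z
    using att_leg(1)[OF that] by (simp add: att_ftor_def)
  fix z z' f assume z: "z \<in> Obj cells" "z' \<in> Obj cells" and "f \<in> hom cells z z'"
  then obtain \<alpha> where e: "f = (z, \<alpha>, z')" and f: "(z, \<alpha>, z') \<in> hom cells z z'" by (auto simp: cells_hom)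
  have \<alpha>: "\<alpha> \<in> hom J (fst z) (fst z')" "push \<alpha> ` snd z \<subseteq> snd z'" using f by (auto simp: cells_hom)
  note h = att_leg(1)[OF z(2)] att_map(1)[OF f] att_hom(1)[OF z(1)] att_hom(1)[OF z(2)] functor_hom[OF D \<alpha>(1)]
    m_hom(1) \<iota>_hom[OF J.hom_ObjD(2)[OF \<alpha>(1)]]
  have "att_leg z' \<cdot> att_map (z, \<alpha>, z') = att_leg z"
  proof (rule mpush_unique[OF att[OF z(1)] Comp_hom[OF h(2,1)] att_leg(1)[OF z(1)]])
    have "(att_leg z' \<cdot> att_map (z, \<alpha>, z')) \<cdot> qc z = att_leg z' \<cdot> (att_map (z, \<alpha>, z') \<cdot> qc z)"
      using h by (simp add: hom_def)
    also have "\<dots> = (att_leg z' \<cdot> qc z') \<cdot> FA D \<alpha>" unfolding att_map(2)[OF f] using h by (simp add: hom_def)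
    also have "\<dots> = c \<cdot> (\<iota> (fst z') \<cdot> FA D \<alpha>)" unfolding att_leg(2)[OF z(2)] using h by (simp add: hom_def)
    finally show "(att_leg z' \<cdot> att_map (z, \<alpha>, z')) \<cdot> qc z = att_leg z \<cdot> qc z"
      unfolding att_leg(2)[OF z(1)] \<iota>_Comp[OF \<alpha>(1)] .
    fix x assume x: "x \<in> snd z"
    have "(att_leg z' \<cdot> att_map (z, \<alpha>, z')) \<cdot> qb z x = att_leg z' \<cdot> (att_map (z, \<alpha>, z') \<cdot> qb z x)"
      using h att_hom(4)[OF z(1) x] by (simp add: hom_def)
    also have "\<dots> = b (fst x)"
      unfolding att_map(3)[OF f x] using att_leg(3)[OF z(2), of "push \<alpha> x"] \<alpha>(2) x by (auto simp: push_def)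
    finally show "(att_leg z' \<cdot> att_map (z, \<alpha>, z')) \<cdot> qb z x = att_leg z \<cdot> qb z x"
      unfolding att_leg(3)[OF z(1) x] .
  qed
  then show "att_leg z' \<cdot> FA att_ftor f = att_leg z" by (simp add: att_ftor_def e)
qed

lemma lift_exists:
  assumes i: "i \<in> K"
  obtains k e where "k \<in> Obj J" "(i, e) \<in> lifts k"
proof -
  obtain k e where "k \<in> Obj J" "e \<in> hom C (Dom C (t i)) (FO D k)" "\<iota> k \<cdot> e = a i"
    by (rule presentable_surj[OF fpt(1)[OF i] J D X m_hom(3)[OF i]])
  then show thesis using that i by (simp add: lifts_def)
qed

text \<open>Stages without cells form a copy of \<open>J\<close> and determine a map on
  \<open>X\<close>; a stage with one lifted cell determines it on that cell. This gives uniqueness,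
  and existence follows once the value on a cell is independent of the stage and of the
  lift.\<close>

lemma colimit_att: "is_colimit C cells att_ftor P att_leg"
proof (rule is_colimitI[OF cocone_att])
  fix Y h h' assume h: "h \<in> hom C P Y" "h' \<in> hom C P Y"
    and eq: "\<And>z. z \<in> Obj cells \<Longrightarrow> h \<cdot> att_leg z = h' \<cdot> att_leg z"
  have eqe: "h \<cdot> (att_leg z \<cdot> e) = h' \<cdot> (att_leg z \<cdot> e)" if z: "z \<in> Obj cells" and e: "e \<in> hom C A (Q z)" for z e A
  proof -
    have "(h \<cdot> att_leg z) \<cdot> e = (h' \<cdot> att_leg z) \<cdot> e" using eq[OF z] by simp
    then show ?thesis using h att_leg(1)[OF z] e by (simp add: hom_def)
  qed
  show "h = h'"
  proof (rule mpush_unique[OF m h])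
    show "h \<cdot> c = h' \<cdot> c"
    proof (rule colimit_unique[OF X J.category_axioms D Comp_hom[OF m_hom(1) h(1)] Comp_hom[OF m_hom(1) h(2)]])
      fix k assume k: "k \<in> Obj J"
      then have z: "(k, {}) \<in> Obj cells" by (simp add: cells_Obj)
      have "h \<cdot> (c \<cdot> \<iota> k) = h' \<cdot> (c \<cdot> \<iota> k)"
        using eqe[OF z att_hom(1)[OF z]] unfolding att_leg(2)[OF z] by simp
      then show "(h \<cdot> c) \<cdot> \<iota> k = (h' \<cdot> c) \<cdot> \<iota> k" using h m_hom(1) \<iota>_hom[OF k] by (simp add: hom_def)
    qed
    fix i assume "i \<in> K"
    then obtain k e where k: "k \<in> Obj J" "(i, e) \<in> lifts k" by (rule lift_exists)
    then have z: "(k, {(i, e)}) \<in> Obj cells" by (simp add: cells_Obj)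
    show "h \<cdot> b i = h' \<cdot> b i"
      using eqe[OF z att_hom(4)[OF z, of "(i, e)"]] att_leg(3)[OF z, of "(i, e)"] by simp
  qed
next
  fix Y \<tau> assume \<tau>: "is_cocone C cells att_ftor Y \<tau>"
  have \<tau>h: "\<tau> z \<in> hom C (Q z) Y" if "z \<in> Obj cells" for z
    using cocone_hom[OF \<tau> that] by (simp add: att_ftor_def)
  have \<tau>c: "\<tau> z' \<cdot> att_map (z, \<alpha>, z') = \<tau> z" if "(z, \<alpha>, z') \<in> hom cells z z'" for z \<alpha> z'
    using cocone_Comp[OF \<tau> that] by (simp add: att_ftor_def)
  have \<tau>qc: "\<tau> z \<cdot> qc z = (\<tau> z' \<cdot> qc z') \<cdot> FA D \<alpha>" if f: "(z, \<alpha>, z') \<in> hom cells z z'" for z \<alpha> z'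
  proof -
    have z: "z \<in> Obj cells" "z' \<in> Obj cells" "\<alpha> \<in> hom J (fst z) (fst z')" using f by (auto simp: cells_hom)
    note h = att_map(1)[OF f] att_hom(1)[OF z(1)] att_hom(1)[OF z(2)] functor_hom[OF D z(3)] \<tau>h[OF z(2)]
    have "\<tau> z \<cdot> qc z = \<tau> z' \<cdot> (att_map (z, \<alpha>, z') \<cdot> qc z)"
      unfolding \<tau>c[OF f, symmetric] using h by (simp add: hom_def)
    then show ?thesis unfolding att_map(2)[OF f] using h by (simp add: hom_def)
  qed
  have \<tau>qb: "\<tau> z \<cdot> qb z x = \<tau> z' \<cdot> qb z' (push \<alpha> x)"
    if f: "(z, \<alpha>, z') \<in> hom cells z z'" and x: "x \<in> snd z" for z \<alpha> z' x
  proof -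
    have z: "z \<in> Obj cells" "z' \<in> Obj cells" using f by (auto simp: cells_hom)
    have "\<tau> z \<cdot> qb z x = \<tau> z' \<cdot> (att_map (z, \<alpha>, z') \<cdot> qb z x)"
      unfolding \<tau>c[OF f, symmetric] using att_map(1)[OF f] att_hom(4)[OF z(1) x] \<tau>h[OF z(2)] by (simp add: hom_def)
    then show ?thesis unfolding att_map(3)[OF f x] .
  qed
  \<comment> \<open>On the cell-free stages a cocone restricts to one on \<open>D\<close>, which
    induces the map \<open>c'\<close> on \<open>X\<close>.\<close>
  define c0 where "c0 k = \<tau> (k, {}) \<cdot> qc (k, {})" for k
  have e: "(k, {}) \<in> Obj cells" if "k \<in> Obj J" for k using that by (simp add: cells_Obj)
  have "is_cocone C J D Y c0"
  proof (rule is_coconeI[OF _ _ _ J.category_axioms])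
    show "Y \<in> Obj C" using \<tau> by (simp add: is_cocone_def)
    show "c0 k \<in> hom C (FO D k) Y" if "k \<in> Obj J" for k
      unfolding c0_def using Comp_hom[OF att_hom(1)[OF e[OF that]] \<tau>h[OF e[OF that]]] by simp
    fix k l \<alpha> assume a: "k \<in> Obj J" "l \<in> Obj J" "\<alpha> \<in> hom J k l"
    have "((k, {}), \<alpha>, (l, {})) \<in> hom cells (k, {}) (l, {})"
      by (rule cells_homI[OF e[OF a(1)] e[OF a(2)]]) (simp_all add: a(3))
    from \<tau>qc[OF this] show "c0 l \<cdot> FA D \<alpha> = c0 k" by (simp add: c0_def)
  qed
  then obtain c' where c': "c' \<in> hom C X Y" "\<forall>k \<in> Obj J. c' \<cdot> \<iota> k = c0 k" by (rule colimit_ex[OF X])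
  have key: "\<tau> z \<cdot> qc z = c' \<cdot> \<iota> (fst z)" if z: "z \<in> Obj cells" for z
  proof -
    have k: "fst z \<in> Obj J" using z by (simp add: cells_Obj)
    have "((fst z, {}), Ident J (fst z), z) \<in> hom cells (fst z, {}) z"
      by (rule cells_homI[OF e[OF k] z]) (simp_all add: J.Ident_hom k)
    from \<tau>qc[OF this] have "c0 (fst z) = (\<tau> z \<cdot> qc z) \<cdot> Ident C (FO D (fst z))"
      by (simp add: c0_def functor_Ident[OF D k])
    then show ?thesis using c'(2) k \<tau>h[OF z] att_hom(1)[OF z] by (simp add: hom_def)
  qed
  \<comment> \<open>Two lifts \<open>d\<close> and \<open>d'\<close> of the same attaching map
    become equal over some \<open>l\<close>. The one-cell stages \<open>?z\<close> and
    \<open>?z'\<close> then both map to \<open>?y\<close>, and they also map to the given stages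
    \<open>z\<close> and \<open>z'\<close>, so the values there coincide.\<close>
  have agree: "\<tau> z \<cdot> qb z (i, d) = \<tau> z' \<cdot> qb z' (i, d')"
    if z: "z \<in> Obj cells" "z' \<in> Obj cells" "(i, d) \<in> snd z" "(i, d') \<in> snd z'" for z z' i d d'
  proof -
    have k: "fst z \<in> Obj J" "fst z' \<in> Obj J" "(i, d) \<in> lifts (fst z)" "(i, d') \<in> lifts (fst z')"
      using z by (auto simp: cells_Obj)
    then have d: "i \<in> K" "d \<in> hom C (Dom C (t i)) (FO D (fst z))" "d' \<in> hom C (Dom C (t i)) (FO D (fst z'))"
      "\<iota> (fst z) \<cdot> d = \<iota> (fst z') \<cdot> d'" by (auto simp: lifts_def)
    obtain l \<alpha> \<beta> where l: "\<alpha> \<in> hom J (fst z) l" "\<beta> \<in> hom J (fst z') l" "FA D \<alpha> \<cdot> d = FA D \<beta> \<cdot> d'"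
      by (rule presentable_inj[OF fpt(1)[OF d(1)] J D X k(1,2) d(2-4)])
    let ?y = "(l, {(i, FA D \<alpha> \<cdot> d)})"
    let ?z = "(fst z, {(i, d)})" and ?z' = "(fst z', {(i, d')})"
    have p: "push \<alpha> (i, d) = (i, FA D \<alpha> \<cdot> d)" "push \<beta> (i, d') = (i, FA D \<alpha> \<cdot> d)"
      by (simp_all add: push_def l(3))
    have y: "?y \<in> Obj cells" "?z \<in> Obj cells" "?z' \<in> Obj cells"
      using push_lifts[OF l(1) k(3)] J.hom_ObjD(2)[OF l(1)] k by (auto simp: cells_Obj p)
    have f1: "(?z, \<alpha>, ?y) \<in> hom cells ?z ?y" by (rule cells_homI[OF y(2,1)]) (use l(1) p in simp_all)
    have f2: "(?z', \<beta>, ?y) \<in> hom cells ?z' ?y" by (rule cells_homI[OF y(3,1)]) (use l(2) p in simp_all)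
    note f = f1 f2
    have i1: "(?z, Ident J (fst z), z) \<in> hom cells ?z z"
      by (rule cells_homI[OF y(2) z(1)]) (use push_Ident[OF k(1,3)] z J.Ident_hom[OF k(1)] in simp_all)
    have i2: "(?z', Ident J (fst z'), z') \<in> hom cells ?z' z'"
      by (rule cells_homI[OF y(3) z(2)]) (use push_Ident[OF k(2,4)] z J.Ident_hom[OF k(2)] in simp_all)
    note i = i1 i2
    show ?thesis
      using \<tau>qb[OF f(1), of "(i, d)"] \<tau>qb[OF f(2), of "(i, d')"] \<tau>qb[OF i(1), of "(i, d)"]
        \<tau>qb[OF i(2), of "(i, d')"] p push_Ident[OF k(1,3)] push_Ident[OF k(2,4)] by simp
  qed
  have "\<forall>i \<in> K. \<exists>z. \<exists>d. z \<in> Obj cells \<and> (i, d) \<in> snd z"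
  proof
    fix i assume "i \<in> K"
    then obtain k e where "k \<in> Obj J" "(i, e) \<in> lifts k" by (rule lift_exists)
    then show "\<exists>z d. z \<in> Obj cells \<and> (i, d) \<in> snd z" by (intro exI[of _ "(k, {(i, e)})"] exI[of _ e]) (simp add: cells_Obj)
  qed
  then obtain zz dd where zz: "\<And>i. i \<in> K \<Longrightarrow> zz i \<in> Obj cells" "\<And>i. i \<in> K \<Longrightarrow> (i, dd i) \<in> snd (zz i)" by metis
  have b1: "\<tau> (zz i) \<cdot> qb (zz i) (i, dd i) \<in> hom C (Cod C (t i)) Y" if i: "i \<in> K" for i
    using Comp_hom[OF att_hom(4)[OF zz(1)[OF i] zz(2)[OF i]] \<tau>h[OF zz(1)[OF i]]] by simp
  have b2: "(\<tau> (zz i) \<cdot> qb (zz i) (i, dd i)) \<cdot> t i = c' \<cdot> a i" if i: "i \<in> K" for i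
  proof -
    note z = zz(1)[OF i] zz(2)[OF i]
    have k: "fst (zz i) \<in> Obj J" "(i, dd i) \<in> lifts (fst (zz i))" using z by (auto simp: cells_Obj)
    then have d: "dd i \<in> hom C (Dom C (t i)) (FO D (fst (zz i)))" "\<iota> (fst (zz i)) \<cdot> dd i = a i" by (auto simp: lifts_def)
    note h = \<tau>h[OF z(1)] att_hom(1)[OF z(1)] att_hom(4)[OF z] m_hom(2)[OF i] d(1) \<iota>_hom[OF k(1)] c'(1)
    have "(\<tau> (zz i) \<cdot> qb (zz i) (i, dd i)) \<cdot> t i = \<tau> (zz i) \<cdot> (qb (zz i) (i, dd i) \<cdot> t i)"
      using h by (simp add: hom_def)
    also have "\<dots> = (\<tau> (zz i) \<cdot> qc (zz i)) \<cdot> dd i" using att_hom(5)[OF z] h by (simp add: hom_def)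
    also have "\<dots> = c' \<cdot> a i" unfolding key[OF z(1)] d(2)[symmetric] using h by (simp add: hom_def)
    finally show ?thesis .
  qed
  obtain h where h: "h \<in> hom C P Y" "h \<cdot> c = c'" "\<forall>i \<in> K. h \<cdot> b i = \<tau> (zz i) \<cdot> qb (zz i) (i, dd i)"
    by (rule mpush_ex[OF m c'(1) b1 b2])
  have "h \<cdot> att_leg z = \<tau> z" if z: "z \<in> Obj cells" for z
  proof (rule mpush_unique[OF att[OF z] Comp_hom[OF att_leg(1)[OF z] h(1)] \<tau>h[OF z]])
    have k: "fst z \<in> Obj J" "snd z \<subseteq> lifts (fst z)" using z by (auto simp: cells_Obj)
    have "(h \<cdot> att_leg z) \<cdot> qc z = h \<cdot> (att_leg z \<cdot> qc z)" using h(1) att_leg(1)[OF z] att_hom(1)[OF z] by (simp add: hom_def)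
    also have "\<dots> = (h \<cdot> c) \<cdot> \<iota> (fst z)" unfolding att_leg(2)[OF z] using h(1) m_hom(1) \<iota>_hom[OF k(1)] by (simp add: hom_def)
    finally show "(h \<cdot> att_leg z) \<cdot> qc z = \<tau> z \<cdot> qc z" unfolding h(2) key[OF z] .
    fix x assume x: "x \<in> snd z"
    obtain i d where e: "x = (i, d)" by (cases x)
    have i: "i \<in> K" using x k(2) by (auto simp: e lifts_def)
    have "(h \<cdot> att_leg z) \<cdot> qb z x = h \<cdot> (att_leg z \<cdot> qb z x)"
      using h(1) att_leg(1)[OF z] att_hom(4)[OF z x] by (simp add: hom_def)
    also have "\<dots> = \<tau> (zz i) \<cdot> qb (zz i) (i, dd i)" unfolding att_leg(3)[OF z x] using h(3) i by (simp add: e)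
    also have "\<dots> = \<tau> z \<cdot> qb z x" unfolding e by (rule agree[OF zz(1)[OF i] z zz(2)[OF i] x[unfolded e]])
    finally show "(h \<cdot> att_leg z) \<cdot> qb z x = \<tau> z \<cdot> qb z x" .
  qed
  then show "\<exists>h \<in> hom C P Y. \<forall>z \<in> Obj cells. h \<cdot> att_leg z = \<tau> z" using h(1) by blast
qed

text \<open>The arrow \<open>c\<close> is approximated by the maps \<open>qc z\<close>, which belong
  to \<open>llp C R\<close> as multiple pushouts of cells and have presentable ends. By
  \<open>colimit_att\<close> a square into \<open>c\<close> descends to a square into some
  \<open>qc w\<close>.\<close>

lemma factors_via_attachment:
  assumes R: "R \<subseteq> Arr C" and t: "\<And>i. i \<in> K \<Longrightarrow> t i \<in> llp C R"
  shows "factors_via (llp C R) c"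
proof (rule factors_viaI[OF m_hom(1)])
  note F = filt_cells small_cells functor_att colimit_att
  fix A B g u v assume h: "fp A" "fp B" "g \<in> hom C A B" "u \<in> hom C A X" "v \<in> hom C B P" and eq: "v \<cdot> g = c \<cdot> u"
  obtain k x where k: "k \<in> Obj J" "x \<in> hom C A (FO D k)" "\<iota> k \<cdot> x = u"
    by (rule presentable_surj[OF h(1) J D X h(4)])
  obtain z y where "z \<in> Obj cells" "y \<in> hom C B (FO att_ftor z)" "att_leg z \<cdot> y = v"
    by (rule presentable_surj[OF h(2) F h(5)])
  then have z: "z \<in> Obj cells" "y \<in> hom C B (Q z)" "att_leg z \<cdot> y = v" by (simp_all add: att_ftor_def)
  have k0: "(k, {}) \<in> Obj cells" using k by (simp add: cells_Obj)
  \<comment> \<open>\<open>u\<close> has been lifted to a cell-free stage and \<open>v\<close> to an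
    unrelated stage \<open>z\<close>; both are moved to a common \<open>z'\<close>.\<close>
  obtain z' f1 f2 where f12: "f1 \<in> hom cells (k, {}) z'" "f2 \<in> hom cells z z'" by (rule filt_bound[OF filt_cells k0 z(1)])
  then obtain \<alpha> \<beta> where e: "f1 = ((k, {}), \<alpha>, z')" "f2 = (z, \<beta>, z')" "\<alpha> \<in> hom J k (fst z')" by (auto simp: cells_hom)
  have z': "z' \<in> Obj cells" by (rule cells.hom_ObjD(2)[OF f12(1)])
  note f2 = f12(2)[unfolded e(2)]
  have kz': "fst z' \<in> Obj J" using z' by (simp add: cells_Obj)
  note hh = functor_hom[OF D e(3)] att_map(1)[OF f2] att_hom(1)[OF z'] att_leg(1)[OF z'] k(2) z(2) h(3,4) m_hom(1)
    \<iota>_hom[OF kz'] \<iota>_hom[OF k(1)]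
  have y'h: "att_map (z, \<beta>, z') \<cdot> y \<in> hom C B (Q z')" by (rule Comp_hom[OF z(2) hh(2)])
  have x'h: "FA D \<alpha> \<cdot> x \<in> hom C A (FO D (fst z'))" by (rule Comp_hom[OF k(2) hh(1)])
  have y': "att_leg z' \<cdot> (att_map (z, \<beta>, z') \<cdot> y) = v"
  proof -
    have "(att_leg z' \<cdot> att_map (z, \<beta>, z')) \<cdot> y = v"
      using cocone_Comp[OF cocone_att f2] z(3) by (simp add: att_ftor_def)
    then show ?thesis using hh by (simp add: hom_def)
  qed
  have x': "\<iota> (fst z') \<cdot> (FA D \<alpha> \<cdot> x) = u"
  proof -
    have "(\<iota> (fst z') \<cdot> FA D \<alpha>) \<cdot> x = u" using \<iota>_Comp[OF e(3)] k(3) by simp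
    then show ?thesis using hh by (simp add: hom_def)
  qed
  have "att_leg z' \<cdot> ((att_map (z, \<beta>, z') \<cdot> y) \<cdot> g) = (att_leg z' \<cdot> (att_map (z, \<beta>, z') \<cdot> y)) \<cdot> g"
    using hh by (simp add: hom_def)
  also have "\<dots> = (c \<cdot> \<iota> (fst z')) \<cdot> (FA D \<alpha> \<cdot> x)" unfolding y' eq x'[symmetric] using hh x'h by (simp add: hom_def)
  also have "\<dots> = att_leg z' \<cdot> (qc z' \<cdot> (FA D \<alpha> \<cdot> x))" unfolding att_leg(2)[OF z', symmetric] using hh x'h by (simp add: hom_def)
  finally have eq': "att_leg z' \<cdot> ((att_map (z, \<beta>, z') \<cdot> y) \<cdot> g) = att_leg z' \<cdot> (qc z' \<cdot> (FA D \<alpha> \<cdot> x))" .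
  have th: "(att_map (z, \<beta>, z') \<cdot> y) \<cdot> g \<in> hom C A (FO att_ftor z')" "qc z' \<cdot> (FA D \<alpha> \<cdot> x) \<in> hom C A (FO att_ftor z')"
    unfolding att_ftor_def using Comp_hom[OF h(3) y'h] Comp_hom[OF x'h hh(3)] by simp_all
  \<comment> \<open>Over \<open>z'\<close> the lifted square commutes only after composition with
    \<open>att_leg z'\<close>; one more arrow, to \<open>w\<close>, makes it commute itself.\<close>
  obtain w f3 where f3: "f3 \<in> hom cells z' w"
    "FA att_ftor f3 \<cdot> ((att_map (z, \<beta>, z') \<cdot> y) \<cdot> g) = FA att_ftor f3 \<cdot> (qc z' \<cdot> (FA D \<alpha> \<cdot> x))"
    by (rule presentable_inj_same[OF h(1) F z' th eq'])
  then obtain \<gamma> where e3: "f3 = (z', \<gamma>, w)" "\<gamma> \<in> hom J (fst z') (fst w)" by (auto simp: cells_hom)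
  note f3' = f3(1)[unfolded e3(1)]
  have w: "w \<in> Obj cells" by (rule cells.hom_ObjD(2)[OF f3(1)])
  have kw: "fst w \<in> Obj J" using w by (simp add: cells_Obj)
  note hw = att_map(1)[OF f3'] att_hom(1)[OF w] att_leg(1)[OF w] functor_hom[OF D e3(2)] \<iota>_hom[OF kw]
  have E: "att_map (z', \<gamma>, w) \<cdot> ((att_map (z, \<beta>, z') \<cdot> y) \<cdot> g) = att_map (z', \<gamma>, w) \<cdot> (qc z' \<cdot> (FA D \<alpha> \<cdot> x))"
    using f3(2) by (simp add: att_ftor_def e3(1))
  have "(att_map (z', \<gamma>, w) \<cdot> (att_map (z, \<beta>, z') \<cdot> y)) \<cdot> g = (att_map (z', \<gamma>, w) \<cdot> qc z') \<cdot> (FA D \<alpha> \<cdot> x)"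
    using E hh(3) hw(1) x'h y'h h(3) by (simp add: hom_def)
  also have "\<dots> = qc w \<cdot> (FA D \<gamma> \<cdot> (FA D \<alpha> \<cdot> x))"
    unfolding att_map(2)[OF f3'] using hw x'h by (simp add: hom_def)
  finally have e1: "(att_map (z', \<gamma>, w) \<cdot> (att_map (z, \<beta>, z') \<cdot> y)) \<cdot> g = qc w \<cdot> (FA D \<gamma> \<cdot> (FA D \<alpha> \<cdot> x))" .
  have "(\<iota> (fst w) \<cdot> FA D \<gamma>) \<cdot> (FA D \<alpha> \<cdot> x) = u" using \<iota>_Comp[OF e3(2)] x' by simp
  then have e2: "\<iota> (fst w) \<cdot> (FA D \<gamma> \<cdot> (FA D \<alpha> \<cdot> x)) = u" using hw x'h by (simp add: hom_def)
  have "(att_leg w \<cdot> att_map (z', \<gamma>, w)) \<cdot> (att_map (z, \<beta>, z') \<cdot> y) = v"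
    using cocone_Comp[OF cocone_att f3'] y' by (simp add: att_ftor_def)
  then have e4: "att_leg w \<cdot> (att_map (z', \<gamma>, w) \<cdot> (att_map (z, \<beta>, z') \<cdot> y)) = v" using hw y'h by (simp add: hom_def)
  show "square_factors (llp C R) c X P A B g u v"
    unfolding square_factors_def
    by (rule exI[of _ "FO D (fst w)"], rule exI[of _ "Q w"], rule exI[of _ "qc w"],
        rule exI[of _ "FA D \<gamma> \<cdot> (FA D \<alpha> \<cdot> x)"],
        rule exI[of _ "att_map (z', \<gamma>, w) \<cdot> (att_map (z, \<beta>, z') \<cdot> y)"],
        rule exI[of _ "\<iota> (fst w)"], rule exI[of _ "att_leg w"])
      (intro conjI att_llp[OF w R t] fpD[OF kw] att_presentable[OF w] hw(2) Comp_hom[OF x'h hw(4)]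
        Comp_hom[OF y'h hw(1)] hw(5) hw(3) e1 att_leg(2)[OF w] e2 e4)
qed

end

section \<open>The small object argument\<close>

context category
begin

lemma llp_rlp_subset: "I \<subseteq> Arr C \<Longrightarrow> I \<subseteq> llp C (rlp C I)"
  by (auto simp: llp_def rlp_def)

lemma rlp_Arr: "rlp C I \<subseteq> Arr C"
  by (auto simp: rlp_def)

end

locale cell_set = lfp_category C U for C :: "('o, 'a) cat" (structure) and U :: "'u itself" +
  fixes I :: "'a set"
  assumes I_Arr: "I \<subseteq> Arr C" and I_small: "small U I"
    and I_fp: "\<And>t. t \<in> I \<Longrightarrow> fp (Dom C t)" "\<And>t. t \<in> I \<Longrightarrow> fp (Cod C t)"
begin

abbreviation L :: "'a set" where "L \<equiv> llp C (rlp C I)"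

text \<open>One stage of the small object argument: for every commutative square from an element of
  \<open>I\<close> to \<open>p\<close> a cell is attached that solves it in the next object. That
  \<open>e\<close> factors via \<open>L\<close> comes from \<open>factors_via_attachment\<close>,
  applied to a presentation of \<open>Y\<close> as a filtered colimit of presentable
  objects.\<close>

lemma attach_all:
  assumes p: "p \<in> hom C Y Z"
  obtains Y' e p' where "e \<in> hom C Y Y'" "p' \<in> hom C Y' Z" "p' \<cdot> e = p" "factors_via L e"
    "\<forall>t \<in> I. \<forall>x \<in> hom C (Dom C t) Y. \<forall>y \<in> hom C (Cod C t) Z. y \<cdot> t = p \<cdot> x \<longrightarrow>
      (\<exists>d \<in> hom C (Cod C t) Y'. d \<cdot> t = e \<cdot> x \<and> p' \<cdot> d = y)"
proof -
  define K where "K = {(t, x, y). t \<in> I \<and> x \<in> hom C (Dom C t) Y \<and> y \<in> hom C (Cod C t) Z \<and> y \<cdot> t = p \<cdot> x}"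
  have YZ: "Y \<in> Obj C" "Z \<in> Obj C" by (rule hom_ObjD[OF p])+
  have "small U (SIGMA t:I. hom C (Dom C t) Y \<times> hom C (Cod C t) Z)"
    using I_Arr YZ by (intro small_Sigma[OF universe I_small] small_Times[OF universe] small_hom) auto
  then have K: "small U K" by (rule small_subset) (auto simp: K_def)
  let ?a = "\<lambda>k. fst (snd k)"
  have "\<exists>P c b. is_mpush C Y K fst ?a P c b"
    using I_Arr by (intro mpush_exists[OF cocomplete universe K YZ(1)]) (auto simp: K_def)
  then obtain P c b where m: "is_mpush C Y K fst ?a P c b" by blast
  obtain J :: "('u, 'u) cat" and D \<iota> where J: "filt J" "small U (Arr J)" "is_functor J C D"
    "\<forall>i \<in> Obj J. fp (FO D i)" "is_colimit C J D Y \<iota>"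
    by (rule colimit_presentation[OF YZ(1)])
  interpret A: attachment C U J D Y \<iota> K fst ?a P c b
    by unfold_locales (use J K m I_fp in \<open>auto simp: K_def\<close>)
  have c: "factors_via L c"
    by (rule A.factors_via_attachment[OF rlp_Arr]) (use llp_rlp_subset[OF I_Arr] in \<open>auto simp: K_def\<close>)
  have "\<And>k. k \<in> K \<Longrightarrow> snd (snd k) \<in> hom C (Cod C (fst k)) Z" "\<And>k. k \<in> K \<Longrightarrow> snd (snd k) \<cdot> fst k = p \<cdot> ?a k"
    by (auto simp: K_def)
  then obtain p' where p': "p' \<in> hom C P Z" "p' \<cdot> c = p" "\<forall>k \<in> K. p' \<cdot> b k = snd (snd k)"
    by (rule mpush_ex[OF m p])
  show thesis
  proof (rule that[OF mpush_hom(1)[OF m] p'(1,2) c], intro ballI impI)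
    fix t x y assume "t \<in> I" "x \<in> hom C (Dom C t) Y" "y \<in> hom C (Cod C t) Z" "y \<cdot> t = p \<cdot> x"
    then have k: "(t, x, y) \<in> K" by (simp add: K_def)
    show "\<exists>d \<in> hom C (Cod C t) P. d \<cdot> t = c \<cdot> x \<and> p' \<cdot> d = y"
      using mpush_hom(4)[OF m k] mpush_hom(5)[OF m k] p'(3) k by (intro bexI[of _ "b (t, x, y)"]) auto
  qed
qed

text \<open>Since the domains of the elements of \<open>I\<close> are finitely presentable, a
  countable iteration suffices: a map from such a domain into the colimit \<open>W\<close> already
  comes from some \<open>Y n\<close>, and the lifting problem is solved in
  \<open>Y (Suc n)\<close>.\<close>

lemma small_object_factorization:
  assumes f: "f \<in> hom C X Z"
  obtains W c p where "c \<in> hom C X W" "p \<in> hom C W Z" "p \<cdot> c = f" "factors_via L c" "p \<in> rlp C I"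
proof -
  define good where "good p e p' \<longleftrightarrow> e \<in> hom C (Dom C p) (Dom C p') \<and> p' \<in> hom C (Dom C p') Z \<and>
    p' \<cdot> e = p \<and> factors_via L e \<and>
    (\<forall>t \<in> I. \<forall>x \<in> hom C (Dom C t) (Dom C p). \<forall>y \<in> hom C (Cod C t) Z. y \<cdot> t = p \<cdot> x \<longrightarrow>
      (\<exists>d \<in> hom C (Cod C t) (Dom C p'). d \<cdot> t = e \<cdot> x \<and> p' \<cdot> d = y))" for p e p'
  have ex: "\<exists>e p'. good p e p'" if "p \<in> Arr C" "Cod C p = Z" for p
  proof -
    have p: "p \<in> hom C (Dom C p) Z" using that by (simp add: hom_def)
    obtain Y' e p' where *: "e \<in> hom C (Dom C p) Y'" "p' \<in> hom C Y' Z" "p' \<cdot> e = p" "factors_via L e"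
      "\<forall>t \<in> I. \<forall>x \<in> hom C (Dom C t) (Dom C p). \<forall>y \<in> hom C (Cod C t) Z. y \<cdot> t = p \<cdot> x \<longrightarrow>
        (\<exists>d \<in> hom C (Cod C t) Y'. d \<cdot> t = e \<cdot> x \<and> p' \<cdot> d = y)"
      by (rule attach_all[OF p])
    have "Y' = Dom C p'" using homD(2)[OF *(2)] by simp
    then show ?thesis using * unfolding good_def by blast
  qed
  \<comment> \<open>The choices depend on the arrow \<open>p\<close> to \<open>Z\<close> alone, so
    the tower arises by iterating \<open>N\<close> from \<open>f\<close>.\<close>
  define E where "E p = (SOME e. \<exists>p'. good p e p')" for p
  define N where "N p = (SOME p'. good p (E p) p')" for p
  have good: "good p (E p) (N p)" if "p \<in> Arr C" "Cod C p = Z" for p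
    using someI_ex[OF someI_ex[OF ex[OF that]]] unfolding N_def E_def .
  define q where "q n = (N ^^ n) f" for n
  have qS: "q (Suc n) = N (q n)" for n by (simp add: q_def)
  have q: "q n \<in> Arr C \<and> Cod C (q n) = Z" for n
  proof (induction n)
    case 0
    then show ?case using f by (simp add: q_def hom_def)
  next
    case (Suc n)
    then show ?case using good[of "q n"] unfolding qS good_def by (simp add: hom_def)
  qed
  define Y where "Y n = Dom C (q n)" for n
  define e where "e n = E (q n)" for n
  have qh: "q n \<in> hom C (Y n) Z" for n using q[of n] by (simp add: Y_def hom_def)
  have Y0: "Y 0 = X" "q 0 = f" using f by (simp_all add: Y_def q_def hom_def)
  have YO: "Y n \<in> Obj C" for n by (rule hom_ObjD(1)[OF qh])
  have "good (q n) (e n) (q (Suc n))" for n unfolding e_def qS using good q by blast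
  then have e: "e n \<in> hom C (Y n) (Y (Suc n))" "q (Suc n) \<cdot> e n = q n" "factors_via L (e n)"
    and solve: "t \<in> I \<Longrightarrow> x \<in> hom C (Dom C t) (Y n) \<Longrightarrow> y \<in> hom C (Cod C t) Z \<Longrightarrow> y \<cdot> t = q n \<cdot> x \<Longrightarrow>
      \<exists>d \<in> hom C (Cod C t) (Y (Suc n)). d \<cdot> t = e n \<cdot> x \<and> q (Suc n) \<cdot> d = y" for n t x y
    unfolding good_def Y_def by blast+
  \<comment> \<open>\<open>s m d\<close> is the transition map from \<open>Y m\<close> to
    \<open>Y (m + d)\<close>; indexing by the difference makes it definable by recursion, starting
    with the identity.\<close>
  define s where "s m d = rec_nat (Ident C (Y m)) (\<lambda>d c. e (m + d) \<cdot> c) d" for m d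
  have s0: "s m 0 = Ident C (Y m)" and sS: "s m (Suc d) = e (m + d) \<cdot> s m d" for m d
    by (simp_all add: s_def)
  have s: "s m d \<in> hom C (Y m) (Y (m + d))" for m d
  proof (induction d)
    case 0
    then show ?case using Ident_hom[OF YO] by (simp add: s0)
  next
    case (Suc d)
    then show ?case using Comp_hom[OF Suc e(1)[of "m + d"]] by (simp add: sS)
  qed
  have s_add: "s m (d + d') = s (m + d) d' \<cdot> s m d" for m d d'
  proof (induction d')
    case 0
    then show ?case using s[of m d] by (simp add: s0 hom_def)
  next
    case (Suc d')
    then show ?case using s[of m d] s[of "m + d" d'] e(1)[of "m + d + d'"] by (simp add: sS hom_def add.assoc)
  qed
  have sq: "q (m + d) \<cdot> s m d = q m" for m d
  proof (induction d)
    case 0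
    then show ?case using qh[of m] by (simp add: s0 hom_def)
  next
    case (Suc d)
    have "(q (Suc (m + d)) \<cdot> e (m + d)) \<cdot> s m d = q m" using Suc e(2) by simp
    then show ?case using s[of m d] e(1)[of "m + d"] qh[of "Suc (m + d)"] by (simp add: sS hom_def)
  qed
  have sL: "factors_via L (s 0 d)" for d
  proof (induction d)
    case 0
    show ?case unfolding s0
      by (rule factors_via_Ident[OF YO]) (use llp_iso[OF Ident_hom Ident_hom _ _ rlp_Arr] fp_Obj in \<open>simp add: Comp_Ident_left\<close>)
  next
    case (Suc d)
    show ?case unfolding sS by (rule factors_via_Comp[OF Suc s e(3) e(1) rlp_Arr])
  qed
  define r :: "nat rel" where "r = {(m, n). m \<le> n}"
  define D where "D = \<lparr>FO = Y, FA = \<lambda>(m, n). s m (n - m)\<rparr>"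
  have F: "Field r = UNIV" by (auto simp: r_def Field_def)
  have pre: "Preorder r" unfolding preorder_on_def refl_on_def F by (auto simp: r_def trans_def)
  have cat: "category (order_cat r)" by (rule category_order_cat[OF pre])
  have hom: "\<alpha> \<in> hom (order_cat r) m n \<longleftrightarrow> \<alpha> = (m, n) \<and> m \<le> n" for \<alpha> m n
    by (auto simp: hom_def order_cat_def r_def)
  have obj: "n \<in> Obj (order_cat r)" for n by (simp add: order_cat_def F)
  have filt: "filt (order_cat r)"
    unfolding filt_def
  proof (intro conjI ballI cat)
    show "Obj (order_cat r) \<noteq> {}" using obj by blast
    fix m n
    have "(m, max m n) \<in> hom (order_cat r) m (max m n)" "(n, max m n) \<in> hom (order_cat r) n (max m n)"
      by (simp_all add: hom)
    then show "\<exists>l. \<exists>\<alpha> \<in> hom (order_cat r) m l. \<exists>\<beta> \<in> hom (order_cat r) n l. True" by blast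
    fix \<alpha> \<beta> assume "\<alpha> \<in> hom (order_cat r) m n" "\<beta> \<in> hom (order_cat r) m n"
    then have "\<alpha> = \<beta>" by (simp add: hom)
    moreover have "(n, n) \<in> hom (order_cat r) n n" by (simp add: hom)
    ultimately show "\<exists>l. \<exists>\<gamma> \<in> hom (order_cat r) n l. \<gamma> \<cdot>\<^bsub>order_cat r\<^esub> \<alpha> = \<gamma> \<cdot>\<^bsub>order_cat r\<^esub> \<beta>" by blast
  qed
  have small: "small U (Arr (order_cat r))"
    using small_subset[OF small_Times[OF universe small_nat[OF universe] small_nat[OF universe]], of r UNIV UNIV]
    by (simp add: order_cat_def)
  have D: "is_functor (order_cat r) C D"
    unfolding is_functor_def
  proof (intro conjI ballI impI)
    fix \<alpha> \<beta> assume a: "\<alpha> \<in> Arr (order_cat r)" "\<beta> \<in> Arr (order_cat r)" "Dom (order_cat r) \<beta> = Cod (order_cat r) \<alpha>"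
    obtain l m where \<alpha>: "\<alpha> = (l, m)" by (cases \<alpha>)
    obtain n where \<beta>: "\<beta> = (m, n)" using a(3) \<alpha> by (cases \<beta>) (simp add: order_cat_def)
    have "l \<le> m" "m \<le> n" using a \<alpha> \<beta> by (simp_all add: order_cat_def r_def)
    then have "m = l + (m - l)" "n - l = (m - l) + (n - m)" by simp_all
    then show "FA D (\<beta> \<cdot>\<^bsub>order_cat r\<^esub> \<alpha>) = FA D \<beta> \<cdot> FA D \<alpha>"
      using s_add[of l "m - l" "n - m"] by (simp add: D_def \<alpha> \<beta> order_cat_def)
  next
    show "FO D n \<in> Obj C" for n using YO by (simp add: D_def)
    show "FA D \<alpha> \<in> hom C (FO D (Dom (order_cat r) \<alpha>)) (FO D (Cod (order_cat r) \<alpha>))" if "\<alpha> \<in> Arr (order_cat r)" for \<alpha>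
      using that s[of "fst \<alpha>" "snd \<alpha> - fst \<alpha>"] by (auto simp: order_cat_def D_def r_def)
    show "FA D (Ident (order_cat r) n) = Ident C (FO D n)" for n by (simp add: D_def order_cat_def s0)
  qed
  obtain W \<omega> where W: "is_colimit C (order_cat r) D W \<omega>"
    using cocomplete_any[OF cocomplete cat small D] by blast
  have \<omega>h: "\<omega> n \<in> hom C (Y n) W" for n using cocone_hom[OF colimit_cocone[OF W] obj] by (simp add: D_def)
  have \<omega>c: "\<omega> (m + d) \<cdot> s m d = \<omega> m" for m d
    using cocone_Comp[OF colimit_cocone[OF W], of "(m, m + d)" m "m + d"] by (simp add: hom D_def)
  \<comment> \<open>\<open>\<omega> 0\<close> is the countable composite of the maps
    \<open>e n\<close>: its finite parts \<open>s 0 n\<close> are covered by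
    \<open>factors_via_Comp\<close>, the passage to the limit by
    \<open>factors_via_colimit\<close>.\<close>
  have c: "factors_via L (\<omega> 0)"
  proof (rule factors_via_colimit[OF filt small D W, of "s 0" "Y 0"])
    show "s 0 n \<in> hom C (Y 0) (FO D n)" for n using s[of 0 n] by (simp add: D_def)
    show "factors_via L (s 0 n)" for n by (rule sL)
    show "\<omega> n \<cdot> s 0 n = \<omega> 0" for n using \<omega>c[of 0 n] by simp
    show "FA D \<alpha> \<cdot> s 0 m = s 0 n" if "\<alpha> \<in> hom (order_cat r) m n" for m n \<alpha>
      using that s_add[of 0 m "n - m"] by (simp add: hom D_def)
  qed (rule \<omega>h)
  have "is_cocone C (order_cat r) D Z q"
  proof (rule is_coconeI[OF _ _ _ cat])
    show "Z \<in> Obj C" by (rule hom_ObjD(2)[OF f])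
    show "q n \<in> hom C (FO D n) Z" for n using qh by (simp add: D_def)
    show "q n \<cdot> FA D \<alpha> = q m" if "\<alpha> \<in> hom (order_cat r) m n" for m n \<alpha>
      using that sq[of m "n - m"] by (simp add: hom D_def)
  qed
  then obtain p where p: "p \<in> hom C W Z" "\<forall>n \<in> Obj (order_cat r). p \<cdot> \<omega> n = q n" by (rule colimit_ex[OF W])
  have pq: "p \<cdot> \<omega> n = q n" for n using p(2) obj by blast
  have "has_lift C t p" if t: "t \<in> I" for t
  proof -
    have th: "t \<in> hom C (Dom C t) (Cod C t)" using t I_Arr by (auto simp: hom_def)
    show ?thesis
    proof (rule has_liftI[OF th p(1)])
      fix u v assume uv: "u \<in> hom C (Dom C t) W" "v \<in> hom C (Cod C t) Z" "v \<cdot> t = p \<cdot> u"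
      obtain n x where "n \<in> Obj (order_cat r)" "x \<in> hom C (Dom C t) (FO D n)" "\<omega> n \<cdot> x = u"
        by (rule presentable_surj[OF I_fp(1)[OF t] filt small D W uv(1)])
      then have x: "x \<in> hom C (Dom C t) (Y n)" "\<omega> n \<cdot> x = u" by (simp_all add: D_def)
      have "v \<cdot> t = (p \<cdot> \<omega> n) \<cdot> x" unfolding uv(3) x(2)[symmetric] using p(1) \<omega>h[of n] x(1) by (simp add: hom_def)
      then obtain d where d: "d \<in> hom C (Cod C t) (Y (Suc n))" "d \<cdot> t = e n \<cdot> x" "q (Suc n) \<cdot> d = v"
        using solve[OF t x(1) uv(2)] unfolding pq by blast
      have "s n 1 = e n" using sS[of n 0] e(1)[of n] by (simp add: s0 hom_def)
      then have \<omega>e: "\<omega> (Suc n) \<cdot> e n = \<omega> n" using \<omega>c[of n 1] by simp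
      have "(\<omega> (Suc n) \<cdot> d) \<cdot> t = \<omega> (Suc n) \<cdot> (d \<cdot> t)" using \<omega>h[of "Suc n"] d(1) th by (simp add: hom_def)
      also have "\<dots> = (\<omega> (Suc n) \<cdot> e n) \<cdot> x" unfolding d(2) using \<omega>h[of "Suc n"] e(1)[of n] x(1) by (simp add: hom_def)
      finally have 1: "(\<omega> (Suc n) \<cdot> d) \<cdot> t = u" unfolding \<omega>e x(2) .
      have "p \<cdot> (\<omega> (Suc n) \<cdot> d) = (p \<cdot> \<omega> (Suc n)) \<cdot> d" using p(1) \<omega>h[of "Suc n"] d(1) by (simp add: hom_def)
      then have 2: "p \<cdot> (\<omega> (Suc n) \<cdot> d) = v" unfolding pq d(3) .
      show "\<exists>h \<in> hom C (Cod C t) W. h \<cdot> t = u \<and> p \<cdot> h = v" using 1 2 Comp_hom[OF d(1) \<omega>h] by blast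
    qed
  qed
  then have "p \<in> rlp C I" using p(1) by (simp add: rlp_def hom_def)
  then show thesis using that[of "\<omega> 0" W p] \<omega>h[of 0] p(1) pq[of 0] c by (simp add: Y0)
qed

text \<open>The retract argument: lifting \<open>f\<close> against \<open>p\<close> makes
  \<open>f\<close> a retract of \<open>c\<close> under its domain. A square into \<open>f\<close> is
  carried by \<open>s\<close> to one into \<open>c\<close>, factored there, and carried back by
  \<open>p\<close>.\<close>

lemma llp_factors_via:
  assumes "f \<in> L" shows "factors_via L f"
proof -
  define X Z where "X = Dom C f" "Z = Cod C f"
  have f: "f \<in> hom C X Z" using assms by (simp add: llp_def hom_def X_Z_def)
  obtain W c p where c: "c \<in> hom C X W" "p \<in> hom C W Z" "p \<cdot> c = f" "factors_via L c" "p \<in> rlp C I"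
    by (rule small_object_factorization[OF f])
  have Z: "Ident C Z \<in> hom C Z Z" by (rule Ident_hom[OF hom_ObjD(2)[OF f]])
  have l: "has_lift C f p" using assms c(5) by (simp add: llp_def)
  have "Ident C Z \<cdot> f = p \<cdot> c" using f c(3) by (simp add: hom_def)
  then obtain s where s: "s \<in> hom C Z W" "s \<cdot> f = c" "p \<cdot> s = Ident C Z"
    by (rule has_liftD[OF l f c(2,1) Z])
  show ?thesis
  proof (rule factors_viaI[OF f])
    fix A B g u v assume h: "fp A" "fp B" "g \<in> hom C A B" "u \<in> hom C A X" "v \<in> hom C B Z" and eq: "v \<cdot> g = f \<cdot> u"
    have "(s \<cdot> v) \<cdot> g = s \<cdot> (v \<cdot> g)" using s(1) h by (simp add: hom_def)
    also have "\<dots> = (s \<cdot> f) \<cdot> u" unfolding eq using s(1) f h by (simp add: hom_def)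
    finally have eq': "(s \<cdot> v) \<cdot> g = c \<cdot> u" unfolding s(2) .
    obtain A' B' w a b u' v' where w: "w \<in> L" "fp A'" "fp B'" "w \<in> hom C A' B'" "a \<in> hom C A A'"
      "b \<in> hom C B B'" "u' \<in> hom C A' X" "v' \<in> hom C B' W"
      "b \<cdot> g = w \<cdot> a" "v' \<cdot> w = c \<cdot> u'" "u' \<cdot> a = u" "v' \<cdot> b = s \<cdot> v"
      by (rule factors_viaD[OF c(4,1) h(1-4) Comp_hom[OF h(5) s(1)] eq'])
    have "(p \<cdot> v') \<cdot> w = p \<cdot> (v' \<cdot> w)" using c(2) w(4,8) by (simp add: hom_def)
    also have "\<dots> = (p \<cdot> c) \<cdot> u'" unfolding w(10) using c(1,2) w(7) by (simp add: hom_def)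
    finally have e1: "(p \<cdot> v') \<cdot> w = f \<cdot> u'" unfolding c(3) .
    have "(p \<cdot> v') \<cdot> b = p \<cdot> (v' \<cdot> b)" using c(2) w(6,8) by (simp add: hom_def)
    also have "\<dots> = (p \<cdot> s) \<cdot> v" unfolding w(12) using c(2) s(1) h(5) by (simp add: hom_def)
    finally have e2: "(p \<cdot> v') \<cdot> b = v" unfolding s(3) using h(5) by (simp add: hom_def)
    show "square_factors L f X Z A B g u v"
    unfolding square_factors_def
      using w(1-7,9,11) Comp_hom[OF w(8) c(2)] e1 e2 by blast
  qed
qed

end

section \<open>Weak equivalences between presentable objects\<close>

locale lfp_model_category = lfp_category C U for C :: "('o, 'a) cat" (structure) and U :: "'u itself" +
  fixes W F Cof :: "'a set"
  assumes model: "model_category U C W F Cof"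
    and generated: "generated_by_finitely_presentable U C Cof"
      "generated_by_finitely_presentable U C (W \<inter> Cof)"
begin

lemma subset_Arr: "W \<subseteq> Arr C" "F \<subseteq> Arr C" "Cof \<subseteq> Arr C"
  using model by (auto simp: model_category_def wide_subcategory_def)

lemma Ident_W: "X \<in> Obj C \<Longrightarrow> Ident C X \<in> W"
  using model by (simp add: model_category_def wide_subcategory_def)

lemma two_of_three:
  assumes "f \<in> hom C X Y" "g \<in> hom C Y Z"
  shows "f \<in> W \<Longrightarrow> g \<in> W \<Longrightarrow> g \<cdot> f \<in> W" "f \<in> W \<Longrightarrow> g \<cdot> f \<in> W \<Longrightarrow> g \<in> W"
    "g \<in> W \<Longrightarrow> g \<cdot> f \<in> W \<Longrightarrow> f \<in> W"
proof -
  have "two_out_of_three C W" using model by (simp add: model_category_def)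
  then show "f \<in> W \<Longrightarrow> g \<in> W \<Longrightarrow> g \<cdot> f \<in> W" "f \<in> W \<Longrightarrow> g \<cdot> f \<in> W \<Longrightarrow> g \<in> W"
    "g \<in> W \<Longrightarrow> g \<cdot> f \<in> W \<Longrightarrow> f \<in> W"
    using assms unfolding two_out_of_three_def hom_def by auto
qed

lemma lift: "i \<in> W \<Longrightarrow> i \<in> Cof \<Longrightarrow> p \<in> F \<Longrightarrow> has_lift C i p"
  "i \<in> Cof \<Longrightarrow> p \<in> W \<Longrightarrow> p \<in> F \<Longrightarrow> has_lift C i p"
  using model unfolding model_category_def by blast+

lemma functorial_factorizationD:
  assumes "functorial_factorization C S T" "f \<in> hom C X Y"
  obtains Z i p where "i \<in> hom C X Z" "p \<in> hom C Z Y" "p \<cdot> i = f" "i \<in> S" "p \<in> T"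
proof -
  obtain E :: "('a, 'a \<times> 'a \<times> 'a \<times> 'a, 'o, 'a) ftor" and \<alpha> \<beta> where "\<forall>f \<in> Arr C. \<alpha> f \<in> S \<and> \<beta> f \<in> T \<and>
           \<alpha> f \<in> hom C (Dom C f) (FO E f) \<and> \<beta> f \<in> hom C (FO E f) (Cod C f) \<and> \<beta> f \<cdot> \<alpha> f = f"
    using assms(1) unfolding functorial_factorization_def by blast
  then show thesis using that assms(2) homD[OF assms(2)] by metis
qed

lemma factor_Cof:
  assumes "f \<in> hom C X Y"
  obtains Z i p where "i \<in> hom C X Z" "p \<in> hom C Z Y" "p \<cdot> i = f" "i \<in> Cof" "p \<in> W" "p \<in> F"
proof -
  have "functorial_factorization C Cof (W \<inter> F)" using model by (simp add: model_category_def)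
  from functorial_factorizationD[OF this assms] show thesis using that by blast
qed

lemma factor_F:
  assumes "f \<in> hom C X Y"
  obtains Z i p where "i \<in> hom C X Z" "p \<in> hom C Z Y" "p \<cdot> i = f" "i \<in> W" "i \<in> Cof" "p \<in> F"
proof -
  have "functorial_factorization C (W \<inter> Cof) F" using model by (simp add: model_category_def)
  from functorial_factorizationD[OF this assms] show thesis using that by blast
qed

lemma generated_cell_set:
  assumes "generated_by_finitely_presentable U C S"
  obtains I where "cell_set C U I" "S = llp C (rlp C I)"
proof -
  obtain I where I: "I \<subseteq> Arr C" "small U I" "\<forall>i \<in> I. fp (Dom C i) \<and> fp (Cod C i)" "S = llp C (rlp C I)"
    using assms unfolding generated_by_finitely_presentable_def by blast
  then have "cell_set C U I" using lfp_category_axioms by (simp add: cell_set_def cell_set_axioms_def)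
  then show thesis using that I(4) by blast
qed

lemma trivial_cofibration_factors_via: "f \<in> W \<Longrightarrow> f \<in> Cof \<Longrightarrow> factors_via (W \<inter> Cof) f"
  using generated_cell_set[OF generated(2)] cell_set.llp_factors_via by (metis IntI)

lemma Cof_pushout:
  assumes "is_pushout C f g P i j" "f \<in> hom C A B" "g \<in> hom C A X" "f \<in> Cof"
  shows "j \<in> Cof"
proof -
  obtain I where "Cof = llp C (rlp C I)" using generated_cell_set[OF generated(1)] by metis
  then show ?thesis using llp_pushout[OF assms(1-3) _ rlp_Arr] assms(4) by blast
qed

lemma trivial_cofibration_pushout:
  assumes "is_pushout C f g P i j" "f \<in> hom C A B" "g \<in> hom C A X" "f \<in> W" "f \<in> Cof"
  shows "j \<in> W" "j \<in> Cof"
proof -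
  obtain I where "W \<inter> Cof = llp C (rlp C I)" using generated_cell_set[OF generated(2)] by metis
  then have "j \<in> W \<inter> Cof" using llp_pushout[OF assms(1-3) _ rlp_Arr] assms(4,5) by blast
  then show "j \<in> W" "j \<in> Cof" by auto
qed

lemma Cof_Comp: "f \<in> hom C X Y \<Longrightarrow> g \<in> hom C Y Z \<Longrightarrow> f \<in> Cof \<Longrightarrow> g \<in> Cof \<Longrightarrow> g \<cdot> f \<in> Cof"
  using model by (auto simp: model_category_def wide_subcategory_def hom_def)

text \<open>An isomorphism lifts against every arrow and hence belongs to each class of the form
  \<open>llp C R\<close>, in particular to the trivial cofibrations.\<close>

lemma iso_W_Cof:
  assumes "f \<in> hom C X Y" "g \<in> hom C Y X" "g \<cdot> f = Ident C X" "f \<cdot> g = Ident C Y"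
  shows "f \<in> W" "f \<in> Cof"
proof -
  obtain I where "W \<inter> Cof = llp C (rlp C I)" using generated_cell_set[OF generated(2)] by metis
  then have "f \<in> W \<inter> Cof" using llp_iso[OF assms rlp_Arr] by blast
  then show "f \<in> W" "f \<in> Cof" by auto
qed

text \<open>Generation describes \<open>Cof\<close> as \<open>llp C (rlp C I)\<close> and says
  nothing directly about \<open>rlp C I\<close>. But lifting the cofibration part \<open>i\<close>
  of \<open>p\<close> against \<open>p\<close> exhibits \<open>p\<close> as a retract of the trivial
  fibration \<open>q\<close>, and \<open>W\<close> is closed under retracts.\<close>

lemma rlp_generators_W:
  assumes I: "Cof = llp C (rlp C I)" and p: "p \<in> rlp C I"
  shows "p \<in> W"
proof -
  define X Y where "X = Dom C p" "Y = Cod C p"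
  have ph: "p \<in> hom C X Y" using p by (simp add: rlp_def hom_def X_Y_def)
  note XY = hom_ObjD[OF ph]
  obtain Z i q where i: "i \<in> hom C X Z" "q \<in> hom C Z Y" "q \<cdot> i = p" "i \<in> Cof" "q \<in> W" "q \<in> F"
    by (rule factor_Cof[OF ph])
  have l: "has_lift C i p" using i(4) p unfolding I llp_def by blast
  have "q \<cdot> i = p \<cdot> Ident C X" using i(3) ph by (simp add: hom_def)
  then obtain r where r: "r \<in> hom C Z X" "r \<cdot> i = Ident C X" "p \<cdot> r = q"
    by (rule has_liftD[OF l i(1) ph Ident_hom[OF XY(1)] i(2)])
  have "(p, i, Ident C Y, q) \<in> hom (arrow_cat C) p q" "(q, r, Ident C Y, p) \<in> hom (arrow_cat C) q p"
    using ph i r XY by (simp_all add: hom_def arrow_cat_def)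
  moreover have "(q, r, Ident C Y, p) \<cdot>\<^bsub>arrow_cat C\<^esub> (p, i, Ident C Y, q) = Ident (arrow_cat C) p"
    using ph XY r by (simp add: hom_def arrow_cat_def)
  moreover have "p \<in> Obj (arrow_cat C)" using ph by (simp add: hom_def arrow_cat_def)
  ultimately have "is_retract (arrow_cat C) p q" unfolding is_retract_def by blast
  moreover have "retract_closed C W" using model by (simp add: model_category_def)
  ultimately show ?thesis using i(5) unfolding retract_closed_def by blast
qed

text \<open>By \<open>rlp_generators_W\<close> it is enough to lift each generator \<open>t\<close>
  against the fibration \<open>p\<close>. The ends of \<open>t\<close> are presentable, so both
  \<open>factors_via\<close> properties, that of \<open>f\<close> and that of the trivial
  cofibration \<open>i\<close>, can be brought to bear on the lifting problem.\<close>

lemma factors_via_imp_W: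
  assumes fv: "factors_via W f" shows "f \<in> W"
proof -
  define X Y where "X = Dom C f" "Y = Cod C f"
  have f: "f \<in> hom C X Y" using fv by (simp add: factors_via_def hom_def X_Y_def)
  obtain Z i p where i: "i \<in> hom C X Z" "p \<in> hom C Z Y" "p \<cdot> i = f" "i \<in> W" "i \<in> Cof" "p \<in> F"
    by (rule factor_F[OF f])
  obtain I where cs: "cell_set C U I" and I: "Cof = llp C (rlp C I)"
    by (rule generated_cell_set[OF generated(1)])
  interpret I: cell_set C U I by (rule cs)
  have "has_lift C t p" if tI: "t \<in> I" for t
  proof -
    define A B where "A = Dom C t" "B = Cod C t"
    have t: "t \<in> hom C A B" and tC: "t \<in> Cof" and fpA: "fp A" and fpB: "fp B"
      using tI I.I_Arr llp_rlp_subset[OF I.I_Arr] I.I_fp unfolding I A_B_def by (auto simp: hom_def)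
    show ?thesis
    proof (rule has_liftI[OF t i(2)])
      fix u v assume u: "u \<in> hom C A Z" and v: "v \<in> hom C B Y" and vt: "v \<cdot> t = p \<cdot> u"
      \<comment> \<open>In order to lift just the map \<open>u\<close> from \<open>A\<close> to
        \<open>Z\<close>, it is read as a square into \<open>i\<close> from the map of the initial
        object to \<open>A\<close>.\<close>
      obtain E where E: "is_initial C E" using initial_exists by blast
      obtain e where e: "e \<in> hom C E A" by (rule initial_hom[OF E hom_ObjD(1)[OF t]])
      obtain eX where eX: "eX \<in> hom C E X" by (rule initial_hom[OF E hom_ObjD(1)[OF f]])
      have "u \<cdot> e = i \<cdot> eX" by (rule initial_unique[OF E Comp_hom[OF e u] Comp_hom[OF eX i(1)]])
      then obtain X1 Z1 w1 a1 b1 u1 v1 where 1: "w1 \<in> W \<inter> Cof" "fp X1" "fp Z1" "w1 \<in> hom C X1 Z1"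
        "a1 \<in> hom C E X1" "b1 \<in> hom C A Z1" "u1 \<in> hom C X1 X" "v1 \<in> hom C Z1 Z"
        "b1 \<cdot> e = w1 \<cdot> a1" "v1 \<cdot> w1 = i \<cdot> u1" "u1 \<cdot> a1 = eX" "v1 \<cdot> b1 = u"
        by (rule factors_viaD[OF trivial_cofibration_factors_via[OF i(4,5)] i(1) fp_initial[OF E] fpA e eX u])
      \<comment> \<open>Pushing \<open>t\<close> out along \<open>b1\<close> replaces
        \<open>u\<close> by \<open>v1\<close>, which comes with a square from \<open>w1\<close> to
        \<open>i\<close>; composing \<open>t'\<close> with \<open>w1\<close> then gives a square
        into \<open>f\<close> itself.\<close>
      obtain B1 b' t' where P1: "is_pushout C t b1 B1 b' t'" and p1: "b' \<in> hom C B B1" "t' \<in> hom C Z1 B1"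
        "b' \<cdot> t = t' \<cdot> b1" and fp1: "fp A \<and> fp B \<and> fp Z1 \<longrightarrow> fp B1" by (rule pushout_exists[OF t 1(6)])
      have fpB1: "fp B1" using fp1 fpA fpB 1(3) by blast
      have t'C: "t' \<in> Cof" by (rule Cof_pushout[OF P1 t 1(6) tC])
      have "v \<cdot> t = (p \<cdot> v1) \<cdot> b1" unfolding vt 1(12)[symmetric] using i(2) 1(6,8) by (simp add: hom_def)
      then obtain v' where v': "v' \<in> hom C B1 Y" "v' \<cdot> b' = v" "v' \<cdot> t' = p \<cdot> v1"
        by (rule pushout_ex[OF P1 t 1(6) v Comp_hom[OF 1(8) i(2)]])
      have "(v' \<cdot> t') \<cdot> w1 = f \<cdot> u1"
        unfolding v'(3) i(3)[symmetric] using i(1,2) 1(4,7,8,10) by (simp add: hom_def)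
      then have "v' \<cdot> (t' \<cdot> w1) = f \<cdot> u1" using v'(1) p1(2) 1(4) by (simp add: hom_def)
      then obtain X2 Y2 w2 a2 b2 u2 v2 where 2: "w2 \<in> W" "fp X2" "fp Y2" "w2 \<in> hom C X2 Y2"
        "a2 \<in> hom C X1 X2" "b2 \<in> hom C B1 Y2" "u2 \<in> hom C X2 X" "v2 \<in> hom C Y2 Y"
        "b2 \<cdot> (t' \<cdot> w1) = w2 \<cdot> a2" "v2 \<cdot> w2 = f \<cdot> u2" "u2 \<cdot> a2 = u1" "v2 \<cdot> b2 = v'"
        by (rule factors_viaD[OF fv f 1(2) fpB1 Comp_hom[OF 1(4) p1(2)] 1(7) v'(1)])
      \<comment> \<open>\<open>l\<close> is a trivial cofibration as a pushout of \<open>w1\<close>,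
        and \<open>w2\<close> is a weak equivalence, so the induced map \<open>y\<close> will be one
        by two-out-of-three.\<close>
      obtain A2 k l where P2: "is_pushout C w1 a2 A2 k l" and p2: "k \<in> hom C Z1 A2" "l \<in> hom C X2 A2"
        "k \<cdot> w1 = l \<cdot> a2" and "fp X1 \<and> fp Z1 \<and> fp X2 \<longrightarrow> fp A2" by (rule pushout_exists[OF 1(4) 2(5)])
      have lW: "l \<in> W" using trivial_cofibration_pushout(1)[OF P2 1(4) 2(5)] 1(1) by blast
      have "v1 \<cdot> w1 = (i \<cdot> u2) \<cdot> a2" unfolding 1(10) 2(11)[symmetric] using i(1) 2(5,7) by (simp add: hom_def)
      then obtain z where z: "z \<in> hom C A2 Z" "z \<cdot> k = v1" "z \<cdot> l = i \<cdot> u2"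
        by (rule pushout_ex[OF P2 1(4) 2(5) 1(8) Comp_hom[OF 2(7) i(1)]])
      have "(b2 \<cdot> t') \<cdot> w1 = w2 \<cdot> a2" unfolding 2(9)[symmetric] using 2(6) p1(2) 1(4) by (simp add: hom_def)
      then obtain y where y: "y \<in> hom C A2 Y2" "y \<cdot> k = b2 \<cdot> t'" "y \<cdot> l = w2"
        by (rule pushout_ex[OF P2 1(4) 2(5) Comp_hom[OF p1(2) 2(6)] 2(4)])
      have yW: "y \<in> W" using two_of_three(2)[OF p2(2) y(1) lW] y(3) 2(1) by simp
      \<comment> \<open>Splitting the weak equivalence \<open>y\<close> leaves a trivial fibration
        \<open>s\<close>, against which the cofibration \<open>t'\<close> lifts, and a trivial
        cofibration \<open>r\<close>, which lifts against the fibration \<open>p\<close>. The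
        composite of the two lifts solves the problem for \<open>t'\<close> and hence for
        \<open>t\<close>.\<close>
      obtain V r s where r: "r \<in> hom C A2 V" "s \<in> hom C V Y2" "s \<cdot> r = y" "r \<in> Cof" "s \<in> W" "s \<in> F"
        by (rule factor_Cof[OF y(1)])
      have rW: "r \<in> W" using two_of_three(3)[OF r(1,2,5)] r(3) yW by simp
      have "b2 \<cdot> t' = s \<cdot> (r \<cdot> k)" unfolding y(2)[symmetric] r(3)[symmetric] using r(1,2) p2(1) by (simp add: hom_def)
      then obtain d where d: "d \<in> hom C B1 V" "d \<cdot> t' = r \<cdot> k" "s \<cdot> d = b2"
        by (rule has_liftD[OF lift(2)[OF t'C r(5,6)] p1(2) r(2) Comp_hom[OF p2(1) r(1)] 2(6)])
      have vy: "v2 \<cdot> y = p \<cdot> z"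
      proof (rule pushout_unique[OF P2 1(4) 2(5) Comp_hom[OF y(1) 2(8)] Comp_hom[OF z(1) i(2)]])
        have "(v2 \<cdot> y) \<cdot> k = (v2 \<cdot> b2) \<cdot> t'" using y 2(6,8) p1(2) p2(1) by (simp add: hom_def)
        also have "\<dots> = (p \<cdot> z) \<cdot> k" unfolding 2(12) v'(3) z(2)[symmetric] using z(1) i(2) p2(1) by (simp add: hom_def)
        finally show "(v2 \<cdot> y) \<cdot> k = (p \<cdot> z) \<cdot> k" .
        have "(v2 \<cdot> y) \<cdot> l = v2 \<cdot> w2" using y 2(8) p2(2) by (simp add: hom_def)
        also have "\<dots> = p \<cdot> (i \<cdot> u2)" unfolding 2(10) i(3)[symmetric] using i(1,2) 2(7) by (simp add: hom_def)
        also have "\<dots> = (p \<cdot> z) \<cdot> l" unfolding z(3)[symmetric] using z(1) i(2) p2(2) by (simp add: hom_def)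
        finally show "(v2 \<cdot> y) \<cdot> l = (p \<cdot> z) \<cdot> l" .
      qed
      have "(v2 \<cdot> s) \<cdot> r = p \<cdot> z" unfolding vy[symmetric] r(3)[symmetric] using 2(8) r(1,2) by (simp add: hom_def)
      then obtain n where n: "n \<in> hom C V Z" "n \<cdot> r = z" "p \<cdot> n = v2 \<cdot> s"
        by (rule has_liftD[OF lift(1)[OF rW r(4) i(6)] r(1) i(2) z(1) Comp_hom[OF r(2) 2(8)]])
      have nd: "n \<cdot> d \<in> hom C B1 Z" by (rule Comp_hom[OF d(1) n(1)])
      have ndt: "(n \<cdot> d) \<cdot> t' = v1"
      proof -
        have "(n \<cdot> d) \<cdot> t' = (n \<cdot> r) \<cdot> k" using n(1) d(1,2) p1(2) r(1) p2(1) by (simp add: hom_def)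
        then show ?thesis unfolding n(2) z(2) .
      qed
      have "((n \<cdot> d) \<cdot> b') \<cdot> t = ((n \<cdot> d) \<cdot> t') \<cdot> b1"
        using nd p1 t 1(6) n(1) d(1) by (simp add: hom_def)
      then have 3: "((n \<cdot> d) \<cdot> b') \<cdot> t = u" unfolding ndt 1(12) .
      have "p \<cdot> (n \<cdot> d) = v2 \<cdot> (s \<cdot> d)"
      proof -
        have "p \<cdot> (n \<cdot> d) = (p \<cdot> n) \<cdot> d" using i(2) n(1) d(1) by (simp add: hom_def)
        then show ?thesis unfolding n(3) using 2(8) r(2) d(1) by (simp add: hom_def)
      qed
      then have pnd: "p \<cdot> (n \<cdot> d) = v'" unfolding d(3) 2(12) .
      have "p \<cdot> ((n \<cdot> d) \<cdot> b') = (p \<cdot> (n \<cdot> d)) \<cdot> b'" using i(2) n(1) d(1) p1(1) by (simp add: hom_def)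
      then have 4: "p \<cdot> ((n \<cdot> d) \<cdot> b') = v" unfolding pnd v'(2) .
      show "\<exists>h \<in> hom C B Z. h \<cdot> t = u \<and> p \<cdot> h = v" using 3 4 Comp_hom[OF p1(1) nd] by blast
    qed
  qed
  then have "p \<in> rlp C I" using i(2) by (simp add: rlp_def hom_def)
  then have "p \<in> W" by (rule rlp_generators_W[OF I])
  then show ?thesis using two_of_three(1)[OF i(1,2,4)] i(3) by simp
qed

lemma W_imp_factors_via:
  assumes proper: "left_proper C W Cof"
    and cyl: "\<And>A B f. fp A \<Longrightarrow> fp B \<Longrightarrow> f \<in> hom C A B \<Longrightarrow>
      \<exists>Z i p. fp Z \<and> i \<in> hom C A Z \<and> p \<in> hom C Z B \<and> p \<cdot> i = f \<and> i \<in> Cof \<and> p \<in> W"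
    and fW: "f \<in> W"
  shows "factors_via W f"
proof -
  define X Y where "X = Dom C f" "Y = Cod C f"
  have f: "f \<in> hom C X Y" using fW subset_Arr by (auto simp: hom_def X_Y_def)
  obtain Z i p where i: "i \<in> hom C X Z" "p \<in> hom C Z Y" "p \<cdot> i = f" "i \<in> Cof" "p \<in> W" "p \<in> F"
    by (rule factor_Cof[OF f])
  have iW: "i \<in> W" using two_of_three(3)[OF i(1,2,5)] i(3) fW by simp
  show ?thesis
  proof (rule factors_viaI[OF f])
    fix A B g u v assume h: "fp A" "fp B" "g \<in> hom C A B" "u \<in> hom C A X" "v \<in> hom C B Y" and eq: "v \<cdot> g = f \<cdot> u"
    \<comment> \<open>Replacing \<open>g\<close> by a cofibration \<open>i1\<close> allows lifting
      against the trivial fibration \<open>p\<close>, and the square becomes one from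
      \<open>i1\<close> to the trivial cofibration \<open>i\<close>.\<close>
    obtain C1 i1 p1 where 1: "fp C1" "i1 \<in> hom C A C1" "p1 \<in> hom C C1 B" "p1 \<cdot> i1 = g" "i1 \<in> Cof" "p1 \<in> W"
      using cyl[OF h(1,2,3)] by blast
    have "(v \<cdot> p1) \<cdot> i1 = v \<cdot> g" unfolding 1(4)[symmetric] using 1(2,3) h(5) by (simp add: hom_def)
    also have "\<dots> = p \<cdot> (i \<cdot> u)" unfolding eq i(3)[symmetric] using i(1,2) h(4) by (simp add: hom_def)
    finally obtain d where d: "d \<in> hom C C1 Z" "d \<cdot> i1 = i \<cdot> u" "p \<cdot> d = v \<cdot> p1"
      by (rule has_liftD[OF lift(2)[OF 1(5) i(5,6)] 1(2) i(2) Comp_hom[OF h(4) i(1)] Comp_hom[OF 1(3) h(5)]])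
    obtain X2 Z2 w a b u2 v2 where 2: "w \<in> W \<inter> Cof" "fp X2" "fp Z2" "w \<in> hom C X2 Z2" "a \<in> hom C A X2"
      "b \<in> hom C C1 Z2" "u2 \<in> hom C X2 X" "v2 \<in> hom C Z2 Z"
      "b \<cdot> i1 = w \<cdot> a" "v2 \<cdot> w = i \<cdot> u2" "u2 \<cdot> a = u" "v2 \<cdot> b = d"
      by (rule factors_viaD[OF trivial_cofibration_factors_via[OF iW i(4)] i(1) h(1) 1(1,2) h(4) d(1,2)])
    \<comment> \<open>\<open>b\<close> need not be a cofibration, but left properness asks for one.
      Replacing \<open>a\<close> by a cofibration \<open>e\<close> makes \<open>n1\<close> a
      cofibration into the pushout \<open>N\<close>, and factoring the map from \<open>N\<close> to
      \<open>Z2\<close> replaces \<open>b\<close> by the cofibration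
      \<open>r \<cdot> n1\<close>.\<close>
    obtain E1 e q where e: "fp E1" "e \<in> hom C A E1" "q \<in> hom C E1 X2" "q \<cdot> e = a" "e \<in> Cof" "q \<in> W"
      using cyl[OF h(1) 2(2,5)] by blast
    obtain N n1 n2 where P: "is_pushout C i1 e N n1 n2" and n: "n1 \<in> hom C C1 N" "n2 \<in> hom C E1 N"
      "n1 \<cdot> i1 = n2 \<cdot> e" and fpN: "fp A \<and> fp C1 \<and> fp E1 \<longrightarrow> fp N" by (rule pushout_exists[OF 1(2) e(2)])
    have n1C: "n1 \<in> Cof" by (rule Cof_pushout[OF pushout_sym[OF P] e(2) 1(2) e(5)])
    have "b \<cdot> i1 = (w \<cdot> q) \<cdot> e" unfolding 2(9) e(4)[symmetric] using 2(4) e(2,3) by (simp add: hom_def)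
    then obtain x where x: "x \<in> hom C N Z2" "x \<cdot> n1 = b" "x \<cdot> n2 = w \<cdot> q"
      by (rule pushout_ex[OF P 1(2) e(2) 2(6) Comp_hom[OF e(3) 2(4)]])
    have fpN': "fp N" using fpN h(1) 1(1) e(1) by blast
    obtain D1 r y where r: "fp D1" "r \<in> hom C N D1" "y \<in> hom C D1 Z2" "y \<cdot> r = x" "r \<in> Cof" "y \<in> W"
      using cyl[OF fpN' 2(3) x(1)] by blast
    have rn: "r \<cdot> n1 \<in> hom C C1 D1" "r \<cdot> n2 \<in> hom C E1 D1" by (rule Comp_hom[OF n(1) r(2)], rule Comp_hom[OF n(2) r(2)])
    have rn1C: "r \<cdot> n1 \<in> Cof" by (rule Cof_Comp[OF n(1) r(2) n1C r(5)])
    have yr1: "y \<cdot> (r \<cdot> n1) = b" unfolding x(2)[symmetric] r(4)[symmetric] using r(2,3) n(1) by (simp add: hom_def)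
    have yr2: "y \<cdot> (r \<cdot> n2) = w \<cdot> q" unfolding x(3)[symmetric] r(4)[symmetric] using r(2,3) n(2) by (simp add: hom_def)
    \<comment> \<open>\<open>w\<close>, \<open>q\<close> and \<open>y\<close> are weak equivalences,
      hence so is \<open>r \<cdot> n2\<close>, the replacement of \<open>w\<close>.\<close>
    have "w \<cdot> q \<in> W" using two_of_three(1)[OF e(3) 2(4) e(6)] 2(1) by blast
    then have rn2W: "r \<cdot> n2 \<in> W" using two_of_three(3)[OF rn(2) r(3,6)] yr2 by simp
    \<comment> \<open>The weak equivalence \<open>p1\<close> is pushed forward along the cofibration
      \<open>r \<cdot> n1\<close>. Left properness makes \<open>j2\<close> a weak equivalence, and
      \<open>j2 \<cdot> (r \<cdot> n2)\<close> from \<open>E1\<close> to \<open>B2\<close> is the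
      arrow through which the given square factors.\<close>
    obtain B2 j1 j2 where P2: "is_pushout C p1 (r \<cdot> n1) B2 j1 j2" and j: "j1 \<in> hom C B B2" "j2 \<in> hom C D1 B2"
      "j1 \<cdot> p1 = j2 \<cdot> (r \<cdot> n1)" and fpB2: "fp C1 \<and> fp B \<and> fp D1 \<longrightarrow> fp B2" by (rule pushout_exists[OF 1(3) rn(1)])
    have "j2 \<in> W" using proper P2 1(6) rn1C unfolding left_proper_def by blast
    then have w'W: "j2 \<cdot> (r \<cdot> n2) \<in> W" by (rule two_of_three(1)[OF rn(2) j(2) rn2W])
    have "v \<cdot> p1 = p \<cdot> (v2 \<cdot> (y \<cdot> (r \<cdot> n1)))" unfolding yr1 2(12) d(3) ..
    then have "v \<cdot> p1 = (p \<cdot> (v2 \<cdot> y)) \<cdot> (r \<cdot> n1)" using i(2) 2(8) r(2,3) n(1) by (simp add: hom_def)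
    then obtain v' where v': "v' \<in> hom C B2 Y" "v' \<cdot> j1 = v" "v' \<cdot> j2 = p \<cdot> (v2 \<cdot> y)"
      by (rule pushout_ex[OF P2 1(3) rn(1) h(5) Comp_hom[OF Comp_hom[OF r(3) 2(8)] i(2)]])
    have "j1 \<cdot> g = (j1 \<cdot> p1) \<cdot> i1" unfolding 1(4)[symmetric] using j(1) 1(2,3) by (simp add: hom_def)
    also have "\<dots> = (j2 \<cdot> r) \<cdot> (n1 \<cdot> i1)" unfolding j(3) using j(2) r(2) n(1) 1(2) by (simp add: hom_def)
    also have "\<dots> = (j2 \<cdot> (r \<cdot> n2)) \<cdot> e" unfolding n(3) using j(2) r(2) n(2) e(2) by (simp add: hom_def)
    finally have e1: "j1 \<cdot> g = (j2 \<cdot> (r \<cdot> n2)) \<cdot> e" .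
    have "v' \<cdot> (j2 \<cdot> (r \<cdot> n2)) = (v' \<cdot> j2) \<cdot> (r \<cdot> n2)" using v'(1) j(2) r(2) n(2) by (simp add: hom_def)
    also have "\<dots> = p \<cdot> (v2 \<cdot> (y \<cdot> (r \<cdot> n2)))" unfolding v'(3) using i(2) 2(8) r(2,3) n(2) by (simp add: hom_def)
    also have "\<dots> = p \<cdot> ((v2 \<cdot> w) \<cdot> q)" unfolding yr2 using 2(4,8) e(3) by (simp add: hom_def)
    also have "\<dots> = f \<cdot> (u2 \<cdot> q)" unfolding 2(10) i(3)[symmetric] using i(1,2) 2(7) e(3) by (simp add: hom_def)
    finally have e2: "v' \<cdot> (j2 \<cdot> (r \<cdot> n2)) = f \<cdot> (u2 \<cdot> q)" .
    have e3: "(u2 \<cdot> q) \<cdot> e = u" unfolding 2(11)[symmetric] e(4)[symmetric] using 2(7) e(2,3) by (simp add: hom_def)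
    have fpB2': "fp B2" using fpB2 1(1) h(2) r(1) by blast
    show "square_factors W f X Y A B g u v"
    unfolding square_factors_def
      using w'W e(1) fpB2' Comp_hom[OF rn(2) j(2)] e(2) j(1) Comp_hom[OF e(3) 2(7)] v'(1) e1 e2 e3 v'(2) by blast
  qed
qed

end

section \<open>Mapping cylinders\<close>

context category
begin

lemma product_ex:
  assumes "is_product C A B P p q" "f \<in> hom C X A" "g \<in> hom C X B"
  obtains h where "h \<in> hom C X P" "p \<cdot> h = f" "q \<cdot> h = g"
  using assms unfolding is_product_def by blast

lemma product_hom:
  "is_product C A B P p q \<Longrightarrow> p \<in> hom C P A" "is_product C A B P p q \<Longrightarrow> q \<in> hom C P B"
  by (simp_all add: is_product_def)

lemma product_unique:
  assumes P: "is_product C A B P p q"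
    and h: "h \<in> hom C X P" "h' \<in> hom C X P" "p \<cdot> h = p \<cdot> h'" "q \<cdot> h = q \<cdot> h'"
  shows "h = h'"
proof -
  have "\<exists>!k. k \<in> hom C X P \<and> p \<cdot> k = p \<cdot> h \<and> q \<cdot> k = q \<cdot> h"
    using P Comp_hom[OF h(1) product_hom(1)[OF P]] Comp_hom[OF h(1) product_hom(2)[OF P]]
    by (simp add: is_product_def)
  then show ?thesis using h by metis
qed

lemma finite_limits_product:
  assumes "has_finite_limits C" "A \<in> Obj C" "B \<in> Obj C"
  shows "\<exists>P p q. is_product C A B P p q"
proof -
  let ?J = "discrete_cat {0, 1 :: nat}"
  let ?F = "\<lambda>n :: nat. if n = 0 then A else B"
  let ?D = "\<lparr>FO = ?F, FA = \<lambda>n. Ident C (?F n)\<rparr>"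
  have J: "finite_category ?J" using category_discrete_cat[of "{0, 1 :: nat}"]
    by (simp add: finite_category_def) (simp add: discrete_cat_def)
  have D: "is_functor ?J C ?D" by (rule is_functor_discrete_cat[OF category_axioms]) (use assms in auto)
  obtain P \<pi> where P: "is_limit C ?J ?D P \<pi>"
    using assms(1)[unfolded has_finite_limits_def, rule_format, OF conjI[OF J D]] by blast
  have cone: "is_cone C ?J ?D X \<tau> \<longleftrightarrow> \<tau> 0 \<in> hom C X A \<and> \<tau> 1 \<in> hom C X B" for X \<tau>
  proof
    assume "\<tau> 0 \<in> hom C X A \<and> \<tau> 1 \<in> hom C X B"
    then show "is_cone C ?J ?D X \<tau>"
      using hom_ObjD(1)[of "\<tau> 0" X A] by (simp add: is_cone_def discrete_cat_def) (simp add: hom_def)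
  qed (simp add: is_cone_def discrete_cat_def)
  have "\<exists>!h. h \<in> hom C X P \<and> \<pi> 0 \<cdot> h = f \<and> \<pi> 1 \<cdot> h = g" if "f \<in> hom C X A" "g \<in> hom C X B" for X f g
  proof -
    have "is_cone C ?J ?D X (\<lambda>n. if n = 0 then f else g)" unfolding cone using that by simp
    from P[unfolded is_limit_def, THEN conjunct2, rule_format, OF this]
    show ?thesis by (simp add: discrete_cat_def)
  qed
  moreover have "P \<in> Obj C" "\<pi> 0 \<in> hom C P A" "\<pi> 1 \<in> hom C P B"
    using P cone[of P \<pi>] by (auto simp: is_limit_def is_cone_def)
  ultimately have "is_product C A B P (\<pi> 0) (\<pi> 1)" by (simp add: is_product_def)
  then show ?thesis by blast
qed

lemma product_functor_exists:
  assumes "\<And>X. X \<in> Obj C \<Longrightarrow> \<exists>P p q. is_product C A X P p q"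
  shows "\<exists>P p q. product_functor C A P p q"
proof -
  obtain T p q where T: "\<And>X. X \<in> Obj C \<Longrightarrow> is_product C A X (T X) (p X) (q X)"
    using assms by metis
  have "\<exists>k. k \<in> hom C (T (Dom C h)) (T (Cod C h)) \<and> p (Cod C h) \<cdot> k = p (Dom C h) \<and>
      q (Cod C h) \<cdot> k = h \<cdot> q (Dom C h)" if h: "h \<in> Arr C" for h
  proof -
    have hh: "h \<in> hom C (Dom C h) (Cod C h)" using h by (simp add: hom_def)
    note P = T[OF Dom_Obj[OF h]] and P' = T[OF Cod_Obj[OF h]]
    show ?thesis
      using product_ex[OF P' product_hom(1)[OF P] Comp_hom[OF product_hom(2)[OF P] hh]] by blast
  qed
  then obtain k where k: "\<And>h. h \<in> Arr C \<Longrightarrow> k h \<in> hom C (T (Dom C h)) (T (Cod C h))"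
    "\<And>h. h \<in> Arr C \<Longrightarrow> p (Cod C h) \<cdot> k h = p (Dom C h)"
    "\<And>h. h \<in> Arr C \<Longrightarrow> q (Cod C h) \<cdot> k h = h \<cdot> q (Dom C h)" by metis
  let ?P = "\<lparr>FO = T, FA = k\<rparr>"
  have "is_functor C C ?P"
    unfolding is_functor_def
  proof (intro conjI ballI impI)
    show "FO ?P X \<in> Obj C" if "X \<in> Obj C" for X using T[OF that] by (simp add: is_product_def)
    show "FA ?P h \<in> hom C (FO ?P (Dom C h)) (FO ?P (Cod C h))" if "h \<in> Arr C" for h using k(1)[OF that] by simp
    show "FA ?P (Ident C X) = Ident C (FO ?P X)" if X: "X \<in> Obj C" for X
    proof -
      have TX: "T X \<in> Obj C" using T[OF X] by (simp add: is_product_def)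
      have "k (Ident C X) = Ident C (T X)"
        by (rule product_unique[OF T[OF X] _ Ident_hom[OF TX]])
          (use k[OF Arr_Ident[OF X]] product_hom[OF T[OF X]] X TX in \<open>simp_all add: hom_def\<close>)
      then show ?thesis by simp
    qed
    fix f g assume f: "f \<in> Arr C" "g \<in> Arr C" "Dom C g = Cod C f"
    have gf: "g \<cdot> f \<in> Arr C" "Dom C (g \<cdot> f) = Dom C f" "Cod C (g \<cdot> f) = Cod C g" using f by simp_all
    note kf = k[OF f(1)] and kg = k[OF f(2)] and kgf = k[OF gf(1), unfolded gf(2,3)]
    note pf = product_hom[OF T[OF Dom_Obj[OF f(1)]]] and pg = product_hom[OF T[OF Cod_Obj[OF f(2)]]]
      and pm = product_hom[OF T[OF Cod_Obj[OF f(1)]]]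
    have kk: "k g \<cdot> k f \<in> hom C (T (Dom C f)) (T (Cod C g))" using kf(1) kg(1) f(3) by (simp add: hom_def)
    have "k (g \<cdot> f) = k g \<cdot> k f"
    proof (rule product_unique[OF T[OF Cod_Obj[OF f(2)]] kgf(1) kk])
      have "p (Cod C g) \<cdot> (k g \<cdot> k f) = (p (Cod C g) \<cdot> k g) \<cdot> k f" using pg(1) kf(1) kg(1) f(3) by (simp add: hom_def)
      then show "p (Cod C g) \<cdot> k (g \<cdot> f) = p (Cod C g) \<cdot> (k g \<cdot> k f)" unfolding kgf(2) kg(2) f(3) kf(2) by simp
      have "q (Cod C g) \<cdot> (k g \<cdot> k f) = (q (Cod C g) \<cdot> k g) \<cdot> k f" using pg(2) kf(1) kg(1) f(3) by (simp add: hom_def)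
      also have "\<dots> = g \<cdot> (q (Cod C f) \<cdot> k f)" unfolding kg(3) f(3) using pm(2) kf(1) f by (simp add: hom_def)
      also have "\<dots> = (g \<cdot> f) \<cdot> q (Dom C f)" unfolding kf(3) using pf(2) f by (simp add: hom_def)
      finally show "q (Cod C g) \<cdot> k (g \<cdot> f) = q (Cod C g) \<cdot> (k g \<cdot> k f)" unfolding kgf(3) by simp
    qed
    then show "FA ?P (g \<cdot> f) = FA ?P g \<cdot> FA ?P f" by simp
  qed
  then have "product_functor C A ?P p q" using T k unfolding product_functor_def by simp
  then show ?thesis by blast
qed

lemma terminal_hom: "is_terminal C pt \<Longrightarrow> X \<in> Obj C \<Longrightarrow> \<exists>f. f \<in> hom C X pt"
  unfolding is_terminal_def by blast

lemma terminal_unique: "is_terminal C pt \<Longrightarrow> f \<in> hom C X pt \<Longrightarrow> g \<in> hom C X pt \<Longrightarrow> f = g"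
  unfolding is_terminal_def using hom_ObjD(1)[of f X pt] by blast

text \<open>Over a terminal object every square commutes, so products are pullbacks. This makes the
  hypothesis on pullback functors available for the product functor of \<open>A\<close>.\<close>

lemma product_functor_pullback:
  assumes pt: "is_terminal C pt" and P: "product_functor C A P p q" and f: "f \<in> hom C A pt"
  shows "pullback_functor C f \<lparr>FO = \<lambda>x. FO P (Dom C x), FA = \<lambda>(x, h, y). FA P h\<rparr>
    (\<lambda>x. p (Dom C x)) (\<lambda>x. q (Dom C x))" (is "pullback_functor C f ?P ?p ?q")
proof -
  have cf: "Cod C f = pt" "Dom C f = A" "f \<in> Arr C" using f by (simp_all add: hom_def)
  have F: "is_functor C C P" and pr: "\<And>X. X \<in> Obj C \<Longrightarrow> is_product C A X (FO P X) (p X) (q X)"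
    and nat: "\<And>h. h \<in> Arr C \<Longrightarrow> p (Cod C h) \<cdot> FA P h = p (Dom C h) \<and> q (Cod C h) \<cdot> FA P h = h \<cdot> q (Dom C h)"
    using P by (simp_all add: product_functor_def)
  have "is_functor (slice C pt) C ?P"
    using F unfolding is_functor_def slice_def by (auto simp: hom_def)
  moreover have "is_pullback C f x (FO P (Dom C x)) (p (Dom C x)) (q (Dom C x))"
    if x: "x \<in> Arr C" "Cod C x = pt" for x
  proof -
    note X = pr[OF Dom_Obj[OF x(1)]]
    have xh: "x \<in> hom C (Dom C x) pt" using x by (simp add: hom_def)
    have "f \<cdot> p (Dom C x) = x \<cdot> q (Dom C x)"
      by (rule terminal_unique[OF pt Comp_hom[OF product_hom(1)[OF X] f] Comp_hom[OF product_hom(2)[OF X] xh]])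
    moreover have "\<exists>!h. h \<in> hom C Y (FO P (Dom C x)) \<and> p (Dom C x) \<cdot> h = u \<and> q (Dom C x) \<cdot> h = v"
      if "u \<in> hom C Y A \<and> v \<in> hom C Y (Dom C x) \<and> f \<cdot> u = x \<cdot> v" for Y u v
      using X that unfolding is_product_def by blast
    ultimately show ?thesis
      unfolding is_pullback_def cf(1,2) by (intro conjI allI impI product_hom[OF X] x(1) cf(3) x(2)[symmetric])
  qed
  moreover have "p (Dom C y) \<cdot> FA P h = p (Dom C x) \<and> q (Dom C y) \<cdot> FA P h = h \<cdot> q (Dom C x)"
    if "(x, h, y) \<in> Arr (slice C pt)" for x h y
    using that nat[of h] by (simp add: slice_def hom_def)
  ultimately show ?thesis
    unfolding pullback_functor_def cf(1) by (intro conjI ballI) (simp_all add: slice_def split_beta)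
qed

text \<open>
  The hypothesis on pullbacks speaks about colimits in slices; it applies here because the
  coproduct of the terminal object with itself is also a colimit in the slice over it.
\<close>

lemma product_functor_coproduct:
  assumes pt: "is_terminal C pt" and P: "product_functor C A P p q" and A: "A \<in> Obj C"
    and fold: "is_fold_map C pt S i0 i1 nab"
    and pres: "\<And>f P p1 p2. f \<in> Arr C \<Longrightarrow> pullback_functor C f P p1 p2 \<Longrightarrow>
      preserves_finite_colimits (slice C (Cod C f)) C P"
  shows "is_coproduct C (FO P pt) (FO P pt) (FO P S) (FA P i0) (FA P i1)"
proof -
  have S: "is_coproduct C pt pt S i0 i1" and n: "nab \<in> hom C S pt" "nab \<cdot> i0 = Ident C pt" "nab \<cdot> i1 = Ident C pt"
    using fold by (auto simp: is_fold_map_def)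
  note ii = coproduct_hom[OF S]
  have pO: "pt \<in> Obj C" using pt by (simp add: is_terminal_def)
  obtain f where f: "f \<in> hom C A pt" using terminal_hom[OF pt A] by blast
  define P' where "P' = \<lparr>FO = \<lambda>x. FO P (Dom C x), FA = \<lambda>(x :: 'a, h, y :: 'a). FA P h\<rparr>"
  have pres': "preserves_finite_colimits (slice C pt) C P'"
    using pres[OF homD(1)[OF f] product_functor_pullback[OF pt P f]] homD(3)[OF f] by (simp add: P'_def)
  let ?J = "discrete_cat {0, 1 :: nat}"
  let ?i = "Ident C pt"
  define D :: "(nat, nat, 'a, 'a \<times> 'a \<times> 'a) ftor" where "D = \<lparr>FO = \<lambda>_. ?i, FA = \<lambda>_. Ident (slice C pt) ?i\<rparr>"
  have J: "finite_category ?J" using category_discrete_cat[of "{0, 1 :: nat}"]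
    by (simp add: finite_category_def) (simp add: discrete_cat_def)
  have iO: "?i \<in> Obj (slice C pt)" using pO by (simp add: slice_def)
  have D: "is_functor ?J (slice C pt) D"
    unfolding D_def by (rule is_functor_discrete_cat[OF category_slice[OF category_axioms]]) (rule iO)
  define \<iota> where "\<iota> m = (?i, if m = 0 then i0 else i1, nab)" for m :: nat
  have slice_hom: "z \<in> hom (slice C pt) x y \<longleftrightarrow> (\<exists>h. z = (x, h, y) \<and> x \<in> Arr C \<and> Cod C x = pt \<and> y \<in> Arr C \<and>
      Cod C y = pt \<and> h \<in> hom C (Dom C x) (Dom C y) \<and> y \<cdot> h = x)" for z x y
    by (auto simp: hom_def slice_def)
  have col: "is_colimit (slice C pt) ?J D nab \<iota>"
    unfolding is_colimit_def
  proof (intro conjI allI impI)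
    have \<iota>h: "\<iota> m \<in> hom (slice C pt) ?i nab" for m
      unfolding slice_hom \<iota>_def using n ii pO by (simp add: hom_def)
    have "\<iota> m \<cdot>\<^bsub>slice C pt\<^esub> Ident (slice C pt) ?i = \<iota> m" for m
      using category.Ident_right[OF category_slice[OF category_axioms] \<iota>h] .
    then show "is_cocone (slice C pt) ?J D nab \<iota>"
      using \<iota>h n(1) by (simp add: is_cocone_def discrete_cat_def D_def) (simp add: slice_def hom_def)
    fix y \<tau> assume t: "is_cocone (slice C pt) ?J D y \<tau>"
    have "\<tau> 0 \<in> hom (slice C pt) ?i y" "\<tau> 1 \<in> hom (slice C pt) ?i y"
      using t by (auto simp: is_cocone_def discrete_cat_def D_def)
    then obtain h0 h1 where h: "\<tau> 0 = (?i, h0, y)" "\<tau> 1 = (?i, h1, y)" "y \<in> Arr C" "Cod C y = pt"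
      "h0 \<in> hom C pt (Dom C y)" "h1 \<in> hom C pt (Dom C y)" using pO by (auto simp: slice_hom)
    obtain k where k: "k \<in> hom C S (Dom C y)" "k \<cdot> i0 = h0" "k \<cdot> i1 = h1" by (rule coproduct_ex[OF S h(5,6)])
    have yh: "y \<in> hom C (Dom C y) pt" using h by (simp add: hom_def)
    have yk: "y \<cdot> k = nab" by (rule terminal_unique[OF pt Comp_hom[OF k(1) yh] n(1)])
    show "\<exists>!g. g \<in> hom (slice C pt) nab y \<and> (\<forall>m \<in> Obj ?J. g \<cdot>\<^bsub>slice C pt\<^esub> \<iota> m = \<tau> m)"
    proof (rule ex1I[of _ "(nab, k, y)"])
      show "(nab, k, y) \<in> hom (slice C pt) nab y \<and> (\<forall>m \<in> Obj ?J. (nab, k, y) \<cdot>\<^bsub>slice C pt\<^esub> \<iota> m = \<tau> m)"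
        unfolding slice_hom using n(1) k yk h by (auto simp: discrete_cat_def \<iota>_def) (auto simp: hom_def slice_def)
      fix g assume g: "g \<in> hom (slice C pt) nab y \<and> (\<forall>m \<in> Obj ?J. g \<cdot>\<^bsub>slice C pt\<^esub> \<iota> m = \<tau> m)"
      then have "g \<in> hom (slice C pt) nab y" by blast
      then obtain k' where "g = (nab, k', y)" "k' \<in> hom C (Dom C nab) (Dom C y)"
        unfolding slice_hom by blast
      then have k': "g = (nab, k', y)" "k' \<in> hom C S (Dom C y)" using homD(2)[OF n(1)] by simp_all
      have "g \<cdot>\<^bsub>slice C pt\<^esub> \<iota> 0 = (?i, h0, y)" "g \<cdot>\<^bsub>slice C pt\<^esub> \<iota> 1 = (?i, h1, y)"
        using g unfolding h(1,2)[symmetric] by (simp_all add: discrete_cat_def)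
      then have "k' \<cdot> i0 = h0" "k' \<cdot> i1 = h1" by (simp_all add: k' \<iota>_def slice_def)
      then have "k' = k" using coproduct_unique[OF S k'(2) k(1)] k by simp
      then show "g = (nab, k, y)" by (simp add: k')
    qed
  qed
  have col': "is_colimit C ?J (compose_ftor P' D) (FO P S) (\<lambda>m. FA P (if m = 0 then i0 else i1))"
    using pres'[unfolded preserves_finite_colimits_def, rule_format, OF conjI[OF J conjI[OF D col]]] n(1)
    by (simp add: P'_def \<iota>_def hom_def)
  have F: "is_functor C C P" using P by (simp add: product_functor_def)
  have Fi: "FA P i0 \<in> hom C (FO P pt) (FO P S)" "FA P i1 \<in> hom C (FO P pt) (FO P S)"
    using functor_hom[OF F ii(1)] functor_hom[OF F ii(2)] .
  have "\<exists>!h. h \<in> hom C (FO P S) X \<and> h \<cdot> FA P i0 = u \<and> h \<cdot> FA P i1 = v"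
    if uv: "u \<in> hom C (FO P pt) X" "v \<in> hom C (FO P pt) X" for X u v
  proof -
    have "is_cocone C ?J (compose_ftor P' D) X (\<lambda>m. if m = 0 then u else v)"
      using uv hom_ObjD(2)[OF uv(1)] pO functor_Ident[OF F pO] hom_ObjD(1)[OF uv(1)]
      by (simp add: is_cocone_def discrete_cat_def compose_ftor_def P'_def D_def) (simp add: slice_def hom_def)
    from col'[unfolded is_colimit_def, THEN conjunct2, rule_format, OF this]
    show ?thesis by (simp add: discrete_cat_def)
  qed
  then show ?thesis using Fi hom_ObjD(2)[OF Fi(1)] by (simp add: is_coproduct_def)
qed

text \<open>The cylinder obtained from the product functor lives on the product of \<open>A\<close>
  with \<open>pt\<close> instead of \<open>A\<close>; this isomorphism carries the resulting
  factorization back to \<open>A\<close>.\<close>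

lemma product_terminal_iso:
  assumes pt: "is_terminal C pt" and P: "is_product C A pt P p q" and A: "A \<in> Obj C"
  obtains s where "s \<in> hom C A P" "p \<cdot> s = Ident C A" "s \<cdot> p = Ident C P"
proof -
  note pq = product_hom[OF P]
  have PO: "P \<in> Obj C" by (rule hom_ObjD(1)[OF pq(1)])
  obtain f where f: "f \<in> hom C A pt" using terminal_hom[OF pt A] by blast
  obtain s where s: "s \<in> hom C A P" "p \<cdot> s = Ident C A" "q \<cdot> s = f" by (rule product_ex[OF P Ident_hom[OF A] f])
  have "s \<cdot> p = Ident C P"
  proof (rule product_unique[OF P Comp_hom[OF pq(1) s(1)] Ident_hom[OF PO]])
    have "p \<cdot> (s \<cdot> p) = (p \<cdot> s) \<cdot> p" using pq s(1) by (simp add: hom_def)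
    then show "p \<cdot> (s \<cdot> p) = p \<cdot> Ident C P" unfolding s(2) using pq A by (simp add: hom_def)
    show "q \<cdot> (s \<cdot> p) = q \<cdot> Ident C P"
      by (rule terminal_unique[OF pt Comp_hom[OF Comp_hom[OF pq(1) s(1)] pq(2)] Comp_hom[OF Ident_hom[OF PO] pq(2)]])
  qed
  then show thesis using that s by blast
qed

end

section \<open>The full subcategory of finitely presentable objects\<close>

context lfp_category
begin

abbreviation fps :: "('o, 'a) cat" where "fps \<equiv> full_subcat C {X. fp X}"

lemma fps_Obj: "X \<in> Obj fps \<longleftrightarrow> fp X"
  using fp_Obj by (auto simp: full_subcat_def)

lemma fps_hom: "f \<in> hom fps X Y \<longleftrightarrow> fp X \<and> fp Y \<and> f \<in> hom C X Y"
  by (auto simp: full_subcat_def hom_def)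

lemma fps_simps [simp]: "Comp fps = Comp C" "Ident fps = Ident C" "Dom fps = Dom C" "Cod fps = Cod C"
  by (simp_all add: full_subcat_def)

lemma category_fps: "category fps"
  by (rule category_full_subcat) (rule category_axioms)

text \<open>A coproduct in the full subcategory is tested against presentable objects only. The
  coproduct \<open>T\<close> in the whole category is itself presentable, so the two can be
  compared, and a retraction \<open>\<psi>\<close> of \<open>\<phi>\<close> that respects the
  injections transfers the universal property to \<open>S\<close>.\<close>

lemma coproduct_fps:
  assumes S: "is_coproduct fps A B S i j"
  shows "is_coproduct C A B S i j"
proof -
  interpret fps: category fps by (rule category_fps)
  note ij = fps.coproduct_hom[OF S, unfolded fps_hom]
  have fp: "fp A" "fp B" "fp S" and i: "i \<in> hom C A S" and j: "j \<in> hom C B S" using ij by auto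
  obtain T k l where T: "is_coproduct C A B T k l" and fpT: "fp A \<and> fp B \<longrightarrow> fp T"
    by (rule coproduct_exists[OF fp_Obj[OF fp(1)] fp_Obj[OF fp(2)]])
  have fpT': "fp T" using fpT fp by blast
  note kl = coproduct_hom[OF T]
  have "k \<in> hom fps A T" "l \<in> hom fps B T" using kl fp fpT' by (simp_all add: fps_hom)
  then obtain \<phi> where "\<phi> \<in> hom fps S T" "\<phi> \<cdot>\<^bsub>fps\<^esub> i = k" "\<phi> \<cdot>\<^bsub>fps\<^esub> j = l" by (rule fps.coproduct_ex[OF S])
  then have \<phi>: "\<phi> \<in> hom C S T" "\<phi> \<cdot> i = k" "\<phi> \<cdot> j = l" by (simp_all add: fps_hom)
  obtain \<psi> where \<psi>: "\<psi> \<in> hom C T S" "\<psi> \<cdot> k = i" "\<psi> \<cdot> l = j" by (rule coproduct_ex[OF T i j])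
  have SO: "S \<in> Obj C" by (rule fp_Obj[OF fp(3)])
  have id: "\<psi> \<cdot> \<phi> = Ident C S"
  proof (rule fps.coproduct_unique[OF S, where Y = S])
    show "\<psi> \<cdot> \<phi> \<in> hom fps S S" "Ident C S \<in> hom fps S S"
      using Comp_hom[OF \<phi>(1) \<psi>(1)] Ident_hom[OF SO] fp by (simp_all add: fps_hom)
    show "(\<psi> \<cdot> \<phi>) \<cdot>\<^bsub>fps\<^esub> i = Ident C S \<cdot>\<^bsub>fps\<^esub> i" "(\<psi> \<cdot> \<phi>) \<cdot>\<^bsub>fps\<^esub> j = Ident C S \<cdot>\<^bsub>fps\<^esub> j"
      using \<phi> \<psi> i j SO by (simp_all add: hom_def)
  qed
  have "\<exists>!h. h \<in> hom C S Y \<and> h \<cdot> i = u \<and> h \<cdot> j = v" if uv: "u \<in> hom C A Y" "v \<in> hom C B Y" for Y u v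
  proof -
    obtain h where h: "h \<in> hom C T Y" "h \<cdot> k = u" "h \<cdot> l = v" by (rule coproduct_ex[OF T uv])
    show ?thesis
    proof (rule ex1I[of _ "h \<cdot> \<phi>"])
      show "h \<cdot> \<phi> \<in> hom C S Y \<and> (h \<cdot> \<phi>) \<cdot> i = u \<and> (h \<cdot> \<phi>) \<cdot> j = v"
        using h \<phi> i j by (auto simp: hom_def)
      fix g assume g: "g \<in> hom C S Y \<and> g \<cdot> i = u \<and> g \<cdot> j = v"
      have "g \<cdot> \<psi> = h"
      proof (rule coproduct_unique[OF T Comp_hom[OF \<psi>(1)] h(1)])
        show "g \<in> hom C S Y" using g by blast
        show "(g \<cdot> \<psi>) \<cdot> k = h \<cdot> k" "(g \<cdot> \<psi>) \<cdot> l = h \<cdot> l" using g \<psi> h kl by (auto simp: hom_def)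
      qed
      then have "h \<cdot> \<phi> = g \<cdot> (\<psi> \<cdot> \<phi>)" using g \<psi>(1) \<phi>(1) by (auto simp: hom_def)
      then show "g = h \<cdot> \<phi>" unfolding id using g by (simp add: hom_def)
    qed
  qed
  then show ?thesis using i j SO by (simp add: is_coproduct_def)
qed

lemma coproduct_initial_pushout:
  assumes E: "is_initial C E" and e: "e \<in> hom C E A" "e' \<in> hom C E B" and S: "is_coproduct C A B S i j"
  shows "is_pushout C e' e S j i"
proof -
  note ij = coproduct_hom[OF S]
  have "j \<cdot> e' = i \<cdot> e" by (rule initial_unique[OF E Comp_hom[OF e(2) ij(2)] Comp_hom[OF e(1) ij(1)]])
  then show ?thesis using S e ij unfolding is_pushout_def is_coproduct_def
    by (simp add: homD[OF e(1)] homD[OF e(2)] conj_ac)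
qed

end

context lfp_model_category
begin

text \<open>The injection of \<open>A\<close> is a pushout of the map from the initial object to
  \<open>B\<close>, which is why the hypothesis concerns \<open>B\<close>.\<close>

lemma coproduct_Cof:
  assumes S: "is_coproduct C A B S i j" and B: "cofibrant C Cof B"
  shows "i \<in> Cof"
proof -
  obtain E e' where E: "is_initial C E" "e' \<in> hom C E B" "e' \<in> Cof" using B by (auto simp: cofibrant_def)
  obtain e where e: "e \<in> hom C E A" by (rule initial_hom[OF E(1) hom_ObjD(1)[OF coproduct_hom(1)[OF S]]])
  show ?thesis by (rule Cof_pushout[OF coproduct_initial_pushout[OF E(1) e E(2) S] E(2) e E(3)])
qed

lemma coproduct_sym: "is_coproduct C A B S i j \<Longrightarrow> is_coproduct C B A S j i"
  unfolding is_coproduct_def by (simp add: conj_ac)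

text \<open>\<open>I\<close> is a cylinder on \<open>A\<close> with ends \<open>j \<cdot> k0\<close>
  and \<open>j \<cdot> k1\<close>. The mapping cylinder \<open>Z\<close> glues it along both ends
  into the coproduct \<open>T\<close> of \<open>A\<close> and \<open>B\<close>, the second end by
  way of \<open>f\<close>. Gluing both ends at once makes \<open>c\<close> a cofibration, and with
  it the inclusion \<open>c \<cdot> a\<close> of \<open>A\<close>.\<close>

lemma mapping_cylinder:
  assumes A: "fp A" "cofibrant C Cof A" and B: "fp B" "cofibrant C Cof B" and f: "f \<in> hom C A B"
    and S: "is_coproduct C A A S k0 k1" and j: "j \<in> hom C S I" "j \<in> Cof" "fp I" "fp S"
    and r: "r \<in> hom C I A" "r \<in> W" "r \<cdot> (j \<cdot> k0) = Ident C A" "r \<cdot> (j \<cdot> k1) = Ident C A"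
  shows "\<exists>Z i p. fp Z \<and> i \<in> hom C A Z \<and> p \<in> hom C Z B \<and> p \<cdot> i = f \<and> i \<in> Cof \<and> p \<in> W"
proof -
  note AO = fp_Obj[OF A(1)] and BO = fp_Obj[OF B(1)] and k = coproduct_hom[OF S]
  obtain T a b where T: "is_coproduct C A B T a b" and "fp A \<and> fp B \<longrightarrow> fp T" by (rule coproduct_exists[OF AO BO])
  then have fpT: "fp T" using A B by blast
  note ab = coproduct_hom[OF T]
  obtain m where m: "m \<in> hom C S T" "m \<cdot> k0 = a" "m \<cdot> k1 = b \<cdot> f"
    by (rule coproduct_ex[OF S ab(1) Comp_hom[OF f ab(2)]])
  obtain Z w c where P: "is_pushout C j m Z w c" and wc: "w \<in> hom C I Z" "c \<in> hom C T Z" "w \<cdot> j = c \<cdot> m"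
    and fpZ: "fp S \<and> fp I \<and> fp T \<longrightarrow> fp Z" by (rule pushout_exists[OF j(1) m(1)])
  have fpZ': "fp Z" using fpZ j fpT by blast
  have cC: "c \<in> Cof" by (rule Cof_pushout[OF P j(1) m(1) j(2)])
  have iC: "c \<cdot> a \<in> Cof" by (rule Cof_Comp[OF ab(1) wc(2) coproduct_Cof[OF T B(2)] cC])
  obtain \<rho> where \<rho>: "\<rho> \<in> hom C T B" "\<rho> \<cdot> a = f" "\<rho> \<cdot> b = Ident C B" by (rule coproduct_ex[OF T f Ident_hom[OF BO]])
  have "(f \<cdot> r) \<cdot> j = \<rho> \<cdot> m"
  proof (rule coproduct_unique[OF S Comp_hom[OF j(1) Comp_hom[OF r(1) f]] Comp_hom[OF m(1) \<rho>(1)]])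
    have "((f \<cdot> r) \<cdot> j) \<cdot> k0 = f \<cdot> (r \<cdot> (j \<cdot> k0))" using f r(1) j(1) k by (simp add: hom_def)
    then show "((f \<cdot> r) \<cdot> j) \<cdot> k0 = (\<rho> \<cdot> m) \<cdot> k0" unfolding r(3) using m \<rho> f k by (simp add: hom_def)
    have "((f \<cdot> r) \<cdot> j) \<cdot> k1 = f \<cdot> (r \<cdot> (j \<cdot> k1))" using f r(1) j(1) k by (simp add: hom_def)
    also have "\<dots> = (\<rho> \<cdot> b) \<cdot> f" unfolding r(4) \<rho>(3) using f BO by (simp add: hom_def)
    finally show "((f \<cdot> r) \<cdot> j) \<cdot> k1 = (\<rho> \<cdot> m) \<cdot> k1" using m \<rho>(1) f k ab by (simp add: hom_def)
  qed
  then obtain p where p: "p \<in> hom C Z B" "p \<cdot> w = f \<cdot> r" "p \<cdot> c = \<rho>"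
    by (rule pushout_ex[OF P j(1) m(1) Comp_hom[OF r(1) f] \<rho>(1)])
  have "p \<cdot> (c \<cdot> a) = (p \<cdot> c) \<cdot> a" using p(1) wc(2) ab(1) by (simp add: hom_def)
  then have pca: "p \<cdot> (c \<cdot> a) = f" unfolding p(3) \<rho>(2) .
  have jk: "j \<cdot> k1 \<in> hom C A I" by (rule Comp_hom[OF k(2) j(1)])
  have jkC: "j \<cdot> k1 \<in> Cof" by (rule Cof_Comp[OF k(2) j(1) coproduct_Cof[OF coproduct_sym[OF S] A(2)] j(2)])
  have jkW: "j \<cdot> k1 \<in> W" using two_of_three(3)[OF jk r(1,2)] r(4) Ident_W[OF AO] by simp
  have cb: "c \<cdot> b \<in> hom C B Z" by (rule Comp_hom[OF ab(2) wc(2)])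
  \<comment> \<open>The same \<open>Z\<close> is the pushout of the single end
    \<open>j \<cdot> k1\<close> along \<open>f\<close>. That end is a trivial cofibration, so the
    inclusion \<open>c \<cdot> b\<close> of \<open>B\<close> is a weak equivalence; it is also a
    section of \<open>p\<close>, whence \<open>p\<close> is a weak equivalence.\<close>
  have P': "is_pushout C (j \<cdot> k1) f Z w (c \<cdot> b)"
    unfolding is_pushout_def
  proof (intro conjI allI impI)
    show "j \<cdot> k1 \<in> Arr C" "f \<in> Arr C" "Dom C (j \<cdot> k1) = Dom C f" "w \<in> hom C (Cod C (j \<cdot> k1)) Z"
      "c \<cdot> b \<in> hom C (Cod C f) Z" using jk f wc cb by (simp_all add: hom_def)
    have "w \<cdot> (j \<cdot> k1) = (w \<cdot> j) \<cdot> k1" using wc(1) j(1) k by (simp add: hom_def)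
    also have "\<dots> = c \<cdot> (m \<cdot> k1)" unfolding wc(3) using wc(2) m(1) k by (simp add: hom_def)
    finally show "w \<cdot> (j \<cdot> k1) = (c \<cdot> b) \<cdot> f" unfolding m(3) using wc(2) ab f by (simp add: hom_def)
    fix Y z y assume "z \<in> hom C (Cod C (j \<cdot> k1)) Y \<and> y \<in> hom C (Cod C f) Y \<and> z \<cdot> (j \<cdot> k1) = y \<cdot> f"
    then have z: "z \<in> hom C I Y" and y: "y \<in> hom C B Y" and eq: "z \<cdot> (j \<cdot> k1) = y \<cdot> f"
      using homD(3)[OF jk] homD(3)[OF f] by auto
    obtain t where t: "t \<in> hom C T Y" "t \<cdot> a = z \<cdot> (j \<cdot> k0)" "t \<cdot> b = y"
      by (rule coproduct_ex[OF T Comp_hom[OF Comp_hom[OF k(1) j(1)] z] y])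
    have "z \<cdot> j = t \<cdot> m"
    proof (rule coproduct_unique[OF S Comp_hom[OF j(1) z] Comp_hom[OF m(1) t(1)]])
      show "(z \<cdot> j) \<cdot> k0 = (t \<cdot> m) \<cdot> k0" using z j(1) k m t by (simp add: hom_def)
      have "(t \<cdot> m) \<cdot> k1 = (t \<cdot> b) \<cdot> f" using m t(1) k ab f by (simp add: hom_def)
      then show "(z \<cdot> j) \<cdot> k1 = (t \<cdot> m) \<cdot> k1" unfolding t(3) eq[symmetric] using z j(1) k by (simp add: hom_def)
    qed
    then obtain h where h: "h \<in> hom C Z Y" "h \<cdot> w = z" "h \<cdot> c = t" by (rule pushout_ex[OF P j(1) m(1) z t(1)])
    show "\<exists>!h. h \<in> hom C Z Y \<and> h \<cdot> w = z \<and> h \<cdot> (c \<cdot> b) = y"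
    proof (rule ex1I[of _ h])
      have "h \<cdot> (c \<cdot> b) = (h \<cdot> c) \<cdot> b" using h(1) wc(2) ab by (simp add: hom_def)
      then show "h \<in> hom C Z Y \<and> h \<cdot> w = z \<and> h \<cdot> (c \<cdot> b) = y" using h t(3) by simp
      fix g assume "g \<in> hom C Z Y \<and> g \<cdot> w = z \<and> g \<cdot> (c \<cdot> b) = y"
      then have g: "g \<in> hom C Z Y" "g \<cdot> w = z" "g \<cdot> (c \<cdot> b) = y" by auto
      have "g \<cdot> c = t"
      proof (rule coproduct_unique[OF T Comp_hom[OF wc(2) g(1)] t(1)])
        have "(g \<cdot> c) \<cdot> a = (g \<cdot> (c \<cdot> m)) \<cdot> k0" unfolding m(2)[symmetric] using g(1) wc(2) m(1) k by (simp add: hom_def)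
        also have "\<dots> = (g \<cdot> w) \<cdot> (j \<cdot> k0)" unfolding wc(3)[symmetric] using g(1) wc(1) j(1) k by (simp add: hom_def)
        finally show "(g \<cdot> c) \<cdot> a = t \<cdot> a" unfolding g(2) t(2) .
        show "(g \<cdot> c) \<cdot> b = t \<cdot> b" unfolding t(3) g(3)[symmetric] using g(1) wc(2) ab by (simp add: hom_def)
      qed
      then show "g = h" using pushout_unique[OF P j(1) m(1) g(1) h(1)] g h by simp
    qed
  qed
  have cbW: "c \<cdot> b \<in> W" by (rule trivial_cofibration_pushout(1)[OF P' jk f jkW jkC])
  have "p \<cdot> (c \<cdot> b) = (p \<cdot> c) \<cdot> b" using p(1) wc(2) ab by (simp add: hom_def)
  then have "p \<cdot> (c \<cdot> b) \<in> W" unfolding p(3) \<rho>(3) using Ident_W[OF BO] by simp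
  then have "p \<in> W" by (rule two_of_three(2)[OF cb p(1) cbW])
  then show ?thesis using fpZ' Comp_hom[OF ab(1) wc(2)] p(1) pca iC by blast
qed

text \<open>The product functor of \<open>A\<close>, applied to the given factorization of the fold
  map, yields a cylinder on the product of \<open>A\<close> with \<open>pt\<close>:
  \<open>product_functor_coproduct\<close> identifies the image of \<open>S\<close> as a coproduct,
  and preservation of cofibrations and weak equivalences does the rest.\<close>

lemma presentable_factorization:
  assumes limits: "has_finite_limits fps" and pt: "is_terminal fps pt"
    and fold: "is_fold_map fps pt S i0 i1 nab"
    and cylinder: "j \<in> hom fps S I" "j \<in> Cof" "q \<in> hom fps I pt" "q \<in> W" "q \<cdot> j = nab"
    and pullbacks: "\<And>f P p1 p2. f \<in> Arr fps \<Longrightarrow> pullback_functor fps f P p1 p2 \<Longrightarrow>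
      preserves_finite_colimits (slice fps (Cod C f)) fps P"
    and cofibrant: "\<And>X. fp X \<Longrightarrow> cofibrant C Cof X"
    and products: "\<And>B P p1 p2. fp B \<Longrightarrow> product_functor fps B P p1 p2 \<Longrightarrow>
      (\<forall>f \<in> Arr fps \<inter> Cof. FA P f \<in> Cof) \<and> (\<forall>f \<in> Arr fps \<inter> W. FA P f \<in> W)"
    and A: "fp A" and B: "fp B" and f: "f \<in> hom C A B"
  shows "\<exists>Z i p. fp Z \<and> i \<in> hom C A Z \<and> p \<in> hom C Z B \<and> p \<cdot> i = f \<and> i \<in> Cof \<and> p \<in> W"
proof -
  interpret fps: category fps by (rule category_fps)
  have "\<exists>P p1 p2. product_functor fps A P p1 p2"
    using A by (intro fps.product_functor_exists fps.finite_limits_product[OF limits]) (simp_all add: fps_Obj)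
  then obtain P p1 p2 where P: "product_functor fps A P p1 p2" by blast
  have AM: "A \<in> Obj fps" using A by (simp add: fps_Obj)
  have F: "is_functor fps fps P" and pr: "is_product fps A pt (FO P pt) (p1 pt) (p2 pt)"
    using P pt by (auto simp: product_functor_def is_terminal_def)
  have ptM: "pt \<in> Obj fps" using pt by (simp add: is_terminal_def)
  have cop: "is_coproduct fps (FO P pt) (FO P pt) (FO P S) (FA P i0) (FA P i1)"
    by (rule fps.product_functor_coproduct[OF pt P AM fold]) (unfold fps_simps, rule pullbacks)
  let ?A = "FO P pt"
  note S = coproduct_fps[OF cop]
  have S0: "is_coproduct fps pt pt S i0 i1" and n: "nab \<in> hom fps S pt" "nab \<cdot> i0 = Ident C pt" "nab \<cdot> i1 = Ident C pt"
    using fold by (auto simp: is_fold_map_def)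
  note ii = fps.coproduct_hom[OF S0]
  have fpA: "fp ?A" using functor_Obj[OF F ptM] by (simp add: fps_Obj)
  note Fj = functor_hom[OF F cylinder(1)] and Fq = functor_hom[OF F cylinder(3)]
  have j': "FA P j \<in> hom C (FO P S) (FO P I)" "fp (FO P S)" "fp (FO P I)" using Fj by (auto simp: fps_hom)
  have q': "FA P q \<in> hom C (FO P I) ?A" using Fq by (auto simp: fps_hom)
  have jC: "FA P j \<in> Cof" using products[OF A P] cylinder(2) homD(1)[OF cylinder(1)] by blast
  have qW: "FA P q \<in> W" using products[OF A P] cylinder(4) homD(1)[OF cylinder(3)] by blast
  have qji: "FA P q \<cdot> (FA P j \<cdot> FA P k) = Ident C ?A" if k: "k \<in> hom fps pt S" "nab \<cdot> k = Ident C pt" for k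
  proof -
    have "k \<in> hom C pt S" "j \<in> hom C S I" "q \<in> hom C I pt"
      using k(1) cylinder(1,3) by (simp_all add: fps_hom)
    moreover have "(q \<cdot> j) \<cdot> k = Ident C pt" unfolding cylinder(5) by (rule k(2))
    ultimately have "q \<cdot> (j \<cdot> k) = Ident C pt" by (simp add: hom_def)
    moreover have "j \<cdot> k \<in> hom fps pt I" using fps.Comp_hom[OF k(1) cylinder(1)] by simp
    ultimately show ?thesis
      using functor_Comp[OF F k(1) cylinder(1)] functor_Comp[OF F _ cylinder(3), of "j \<cdot> k" pt]
        functor_Ident[OF F ptM] by simp
  qed
  \<comment> \<open>\<open>s\<close> identifies \<open>A\<close> with its product with the terminal
    object; being an isomorphism it is a cofibration and may be put in front of
    \<open>i\<close>.\<close>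
  obtain s where s: "s \<in> hom fps A ?A" "p1 pt \<cdot>\<^bsub>fps\<^esub> s = Ident fps A" "s \<cdot>\<^bsub>fps\<^esub> p1 pt = Ident fps ?A"
    by (rule fps.product_terminal_iso[OF pt pr AM])
  have s': "s \<in> hom C A ?A" "p1 pt \<cdot> s = Ident C A" "s \<cdot> p1 pt = Ident C ?A" using s by (auto simp: fps_hom)
  have p1: "p1 pt \<in> hom C ?A A" using fps.product_hom(1)[OF pr] by (simp add: fps_hom)
  have sC: "s \<in> Cof" by (rule iso_W_Cof(2)[OF s'(1) p1 s'(2,3)])
  obtain Z i p where Z: "fp Z" "i \<in> hom C ?A Z" "p \<in> hom C Z B" "p \<cdot> i = f \<cdot> p1 pt" "i \<in> Cof" "p \<in> W"
    using mapping_cylinder[OF fpA cofibrant[OF fpA] B cofibrant[OF B] Comp_hom[OF p1 f] S j'(1) jC j'(3,2) q' qW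
        qji[OF ii(1) n(2)] qji[OF ii(2) n(3)]] by blast
  have "p \<cdot> (i \<cdot> s) = (p \<cdot> i) \<cdot> s" using Z(2,3) s'(1) by (simp add: hom_def)
  also have "\<dots> = f \<cdot> (p1 pt \<cdot> s)" unfolding Z(4) using f p1 s'(1) by (simp add: hom_def)
  finally have "p \<cdot> (i \<cdot> s) = f" unfolding s'(2) using f by (simp add: hom_def)
  then show ?thesis using Z(1,3,6) Comp_hom[OF s'(1) Z(2)] Cof_Comp[OF s'(1) Z(2) sC Z(5)] by blast
qed

end

section \<open>Accessibility of classes of arrows\<close>

context lfp_category
begin

text \<open>
  Presentable objects are retracts of generators, hence determined up to isomorphism by an
  idempotent of a generator.
\<close>

lemma small_skeleton:
  obtains R where "small U R" "\<forall>A \<in> R. fp A"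
    "\<forall>A. fp A \<longrightarrow> (\<exists>B \<in> R. \<exists>\<phi> \<in> hom C A B. \<exists>\<psi> \<in> hom C B A. \<psi> \<cdot> \<phi> = Ident C A \<and> \<phi> \<cdot> \<psi> = Ident C B)"
proof -
  obtain G where G: "G \<subseteq> Obj C" "small U G" "\<forall>A \<in> G. fp A" and dense: "\<forall>X \<in> Obj C. \<exists>(J :: ('u, 'u) cat) D \<iota>.
      small_category J \<and> filtered natLeq J \<and> is_functor J C D \<and> FO D ` Obj J \<subseteq> G \<and> is_colimit C J D X \<iota>"
    using accessible unfolding accessible_def by (elim conjE exE) blast
  \<comment> \<open>\<open>splits e B\<close> says that the endomorphism \<open>e\<close> of a
    generator is an idempotent split by the presentable object \<open>B\<close>. \<open>R\<close>
    collects one such object for each \<open>e\<close> that splits, and the generators have only a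
    small set of endomorphisms.\<close>
  define splits where "splits e B \<longleftrightarrow> fp B \<and> (\<exists>g \<in> G. \<exists>s \<in> hom C B g. \<exists>r \<in> hom C g B. r \<cdot> s = Ident C B \<and> s \<cdot> r = e)" for e B
  define sp where "sp e = (SOME B. splits e B)" for e
  define R where "R = sp ` {e \<in> (\<Union>g \<in> G. hom C g g). \<exists>B. splits e B}"
  have "small U (\<Union>g \<in> G. hom C g g)" using G(1) by (intro small_UN[OF universe G(2)] small_hom) auto
  then have "small U {e \<in> (\<Union>g \<in> G. hom C g g). \<exists>B. splits e B}" by (rule small_subset) blast
  then have R: "small U R" unfolding R_def by (rule small_image)
  have sp: "splits e (sp e)" if "splits e B" for e B unfolding sp_def using that by (rule someI)
  show thesis
  proof (rule that[OF R], safe)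
    show "fp A" if "A \<in> R" for A using that sp unfolding R_def splits_def by blast
  next
    fix A assume A: "fp A"
    note AO = fp_Obj[OF A]
    obtain J :: "('u, 'u) cat" and D \<iota> where J: "small_category J" "filtered natLeq J" "is_functor J C D"
      "FO D ` Obj J \<subseteq> G" "is_colimit C J D A \<iota>" using dense AO by blast
    have "universe TYPE('u)" using universe by (simp add: universe_def)
    then have filt: "filt J" using J(2) by (rule filtered_imp_filt)
    have small: "small U (Arr J)" using J(1) by (simp add: small_category_def small_def)
    \<comment> \<open>Lifting the identity of \<open>A\<close> along its own presentation makes
      \<open>A\<close> a retract of the generator \<open>FO D i\<close>.\<close>
    obtain i s where i: "i \<in> Obj J" "s \<in> hom C A (FO D i)" "\<iota> i \<cdot> s = Ident C A"
      by (rule presentable_surj[OF A filt small J(3,5) Ident_hom[OF AO]])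
    have \<iota>: "\<iota> i \<in> hom C (FO D i) A" by (rule cocone_hom[OF colimit_cocone[OF J(5)] i(1)])
    have g: "FO D i \<in> G" using J(4) i(1) by blast
    define e where "e = s \<cdot> \<iota> i"
    have eA: "splits e A" unfolding splits_def using A g i \<iota> e_def by blast
    have "e \<in> hom C (FO D i) (FO D i)" unfolding e_def by (rule Comp_hom[OF \<iota> i(2)])
    then have B: "sp e \<in> R" using g eA unfolding R_def by blast
    obtain g' s' r' where s': "s' \<in> hom C (sp e) g'" "r' \<in> hom C g' (sp e)" "r' \<cdot> s' = Ident C (sp e)" "s' \<cdot> r' = e"
      using sp[OF eA] unfolding splits_def by blast
    \<comment> \<open>\<open>splits\<close> does not name the generator; it is recovered as the
      domain of \<open>e\<close>.\<close>
    have "g' = FO D i" using s'(4) s'(1,2) \<iota> i(2) unfolding e_def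
      by (metis Dom_Comp homD(1) homD(2) homD(3))
    note s' = s'[unfolded this]
    \<comment> \<open>Two objects that split the same idempotent are isomorphic: each inclusion
      followed by the other retraction gives the two inverse maps.\<close>
    have "(\<iota> i \<cdot> s') \<cdot> (r' \<cdot> s) = \<iota> i \<cdot> ((s' \<cdot> r') \<cdot> s)" using \<iota> i(2) s'(1,2) by (simp add: hom_def)
    also have "\<dots> = (\<iota> i \<cdot> s) \<cdot> (\<iota> i \<cdot> s)" unfolding s'(4) e_def using \<iota> i(2) by (simp add: hom_def)
    finally have 1: "(\<iota> i \<cdot> s') \<cdot> (r' \<cdot> s) = Ident C A" unfolding i(3) using AO by simp
    have spO: "sp e \<in> Obj C" by (rule hom_ObjD(1)[OF s'(1)])
    have "(r' \<cdot> s) \<cdot> (\<iota> i \<cdot> s') = r' \<cdot> ((s \<cdot> \<iota> i) \<cdot> s')" using \<iota> i(2) s'(1,2) by (simp add: hom_def)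
    also have "\<dots> = (r' \<cdot> s') \<cdot> (r' \<cdot> s')" unfolding e_def[symmetric] s'(4)[symmetric] using s'(1,2) by (simp add: hom_def)
    finally have 2: "(r' \<cdot> s) \<cdot> (\<iota> i \<cdot> s') = Ident C (sp e)" unfolding s'(3) using spO by simp
    show "\<exists>B \<in> R. \<exists>\<phi> \<in> hom C A B. \<exists>\<psi> \<in> hom C B A. \<psi> \<cdot> \<phi> = Ident C A \<and> \<phi> \<cdot> \<psi> = Ident C B"
      using B Comp_hom[OF i(2) s'(2)] Comp_hom[OF s'(1) \<iota>] 1 2 by blast
  qed
qed

end

text \<open>Isolates the one property of weak equivalences on which accessibility rests: they are
  exactly the arrows that factor via weak equivalences between presentable objects.\<close>

locale arrow_class = lfp_category C U for C :: "('o, 'a) cat" (structure) and U :: "'u itself" +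
  fixes W :: "'a set"
  assumes W_iff: "\<And>f. f \<in> W \<longleftrightarrow> factors_via W f"
begin

lemma W_Arr: "f \<in> W \<Longrightarrow> f \<in> Arr C"
  using W_iff[of f] by (simp add: factors_via_def)

lemma W_hom: "f \<in> W \<Longrightarrow> f \<in> hom C (Dom C f) (Cod C f)"
  using W_Arr by (simp add: hom_def)

abbreviation AW :: "('a, 'a \<times> 'a \<times> 'a \<times> 'a) cat" where "AW \<equiv> full_subcat (arrow_cat C) W"

lemma AW_Obj: "Obj AW = W"
  using W_Arr by (auto simp: full_subcat_def arrow_cat_def)

lemma AW_hom: "z \<in> hom AW f g \<longleftrightarrow> (\<exists>u v. z = (f, u, v, g) \<and> f \<in> W \<and> g \<in> W \<and>
    u \<in> hom C (Dom C f) (Dom C g) \<and> v \<in> hom C (Cod C f) (Cod C g) \<and> v \<cdot> f = g \<cdot> u)"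
  using W_Arr by (cases z) (auto simp: full_subcat_def arrow_cat_def hom_def)

lemma AW_homI: "f \<in> W \<Longrightarrow> g \<in> W \<Longrightarrow> u \<in> hom C (Dom C f) (Dom C g) \<Longrightarrow> v \<in> hom C (Cod C f) (Cod C g) \<Longrightarrow>
    v \<cdot> f = g \<cdot> u \<Longrightarrow> (f, u, v, g) \<in> hom AW f g"
  by (simp add: AW_hom)

lemma AW_Comp: "(g, u', v', h) \<cdot>\<^bsub>AW\<^esub> (f, u, v, g') = (f, u' \<cdot> u, v' \<cdot> v, h)"
  by (simp add: full_subcat_def arrow_cat_def)

lemma category_AW: "category AW"
  by (intro category_full_subcat category_arrow_cat category_axioms)

lemma AW_small_hom: "f \<in> W \<Longrightarrow> g \<in> W \<Longrightarrow> small U (hom AW f g)"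
proof -
  assume f: "f \<in> W" and g: "g \<in> W"
  let ?H = "hom C (Dom C f) (Dom C g) \<times> hom C (Cod C f) (Cod C g)"
  have "small U ?H" using W_Arr[OF f] W_Arr[OF g] by (intro small_Times[OF universe] small_hom) simp_all
  then have "small U ((\<lambda>(u, v). (f, u, v, g)) ` ?H)" by (rule small_image)
  then show ?thesis by (rule small_subset) (auto simp: AW_hom)
qed

definition dom_ftor :: "('i, 'j, 'a, 'a \<times> 'a \<times> 'a \<times> 'a) ftor \<Rightarrow> ('i, 'j, 'o, 'a) ftor" where
  "dom_ftor D = \<lparr>FO = \<lambda>i. Dom C (FO D i), FA = \<lambda>\<alpha>. fst (snd (FA D \<alpha>))\<rparr>"

definition cod_ftor :: "('i, 'j, 'a, 'a \<times> 'a \<times> 'a \<times> 'a) ftor \<Rightarrow> ('i, 'j, 'o, 'a) ftor" where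
  "cod_ftor D = \<lparr>FO = \<lambda>i. Cod C (FO D i), FA = \<lambda>\<alpha>. fst (snd (snd (FA D \<alpha>)))\<rparr>"

context
  fixes J :: "('i, 'j) cat" and D
  assumes J: "category J" and D: "is_functor J AW D"
begin

lemma FO_W: "i \<in> Obj J \<Longrightarrow> FO D i \<in> W"
  using functor_Obj[OF D] by (simp add: AW_Obj)

lemma FA_AW:
  assumes "\<alpha> \<in> hom J i k"
  shows "FA D \<alpha> = (FO D i, FA (dom_ftor D) \<alpha>, FA (cod_ftor D) \<alpha>, FO D k)"
    "FA (dom_ftor D) \<alpha> \<in> hom C (Dom C (FO D i)) (Dom C (FO D k))"
    "FA (cod_ftor D) \<alpha> \<in> hom C (Cod C (FO D i)) (Cod C (FO D k))"
    "FA (cod_ftor D) \<alpha> \<cdot> FO D i = FO D k \<cdot> FA (dom_ftor D) \<alpha>"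
  using functor_hom[OF D assms] by (auto simp: AW_hom dom_ftor_def cod_ftor_def)

lemma functor_dom_cod: "is_functor J C (dom_ftor D)" "is_functor J C (cod_ftor D)"
proof -
  have h: "\<alpha> \<in> hom J (Dom J \<alpha>) (Cod J \<alpha>)" if "\<alpha> \<in> Arr J" for \<alpha> using that by (simp add: hom_def)
  have c: "FA D (\<beta> \<cdot>\<^bsub>J\<^esub> \<alpha>) = FA D \<beta> \<cdot>\<^bsub>AW\<^esub> FA D \<alpha>" if "\<alpha> \<in> Arr J" "\<beta> \<in> Arr J" "Dom J \<beta> = Cod J \<alpha>" for \<alpha> \<beta>
    using D that by (simp add: is_functor_def)
  have i: "FA D (Ident J i) = (FO D i, Ident C (Dom C (FO D i)), Ident C (Cod C (FO D i)), FO D i)" if "i \<in> Obj J" for i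
    using functor_Ident[OF D that] by (simp add: full_subcat_def arrow_cat_def)
  have c2: "FA (dom_ftor D) (\<beta> \<cdot>\<^bsub>J\<^esub> \<alpha>) = FA (dom_ftor D) \<beta> \<cdot> FA (dom_ftor D) \<alpha> \<and>
      FA (cod_ftor D) (\<beta> \<cdot>\<^bsub>J\<^esub> \<alpha>) = FA (cod_ftor D) \<beta> \<cdot> FA (cod_ftor D) \<alpha>"
    if a: "\<alpha> \<in> Arr J" "\<beta> \<in> Arr J" "Dom J \<beta> = Cod J \<alpha>" for \<alpha> \<beta>
  proof -
    have "FA D (\<beta> \<cdot>\<^bsub>J\<^esub> \<alpha>) = (FO D (Dom J \<alpha>), FA (dom_ftor D) \<beta> \<cdot> FA (dom_ftor D) \<alpha>,
        FA (cod_ftor D) \<beta> \<cdot> FA (cod_ftor D) \<alpha>, FO D (Cod J \<beta>))"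
      unfolding c[OF a] FA_AW(1)[OF h[OF a(1)]] FA_AW(1)[OF h[OF a(2)]] AW_Comp ..
    then show ?thesis by (simp add: dom_ftor_def cod_ftor_def)
  qed
  show "is_functor J C (dom_ftor D)"
    unfolding is_functor_def
  proof (intro conjI ballI impI)
    show "FO (dom_ftor D) i \<in> Obj C" if "i \<in> Obj J" for i using W_Arr[OF FO_W[OF that]] by (simp add: dom_ftor_def)
    show "FA (dom_ftor D) \<alpha> \<in> hom C (FO (dom_ftor D) (Dom J \<alpha>)) (FO (dom_ftor D) (Cod J \<alpha>))" if "\<alpha> \<in> Arr J" for \<alpha>
      using FA_AW(2)[OF h[OF that]] by (simp add: dom_ftor_def)
    show "FA (dom_ftor D) (Ident J i) = Ident C (FO (dom_ftor D) i)" if "i \<in> Obj J" for i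
      using i[OF that] by (simp add: dom_ftor_def)
  qed (use c2 in blast)
  show "is_functor J C (cod_ftor D)"
    unfolding is_functor_def
  proof (intro conjI ballI impI)
    show "FO (cod_ftor D) i \<in> Obj C" if "i \<in> Obj J" for i using W_Arr[OF FO_W[OF that]] by (simp add: cod_ftor_def)
    show "FA (cod_ftor D) \<alpha> \<in> hom C (FO (cod_ftor D) (Dom J \<alpha>)) (FO (cod_ftor D) (Cod J \<alpha>))" if "\<alpha> \<in> Arr J" for \<alpha>
      using FA_AW(3)[OF h[OF that]] by (simp add: cod_ftor_def)
    show "FA (cod_ftor D) (Ident J i) = Ident C (FO (cod_ftor D) i)" if "i \<in> Obj J" for i
      using i[OF that] by (simp add: cod_ftor_def)
  qed (use c2 in blast)
qed

lemma cocone_dom_cod: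
  assumes c: "is_cocone AW J D f \<tau>"
  shows "is_cocone C J (dom_ftor D) (Dom C f) (\<lambda>i. fst (snd (\<tau> i)))"
    "is_cocone C J (cod_ftor D) (Cod C f) (\<lambda>i. fst (snd (snd (\<tau> i))))"
proof -
  have f: "f \<in> W" using c by (simp add: is_cocone_def AW_Obj)
  have h: "\<exists>u v. \<tau> i = (FO D i, u, v, f) \<and> u \<in> hom C (Dom C (FO D i)) (Dom C f) \<and> v \<in> hom C (Cod C (FO D i)) (Cod C f)"
    if "i \<in> Obj J" for i using cocone_hom[OF c that] by (auto simp: AW_hom)
  have n: "fst (snd (\<tau> k)) \<cdot> FA (dom_ftor D) \<alpha> = fst (snd (\<tau> i)) \<and>
      fst (snd (snd (\<tau> k))) \<cdot> FA (cod_ftor D) \<alpha> = fst (snd (snd (\<tau> i)))"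
    if a: "i \<in> Obj J" "k \<in> Obj J" "\<alpha> \<in> hom J i k" for i k \<alpha>
  proof -
    obtain u v where t: "\<tau> k = (FO D k, u, v, f)" using h[OF a(2)] by blast
    have "\<tau> i = (FO D i, u \<cdot> FA (dom_ftor D) \<alpha>, v \<cdot> FA (cod_ftor D) \<alpha>, f)"
      unfolding cocone_Comp[OF c a(3), symmetric] t FA_AW(1)[OF a(3)] AW_Comp ..
    then show ?thesis by (simp add: t)
  qed
  show "is_cocone C J (dom_ftor D) (Dom C f) (\<lambda>i. fst (snd (\<tau> i)))"
    by (rule is_coconeI[OF _ _ _ J]) (use h n W_Arr[OF f] in \<open>fastforce simp: dom_ftor_def\<close>)+
  show "is_cocone C J (cod_ftor D) (Cod C f) (\<lambda>i. fst (snd (snd (\<tau> i))))"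
    by (rule is_coconeI[OF _ _ _ J]) (use h n W_Arr[OF f] in \<open>fastforce simp: cod_ftor_def\<close>)+
qed

text \<open>Colimits of arrows are computed on domains and codomains separately; as the subcategory
  is full, the vertex \<open>f\<close> only has to lie in \<open>W\<close>.\<close>

lemma pointwise_colimit:
  assumes X: "is_colimit C J (dom_ftor D) X \<iota>" and Y: "is_colimit C J (cod_ftor D) Y \<kappa>"
    and f: "f \<in> W" "f \<in> hom C X Y" and eq: "\<And>i. i \<in> Obj J \<Longrightarrow> f \<cdot> \<iota> i = \<kappa> i \<cdot> FO D i"
  shows "is_colimit AW J D f (\<lambda>i. (FO D i, \<iota> i, \<kappa> i, f))"
proof -
  note fh = homD[OF f(2)]
  have \<iota>: "\<iota> i \<in> hom C (Dom C (FO D i)) X" if "i \<in> Obj J" for i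
    using cocone_hom[OF colimit_cocone[OF X] that] by (simp add: dom_ftor_def)
  have \<kappa>: "\<kappa> i \<in> hom C (Cod C (FO D i)) Y" if "i \<in> Obj J" for i
    using cocone_hom[OF colimit_cocone[OF Y] that] by (simp add: cod_ftor_def)
  show ?thesis
  proof (rule category.is_colimitI[OF category_AW])
    show "is_cocone AW J D f (\<lambda>i. (FO D i, \<iota> i, \<kappa> i, f))"
    proof (rule is_coconeI[OF _ _ _ J])
      show "f \<in> Obj AW" using f by (simp add: AW_Obj)
      show "(FO D i, \<iota> i, \<kappa> i, f) \<in> hom AW (FO D i) f" if "i \<in> Obj J" for i
        by (rule AW_homI) (use FO_W[OF that] f(1) \<iota>[OF that] \<kappa>[OF that] eq[OF that] fh in simp_all)
      fix i k \<alpha> assume a: "i \<in> Obj J" "k \<in> Obj J" "\<alpha> \<in> hom J i k"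
      show "(FO D k, \<iota> k, \<kappa> k, f) \<cdot>\<^bsub>AW\<^esub> FA D \<alpha> = (FO D i, \<iota> i, \<kappa> i, f)"
        unfolding FA_AW(1)[OF a(3)] AW_Comp
          cocone_Comp[OF colimit_cocone[OF X] a(3)] cocone_Comp[OF colimit_cocone[OF Y] a(3)] ..
    qed
  next
    fix g \<tau> assume c: "is_cocone AW J D g \<tau>"
    have g: "g \<in> W" using c by (simp add: is_cocone_def AW_Obj)
    note gh = W_hom[OF g]
    define u v where "u i = fst (snd (\<tau> i))" "v i = fst (snd (snd (\<tau> i)))" for i
    have \<tau>: "\<tau> i = (FO D i, u i, v i, g)" "u i \<in> hom C (Dom C (FO D i)) (Dom C g)"
        "v i \<in> hom C (Cod C (FO D i)) (Cod C g)" "v i \<cdot> FO D i = g \<cdot> u i" if "i \<in> Obj J" for i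
      using cocone_hom[OF c that] by (auto simp: AW_hom u_v_def)
    obtain h where h: "h \<in> hom C X (Dom C g)" "\<forall>i \<in> Obj J. h \<cdot> \<iota> i = u i"
      using colimit_ex[OF X cocone_dom_cod(1)[OF c]] unfolding u_v_def by blast
    obtain k where k: "k \<in> hom C Y (Cod C g)" "\<forall>i \<in> Obj J. k \<cdot> \<kappa> i = v i"
      using colimit_ex[OF Y cocone_dom_cod(2)[OF c]] unfolding u_v_def by blast
    have "k \<cdot> f = g \<cdot> h"
    proof (rule colimit_unique[OF X J functor_dom_cod(1) Comp_hom[OF f(2) k(1)] Comp_hom[OF h(1) gh]])
      fix i assume i: "i \<in> Obj J"
      note Di = W_hom[OF FO_W[OF i]]
      have "(k \<cdot> f) \<cdot> \<iota> i = k \<cdot> (f \<cdot> \<iota> i)" using k(1) f(2) \<iota>[OF i] by (simp add: hom_def)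
      also have "\<dots> = (k \<cdot> \<kappa> i) \<cdot> FO D i" unfolding eq[OF i] using k(1) \<kappa>[OF i] Di by (simp add: hom_def)
      also have "\<dots> = g \<cdot> (h \<cdot> \<iota> i)" using k(2) h(2) i \<tau>(4)[OF i] by simp
      finally show "(k \<cdot> f) \<cdot> \<iota> i = (g \<cdot> h) \<cdot> \<iota> i" using gh h(1) \<iota>[OF i] by (simp add: hom_def)
    qed
    then have "(f, h, k, g) \<in> hom AW f g" using f(1) g h(1) k(1) fh by (intro AW_homI) simp_all
    moreover have "(f, h, k, g) \<cdot>\<^bsub>AW\<^esub> (FO D i, \<iota> i, \<kappa> i, f) = \<tau> i" if "i \<in> Obj J" for i
      unfolding AW_Comp \<tau>(1)[OF that] using h(2) k(2) that by simp
    ultimately show "\<exists>z \<in> hom AW f g. \<forall>i \<in> Obj J. z \<cdot>\<^bsub>AW\<^esub> (FO D i, \<iota> i, \<kappa> i, f) = \<tau> i" by blast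
  next
    fix g z z' assume z: "z \<in> hom AW f g" "z' \<in> hom AW f g"
      and e: "\<And>i. i \<in> Obj J \<Longrightarrow> z \<cdot>\<^bsub>AW\<^esub> (FO D i, \<iota> i, \<kappa> i, f) = z' \<cdot>\<^bsub>AW\<^esub> (FO D i, \<iota> i, \<kappa> i, f)"
    have fh: "Dom C f = X" "Cod C f = Y" using f(2) by (simp_all add: hom_def)
    from z obtain u v u' v' where z': "z = (f, u, v, g)" "z' = (f, u', v', g)"
      "u \<in> hom C X (Dom C g)" "u' \<in> hom C X (Dom C g)" "v \<in> hom C Y (Cod C g)" "v' \<in> hom C Y (Cod C g)"
      unfolding AW_hom fh by blast
    have "u = u'"
      by (rule colimit_unique[OF X J functor_dom_cod(1) z'(3,4)]) (use e in \<open>simp add: z' AW_Comp\<close>)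
    moreover have "v = v'"
      by (rule colimit_unique[OF Y J functor_dom_cod(2) z'(5,6)]) (use e in \<open>simp add: z' AW_Comp\<close>)
    ultimately show "z = z'" by (simp add: z')
  qed
qed

end

text \<open>\<open>u\<close> and \<open>v\<close> are lifted independently and moved to a common
  index \<open>n\<close>, where the square commutes after composition with
  \<open>\<kappa> n\<close>; presentability of \<open>A\<close> makes it commute at a later index.
  The arrow \<open>f\<close> between the colimits is arbitrary, since
  \<open>filtered_colimit_exists\<close> uses this to place it in \<open>W\<close>.\<close>

lemma arrow_colimit_surj:
  fixes J :: "('i, 'j) cat"
  assumes J: "filt J" "small U (Arr J)" and D: "is_functor J AW D"
    and X: "is_colimit C J (dom_ftor D) X \<iota>" and Y: "is_colimit C J (cod_ftor D) Y \<kappa>"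
    and f: "f \<in> hom C X Y" and eq: "\<And>i. i \<in> Obj J \<Longrightarrow> f \<cdot> \<iota> i = \<kappa> i \<cdot> FO D i"
    and h: "fp A" "fp B" "g \<in> hom C A B" "u \<in> hom C A X" "v \<in> hom C B Y" "v \<cdot> g = f \<cdot> u"
  obtains l x y where "l \<in> Obj J" "x \<in> hom C A (Dom C (FO D l))" "y \<in> hom C B (Cod C (FO D l))"
    "y \<cdot> g = FO D l \<cdot> x" "\<iota> l \<cdot> x = u" "\<kappa> l \<cdot> y = v"
proof -
  interpret J: category J using J(1) by (rule filt_category)
  note F = functor_dom_cod[OF J.category_axioms D] and FA = FA_AW[OF J.category_axioms D]
    and FOW = W_hom[OF FO_W[OF J.category_axioms D]]
  have \<iota>: "\<iota> i \<in> hom C (Dom C (FO D i)) X" if "i \<in> Obj J" for i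
    using cocone_hom[OF colimit_cocone[OF X] that] by (simp add: dom_ftor_def)
  have \<kappa>: "\<kappa> i \<in> hom C (Cod C (FO D i)) Y" if "i \<in> Obj J" for i
    using cocone_hom[OF colimit_cocone[OF Y] that] by (simp add: cod_ftor_def)
  obtain i x where "i \<in> Obj J" "x \<in> hom C A (FO (dom_ftor D) i)" "\<iota> i \<cdot> x = u"
    by (rule presentable_surj[OF h(1) J F(1) X h(4)])
  then have i: "i \<in> Obj J" "x \<in> hom C A (Dom C (FO D i))" "\<iota> i \<cdot> x = u" by (simp_all add: dom_ftor_def)
  obtain k y where "k \<in> Obj J" "y \<in> hom C B (FO (cod_ftor D) k)" "\<kappa> k \<cdot> y = v"
    by (rule presentable_surj[OF h(2) J F(2) Y h(5)])
  then have k: "k \<in> Obj J" "y \<in> hom C B (Cod C (FO D k))" "\<kappa> k \<cdot> y = v" by (simp_all add: cod_ftor_def)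
  obtain n \<alpha> \<beta> where n: "\<alpha> \<in> hom J i n" "\<beta> \<in> hom J k n" by (rule filt_bound[OF J(1) i(1) k(1)])
  have no: "n \<in> Obj J" by (rule J.hom_ObjD(2)[OF n(1)])
  let ?x = "FA (dom_ftor D) \<alpha> \<cdot> x" and ?y = "FA (cod_ftor D) \<beta> \<cdot> y"
  note x = Comp_hom[OF i(2) FA(2)[OF n(1)]] and y = Comp_hom[OF k(2) FA(3)[OF n(2)]]
  have "\<iota> n \<cdot> ?x = (\<iota> n \<cdot> FA (dom_ftor D) \<alpha>) \<cdot> x" using \<iota>[OF no] FA(2)[OF n(1)] i(2) by (simp add: hom_def)
  then have ux: "\<iota> n \<cdot> ?x = u" unfolding cocone_Comp[OF colimit_cocone[OF X] n(1)] i(3) .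
  have "\<kappa> n \<cdot> ?y = (\<kappa> n \<cdot> FA (cod_ftor D) \<beta>) \<cdot> y" using \<kappa>[OF no] FA(3)[OF n(2)] k(2) by (simp add: hom_def)
  then have vy: "\<kappa> n \<cdot> ?y = v" unfolding cocone_Comp[OF colimit_cocone[OF Y] n(2)] k(3) .
  have "\<kappa> n \<cdot> (?y \<cdot> g) = (\<kappa> n \<cdot> ?y) \<cdot> g" using \<kappa>[OF no] y h(3) by (simp add: hom_def)
  also have "\<dots> = (f \<cdot> \<iota> n) \<cdot> ?x" unfolding vy h(6) ux[symmetric] using f \<iota>[OF no] x by (simp add: hom_def)
  also have "\<dots> = \<kappa> n \<cdot> (FO D n \<cdot> ?x)" unfolding eq[OF no] using \<kappa>[OF no] FOW[OF no] x by (simp add: hom_def)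
  finally have e: "\<kappa> n \<cdot> (?y \<cdot> g) = \<kappa> n \<cdot> (FO D n \<cdot> ?x)" .
  have "?y \<cdot> g \<in> hom C A (FO (cod_ftor D) n)" "FO D n \<cdot> ?x \<in> hom C A (FO (cod_ftor D) n)"
    using Comp_hom[OF h(3) y] Comp_hom[OF x FOW[OF no]] by (simp_all add: cod_ftor_def)
  then obtain l \<gamma> where l: "\<gamma> \<in> hom J n l" "FA (cod_ftor D) \<gamma> \<cdot> (?y \<cdot> g) = FA (cod_ftor D) \<gamma> \<cdot> (FO D n \<cdot> ?x)"
    by (rule presentable_inj_same[OF h(1) J F(2) Y no _ _ e])
  have lo: "l \<in> Obj J" by (rule J.hom_ObjD(2)[OF l(1)])
  note \<gamma> = FA[OF l(1)]
  show thesis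
  proof (rule that[OF lo Comp_hom[OF x \<gamma>(2)] Comp_hom[OF y \<gamma>(3)]])
    have "(FA (cod_ftor D) \<gamma> \<cdot> ?y) \<cdot> g = FA (cod_ftor D) \<gamma> \<cdot> (?y \<cdot> g)" using \<gamma>(3) y h(3) by (simp add: hom_def)
    also have "\<dots> = (FA (cod_ftor D) \<gamma> \<cdot> FO D n) \<cdot> ?x" unfolding l(2) using \<gamma>(3) FOW[OF no] x by (simp add: hom_def)
    finally show "(FA (cod_ftor D) \<gamma> \<cdot> ?y) \<cdot> g = FO D l \<cdot> (FA (dom_ftor D) \<gamma> \<cdot> ?x)"
      unfolding \<gamma>(4) using FOW[OF lo] \<gamma>(2) x by (simp add: hom_def)
    have "\<iota> l \<cdot> (FA (dom_ftor D) \<gamma> \<cdot> ?x) = (\<iota> l \<cdot> FA (dom_ftor D) \<gamma>) \<cdot> ?x" using \<iota>[OF lo] \<gamma>(2) x by (simp add: hom_def)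
    then show "\<iota> l \<cdot> (FA (dom_ftor D) \<gamma> \<cdot> ?x) = u" unfolding cocone_Comp[OF colimit_cocone[OF X] l(1)] ux .
    have "\<kappa> l \<cdot> (FA (cod_ftor D) \<gamma> \<cdot> ?y) = (\<kappa> l \<cdot> FA (cod_ftor D) \<gamma>) \<cdot> ?y" using \<kappa>[OF lo] \<gamma>(3) y by (simp add: hom_def)
    then show "\<kappa> l \<cdot> (FA (cod_ftor D) \<gamma> \<cdot> ?y) = v" unfolding cocone_Comp[OF colimit_cocone[OF Y] l(1)] vy .
  qed
qed

text \<open>A square into the induced arrow \<open>f\<close> between the colimits descends to a
  square into some \<open>FO D l\<close>, and this factors because \<open>FO D l\<close> lies in
  \<open>W\<close>. With \<open>W_iff\<close> the outcome is that \<open>W\<close> is closed under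
  filtered colimits.\<close>

lemma filtered_colimit_exists:
  fixes J :: "('i, 'j) cat"
  assumes J: "filt J" "small U (Arr J)" and D: "is_functor J AW D"
  obtains X \<iota> Y \<kappa> f where "is_colimit C J (dom_ftor D) X \<iota>" "is_colimit C J (cod_ftor D) Y \<kappa>"
    "f \<in> W" "f \<in> hom C X Y" "\<forall>i \<in> Obj J. f \<cdot> \<iota> i = \<kappa> i \<cdot> FO D i"
proof -
  interpret J: category J using J(1) by (rule filt_category)
  note F = functor_dom_cod[OF J.category_axioms D] and FA = FA_AW[OF J.category_axioms D]
    and FOW = W_hom[OF FO_W[OF J.category_axioms D]]
  obtain X \<iota> where X: "is_colimit C J (dom_ftor D) X \<iota>" using cocomplete_any[OF cocomplete J.category_axioms J(2) F(1)] by blast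
  obtain Y \<kappa> where Y: "is_colimit C J (cod_ftor D) Y \<kappa>" using cocomplete_any[OF cocomplete J.category_axioms J(2) F(2)] by blast
  have \<iota>: "\<iota> i \<in> hom C (Dom C (FO D i)) X" if "i \<in> Obj J" for i
    using cocone_hom[OF colimit_cocone[OF X] that] by (simp add: dom_ftor_def)
  have \<kappa>: "\<kappa> i \<in> hom C (Cod C (FO D i)) Y" if "i \<in> Obj J" for i
    using cocone_hom[OF colimit_cocone[OF Y] that] by (simp add: cod_ftor_def)
  have "is_cocone C J (dom_ftor D) Y (\<lambda>i. \<kappa> i \<cdot> FO D i)"
  proof (rule is_coconeI[OF _ _ _ J.category_axioms])
    show "Y \<in> Obj C" using colimit_cocone[OF Y] by (simp add: is_cocone_def)
    show "\<kappa> i \<cdot> FO D i \<in> hom C (FO (dom_ftor D) i) Y" if "i \<in> Obj J" for i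
      using Comp_hom[OF FOW[OF that] \<kappa>[OF that]] by (simp add: dom_ftor_def)
    fix i k \<alpha> assume a: "i \<in> Obj J" "k \<in> Obj J" "\<alpha> \<in> hom J i k"
    have "(\<kappa> k \<cdot> FO D k) \<cdot> FA (dom_ftor D) \<alpha> = \<kappa> k \<cdot> (FA (cod_ftor D) \<alpha> \<cdot> FO D i)"
      unfolding FA(4)[OF a(3)] using \<kappa>[OF a(2)] FOW[OF a(2)] FA(2)[OF a(3)] by (simp add: hom_def)
    also have "\<dots> = (\<kappa> k \<cdot> FA (cod_ftor D) \<alpha>) \<cdot> FO D i"
      using \<kappa>[OF a(2)] FOW[OF a(1)] FA(3)[OF a(3)] by (simp add: hom_def)
    finally show "(\<kappa> k \<cdot> FO D k) \<cdot> FA (dom_ftor D) \<alpha> = \<kappa> i \<cdot> FO D i"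
      unfolding cocone_Comp[OF colimit_cocone[OF Y] a(3)] .
  qed
  then obtain f where f: "f \<in> hom C X Y" "\<forall>i \<in> Obj J. f \<cdot> \<iota> i = \<kappa> i \<cdot> FO D i" by (rule colimit_ex[OF X])
  have "factors_via W f"
  proof (rule factors_viaI[OF f(1)])
    fix A B g u v assume h: "fp A" "fp B" "g \<in> hom C A B" "u \<in> hom C A X" "v \<in> hom C B Y" "v \<cdot> g = f \<cdot> u"
    obtain l x y where l: "l \<in> Obj J" "x \<in> hom C A (Dom C (FO D l))" "y \<in> hom C B (Cod C (FO D l))"
      "y \<cdot> g = FO D l \<cdot> x" "\<iota> l \<cdot> x = u" "\<kappa> l \<cdot> y = v"
      by (rule arrow_colimit_surj[OF J D X Y f(1) f(2)[rule_format] h])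
    have fv: "factors_via W (FO D l)" using FO_W[OF J.category_axioms D l(1)] W_iff by blast
    note Dl = FOW[OF l(1)]
    obtain A' B' w a b u' v' where w: "w \<in> W" "fp A'" "fp B'" "w \<in> hom C A' B'" "a \<in> hom C A A'"
      "b \<in> hom C B B'" "u' \<in> hom C A' (Dom C (FO D l))" "v' \<in> hom C B' (Cod C (FO D l))"
      "b \<cdot> g = w \<cdot> a" "v' \<cdot> w = FO D l \<cdot> u'" "u' \<cdot> a = x" "v' \<cdot> b = y"
      by (rule factors_viaD[OF fv Dl h(1-3) l(2,3,4)])
    have "(\<kappa> l \<cdot> v') \<cdot> w = \<kappa> l \<cdot> (v' \<cdot> w)" using \<kappa>[OF l(1)] w(4,8) by (simp add: hom_def)
    also have "\<dots> = (f \<cdot> \<iota> l) \<cdot> u'"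
      unfolding w(10) f(2)[rule_format, OF l(1)] using \<kappa>[OF l(1)] Dl w(7) by (simp add: hom_def)
    finally have e1: "(\<kappa> l \<cdot> v') \<cdot> w = f \<cdot> (\<iota> l \<cdot> u')" using f(1) \<iota>[OF l(1)] w(7) by (simp add: hom_def)
    have e2: "(\<iota> l \<cdot> u') \<cdot> a = u" unfolding l(5)[symmetric] w(11)[symmetric] using \<iota>[OF l(1)] w(5,7) by (simp add: hom_def)
    have e3: "(\<kappa> l \<cdot> v') \<cdot> b = v" unfolding l(6)[symmetric] w(12)[symmetric] using \<kappa>[OF l(1)] w(6,8) by (simp add: hom_def)
    show "square_factors W f X Y A B g u v"
    unfolding square_factors_def
      using w(1-6) Comp_hom[OF w(7) \<iota>[OF l(1)]] Comp_hom[OF w(8) \<kappa>[OF l(1)]] w(9) e1 e2 e3 by blast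
  qed
  then have "f \<in> W" using W_iff by blast
  then show thesis using that X Y f by blast
qed

text \<open>The given colimit \<open>f'\<close> comes without a pointwise description, so it is
  compared with the pointwise colimit \<open>f\<close> through \<open>\<theta>\<close> and
  \<open>\<theta>'\<close>. For \<open>f\<close>, maps lift by \<open>arrow_colimit_surj\<close>,
  and equality of two lifts is reached first on domains and then on codomains.\<close>

lemma arrow_presentable:
  assumes w: "w \<in> W" "fp (Dom C w)" "fp (Cod C w)"
  shows "presentable U natLeq AW w"
proof (rule category.presentableI[OF category_AW universe])
  interpret AW: category AW by (rule category_AW)
  note wh = W_hom[OF w(1)]
  show "w \<in> Obj AW" using w by (simp add: AW_Obj)
  fix J :: "('u, 'u) cat" and D f' \<tau>
  assume J: "filt J" "small U (Arr J)" and D: "is_functor J AW D" and T: "is_colimit AW J D f' \<tau>"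
  interpret J: category J using J(1) by (rule filt_category)
  note F = functor_dom_cod[OF J.category_axioms D] and FA = FA_AW[OF J.category_axioms D]
    and FOW = FO_W[OF J.category_axioms D]
  obtain X \<iota> Y \<kappa> f where X: "is_colimit C J (dom_ftor D) X \<iota>" and Y: "is_colimit C J (cod_ftor D) Y \<kappa>"
    and f: "f \<in> W" "f \<in> hom C X Y" "\<forall>i \<in> Obj J. f \<cdot> \<iota> i = \<kappa> i \<cdot> FO D i"
    by (rule filtered_colimit_exists[OF J D])
  note fh = homD[OF f(2)]
  let ?\<iota> = "\<lambda>i. (FO D i, \<iota> i, \<kappa> i, f)"
  have f_col: "is_colimit AW J D f ?\<iota>"
    by (rule pointwise_colimit[OF J.category_axioms D X Y f(1,2) f(3)[rule_format]])
  obtain \<theta> where \<theta>: "\<theta> \<in> hom AW f f'" "\<forall>i \<in> Obj J. \<theta> \<cdot>\<^bsub>AW\<^esub> ?\<iota> i = \<tau> i"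
    by (rule colimit_ex[OF f_col colimit_cocone[OF T]])
  obtain \<theta>' where \<theta>': "\<theta>' \<in> hom AW f' f" "\<forall>i \<in> Obj J. \<theta>' \<cdot>\<^bsub>AW\<^esub> \<tau> i = ?\<iota> i"
    by (rule colimit_ex[OF T colimit_cocone[OF f_col]])
  have \<tau>: "\<tau> i \<in> hom AW (FO D i) f'" if "i \<in> Obj J" for i by (rule cocone_hom[OF colimit_cocone[OF T] that])
  have \<iota>: "?\<iota> i \<in> hom AW (FO D i) f" if "i \<in> Obj J" for i by (rule cocone_hom[OF colimit_cocone[OF f_col] that])
  have \<theta>\<theta>': "\<theta> \<cdot>\<^bsub>AW\<^esub> \<theta>' = Ident AW f'"
  proof (rule AW.colimit_unique[OF T J.category_axioms D AW.Comp_hom[OF \<theta>'(1) \<theta>(1)] AW.Ident_hom[OF AW.hom_ObjD(1)[OF \<theta>'(1)]]])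
    fix i assume i: "i \<in> Obj J"
    have "(\<theta> \<cdot>\<^bsub>AW\<^esub> \<theta>') \<cdot>\<^bsub>AW\<^esub> \<tau> i = \<theta> \<cdot>\<^bsub>AW\<^esub> (\<theta>' \<cdot>\<^bsub>AW\<^esub> \<tau> i)" by (rule AW.Comp_assoc[OF \<tau>[OF i] \<theta>'(1) \<theta>(1), symmetric])
    also have "\<dots> = \<tau> i" using \<theta>(2) \<theta>'(2) i by simp
    finally show "(\<theta> \<cdot>\<^bsub>AW\<^esub> \<theta>') \<cdot>\<^bsub>AW\<^esub> \<tau> i = Ident AW f' \<cdot>\<^bsub>AW\<^esub> \<tau> i" using AW.Ident_left[OF \<tau>[OF i]] by simp
  qed
  show "\<exists>i \<in> Obj J. \<exists>z \<in> hom AW w (FO D i). \<tau> i \<cdot>\<^bsub>AW\<^esub> z = h" if h: "h \<in> hom AW w f'" for h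
  proof -
    have "\<theta>' \<cdot>\<^bsub>AW\<^esub> h \<in> hom AW w f" by (rule AW.Comp_hom[OF h \<theta>'(1)])
    then obtain u v where uv: "\<theta>' \<cdot>\<^bsub>AW\<^esub> h = (w, u, v, f)" "u \<in> hom C (Dom C w) X" "v \<in> hom C (Cod C w) Y" "v \<cdot> w = f \<cdot> u"
      unfolding AW_hom fh by blast
    obtain l x y where l: "l \<in> Obj J" "x \<in> hom C (Dom C w) (Dom C (FO D l))" "y \<in> hom C (Cod C w) (Cod C (FO D l))"
      "y \<cdot> w = FO D l \<cdot> x" "\<iota> l \<cdot> x = u" "\<kappa> l \<cdot> y = v"
      by (rule arrow_colimit_surj[OF J D X Y f(2) f(3)[rule_format] w(2,3) wh uv(2-4)])
    let ?z = "(w, x, y, FO D l)"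
    have z: "?z \<in> hom AW w (FO D l)" by (rule AW_homI[OF w(1) FOW[OF l(1)] l(2-4)])
    have "\<tau> l \<cdot>\<^bsub>AW\<^esub> ?z = (\<theta> \<cdot>\<^bsub>AW\<^esub> ?\<iota> l) \<cdot>\<^bsub>AW\<^esub> ?z" using \<theta>(2) l(1) by simp
    also have "\<dots> = \<theta> \<cdot>\<^bsub>AW\<^esub> (?\<iota> l \<cdot>\<^bsub>AW\<^esub> ?z)" by (rule AW.Comp_assoc[OF z \<iota>[OF l(1)] \<theta>(1), symmetric])
    also have "?\<iota> l \<cdot>\<^bsub>AW\<^esub> ?z = \<theta>' \<cdot>\<^bsub>AW\<^esub> h" unfolding AW_Comp l(5,6) uv(1) ..
    also have "\<theta> \<cdot>\<^bsub>AW\<^esub> (\<theta>' \<cdot>\<^bsub>AW\<^esub> h) = (\<theta> \<cdot>\<^bsub>AW\<^esub> \<theta>') \<cdot>\<^bsub>AW\<^esub> h" by (rule AW.Comp_assoc[OF h \<theta>'(1) \<theta>(1)])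
    also have "\<dots> = h" unfolding \<theta>\<theta>' by (rule AW.Ident_left[OF h])
    finally show ?thesis using l(1) z by blast
  qed
  show "\<exists>l. \<exists>\<alpha> \<in> hom J i l. FA D \<alpha> \<cdot>\<^bsub>AW\<^esub> z = FA D \<alpha> \<cdot>\<^bsub>AW\<^esub> z'"
    if i: "i \<in> Obj J" and z: "z \<in> hom AW w (FO D i)" and z': "z' \<in> hom AW w (FO D i)"
      and eq: "\<tau> i \<cdot>\<^bsub>AW\<^esub> z = \<tau> i \<cdot>\<^bsub>AW\<^esub> z'" for i z z'
  proof -
    obtain x y where x: "z = (w, x, y, FO D i)" "x \<in> hom C (Dom C w) (Dom C (FO D i))" "y \<in> hom C (Cod C w) (Cod C (FO D i))"
      using z unfolding AW_hom by blast
    obtain x' y' where x': "z' = (w, x', y', FO D i)" "x' \<in> hom C (Dom C w) (Dom C (FO D i))" "y' \<in> hom C (Cod C w) (Cod C (FO D i))"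
      using z' unfolding AW_hom by blast
    have "?\<iota> i \<cdot>\<^bsub>AW\<^esub> z = \<theta>' \<cdot>\<^bsub>AW\<^esub> (\<tau> i \<cdot>\<^bsub>AW\<^esub> z)"
      using AW.Comp_assoc[OF z \<tau>[OF i] \<theta>'(1)] \<theta>'(2) i by simp
    also have "\<dots> = ?\<iota> i \<cdot>\<^bsub>AW\<^esub> z'" unfolding eq using AW.Comp_assoc[OF z' \<tau>[OF i] \<theta>'(1)] \<theta>'(2) i by simp
    finally have e: "\<iota> i \<cdot> x = \<iota> i \<cdot> x'" "\<kappa> i \<cdot> y = \<kappa> i \<cdot> y'" unfolding x(1) x'(1) AW_Comp by simp_all
    have "x \<in> hom C (Dom C w) (FO (dom_ftor D) i)" "x' \<in> hom C (Dom C w) (FO (dom_ftor D) i)"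
      using x x' by (simp_all add: dom_ftor_def)
    then obtain k \<alpha> where k: "\<alpha> \<in> hom J i k" "FA (dom_ftor D) \<alpha> \<cdot> x = FA (dom_ftor D) \<alpha> \<cdot> x'"
      by (rule presentable_inj_same[OF w(2) J F(1) X i _ _ e(1)])
    have ko: "k \<in> Obj J" by (rule J.hom_ObjD(2)[OF k(1)])
    note \<alpha> = FA[OF k(1)]
    have \<kappa>: "\<kappa> k \<in> hom C (Cod C (FO D k)) Y" using cocone_hom[OF colimit_cocone[OF Y] ko] by (simp add: cod_ftor_def)
    have "(\<kappa> k \<cdot> FA (cod_ftor D) \<alpha>) \<cdot> y = (\<kappa> k \<cdot> FA (cod_ftor D) \<alpha>) \<cdot> y'"
      unfolding cocone_Comp[OF colimit_cocone[OF Y] k(1)] by (rule e(2))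
    then have e': "\<kappa> k \<cdot> (FA (cod_ftor D) \<alpha> \<cdot> y) = \<kappa> k \<cdot> (FA (cod_ftor D) \<alpha> \<cdot> y')"
      using \<kappa> \<alpha>(3) x(3) x'(3) by (simp add: hom_def)
    have "FA (cod_ftor D) \<alpha> \<cdot> y \<in> hom C (Cod C w) (FO (cod_ftor D) k)" "FA (cod_ftor D) \<alpha> \<cdot> y' \<in> hom C (Cod C w) (FO (cod_ftor D) k)"
      using Comp_hom[OF x(3) \<alpha>(3)] Comp_hom[OF x'(3) \<alpha>(3)] by (simp_all add: cod_ftor_def)
    then obtain l \<beta> where l: "\<beta> \<in> hom J k l"
      "FA (cod_ftor D) \<beta> \<cdot> (FA (cod_ftor D) \<alpha> \<cdot> y) = FA (cod_ftor D) \<beta> \<cdot> (FA (cod_ftor D) \<alpha> \<cdot> y')"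
      by (rule presentable_inj_same[OF w(3) J F(2) Y ko _ _ e'])
    have "FA D \<beta> \<cdot>\<^bsub>AW\<^esub> (FA D \<alpha> \<cdot>\<^bsub>AW\<^esub> z) = FA D \<beta> \<cdot>\<^bsub>AW\<^esub> (FA D \<alpha> \<cdot>\<^bsub>AW\<^esub> z')"
      unfolding x(1) x'(1) \<alpha>(1) FA(1)[OF l(1)] AW_Comp using k(2) l(2) by simp
    moreover have "FA D (\<beta> \<cdot>\<^bsub>J\<^esub> \<alpha>) \<cdot>\<^bsub>AW\<^esub> z = FA D \<beta> \<cdot>\<^bsub>AW\<^esub> (FA D \<alpha> \<cdot>\<^bsub>AW\<^esub> z)"
      "FA D (\<beta> \<cdot>\<^bsub>J\<^esub> \<alpha>) \<cdot>\<^bsub>AW\<^esub> z' = FA D \<beta> \<cdot>\<^bsub>AW\<^esub> (FA D \<alpha> \<cdot>\<^bsub>AW\<^esub> z')"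
      unfolding functor_Comp[OF D k(1) l(1)]
      using AW.Comp_assoc[OF z functor_hom[OF D k(1)] functor_hom[OF D l(1)]]
        AW.Comp_assoc[OF z' functor_hom[OF D k(1)] functor_hom[OF D l(1)]] by simp_all
    ultimately show ?thesis using J.Comp_hom[OF k(1) l(1)] by metis
  qed
qed

end

lemma full_subcat_simps:
  "Obj (full_subcat C S) = Obj C \<inter> S" "Arr (full_subcat C S) = {f \<in> Arr C. Dom C f \<in> S \<and> Cod C f \<in> S}"
  "Dom (full_subcat C S) = Dom C" "Cod (full_subcat C S) = Cod C" "Ident (full_subcat C S) = Ident C"
  "Comp (full_subcat C S) = Comp C"
  by (simp_all add: full_subcat_def)

lemma slice_simps:
  "Obj (slice C B) = {x \<in> Arr C. Cod C x = B}"
  "(x, h, y) \<in> Arr (slice C B) \<longleftrightarrow> x \<in> Arr C \<and> Cod C x = B \<and> y \<in> Arr C \<and> Cod C y = B \<and>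
     h \<in> hom C (Dom C x) (Dom C y) \<and> y \<cdot>\<^bsub>C\<^esub> h = x"
  "Dom (slice C B) (x, h, y) = x" "Cod (slice C B) (x, h, y) = y"
  "Ident (slice C B) x = (x, Ident C (Dom C x), x)"
  "(y, k, z) \<cdot>\<^bsub>slice C B\<^esub> (x, h, y') = (x, k \<cdot>\<^bsub>C\<^esub> h, z)"
  by (simp_all add: slice_def)

section \<open>The canonical diagram of a weak equivalence\<close>

locale arrow_skeleton = arrow_class C U W for C :: "('o, 'a) cat" (structure) and U :: "'u itself" and W +
  fixes R :: "'o set"
  assumes R_small: "small U R" and R_fp: "\<And>A. A \<in> R \<Longrightarrow> fp A"
    and R_iso: "\<And>A. fp A \<Longrightarrow> \<exists>B \<in> R. \<exists>\<phi> \<in> hom C A B. \<exists>\<psi> \<in> hom C B A. \<psi> \<cdot> \<phi> = Ident C A \<and> \<phi> \<cdot> \<psi> = Ident C B"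
begin

sublocale AW: category AW by (rule category_AW)

definition G :: "'a set" where "G = {w \<in> W. Dom C w \<in> R \<and> Cod C w \<in> R}"

lemma small_G: "small U G"
proof -
  have "small U (\<Union>(A, B) \<in> R \<times> R. hom C A B)"
    by (rule small_UN[OF universe small_Times[OF universe R_small R_small]])
      (use R_fp fp_Obj small_hom in auto)
  then show ?thesis by (rule small_subset) (use W_hom in \<open>auto simp: G_def\<close>)
qed

lemma G_D: "w \<in> G \<Longrightarrow> w \<in> W" "w \<in> G \<Longrightarrow> fp (Dom C w)" "w \<in> G \<Longrightarrow> fp (Cod C w)"
  using R_fp by (auto simp: G_def)

text \<open>An arrow isomorphic to \<open>w\<close> factors via \<open>w\<close> itself, whose ends
  are presentable, and \<open>W_iff\<close> then puts it in \<open>W\<close>.\<close>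

lemma iso_W:
  assumes w: "w \<in> W" "w \<in> hom C A B" "fp A" "fp B"
    and \<phi>: "\<phi> \<in> hom C A A'" "\<psi> \<in> hom C A' A" "\<psi> \<cdot> \<phi> = Ident C A" "\<phi> \<cdot> \<psi> = Ident C A'"
    and \<phi>': "\<phi>' \<in> hom C B B'" "\<psi>' \<in> hom C B' B" "\<psi>' \<cdot> \<phi>' = Ident C B" "\<phi>' \<cdot> \<psi>' = Ident C B'"
  shows "\<phi>' \<cdot> (w \<cdot> \<psi>) \<in> W"
proof -
  have "factors_via W (\<phi>' \<cdot> (w \<cdot> \<psi>))"
  proof (rule factors_viaI[OF Comp_hom[OF Comp_hom[OF \<phi>(2) w(2)] \<phi>'(1)]])
    fix P Q g x y assume h: "fp P" "fp Q" "g \<in> hom C P Q" "x \<in> hom C P A'" "y \<in> hom C Q B'"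
      and eq: "y \<cdot> g = (\<phi>' \<cdot> (w \<cdot> \<psi>)) \<cdot> x"
    have "(\<psi>' \<cdot> y) \<cdot> g = \<psi>' \<cdot> (y \<cdot> g)" using \<phi>'(2) h by (simp add: hom_def)
    also have "\<dots> = (\<psi>' \<cdot> \<phi>') \<cdot> (w \<cdot> (\<psi> \<cdot> x))" unfolding eq using \<phi>'(1,2) w(2) \<phi>(2) h by (simp add: hom_def)
    finally have e1: "(\<psi>' \<cdot> y) \<cdot> g = w \<cdot> (\<psi> \<cdot> x)" unfolding \<phi>'(3) using w(2) \<phi>(2) h by (simp add: hom_def)
    have "(\<phi>' \<cdot> (w \<cdot> \<psi>)) \<cdot> \<phi> = (\<phi>' \<cdot> w) \<cdot> (\<psi> \<cdot> \<phi>)" using \<phi>(1,2) \<phi>'(1) w(2) by (simp add: hom_def)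
    then have e2: "\<phi>' \<cdot> w = (\<phi>' \<cdot> (w \<cdot> \<psi>)) \<cdot> \<phi>" unfolding \<phi>(3) using \<phi>'(1) w(2) by (simp add: hom_def)
    have "\<phi> \<cdot> (\<psi> \<cdot> x) = (\<phi> \<cdot> \<psi>) \<cdot> x" using \<phi>(1,2) h by (simp add: hom_def)
    then have e3: "\<phi> \<cdot> (\<psi> \<cdot> x) = x" unfolding \<phi>(4) using h by (simp add: hom_def)
    have "\<phi>' \<cdot> (\<psi>' \<cdot> y) = (\<phi>' \<cdot> \<psi>') \<cdot> y" using \<phi>'(1,2) h by (simp add: hom_def)
    then have e4: "\<phi>' \<cdot> (\<psi>' \<cdot> y) = y" unfolding \<phi>'(4) using h by (simp add: hom_def)
    show "square_factors W (\<phi>' \<cdot> (w \<cdot> \<psi>)) A' B' P Q g x y"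
      unfolding square_factors_def
      using w(1,3,4,2) Comp_hom[OF h(4) \<phi>(2)] Comp_hom[OF h(5) \<phi>'(2)] \<phi>(1) \<phi>'(1) e1 e2 e3 e4 by blast
  qed
  then show ?thesis using W_iff by blast
qed

text \<open>
  \<open>K f\<close> indexes the canonical diagram of \<open>f\<close> with respect to \<open>G\<close>; its objects are the
  squares \<open>(w, u, v, f)\<close> with \<open>w \<in> G\<close>.
\<close>

definition K :: "'a \<Rightarrow> ('a \<times> 'a \<times> 'a \<times> 'a, ('a \<times> 'a \<times> 'a \<times> 'a) \<times> ('a \<times> 'a \<times> 'a \<times> 'a) \<times> ('a \<times> 'a \<times> 'a \<times> 'a)) cat"
  where "K f = full_subcat (slice AW f) {x. fst x \<in> G}"

lemma category_K: "category (K f)"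
  unfolding K_def by (intro category_full_subcat category_slice category_AW)

lemma AW_Dom_Cod: "Dom AW x = fst x" "Cod AW (w, u, v, g) = g"
  by (cases x) (simp_all add: full_subcat_def arrow_cat_def)

lemma K_Obj: "x \<in> Obj (K f) \<longleftrightarrow> fst x \<in> G \<and> x \<in> hom AW (fst x) f"
  by (auto simp: K_def full_subcat_simps[of "slice AW f"] slice_simps hom_def[of AW] AW_Dom_Cod)

lemma K_hom: "m \<in> hom (K f) x y \<longleftrightarrow> (\<exists>h. m = (x, h, y) \<and> x \<in> Obj (K f) \<and> y \<in> Obj (K f) \<and>
    h \<in> hom AW (fst x) (fst y) \<and> y \<cdot>\<^bsub>AW\<^esub> h = x)"
proof -
  obtain x' h y' where m: "m = (x', h, y')" by (cases m)
  show ?thesis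
    unfolding m K_def hom_def full_subcat_simps[of "slice AW f"]
    by (simp add: slice_simps hom_def[of AW] AW_Dom_Cod; blast)
qed

lemma K_Comp: "(y, k, z) \<cdot>\<^bsub>K f\<^esub> (x, h, y') = (x, k \<cdot>\<^bsub>AW\<^esub> h, z)"
  by (simp add: K_def full_subcat_simps[of "slice AW f"] slice_simps)

lemma K_Ident: "Ident (K f) x = (x, Ident AW (fst x), x)"
  by (simp add: K_def full_subcat_simps[of "slice AW f"] slice_simps AW_Dom_Cod)

definition proj :: "('a \<times> 'a \<times> 'a \<times> 'a, ('a \<times> 'a \<times> 'a \<times> 'a) \<times> ('a \<times> 'a \<times> 'a \<times> 'a) \<times> ('a \<times> 'a \<times> 'a \<times> 'a),
    'a, 'a \<times> 'a \<times> 'a \<times> 'a) ftor" where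
  "proj = \<lparr>FO = fst, FA = \<lambda>m. fst (snd m)\<rparr>"

lemma functor_proj: "is_functor (K f) AW proj"
  unfolding is_functor_def
proof (intro conjI ballI impI)
  interpret K: category "K f" by (rule category_K)
  show "FO proj x \<in> Obj AW" if "x \<in> Obj (K f)" for x
    using that AW.hom_ObjD(1)[of x "fst x" f] by (simp add: proj_def K_Obj)
  show "FA proj m \<in> hom AW (FO proj (Dom (K f) m)) (FO proj (Cod (K f) m))" if "m \<in> Arr (K f)" for m
  proof -
    have "m \<in> hom (K f) (Dom (K f) m) (Cod (K f) m)" using that by (simp add: hom_def)
    then obtain x h y where "Dom (K f) m = x" "Cod (K f) m = y" "m = (x, h, y)" "h \<in> hom AW (fst x) (fst y)"
      unfolding K_hom by blast
    then show ?thesis by (simp add: proj_def)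
  qed
  show "FA proj (Ident (K f) x) = Ident AW (FO proj x)" for x by (simp add: proj_def K_Ident)
  show "FA proj (n \<cdot>\<^bsub>K f\<^esub> m) = FA proj n \<cdot>\<^bsub>AW\<^esub> FA proj m" for m n
    by (cases m; cases n) (simp add: proj_def K_Comp)
qed

lemma cocone_proj:
  assumes "f \<in> W" shows "is_cocone AW (K f) proj f (\<lambda>x. x)"
proof (rule is_coconeI[OF _ _ _ category_K])
  show "f \<in> Obj AW" using assms by (simp add: AW_Obj)
  show "x \<in> hom AW (FO proj x) f" if "x \<in> Obj (K f)" for x using that by (simp add: K_Obj proj_def)
  show "y \<cdot>\<^bsub>AW\<^esub> FA proj m = x" if "m \<in> hom (K f) x y" for x y m using that by (auto simp: K_hom proj_def)
qed

lemma small_K: "small U (Arr (K f))"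
proof (cases "f \<in> W")
  case False
  then have "Arr (K f) = {}"
    using category.Dom_Obj[OF category_K, of _ f] by (auto simp: K_Obj AW_hom)
  then show ?thesis using small_finite[OF universe, of "{}"] by simp
next
  case True
  have "small U (\<Union>w \<in> G. hom AW w f)"
    by (rule small_UN[OF universe small_G AW_small_hom[OF G_D(1) True]])
  then have o: "small U (Obj (K f))" by (rule small_subset) (auto simp: K_Obj)
  have "small U (\<Union>(w, w') \<in> G \<times> G. hom AW w w')"
    by (rule small_UN[OF universe small_Times[OF universe small_G small_G]]) (use AW_small_hom G_D(1) in auto)
  then have "small U (Obj (K f) \<times> (\<Union>(w, w') \<in> G \<times> G. hom AW w w') \<times> Obj (K f))"
    by (intro small_Times[OF universe] o)
  moreover have "Arr (K f) \<subseteq> Obj (K f) \<times> (\<Union>(w, w') \<in> G \<times> G. hom AW w w') \<times> Obj (K f)"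
  proof
    fix m assume "m \<in> Arr (K f)"
    then have "m \<in> hom (K f) (Dom (K f) m) (Cod (K f) m)" by (simp add: hom_def)
    then obtain x h y where "m = (x, h, y)" "x \<in> Obj (K f)" "y \<in> Obj (K f)" "h \<in> hom AW (fst x) (fst y)"
      unfolding K_hom by blast
    moreover from this have "fst x \<in> G" "fst y \<in> G" by (simp_all add: K_Obj)
    ultimately show "m \<in> Obj (K f) \<times> (\<Union>(w, w') \<in> G \<times> G. hom AW w w') \<times> Obj (K f)" by blast
  qed
  ultimately show ?thesis by (rule small_subset)
qed

context
  fixes f :: 'a and X Y :: 'o
  assumes f: "f \<in> W" "f \<in> hom C X Y"
begin

lemma K_ObjI: "w \<in> G \<Longrightarrow> u \<in> hom C (Dom C w) X \<Longrightarrow> v \<in> hom C (Cod C w) Y \<Longrightarrow> v \<cdot> w = f \<cdot> u \<Longrightarrow> (w, u, v, f) \<in> Obj (K f)"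
  using f G_D(1) homD(2,3)[OF f(2)] by (simp add: K_Obj AW_hom)

lemma K_ObjE:
  assumes "x \<in> Obj (K f)"
  obtains w u v where "x = (w, u, v, f)" "w \<in> G" "u \<in> hom C (Dom C w) X" "v \<in> hom C (Cod C w) Y" "v \<cdot> w = f \<cdot> u"
  using assms homD(2,3)[OF f(2)] by (auto simp: K_Obj AW_hom)

lemma K_homI:
  assumes "(w, u, v, f) \<in> Obj (K f)" "(w', u', v', f) \<in> Obj (K f)" "s \<in> hom C (Dom C w) (Dom C w')"
    "t \<in> hom C (Cod C w) (Cod C w')" "t \<cdot> w = w' \<cdot> s" "u' \<cdot> s = u" "v' \<cdot> t = v"
  shows "((w, u, v, f), (w, s, t, w'), (w', u', v', f)) \<in> hom (K f) (w, u, v, f) (w', u', v', f)"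
proof -
  have "w \<in> G" "w' \<in> G" using assms(1,2) by (simp_all add: K_Obj)
  then have "(w, s, t, w') \<in> hom AW w w'" using assms G_D(1) by (intro AW_homI) auto
  then show ?thesis using assms unfolding K_hom by (simp add: AW_Comp)
qed

text \<open>The arrow supplied by \<open>factors_via\<close> may lie outside the small set
  \<open>G\<close>; conjugating it by isomorphisms to objects of \<open>R\<close> moves it into
  \<open>G\<close>, so that the factorization runs through an object of \<open>K f\<close>.
  Filteredness and the colimit property of \<open>K f\<close> rest on this.\<close>

lemma K_factor:
  assumes h: "fp A" "fp B" "g \<in> hom C A B" "u \<in> hom C A X" "v \<in> hom C B Y" "v \<cdot> g = f \<cdot> u"
  obtains w a b u' v' where "(w, u', v', f) \<in> Obj (K f)" "w \<in> G" "a \<in> hom C A (Dom C w)" "b \<in> hom C B (Cod C w)"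
    "u' \<in> hom C (Dom C w) X" "v' \<in> hom C (Cod C w) Y" "b \<cdot> g = w \<cdot> a" "v' \<cdot> w = f \<cdot> u'" "u' \<cdot> a = u" "v' \<cdot> b = v"
proof -
  have fv: "factors_via W f" using f W_iff by blast
  obtain A' B' w a b u' v' where w: "w \<in> W" "fp A'" "fp B'" "w \<in> hom C A' B'" "a \<in> hom C A A'"
    "b \<in> hom C B B'" "u' \<in> hom C A' X" "v' \<in> hom C B' Y" "b \<cdot> g = w \<cdot> a" "v' \<cdot> w = f \<cdot> u'" "u' \<cdot> a = u" "v' \<cdot> b = v"
    by (rule factors_viaD[OF fv f(2) h])
  obtain A1 \<phi> \<psi> where \<phi>: "A1 \<in> R" "\<phi> \<in> hom C A' A1" "\<psi> \<in> hom C A1 A'" "\<psi> \<cdot> \<phi> = Ident C A'" "\<phi> \<cdot> \<psi> = Ident C A1"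
    using R_iso[OF w(2)] by blast
  obtain B1 \<phi>' \<psi>' where \<phi>': "B1 \<in> R" "\<phi>' \<in> hom C B' B1" "\<psi>' \<in> hom C B1 B'" "\<psi>' \<cdot> \<phi>' = Ident C B'" "\<phi>' \<cdot> \<psi>' = Ident C B1"
    using R_iso[OF w(3)] by blast
  let ?w = "\<phi>' \<cdot> (w \<cdot> \<psi>)"
  have wW: "?w \<in> W" by (rule iso_W[OF w(1,4,2,3) \<phi>(2-5) \<phi>'(2-5)])
  have wh: "?w \<in> hom C A1 B1" by (rule Comp_hom[OF Comp_hom[OF \<phi>(3) w(4)] \<phi>'(2)])
  have d: "Dom C ?w = A1" "Cod C ?w = B1" using wh by (simp_all add: hom_def)
  have wG: "?w \<in> G" using wW \<phi>(1) \<phi>'(1) by (simp add: G_def d)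
  have u1: "u' \<cdot> \<psi> \<in> hom C A1 X" by (rule Comp_hom[OF \<phi>(3) w(7)])
  have v1: "v' \<cdot> \<psi>' \<in> hom C B1 Y" by (rule Comp_hom[OF \<phi>'(3) w(8)])
  have a1: "\<phi> \<cdot> a \<in> hom C A A1" by (rule Comp_hom[OF w(5) \<phi>(2)])
  have b1: "\<phi>' \<cdot> b \<in> hom C B B1" by (rule Comp_hom[OF w(6) \<phi>'(2)])
  have "(v' \<cdot> \<psi>') \<cdot> ?w = v' \<cdot> ((\<psi>' \<cdot> \<phi>') \<cdot> (w \<cdot> \<psi>))" using w(4,8) \<phi>(3) \<phi>'(2,3) by (simp add: hom_def)
  also have "\<dots> = (v' \<cdot> w) \<cdot> \<psi>" unfolding \<phi>'(4) using w(4,8) \<phi>(3) by (simp add: hom_def)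
  also have "\<dots> = f \<cdot> (u' \<cdot> \<psi>)" unfolding w(10) using f(2) w(7) \<phi>(3) by (simp add: hom_def)
  finally have e1: "(v' \<cdot> \<psi>') \<cdot> ?w = f \<cdot> (u' \<cdot> \<psi>)" .
  have "(\<phi>' \<cdot> b) \<cdot> g = \<phi>' \<cdot> (b \<cdot> g)" using \<phi>'(2) w(6) h(3) by (simp add: hom_def)
  also have "\<dots> = \<phi>' \<cdot> (w \<cdot> ((\<psi> \<cdot> \<phi>) \<cdot> a))" unfolding w(9) \<phi>(4) using w(5) by (simp add: hom_def)
  finally have e2: "(\<phi>' \<cdot> b) \<cdot> g = ?w \<cdot> (\<phi> \<cdot> a)" using \<phi>'(2) w(4,5) \<phi>(2,3) by (simp add: hom_def)
  have "(u' \<cdot> \<psi>) \<cdot> (\<phi> \<cdot> a) = u' \<cdot> ((\<psi> \<cdot> \<phi>) \<cdot> a)" using w(5,7) \<phi>(2,3) by (simp add: hom_def)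
  then have e3: "(u' \<cdot> \<psi>) \<cdot> (\<phi> \<cdot> a) = u" unfolding \<phi>(4) using w(5,11) by (simp add: hom_def)
  have "(v' \<cdot> \<psi>') \<cdot> (\<phi>' \<cdot> b) = v' \<cdot> ((\<psi>' \<cdot> \<phi>') \<cdot> b)" using w(6,8) \<phi>'(2,3) by (simp add: hom_def)
  then have e4: "(v' \<cdot> \<psi>') \<cdot> (\<phi>' \<cdot> b) = v" unfolding \<phi>'(4) using w(6,12) by (simp add: hom_def)
  have "(?w, u' \<cdot> \<psi>, v' \<cdot> \<psi>', f) \<in> Obj (K f)" by (rule K_ObjI[OF wG], unfold d) (fact u1 v1 e1)+
  then show thesis
    by (rule that[OF _ wG a1[folded d] b1[folded d] u1[folded d] v1[folded d] e2 e1 e3 e4])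
qed

text \<open>\<open>u\<close> factors through the coequalizer \<open>c\<close> of \<open>s\<close>
  and \<open>t\<close>. Pushing \<open>w\<close> out along \<open>c\<close> gives an arrow
  \<open>j\<close> over \<open>f\<close> on whose domain the two maps agree. It need not lie in
  \<open>W\<close>, but \<open>K_factor\<close> leads from it to an object of the diagram.\<close>

lemma K_coeq_dom:
  assumes x: "(w, u, v, f) \<in> Obj (K f)" and A: "fp A" and s: "s \<in> hom C A (Dom C w)" "t \<in> hom C A (Dom C w)" "u \<cdot> s = u \<cdot> t"
  obtains w' u' v' a b where "((w, u, v, f), (w, a, b, w'), (w', u', v', f)) \<in> hom (K f) (w, u, v, f) (w', u', v', f)"
    "a \<in> hom C (Dom C w) (Dom C w')" "b \<in> hom C (Cod C w) (Cod C w')" "a \<cdot> s = a \<cdot> t"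
proof -
  from x have w: "w \<in> G" and u: "u \<in> hom C (Dom C w) X" and v: "v \<in> hom C (Cod C w) Y" and eq: "v \<cdot> w = f \<cdot> u"
    by (auto elim: K_ObjE)
  note wh = W_hom[OF G_D(1)[OF w]]
  obtain Q c where c: "fp Q" "c \<in> hom C (Dom C w) Q" "c \<cdot> s = c \<cdot> t"
    "\<forall>Y y. y \<in> hom C (Dom C w) Y \<longrightarrow> y \<cdot> s = y \<cdot> t \<longrightarrow> (\<exists>h \<in> hom C Q Y. h \<cdot> c = y)"
    by (rule coequalizer_exists[OF s(1,2) A G_D(2)[OF w]])
  obtain d where d: "d \<in> hom C Q X" "d \<cdot> c = u" using c(4) u s(3) by blast
  obtain N i j where P: "is_pushout C w c N i j" and ij: "i \<in> hom C (Cod C w) N" "j \<in> hom C Q N" "i \<cdot> w = j \<cdot> c"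
    and fpN: "fp (Dom C w) \<and> fp (Cod C w) \<and> fp Q \<longrightarrow> fp N" by (rule pushout_exists[OF wh c(2)])
  have fpN': "fp N" using fpN c(1) G_D[OF w] by blast
  have "v \<cdot> w = (f \<cdot> d) \<cdot> c" unfolding eq d(2)[symmetric] using f(2) d(1) c(2) by (simp add: hom_def)
  then obtain h where h: "h \<in> hom C N Y" "h \<cdot> i = v" "h \<cdot> j = f \<cdot> d" by (rule pushout_ex[OF P wh c(2) v Comp_hom[OF d(1) f(2)]])
  obtain w' a b u' v' where w': "(w', u', v', f) \<in> Obj (K f)" "w' \<in> G" "a \<in> hom C Q (Dom C w')" "b \<in> hom C N (Cod C w')"
    "u' \<in> hom C (Dom C w') X" "v' \<in> hom C (Cod C w') Y" "b \<cdot> j = w' \<cdot> a" "v' \<cdot> w' = f \<cdot> u'" "u' \<cdot> a = d" "v' \<cdot> b = h"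
    by (rule K_factor[OF c(1) fpN' ij(2) d(1) h(1,3)])
  note wh' = W_hom[OF G_D(1)[OF w'(2)]]
  have a: "a \<cdot> c \<in> hom C (Dom C w) (Dom C w')" by (rule Comp_hom[OF c(2) w'(3)])
  have b: "b \<cdot> i \<in> hom C (Cod C w) (Cod C w')" by (rule Comp_hom[OF ij(1) w'(4)])
  have "(b \<cdot> i) \<cdot> w = b \<cdot> (i \<cdot> w)" using w'(4) ij(1) wh by (simp add: hom_def)
  also have "\<dots> = (b \<cdot> j) \<cdot> c" unfolding ij(3) using w'(4) ij(2) c(2) by (simp add: hom_def)
  also have "\<dots> = w' \<cdot> (a \<cdot> c)" unfolding w'(7) using wh' w'(3) c(2) by (simp add: hom_def)
  finally have e1: "(b \<cdot> i) \<cdot> w = w' \<cdot> (a \<cdot> c)" .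
  have e2: "u' \<cdot> (a \<cdot> c) = u" unfolding d(2)[symmetric] w'(9)[symmetric] using w'(3,5) c(2) by (simp add: hom_def)
  have e3: "v' \<cdot> (b \<cdot> i) = v" unfolding h(2)[symmetric] w'(10)[symmetric] using w'(4,6) ij(1) by (simp add: hom_def)
  have "(a \<cdot> c) \<cdot> s = a \<cdot> (c \<cdot> s)" using w'(3) c(2) s by (simp add: hom_def)
  also have "\<dots> = (a \<cdot> c) \<cdot> t" unfolding c(3) using w'(3) c(2) s(2) by (simp add: hom_def)
  finally show thesis by (rule that[OF K_homI[OF x w'(1) a b e1 e2 e3] a b])
qed

text \<open>On the codomain it is enough to replace \<open>w\<close> by \<open>c \<cdot> w\<close>,
  with \<open>c\<close> the coequalizer of \<open>s\<close> and \<open>t\<close>, before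
  \<open>K_factor\<close> is applied.\<close>

lemma K_coeq_cod:
  assumes x: "(w, u, v, f) \<in> Obj (K f)" and A: "fp A" and s: "s \<in> hom C A (Cod C w)" "t \<in> hom C A (Cod C w)" "v \<cdot> s = v \<cdot> t"
  obtains w' u' v' a b where "((w, u, v, f), (w, a, b, w'), (w', u', v', f)) \<in> hom (K f) (w, u, v, f) (w', u', v', f)"
    "a \<in> hom C (Dom C w) (Dom C w')" "b \<in> hom C (Cod C w) (Cod C w')" "b \<cdot> s = b \<cdot> t"
proof -
  from x have w: "w \<in> G" and u: "u \<in> hom C (Dom C w) X" and v: "v \<in> hom C (Cod C w) Y" and eq: "v \<cdot> w = f \<cdot> u"
    by (auto elim: K_ObjE)
  note wh = W_hom[OF G_D(1)[OF w]]
  obtain Q c where c: "fp Q" "c \<in> hom C (Cod C w) Q" "c \<cdot> s = c \<cdot> t"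
    "\<forall>Y y. y \<in> hom C (Cod C w) Y \<longrightarrow> y \<cdot> s = y \<cdot> t \<longrightarrow> (\<exists>h \<in> hom C Q Y. h \<cdot> c = y)"
    by (rule coequalizer_exists[OF s(1,2) A G_D(3)[OF w]])
  obtain d where d: "d \<in> hom C Q Y" "d \<cdot> c = v" using c(4) v s(3) by blast
  have "(d \<cdot> c) \<cdot> w = f \<cdot> u" unfolding d(2) by (rule eq)
  then have "d \<cdot> (c \<cdot> w) = f \<cdot> u" using d(1) c(2) wh by (simp add: hom_def)
  then obtain w' a b u' v' where w': "(w', u', v', f) \<in> Obj (K f)" "w' \<in> G" "a \<in> hom C (Dom C w) (Dom C w')"
    "b \<in> hom C Q (Cod C w')" "u' \<in> hom C (Dom C w') X" "v' \<in> hom C (Cod C w') Y" "b \<cdot> (c \<cdot> w) = w' \<cdot> a" "v' \<cdot> w' = f \<cdot> u'"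
    "u' \<cdot> a = u" "v' \<cdot> b = d"
    by (rule K_factor[OF G_D(2)[OF w] c(1) Comp_hom[OF wh c(2)] u d(1)])
  have b: "b \<cdot> c \<in> hom C (Cod C w) (Cod C w')" by (rule Comp_hom[OF c(2) w'(4)])
  have e1: "(b \<cdot> c) \<cdot> w = w' \<cdot> a" unfolding w'(7)[symmetric] using w'(4) c(2) wh by (simp add: hom_def)
  have e3: "v' \<cdot> (b \<cdot> c) = v" unfolding d(2)[symmetric] w'(10)[symmetric] using w'(4,6) c(2) by (simp add: hom_def)
  have "(b \<cdot> c) \<cdot> s = b \<cdot> (c \<cdot> s)" using w'(4) c(2) s by (simp add: hom_def)
  also have "\<dots> = (b \<cdot> c) \<cdot> t" unfolding c(3) using w'(4) c(2) s(2) by (simp add: hom_def)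
  finally show thesis by (rule that[OF K_homI[OF x w'(1,3) b e1 w'(9) e3] w'(3) b])
qed

text \<open>Each clause forms a finite colimit of arrows over \<open>f\<close> between presentable
  objects, disregarding membership in \<open>W\<close>, and then passes to \<open>K f\<close> by
  \<open>K_factor\<close>: an arrow on the initial object, the coproduct of two arrows, and
  coequalizers.\<close>

lemma filt_K: "filt (K f)"
  unfolding filt_def
proof (intro conjI ballI)
  interpret K: category "K f" by (rule category_K)
  show "category (K f)" by (rule category_K)
  note XY = hom_ObjD[OF f(2)]
  obtain E where E: "is_initial C E" using initial_exists by blast
  have EO: "E \<in> Obj C" using E by (simp add: is_initial_def)
  obtain eX where eX: "eX \<in> hom C E X" by (rule initial_hom[OF E XY(1)])
  obtain eY where eY: "eY \<in> hom C E Y" by (rule initial_hom[OF E XY(2)])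
  have "eY \<cdot> Ident C E = f \<cdot> eX" by (rule initial_unique[OF E Comp_hom[OF Ident_hom[OF EO] eY] Comp_hom[OF eX f(2)]])
  then show "Obj (K f) \<noteq> {}"
    by (rule K_factor[OF fp_initial[OF E] fp_initial[OF E] Ident_hom[OF EO] eX eY]) blast
next
  fix x1 x2 assume x: "x1 \<in> Obj (K f)" "x2 \<in> Obj (K f)"
  obtain w1 u1 v1 where 1: "x1 = (w1, u1, v1, f)" "w1 \<in> G" "u1 \<in> hom C (Dom C w1) X" "v1 \<in> hom C (Cod C w1) Y"
    "v1 \<cdot> w1 = f \<cdot> u1" by (rule K_ObjE[OF x(1)])
  obtain w2 u2 v2 where 2: "x2 = (w2, u2, v2, f)" "w2 \<in> G" "u2 \<in> hom C (Dom C w2) X" "v2 \<in> hom C (Cod C w2) Y"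
    "v2 \<cdot> w2 = f \<cdot> u2" by (rule K_ObjE[OF x(2)])
  note wh = W_hom[OF G_D(1)[OF 1(2)]] W_hom[OF G_D(1)[OF 2(2)]]
  note d1 = fp_Obj[OF G_D(2)[OF 1(2)]] fp_Obj[OF G_D(3)[OF 1(2)]] and d2 = fp_Obj[OF G_D(2)[OF 2(2)]] fp_Obj[OF G_D(3)[OF 2(2)]]
  obtain A i1 i2 where A: "is_coproduct C (Dom C w1) (Dom C w2) A i1 i2" and fpA: "fp (Dom C w1) \<and> fp (Dom C w2) \<longrightarrow> fp A"
    by (rule coproduct_exists[OF d1(1) d2(1)])
  obtain B j1 j2 where B: "is_coproduct C (Cod C w1) (Cod C w2) B j1 j2" and fpB: "fp (Cod C w1) \<and> fp (Cod C w2) \<longrightarrow> fp B"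
    by (rule coproduct_exists[OF d1(2) d2(2)])
  have fpAB: "fp A" "fp B" using fpA fpB G_D[OF 1(2)] G_D[OF 2(2)] by auto
  note i = coproduct_hom[OF A] and j = coproduct_hom[OF B]
  obtain g where g: "g \<in> hom C A B" "g \<cdot> i1 = j1 \<cdot> w1" "g \<cdot> i2 = j2 \<cdot> w2"
    by (rule coproduct_ex[OF A Comp_hom[OF wh(1) j(1)] Comp_hom[OF wh(2) j(2)]])
  obtain u where u: "u \<in> hom C A X" "u \<cdot> i1 = u1" "u \<cdot> i2 = u2" by (rule coproduct_ex[OF A 1(3) 2(3)])
  obtain v where v: "v \<in> hom C B Y" "v \<cdot> j1 = v1" "v \<cdot> j2 = v2" by (rule coproduct_ex[OF B 1(4) 2(4)])
  have "v \<cdot> g = f \<cdot> u"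
  proof (rule coproduct_unique[OF A Comp_hom[OF g(1) v(1)] Comp_hom[OF u(1) f(2)]])
    have "(v \<cdot> g) \<cdot> i1 = (v \<cdot> j1) \<cdot> w1" using v(1) g i j wh by (simp add: hom_def)
    then show "(v \<cdot> g) \<cdot> i1 = (f \<cdot> u) \<cdot> i1" unfolding v(2) 1(5) using f(2) u i by (simp add: hom_def)
    have "(v \<cdot> g) \<cdot> i2 = (v \<cdot> j2) \<cdot> w2" using v(1) g i j wh by (simp add: hom_def)
    then show "(v \<cdot> g) \<cdot> i2 = (f \<cdot> u) \<cdot> i2" unfolding v(3) 2(5) using f(2) u i by (simp add: hom_def)
  qed
  then obtain w a b u' v' where w: "(w, u', v', f) \<in> Obj (K f)" "w \<in> G" "a \<in> hom C A (Dom C w)" "b \<in> hom C B (Cod C w)"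
    "u' \<in> hom C (Dom C w) X" "v' \<in> hom C (Cod C w) Y" "b \<cdot> g = w \<cdot> a" "v' \<cdot> w = f \<cdot> u'" "u' \<cdot> a = u" "v' \<cdot> b = v"
    by (rule K_factor[OF fpAB g(1) u(1) v(1)])
  have key: "((w0, u0, v0, f), (w0, a \<cdot> i0, b \<cdot> j0, w), (w, u', v', f)) \<in> hom (K f) (w0, u0, v0, f) (w, u', v', f)"
    if 0: "(w0, u0, v0, f) \<in> Obj (K f)" "w0 \<in> hom C (Dom C w0) (Cod C w0)" "i0 \<in> hom C (Dom C w0) A" "j0 \<in> hom C (Cod C w0) B"
      "g \<cdot> i0 = j0 \<cdot> w0" "u \<cdot> i0 = u0" "v \<cdot> j0 = v0" for w0 u0 v0 i0 j0
  proof (rule K_homI[OF 0(1) w(1) Comp_hom[OF 0(3) w(3)] Comp_hom[OF 0(4) w(4)]])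
    have "(b \<cdot> j0) \<cdot> w0 = b \<cdot> (j0 \<cdot> w0)" using w(4) 0(2,4) by (simp add: hom_def)
    also have "\<dots> = (b \<cdot> g) \<cdot> i0" unfolding 0(5)[symmetric] using w(4) g(1) 0(3) by (simp add: hom_def)
    finally show "(b \<cdot> j0) \<cdot> w0 = w \<cdot> (a \<cdot> i0)" unfolding w(7) using W_hom[OF G_D(1)[OF w(2)]] w(3) 0(3) by (simp add: hom_def)
    show "u' \<cdot> (a \<cdot> i0) = u0" unfolding 0(6)[symmetric] w(9)[symmetric] using w(3,5) 0(3) by (simp add: hom_def)
    show "v' \<cdot> (b \<cdot> j0) = v0" unfolding 0(7)[symmetric] w(10)[symmetric] using w(4,6) 0(4) by (simp add: hom_def)
  qed
  have "(x1, (w1, a \<cdot> i1, b \<cdot> j1, w), (w, u', v', f)) \<in> hom (K f) x1 (w, u', v', f)"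
    unfolding 1(1) by (rule key[OF x(1)[unfolded 1(1)] wh(1) i(1) j(1) g(2) u(2) v(2)])
  moreover have "(x2, (w2, a \<cdot> i2, b \<cdot> j2, w), (w, u', v', f)) \<in> hom (K f) x2 (w, u', v', f)"
    unfolding 2(1) by (rule key[OF x(2)[unfolded 2(1)] wh(2) i(2) j(2) g(3) u(3) v(3)])
  ultimately show "\<exists>y. \<exists>\<alpha> \<in> hom (K f) x1 y. \<exists>\<beta> \<in> hom (K f) x2 y. True" by blast
next
  interpret K: category "K f" by (rule category_K)
  fix x1 x2 \<alpha> \<beta> assume x: "x1 \<in> Obj (K f)" "x2 \<in> Obj (K f)" and \<alpha>: "\<alpha> \<in> hom (K f) x1 x2" and \<beta>: "\<beta> \<in> hom (K f) x1 x2"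
  obtain w1 u1 v1 where 1: "x1 = (w1, u1, v1, f)" "w1 \<in> G" "u1 \<in> hom C (Dom C w1) X" "v1 \<in> hom C (Cod C w1) Y"
    "v1 \<cdot> w1 = f \<cdot> u1" by (rule K_ObjE[OF x(1)])
  obtain w2 u2 v2 where 2: "x2 = (w2, u2, v2, f)" "w2 \<in> G" "u2 \<in> hom C (Dom C w2) X" "v2 \<in> hom C (Cod C w2) Y"
    "v2 \<cdot> w2 = f \<cdot> u2" by (rule K_ObjE[OF x(2)])
  obtain s s' where s: "\<alpha> = (x1, (w1, s, s', w2), x2)" "s \<in> hom C (Dom C w1) (Dom C w2)" "s' \<in> hom C (Cod C w1) (Cod C w2)"
    "u2 \<cdot> s = u1" "v2 \<cdot> s' = v1" using \<alpha> unfolding K_hom 1(1) 2(1) AW_hom fst_conv by (auto simp: AW_Comp)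
  obtain t t' where t: "\<beta> = (x1, (w1, t, t', w2), x2)" "t \<in> hom C (Dom C w1) (Dom C w2)" "t' \<in> hom C (Cod C w1) (Cod C w2)"
    "u2 \<cdot> t = u1" "v2 \<cdot> t' = v1" using \<beta> unfolding K_hom 1(1) 2(1) AW_hom fst_conv by (auto simp: AW_Comp)
  have us: "u2 \<cdot> s = u2 \<cdot> t" using s(4) t(4) by simp
  \<comment> \<open>The two arrows are made equal on domains first; their codomain components,
    composed with \<open>b\<close>, still agree over \<open>Y\<close> and are made equal in a second
    step.\<close>
  obtain w3 u3 v3 a b where 3: "((w2, u2, v2, f), (w2, a, b, w3), (w3, u3, v3, f)) \<in> hom (K f) (w2, u2, v2, f) (w3, u3, v3, f)"
    "a \<in> hom C (Dom C w2) (Dom C w3)" "b \<in> hom C (Cod C w2) (Cod C w3)" "a \<cdot> s = a \<cdot> t"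
    by (rule K_coeq_dom[OF x(2)[unfolded 2(1)] G_D(2)[OF 1(2)] s(2) t(2) us])
  have v3b: "v3 \<cdot> b = v2" using 3(1) unfolding K_hom by (auto simp: AW_Comp)
  have x3: "(w3, u3, v3, f) \<in> Obj (K f)" by (rule K.hom_ObjD(2)[OF 3(1)])
  then have v3: "v3 \<in> hom C (Cod C w3) Y" by (auto elim: K_ObjE)
  have "(v3 \<cdot> b) \<cdot> s' = (v3 \<cdot> b) \<cdot> t'" unfolding v3b s(5) t(5) ..
  then have vs: "v3 \<cdot> (b \<cdot> s') = v3 \<cdot> (b \<cdot> t')" using v3 3(3) s(3) t(3) by (simp add: hom_def)
  obtain w4 u4 v4 a' b' where 4: "((w3, u3, v3, f), (w3, a', b', w4), (w4, u4, v4, f)) \<in> hom (K f) (w3, u3, v3, f) (w4, u4, v4, f)"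
    "a' \<in> hom C (Dom C w3) (Dom C w4)" "b' \<in> hom C (Cod C w3) (Cod C w4)" "b' \<cdot> (b \<cdot> s') = b' \<cdot> (b \<cdot> t')"
    by (rule K_coeq_cod[OF x3 G_D(3)[OF 1(2)] Comp_hom[OF s(3) 3(3)] Comp_hom[OF t(3) 3(3)] vs])
  have "(a' \<cdot> a) \<cdot> s = a' \<cdot> (a \<cdot> s)" using 4(2) 3(2) s(2) by (simp add: hom_def)
  also have "\<dots> = (a' \<cdot> a) \<cdot> t" unfolding 3(4) using 4(2) 3(2) t(2) by (simp add: hom_def)
  finally have as: "(a' \<cdot> a) \<cdot> s = (a' \<cdot> a) \<cdot> t" .
  have bs: "(b' \<cdot> b) \<cdot> s' = (b' \<cdot> b) \<cdot> t'" using 4(3,4) 3(3) s(3) t(3) by (simp add: hom_def)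
  let ?\<gamma> = "(x2, (w2, a' \<cdot> a, b' \<cdot> b, w4), (w4, u4, v4, f))"
  have "?\<gamma> \<in> hom (K f) x2 (w4, u4, v4, f)"
    using K.Comp_hom[OF 3(1) 4(1)] by (simp add: K_Comp AW_Comp 2(1))
  moreover have "?\<gamma> \<cdot>\<^bsub>K f\<^esub> \<alpha> = ?\<gamma> \<cdot>\<^bsub>K f\<^esub> \<beta>" unfolding s(1) t(1) K_Comp AW_Comp as bs ..
  ultimately show "\<exists>l. \<exists>\<gamma> \<in> hom (K f) x2 l. \<gamma> \<cdot>\<^bsub>K f\<^esub> \<alpha> = \<gamma> \<cdot>\<^bsub>K f\<^esub> \<beta>" by blast
qed

text \<open>By \<open>pointwise_colimit\<close> domains and codomains can be treated separately, and
  \<open>colimitI_presentable\<close> reduces each to factorizations of maps from presentable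
  objects, which \<open>K_factor\<close> and the two coequalizer lemmas supply.\<close>

lemma colimit_K: "\<exists>\<tau>. is_colimit AW (K f) proj f \<tau>"
proof -
  interpret K: category "K f" by (rule category_K)
  note F = functor_dom_cod[OF category_K functor_proj]
  note cc = cocone_dom_cod[OF category_K functor_proj cocone_proj[OF f(1)]]
  have fh: "Dom C f = X" "Cod C f = Y" using f(2) by (simp_all add: hom_def)
  note XY = hom_ObjD[OF f(2)]
  have X: "is_colimit C (K f) (dom_ftor proj) X (\<lambda>x. fst (snd x))"
  proof (rule colimitI_presentable[OF filt_K F(1) cc(1)[unfolded fh]])
    show "fp (FO (dom_ftor proj) x)" if "x \<in> Obj (K f)" for x
      using that G_D(2) by (simp add: dom_ftor_def proj_def K_Obj)
    fix A h assume A: "fp A" and h: "h \<in> hom C A X"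
    note AO = fp_Obj[OF A]
    \<comment> \<open>A map \<open>h\<close> into the domain of \<open>f\<close> is tested as a
      square from the identity of \<open>A\<close> to \<open>f\<close>.\<close>
    have "(f \<cdot> h) \<cdot> Ident C A = f \<cdot> h" using f(2) h by (simp add: hom_def)
    then obtain w a b u' v' where w: "(w, u', v', f) \<in> Obj (K f)" "w \<in> G" "a \<in> hom C A (Dom C w)" "b \<in> hom C A (Cod C w)"
      "u' \<in> hom C (Dom C w) X" "v' \<in> hom C (Cod C w) Y" "b \<cdot> Ident C A = w \<cdot> a" "v' \<cdot> w = f \<cdot> u'" "u' \<cdot> a = h" "v' \<cdot> b = f \<cdot> h"
      by (rule K_factor[OF A A Ident_hom[OF AO] h Comp_hom[OF h f(2)]])
    show "\<exists>x \<in> Obj (K f). \<exists>b \<in> hom C A (FO (dom_ftor proj) x). fst (snd x) \<cdot> b = h"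
      using w(1,3,9) by (intro bexI[of _ "(w, u', v', f)"] bexI[of _ a]) (simp_all add: dom_ftor_def proj_def)
  next
    fix A x s t assume A: "fp A" and x: "x \<in> Obj (K f)" and s: "s \<in> hom C A (FO (dom_ftor proj) x)"
      "t \<in> hom C A (FO (dom_ftor proj) x)" "fst (snd x) \<cdot> s = fst (snd x) \<cdot> t"
    obtain w u v where e: "x = (w, u, v, f)" using x by (auto elim: K_ObjE)
    have s': "s \<in> hom C A (Dom C w)" "t \<in> hom C A (Dom C w)" "u \<cdot> s = u \<cdot> t"
      using s by (simp_all add: e dom_ftor_def proj_def)
    obtain w' u' v' a b where "((w, u, v, f), (w, a, b, w'), (w', u', v', f)) \<in> hom (K f) (w, u, v, f) (w', u', v', f)"
      "a \<in> hom C (Dom C w) (Dom C w')" "b \<in> hom C (Cod C w) (Cod C w')" "a \<cdot> s = a \<cdot> t"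
      by (rule K_coeq_dom[OF x[unfolded e] A s'])
    then show "\<exists>l. \<exists>\<alpha> \<in> hom (K f) x l. FA (dom_ftor proj) \<alpha> \<cdot> s = FA (dom_ftor proj) \<alpha> \<cdot> t"
      unfolding e by (intro exI bexI) (simp_all add: dom_ftor_def proj_def)
  qed
  have Y: "is_colimit C (K f) (cod_ftor proj) Y (\<lambda>x. fst (snd (snd x)))"
  proof (rule colimitI_presentable[OF filt_K F(2) cc(2)[unfolded fh]])
    show "fp (FO (cod_ftor proj) x)" if "x \<in> Obj (K f)" for x
      using that G_D(3) by (simp add: cod_ftor_def proj_def K_Obj)
    fix A h assume A: "fp A" and h: "h \<in> hom C A Y"
    obtain E where E: "is_initial C E" using initial_exists by blast
    obtain e where e: "e \<in> hom C E A" by (rule initial_hom[OF E fp_Obj[OF A]])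
    obtain eX where eX: "eX \<in> hom C E X" by (rule initial_hom[OF E XY(1)])
    \<comment> \<open>A map \<open>h\<close> into the codomain of \<open>f\<close> is tested as a
      square from the map of the initial object to \<open>A\<close>.\<close>
    have "h \<cdot> e = f \<cdot> eX" by (rule initial_unique[OF E Comp_hom[OF e h] Comp_hom[OF eX f(2)]])
    then obtain w a b u' v' where w: "(w, u', v', f) \<in> Obj (K f)" "w \<in> G" "a \<in> hom C E (Dom C w)" "b \<in> hom C A (Cod C w)"
      "u' \<in> hom C (Dom C w) X" "v' \<in> hom C (Cod C w) Y" "b \<cdot> e = w \<cdot> a" "v' \<cdot> w = f \<cdot> u'" "u' \<cdot> a = eX" "v' \<cdot> b = h"
      by (rule K_factor[OF fp_initial[OF E] A e eX h])
    show "\<exists>x \<in> Obj (K f). \<exists>b \<in> hom C A (FO (cod_ftor proj) x). fst (snd (snd x)) \<cdot> b = h"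
      using w(1,4,10) by (intro bexI[of _ "(w, u', v', f)"] bexI[of _ b]) (simp_all add: cod_ftor_def proj_def)
  next
    fix A x s t assume A: "fp A" and x: "x \<in> Obj (K f)" and s: "s \<in> hom C A (FO (cod_ftor proj) x)"
      "t \<in> hom C A (FO (cod_ftor proj) x)" "fst (snd (snd x)) \<cdot> s = fst (snd (snd x)) \<cdot> t"
    obtain w u v where e: "x = (w, u, v, f)" using x by (auto elim: K_ObjE)
    have s': "s \<in> hom C A (Cod C w)" "t \<in> hom C A (Cod C w)" "v \<cdot> s = v \<cdot> t"
      using s by (simp_all add: e cod_ftor_def proj_def)
    obtain w' u' v' a b where "((w, u, v, f), (w, a, b, w'), (w', u', v', f)) \<in> hom (K f) (w, u, v, f) (w', u', v', f)"
      "a \<in> hom C (Dom C w) (Dom C w')" "b \<in> hom C (Cod C w) (Cod C w')" "b \<cdot> s = b \<cdot> t"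
      by (rule K_coeq_cod[OF x[unfolded e] A s'])
    then show "\<exists>l. \<exists>\<alpha> \<in> hom (K f) x l. FA (cod_ftor proj) \<alpha> \<cdot> s = FA (cod_ftor proj) \<alpha> \<cdot> t"
      unfolding e by (intro exI bexI) (simp_all add: cod_ftor_def proj_def)
  qed
  have "f \<cdot> fst (snd x) = fst (snd (snd x)) \<cdot> FO proj x" if "x \<in> Obj (K f)" for x
    using that by (auto elim: K_ObjE simp: proj_def)
  from pointwise_colimit[OF category_K functor_proj X Y f this] show ?thesis by blast
qed

end

lemma accessible_AW: "accessible U natLeq AW"
  unfolding accessible_def
proof (intro conjI allI impI)
  show "category AW" by (rule category_AW)
  show "locally_small U AW" using AW_small_hom by (simp add: locally_small_def AW_Obj)
  have U': "universe TYPE('u)" using universe by (simp add: universe_def)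
  show "\<exists>f \<tau>. is_colimit AW J D f \<tau>"
    if JD: "small_category J \<and> filtered natLeq J \<and> is_functor J AW D" for J :: "('u, 'u) cat" and D
  proof -
    have J: "filt J" "small U (Arr J)" and D: "is_functor J AW D"
      using JD filtered_imp_filt[OF U'] by (auto simp: small_category_def small_def)
    obtain X \<iota> Y \<kappa> f where X: "is_colimit C J (dom_ftor D) X \<iota>" and Y: "is_colimit C J (cod_ftor D) Y \<kappa>"
      and f: "f \<in> W" "f \<in> hom C X Y" "\<forall>i \<in> Obj J. f \<cdot> \<iota> i = \<kappa> i \<cdot> FO D i"
      by (rule filtered_colimit_exists[OF J D])
    show ?thesis using pointwise_colimit[OF filt_category[OF J(1)] D X Y f(1,2) f(3)[rule_format]] by blast
  qed
  have "\<exists>(J :: ('u, 'u) cat) D \<tau>. small_category J \<and> filtered natLeq J \<and> is_functor J AW D \<and> FO D ` Obj J \<subseteq> G \<and>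
      is_colimit AW J D f \<tau>" if f: "f \<in> W" for f
  proof -
    obtain \<tau> where \<tau>: "is_colimit AW (K f) proj f \<tau>" using colimit_K[OF f W_hom[OF f]] by blast
    \<comment> \<open>The objects of \<open>K f\<close> are squares; the category is small and can
      be moved to \<open>'u\<close>, as the definition of \<open>accessible\<close> demands.\<close>
    obtain p :: "'a \<times> 'a \<times> 'a \<times> 'a \<Rightarrow> 'u" and q :: "('a \<times> 'a \<times> 'a \<times> 'a) \<times> ('a \<times> 'a \<times> 'a \<times> 'a) \<times> ('a \<times> 'a \<times> 'a \<times> 'a) \<Rightarrow> 'u"
      where t: "transport (K f) p q" and s: "small_category (transport_cat p q (K f))"
      by (rule transport_small[OF category_K small_K])
    interpret T: transport "K f" p q by (rule t)
    have "filtered natLeq T.J'"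
      by (rule filt_imp_filtered[OF filt_transport[OF filt_K[OF f W_hom[OF f]] T.inj_Obj T.inj_Arr]])
    moreover have "is_functor T.J' AW (transport_ftor p q (K f) proj)" by (rule T.functor_transport[OF functor_proj])
    moreover have "FO (transport_ftor p q (K f) proj) ` Obj T.J' \<subseteq> G" by (auto simp: proj_def K_Obj)
    moreover have "is_colimit AW (K f) proj f ((\<tau> \<circ> inv_into (Obj (K f)) p) \<circ> p)"
      using \<tau> T.inj_Obj unfolding is_colimit_def is_cocone_def by simp
    then have "is_colimit AW T.J' (transport_ftor p q (K f) proj) f (\<tau> \<circ> inv_into (Obj (K f)) p)"
      unfolding T.colimit_transport .
    ultimately show ?thesis using s by blast
  qed
  then show "\<exists>G \<subseteq> Obj AW. small U G \<and> (\<forall>w \<in> G. presentable U natLeq AW w) \<and>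
      (\<forall>f \<in> Obj AW. \<exists>(J :: ('u, 'u) cat) D \<tau>. small_category J \<and> filtered natLeq J \<and> is_functor J AW D \<and>
        FO D ` Obj J \<subseteq> G \<and> is_colimit AW J D f \<tau>)"
    using small_G G_D arrow_presentable by (intro exI[of _ G]) (auto simp: AW_Obj)
qed

end

theorem theorem1p8:
  fixes MM :: "('o, 'a) cat" and W F Cof :: "'a set"
    and M :: "('o, 'a) cat" and pt S I :: 'o and i0 i1 fold j q :: 'a
  assumes universe: "universe TYPE('u)"
    and omega_combinatorial: "omega_combinatorial_model_category TYPE('u) MM W F Cof"
    and left_proper: "left_proper MM W Cof"
    and M: "M = full_subcat MM {X. finitely_presentable TYPE('u) MM X}"
    and finite_limits: "has_finite_limits M"
    and pt: "is_terminal M pt"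
    and fold: "is_fold_map M pt S i0 i1 fold"
    and cylinder: "j \<in> hom M S I" "j \<in> Cof" "q \<in> hom M I pt" "q \<in> W" "q \<cdot>\<^bsub>M\<^esub> j = fold"
    and pullbacks: "\<And>f P p1 p2. f \<in> Arr M \<Longrightarrow> pullback_functor M f P p1 p2 \<Longrightarrow>
      preserves_finite_colimits (slice M (Cod M f)) M P"
    and all_cofibrant: "\<And>X. X \<in> Obj M \<Longrightarrow> cofibrant MM Cof X"
    and products: "\<And>B P p1 p2. B \<in> Obj M \<Longrightarrow> product_functor M B P p1 p2 \<Longrightarrow>
      (\<forall>f \<in> Arr M \<inter> Cof. FA P f \<in> Cof) \<and> (\<forall>f \<in> Arr M \<inter> W. FA P f \<in> W)"
  shows "finitely_accessible TYPE('u) (full_subcat (arrow_cat MM) W)"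
proof -
  have model: "model_category TYPE('u) MM W F Cof" and lfp: "locally_finitely_presentable TYPE('u) MM"
    and gen: "generated_by_finitely_presentable TYPE('u) MM Cof"
      "generated_by_finitely_presentable TYPE('u) MM (W \<inter> Cof)"
    using omega_combinatorial
    by (auto simp: omega_combinatorial_model_category_def combinatorial_model_category_def)
  interpret category MM using model by (simp add: model_category_def)
  interpret lfp_model_category MM "TYPE('u)" W F Cof
    by unfold_locales (use universe lfp model gen in \<open>auto simp: locally_presentable_card_def\<close>)
  \<comment> \<open>The hypotheses on finite limits, the cylinder, pullbacks, cofibrancy and
    products enter together through this factorization among presentable objects; left properness
    enters afterwards, in the characterization of \<open>W\<close>.\<close>
  have "\<exists>Z i p. fp Z \<and> i \<in> hom MM A Z \<and> p \<in> hom MM Z B \<and> p \<cdot>\<^bsub>MM\<^esub> i = f \<and> i \<in> Cof \<and> p \<in> W"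
    if "fp A" "fp B" "f \<in> hom MM A B" for A B f
  proof (rule presentable_factorization[OF _ _ _ _ _ _ _ _ _ _ _ that])
    show "has_finite_limits fps" using finite_limits by (simp only: M)
    show "is_terminal fps pt" using pt by (simp only: M)
    show "is_fold_map fps pt S i0 i1 fold" using fold by (simp only: M)
    show "j \<in> hom fps S I" "j \<in> Cof" "q \<in> hom fps I pt" "q \<in> W" using cylinder by (simp_all only: M)
    show "q \<cdot>\<^bsub>MM\<^esub> j = fold" using cylinder(5) by (simp add: M)
    show "preserves_finite_colimits (slice fps (Cod MM f)) fps P" if "f \<in> Arr fps" "pullback_functor fps f P p1 p2"
      for f P p1 p2 using pullbacks[unfolded M, OF that] by simp
    show "cofibrant MM Cof X" if "fp X" for X using all_cofibrant[of X] that by (simp add: M fps_Obj)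
    show "(\<forall>f \<in> Arr fps \<inter> Cof. FA P f \<in> Cof) \<and> (\<forall>f \<in> Arr fps \<inter> W. FA P f \<in> W)"
      if "fp B" "product_functor fps B P p1 p2" for B P p1 p2
      using products[unfolded M fps_Obj, OF that] .
  qed
  then have W: "f \<in> W \<longleftrightarrow> factors_via W f" for f
    using factors_via_imp_W W_imp_factors_via[OF left_proper] by blast
  obtain R where R: "small TYPE('u) R" "\<forall>A \<in> R. fp A"
    "\<forall>A. fp A \<longrightarrow> (\<exists>B \<in> R. \<exists>\<phi> \<in> hom MM A B. \<exists>\<psi> \<in> hom MM B A. \<psi> \<cdot>\<^bsub>MM\<^esub> \<phi> = Ident MM A \<and> \<phi> \<cdot>\<^bsub>MM\<^esub> \<psi> = Ident MM B)"
    by (rule small_skeleton)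
  interpret arrow_skeleton MM "TYPE('u)" W R by unfold_locales (use W R in blast)+
  show ?thesis by (rule accessible_AW)
qed

end
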